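(* Let $u_\varepsilon$ be the exact solution and let $u_\varepsilon^G=u^p$ be the GFEM approximation that uses no local approximation spaces, where $u^p=\sum_{i=1}^M\chi_iu_i^p$ is the global particular function. Then $$\big\Vert u_{\varepsilon} - u^{G}_{\varepsilon} \big \Vert_{a, \varepsilon}=\big\Vert u_{\varepsilon} - u^{p} \big \Vert_{a, \varepsilon} \leq 2\varepsilon \,\sqrt{\kappa\kappa^{\ast}}\, a_{\max}^{1/2}\,C_{\chi}\, \Vert f\Vert_{L^{2}(\Omega)}.$$ If, in addition, $\gamma^{\ast}_{i} := \delta^{\ast}_{i}/(e\,\varepsilon\, a_{\max}^{1/2}C_{d})>1$ for each $i=1,\dots,M$, then $$\big\Vert u_{\varepsilon} - u^{G}_{\varepsilon} \big \Vert_{a, \varepsilon} \leq 2e\,\varepsilon\,\sqrt{\kappa \kappa^{\ast}}\,a_{\max}^{1/2}\, C_{\chi}\Big(\max_{i=1,\dots,M}e^{-\gamma^{\ast}_{i}}\Big) \Vert f\Vert_{L^{2}(\Omega)}.$$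
   Context: Setting: $\Omega\subset\mathbb{R}^d$ ($d=2,3$) is a bounded Lipschitz polyhedral domain, $\Gamma=\partial\Omega$, $0<\varepsilon\le 1$, $f\in L^2(\Omega)$, and $A\in (L^\infty(\Omega))^{d\times d}$ is pointwise symmetric with $a_{\min}|\xi|^2\le A(x)\xi\cdot\xi\le a_{\max}|\xi|^2$ for all $\xi\in\mathbb{R}^d$, $x\in\Omega$, where $0<a_{\min}<a_{\max}<\infty$. For a subdomain $D\subset\Omega$ and $u,v\in H^1(D)$ put $a_{\varepsilon,D}(u,v)=\varepsilon^2\int_D A\nabla u\cdot\nabla v\,dx+\int_D uv\,dx$ and $\|u\|_{a,\varepsilon,D}=\sqrt{a_{\varepsilon,D}(u,u)}$; the index $D$ is dropped when $D=\Omega$. The exact solution $u_\varepsilon\in H^1_0(\Omega)$ is the unique function with $a_{\varepsilon}(u_\varepsilon,v)=\int_\Omega fv\,dx$ for all $v\in H_0^1(\Omega)$. Cover and partition of unity: $\{\omega_i\}_{i=1}^M$ are connected open subsets of $\Omega$ with $\bigcup_i\omega_i=\Omega$, each point of $\Omega$ lying in at most $\kappa\in\mathbb{N}$ of them; $\{\chi_i\}_{i=1}^M$ are functions with $0\le\chi_i\le1$, $\sum_i\chi_i=1$ on $\Omega$, $\chi_i=0$ on $\Omega\setminus\omega_i$, $\chi_i\in W^{1,\infty}(\Omega)$, and $\|\nabla\chi_i\|_{L^\infty(\omega_i)}\le C/\mathrm{diam}(\omega_i)$ for a fixed constant $C$. For each $i$, $\omega_i^\ast$ is a domain with Lipschitz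 boundary and $\omega_i\subset\omega_i^\ast\subset\Omega$; each point of $\Omega$ lies in at most $\kappa^\ast\in\mathbb{N}$ of the $\omega_i^\ast$. Put $C_\chi=\max_i\|\nabla\chi_i\|_{L^\infty(\omega_i)}$ and $\delta_i^\ast=\mathrm{dist}(\omega_i,\partial\omega_i^\ast\setminus\partial\Omega)$. Local particular functions: with $H^1_\Gamma(\omega_i^\ast)=\{v\in H^1(\omega_i^\ast): v=0\text{ on }\partial\omega_i^\ast\cap\Gamma\}$, $\psi_{\varepsilon,i}\in H^1_\Gamma(\omega_i^\ast)$ is the unique solution of $a_{\varepsilon,\omega_i^\ast}(\psi_{\varepsilon,i},v)=\int_{\omega_i^\ast}fv\,dx$ for all $v\in H^1_\Gamma(\omega_i^\ast)$, and $u_i^p=\psi_{\varepsilon,i}|_{\omega_i}$. Constant $C_d$: $C_d>0$ is a constant depending only on $d$ such that for all open connected $D\subset D^\ast\subset\Omega$ with $\delta=\mathrm{dist}(D,\partial D^\ast\setminus\partial\Omega)>0$ there is $\eta\in C^1(\overline{D^\ast})$ with $\eta=0$ on $\partial D^\ast\setminus\partial\Omega$, $\eta=1$ in $D$ and $|\nabla\eta|\le C_d/\delta$. Here $e$ is Euler's number. *)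

theory Defs
  imports "HOL-Analysis.Analysis" "HOL-Probability.Essential_Supremum"
begin

subsection \<open>Domains\<close>

text \<open>Locally, after a rotation taking the unit vector \<open>n\<close> to the last coordinate direction, the set
  is the strict epigraph of a Lipschitz function \<open>\<phi>\<close> of the remaining coordinates.\<close>

definition lipschitz_boundary :: "'a::euclidean_space set \<Rightarrow> bool" where
  "lipschitz_boundary D \<longleftrightarrow>
     (\<forall>x\<in>frontier D. \<exists>r n L \<phi>. 0 < r \<and> norm n = 1 \<and> L-lipschitz_on {z. z \<bullet> n = 0} \<phi> \<and>
        D \<inter> ball x r = {y \<in> ball x r. \<phi> (y - (y \<bullet> n) *\<^sub>R n) < y \<bullet> n})"

definition domain_in_space :: "'a::euclidean_space set \<Rightarrow> bool" where
  "domain_in_space D \<longleftrightarrow> open D \<and> connected D \<and> D \<noteq> {}"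

definition lipschitz_domain :: "'a::euclidean_space set \<Rightarrow> bool" where
  "lipschitz_domain D \<longleftrightarrow> domain_in_space D \<and> lipschitz_boundary D"

definition polyhedral :: "'a::euclidean_space set \<Rightarrow> bool" where
  "polyhedral D \<longleftrightarrow> (\<exists>\<P>. finite \<P> \<and> (\<forall>P\<in>\<P>. polytope P) \<and> closure D = \<Union>\<P>)"

text \<open>The distance takes values in the extended reals so that the distance to the empty set is
  \<open>\<infinity>\<close> (the library's \<^const>\<open>setdist\<close> would give 0).\<close>

definition set_distance :: "'a::metric_space set \<Rightarrow> 'a set \<Rightarrow> ereal" where
  "set_distance S T = (INF x\<in>S. INF y\<in>T. ereal (dist x y))"

definition exp_neg :: "ereal \<Rightarrow> real" where
  "exp_neg g = (if g = \<infinity> then 0 else exp (- real_of_ereal g))"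

subsection \<open>Lebesgue spaces\<close>

text \<open>Elements of Lebesgue and Sobolev spaces over \<open>D\<close> are represented by functions on the whole
  space, whose values outside \<open>D\<close> are irrelevant.\<close>

definition L2 :: "(real^'d) set \<Rightarrow> (real^'d \<Rightarrow> 'b::euclidean_space) set" where
  "L2 D = {f. f \<in> borel_measurable (lebesgue_on D) \<and>
              integrable (lebesgue_on D) (\<lambda>x. (norm (f x))\<^sup>2)}"

definition L2_norm :: "(real^'d) set \<Rightarrow> (real^'d \<Rightarrow> 'b::euclidean_space) \<Rightarrow> real" where
  "L2_norm D f = sqrt (LINT x|lebesgue_on D. (norm (f x))\<^sup>2)"

definition Linf :: "(real^'d) set \<Rightarrow> (real^'d \<Rightarrow> 'b::euclidean_space) set" where
  "Linf D = {f. f \<in> borel_measurable (lebesgue_on D) \<and>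
                esssup (lebesgue_on D) (\<lambda>x. ereal (norm (f x))) < \<infinity>}"

definition Linf_norm :: "(real^'d) set \<Rightarrow> (real^'d \<Rightarrow> 'b::euclidean_space) \<Rightarrow> real" where
  "Linf_norm D f = real_of_ereal (esssup (lebesgue_on D) (\<lambda>x. ereal (norm (f x))))"

definition locally_integrable ::
    "(real^'d) set \<Rightarrow> (real^'d \<Rightarrow> 'b::euclidean_space) \<Rightarrow> bool" where
  "locally_integrable D f \<longleftrightarrow> (\<forall>K. compact K \<and> K \<subseteq> D \<longrightarrow> integrable (lebesgue_on K) f)"

subsection \<open>Smooth functions and weak gradients\<close>

definition partial_deriv :: "'d::finite \<Rightarrow> (real^'d \<Rightarrow> real) \<Rightarrow> real^'d \<Rightarrow> real" where
  "partial_deriv i f x = frechet_derivative f (at x) (axis i 1)"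

primrec Ck :: "nat \<Rightarrow> (real^'d \<Rightarrow> real) \<Rightarrow> bool" where
  "Ck 0 f \<longleftrightarrow> continuous_on UNIV f"
| "Ck (Suc k) f \<longleftrightarrow> (\<forall>x. f differentiable (at x)) \<and> (\<forall>i. Ck k (partial_deriv i f))"

definition smooth :: "(real^'d \<Rightarrow> real) \<Rightarrow> bool" where
  "smooth f \<longleftrightarrow> (\<forall>k. Ck k f)"

definition test_function :: "(real^'d) set \<Rightarrow> (real^'d \<Rightarrow> real) \<Rightarrow> bool" where
  "test_function D \<phi> \<longleftrightarrow>
     smooth \<phi> \<and> compact (closure {x. \<phi> x \<noteq> 0}) \<and> closure {x. \<phi> x \<noteq> 0} \<subseteq> D"

definition is_weak_gradient ::
    "(real^'d) set \<Rightarrow> (real^'d \<Rightarrow> real) \<Rightarrow> (real^'d \<Rightarrow> real^'d) \<Rightarrow> bool" where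
  "is_weak_gradient D u g \<longleftrightarrow> locally_integrable D u \<and> locally_integrable D g \<and>
     (\<forall>\<phi> i. test_function D \<phi> \<longrightarrow>
        (LINT x|lebesgue_on D. u x * partial_deriv i \<phi> x)
          = - (LINT x|lebesgue_on D. g x $ i * \<phi> x))"

text \<open>Weak gradients on an open set are unique up to null sets; \<open>weak_grad\<close> picks a representative.\<close>

definition weak_grad :: "(real^'d) set \<Rightarrow> (real^'d \<Rightarrow> real) \<Rightarrow> real^'d \<Rightarrow> real^'d" where
  "weak_grad D u = (SOME g. is_weak_gradient D u g)"

subsection \<open>Sobolev spaces\<close>

definition H1 :: "(real^'d) set \<Rightarrow> (real^'d \<Rightarrow> real) set" where
  "H1 D = {u. u \<in> L2 D \<and> (\<exists>g. is_weak_gradient D u g \<and> g \<in> L2 D)}"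

definition H1_norm :: "(real^'d) set \<Rightarrow> (real^'d \<Rightarrow> real) \<Rightarrow> real" where
  "H1_norm D u = sqrt ((L2_norm D u)\<^sup>2 + (L2_norm D (weak_grad D u))\<^sup>2)"

definition W1inf :: "(real^'d) set \<Rightarrow> (real^'d \<Rightarrow> real) set" where
  "W1inf D = {u. u \<in> Linf D \<and> (\<exists>g. is_weak_gradient D u g \<and> g \<in> Linf D)}"

definition H10 :: "(real^'d) set \<Rightarrow> (real^'d \<Rightarrow> real) set" where
  "H10 D = {v \<in> H1 D. \<forall>e>0. \<exists>\<phi>. test_function D \<phi> \<and> H1_norm D (\<lambda>x. v x - \<phi> x) < e}"

text \<open>The functions \<open>v \<in> H\<^sup>1(D)\<close> with \<open>v = 0\<close> on the part \<open>S\<close> of the boundary: the closure in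
  \<open>H\<^sup>1(D)\<close> of the functions that are smooth up to the boundary and vanish pointwise on \<open>S\<close>.\<close>

definition H1_zero_on :: "(real^'d) set \<Rightarrow> (real^'d) set \<Rightarrow> (real^'d \<Rightarrow> real) set" where
  "H1_zero_on S D = {v \<in> H1 D. \<forall>e>0. \<exists>\<phi>. smooth \<phi> \<and> \<phi> \<in> H1 D \<and> (\<forall>x\<in>S. \<phi> x = 0) \<and>
                                     H1_norm D (\<lambda>x. v x - \<phi> x) < e}"

definition H1_Gamma :: "(real^'d) set \<Rightarrow> (real^'d) set \<Rightarrow> (real^'d \<Rightarrow> real) set" where
  "H1_Gamma \<Omega> D = H1_zero_on (frontier D \<inter> frontier \<Omega>) D"

subsection \<open>The reaction-diffusion problem\<close>

definition elliptic_coefficient ::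
    "(real^'d) set \<Rightarrow> real \<Rightarrow> real \<Rightarrow> (real^'d \<Rightarrow> real^'d^'d) \<Rightarrow> bool" where
  "elliptic_coefficient \<Omega> amin amax A \<longleftrightarrow>
     (\<forall>i j. (\<lambda>x. A x $ i $ j) \<in> Linf \<Omega>) \<and>
     (\<forall>x\<in>\<Omega>. transpose (A x) = A x) \<and>
     (\<forall>x\<in>\<Omega>. \<forall>\<xi>. amin * (norm \<xi>)\<^sup>2 \<le> (A x *v \<xi>) \<bullet> \<xi> \<and> (A x *v \<xi>) \<bullet> \<xi> \<le> amax * (norm \<xi>)\<^sup>2)"

definition a_form :: "(real^'d \<Rightarrow> real^'d^'d) \<Rightarrow> real \<Rightarrow> (real^'d) set \<Rightarrow>
    (real^'d \<Rightarrow> real) \<Rightarrow> (real^'d \<Rightarrow> real) \<Rightarrow> real" where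
  "a_form A \<epsilon> D u v =
     \<epsilon>\<^sup>2 * (LINT x|lebesgue_on D. (A x *v weak_grad D u x) \<bullet> weak_grad D v x)
       + (LINT x|lebesgue_on D. u x * v x)"

definition a_norm :: "(real^'d \<Rightarrow> real^'d^'d) \<Rightarrow> real \<Rightarrow> (real^'d) set \<Rightarrow>
    (real^'d \<Rightarrow> real) \<Rightarrow> real" where
  "a_norm A \<epsilon> D u = sqrt (a_form A \<epsilon> D u u)"

text \<open>\<open>u\<close> solves the variational problem on \<open>D\<close> with trial and test space \<open>V\<close>; the solution is
  unique as an element of \<open>L\<^sup>2(D)\<close>, that is, up to null sets.\<close>

definition variational_solution :: "(real^'d \<Rightarrow> real^'d^'d) \<Rightarrow> real \<Rightarrow> (real^'d) set \<Rightarrow>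
    (real^'d \<Rightarrow> real) set \<Rightarrow> (real^'d \<Rightarrow> real) \<Rightarrow> (real^'d \<Rightarrow> real) \<Rightarrow> bool" where
  "variational_solution A \<epsilon> D V f u \<longleftrightarrow>
     u \<in> V \<and> (\<forall>v\<in>V. a_form A \<epsilon> D u v = (LINT x|lebesgue_on D. f x * v x))"

subsection \<open>Cut-off functions, cover and partition of unity\<close>

text \<open>Membership of \<open>\<eta>\<close> in \<open>C\<^sup>1\<close> of the closure of \<open>D'\<close>: the gradient \<open>g\<close> on \<open>D'\<close> extends
  continuously to the closure.\<close>

definition cutoff_constant :: "(real^'d) set \<Rightarrow> real \<Rightarrow> bool" where
  "cutoff_constant \<Omega> C \<longleftrightarrow>
     (\<forall>D D'. open D \<and> connected D \<and> open D' \<and> connected D' \<and> D \<subseteq> D' \<and> D' \<subseteq> \<Omega> \<and>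
             0 < set_distance D (frontier D' - frontier \<Omega>) \<longrightarrow>
        (\<exists>\<eta> g. continuous_on (closure D') \<eta> \<and> continuous_on (closure D') g \<and>
               (\<forall>x\<in>D'. (\<eta> has_derivative (\<lambda>h. g x \<bullet> h)) (at x)) \<and>
               (\<forall>x\<in>frontier D' - frontier \<Omega>. \<eta> x = 0) \<and> (\<forall>x\<in>D. \<eta> x = 1) \<and>
               (\<forall>x\<in>D'. ereal (norm (g x))
                          \<le> ereal C / set_distance D (frontier D' - frontier \<Omega>))))"

definition finite_cover :: "(real^'d) set \<Rightarrow> nat \<Rightarrow> (nat \<Rightarrow> (real^'d) set) \<Rightarrow> bool" where
  "finite_cover \<Omega> M \<omega> \<longleftrightarrow> (\<forall>i\<in>{1..M}. domain_in_space (\<omega> i)) \<and> (\<Union>i\<in>{1..M}. \<omega> i) = \<Omega>"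

definition overlap_at_most ::
    "(real^'d) set \<Rightarrow> nat \<Rightarrow> (nat \<Rightarrow> (real^'d) set) \<Rightarrow> nat \<Rightarrow> bool" where
  "overlap_at_most \<Omega> M \<omega> k \<longleftrightarrow> (\<forall>x\<in>\<Omega>. card {i\<in>{1..M}. x \<in> \<omega> i} \<le> k)"

definition pu_on_cover :: "(real^'d) set \<Rightarrow> nat \<Rightarrow> (nat \<Rightarrow> (real^'d) set) \<Rightarrow>
    (nat \<Rightarrow> real^'d \<Rightarrow> real) \<Rightarrow> real \<Rightarrow> bool" where
  "pu_on_cover \<Omega> M \<omega> chi C \<longleftrightarrow>
     (\<forall>x\<in>\<Omega>. (\<Sum>i=1..M. chi i x) = 1) \<and>
     (\<forall>i\<in>{1..M}. (\<forall>x\<in>\<Omega>. 0 \<le> chi i x \<and> chi i x \<le> 1) \<and> (\<forall>x\<in>\<Omega> - \<omega> i. chi i x = 0) \<and>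
        chi i \<in> W1inf \<Omega> \<and>
        Linf_norm (\<omega> i) (weak_grad \<Omega> (chi i)) \<le> C / diameter (\<omega> i))"

definition C_chi :: "(real^'d) set \<Rightarrow> nat \<Rightarrow> (nat \<Rightarrow> (real^'d) set) \<Rightarrow>
    (nat \<Rightarrow> real^'d \<Rightarrow> real) \<Rightarrow> real" where
  "C_chi \<Omega> M \<omega> chi = (MAX i\<in>{1..M}. Linf_norm (\<omega> i) (weak_grad \<Omega> (chi i)))"

text \<open>In the summand \<open>i\<close>, \<open>\<psi> i\<close> stands for its restriction to \<open>\<omega> i\<close>: since \<open>chi i\<close> vanishes on
  \<open>\<Omega> - \<omega> i\<close>, the product on \<open>\<Omega>\<close> is the extension by zero.\<close>

definition global_particular ::
    "nat \<Rightarrow> (nat \<Rightarrow> real^'d \<Rightarrow> real) \<Rightarrow> (nat \<Rightarrow> real^'d \<Rightarrow> real) \<Rightarrow> real^'d \<Rightarrow> real" where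
  "global_particular M chi \<psi> x = (\<Sum>i=1..M. chi i x * \<psi> i x)"

text \<open>The GFEM approximation is the Galerkin approximation in the affine space \<open>up + gfem_space\<close>;
  the family \<open>V\<close> consists of the local approximation spaces.\<close>

definition gfem_space :: "nat \<Rightarrow> (nat \<Rightarrow> real^'d \<Rightarrow> real) \<Rightarrow> (nat \<Rightarrow> (real^'d \<Rightarrow> real) set) \<Rightarrow>
    (real^'d \<Rightarrow> real) set" where
  "gfem_space M chi V = {\<lambda>x. \<Sum>i=1..M. chi i x * \<phi> i x | \<phi>. \<forall>i\<in>{1..M}. \<phi> i \<in> V i}"

definition gfem_approximation :: "(real^'d \<Rightarrow> real^'d^'d) \<Rightarrow> real \<Rightarrow> (real^'d) set \<Rightarrow>
    (real^'d \<Rightarrow> real) \<Rightarrow> nat \<Rightarrow> (nat \<Rightarrow> real^'d \<Rightarrow> real) \<Rightarrow> (nat \<Rightarrow> (real^'d \<Rightarrow> real) set) \<Rightarrow>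
    (real^'d \<Rightarrow> real) \<Rightarrow> (real^'d \<Rightarrow> real) \<Rightarrow> bool" where
  "gfem_approximation A \<epsilon> \<Omega> f M chi V up uG \<longleftrightarrow>
     (\<exists>us\<in>gfem_space M chi V. uG = (\<lambda>x. up x + us x)) \<and>
     (\<forall>v\<in>gfem_space M chi V. a_form A \<epsilon> \<Omega> uG v = (LINT x|lebesgue_on \<Omega>. f x * v x))"

end

theory Submission
  imports Defs
begin

text \<open>On \<open>\<omega>' i\<close> the local error \<open>w\<^sub>i = u - \<psi> i\<close> satisfies the homogeneous equation, so testing with
  \<open>\<chi>\<^sup>2 w\<^sub>i\<close> for a bounded weakly differentiable \<open>\<chi>\<close> vanishing off \<open>\<omega>' i\<close> gives the Caccioppoli identity
  \<open>\<parallel>\<chi> w\<^sub>i\<parallel>\<^sub>a\<^sup>2 = \<epsilon>\<^sup>2 \<integral> w\<^sub>i\<^sup>2 A\<nabla>\<chi> \<bullet> \<nabla>\<chi>\<close>. With \<open>\<chi> = chi i\<close>, the energy bounds \<open>\<parallel>u\<parallel> \<le> \<parallel>f\<parallel>\<close> and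
  \<open>\<parallel>\<psi> i\<parallel> \<le> \<parallel>f\<parallel>\<close> in \<open>L\<^sup>2\<close>, and the overlap bounds, summing over \<open>i\<close> yields the first estimate. For the
  second, \<open>\<chi> = cosh (k (\<eta> - 1/4)\<^sup>+) - 1\<close> with a cut-off function \<open>\<eta>\<close> and \<open>k = 2 \<gamma> i\<close> shows that
  \<open>w\<^sub>i\<close> is exponentially small on \<open>\<omega> i\<close>.

  Traces are avoided: \<open>w\<^sub>i\<close> is an \<open>H\<^sup>1\<close> limit of smooth functions vanishing pointwise on the part of the
  boundary shared with \<open>\<Omega>\<close>, and truncating these near 0 makes the products with \<open>\<chi>\<^sup>2\<close> compactly
  supported in \<open>\<Omega>\<close>. Such products need not be smooth, but their mollifications converge weakly
  enough to pass to the limit in both variational equations.\<close>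

subsection \<open>Calculus of the classes \<open>C\<^sup>k\<close>\<close>

text \<open>Weak gradients are chosen representatives, so statements about their supports hold only
  almost everywhere. The recurring tool is that the weak gradient of a bounded function vanishes
  almost everywhere on its zero set: it restricts integrals to the set where a cut-off lives, and it
  keeps truncation near 0 from distorting gradients in the limit. The Caccioppoli step is an
  identity, in which nothing is absorbed at the price of a constant; this is why the constants come
  out sharp enough. The factor 2 is the square root of 4, from
  \<open>(u - \<psi>)^2 \<le> 2 u^2 + 2 \<psi>^2\<close> with both terms bounded by f. The overlap
  \<kappa> of the small sets enters when local energies are summed, \<kappa>' when local errors are.
  The hyperbolic cosine controls its own derivative. The product of
  \<open>\<epsilon> * sqrt amax\<close>, the bound on the gradient of \<eta> and k equals
  \<open>2 / e\<close>, which is below 1, so at every point the gradient term exceeds the zero-order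
  term by at most 1. Where \<eta> is 1, the cut-off is at least \<open>exp (\<gamma> - 1)\<close>;
  the loss of one unit in the exponent is the factor e of the second estimate.\<close>

definition gradient :: "(real^'d \<Rightarrow> real) \<Rightarrow> real^'d \<Rightarrow> real^'d" where
  "gradient f x = (\<chi> i. partial_deriv i f x)"

lemma gradient_nth [simp]: "gradient f x $ i = partial_deriv i f x"
  by (simp add: gradient_def)

lemma partial_deriv_eq:
  "(f has_derivative f') (at x) \<Longrightarrow> partial_deriv i f x = f' (axis i 1)"
  unfolding partial_deriv_def using frechet_derivative_at by metis

lemma has_derivative_gradient:
  fixes f :: "real^'d \<Rightarrow> real"
  assumes "f differentiable (at x)"
  shows "(f has_derivative (\<lambda>h. gradient f x \<bullet> h)) (at x)"
proof -
  define L where "L = frechet_derivative f (at x)"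
  have L: "(f has_derivative L) (at x)"
    unfolding L_def using assms by (simp add: frechet_derivative_works)
  have lin: "linear L"
    using L has_derivative_linear by blast
  have "L h = gradient f x \<bullet> h" for h
  proof -
    have "L h = L (\<Sum>i\<in>UNIV. h $ i *\<^sub>R axis i 1)"
      by (simp add: basis_expansion flip: scalar_mult_eq_scaleR)
    also have "\<dots> = (\<Sum>i\<in>UNIV. h $ i * L (axis i 1))"
      by (simp add: linear_sum[OF lin] linear_cmul[OF lin])
    finally show ?thesis
      by (simp add: inner_vec_def gradient_def partial_deriv_def L_def mult.commute)
  qed
  then have "L = (\<lambda>h. gradient f x \<bullet> h)" ..
  with L show ?thesis by simp
qed

lemma gradient_eq:
  fixes f :: "real^'d \<Rightarrow> real"
  assumes "(f has_derivative (\<lambda>h. g \<bullet> h)) (at x)"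
  shows "gradient f x = g"
  by (simp add: vec_eq_iff partial_deriv_eq[OF assms] inner_axis)

lemma partial_deriv_const [simp]: "partial_deriv i (\<lambda>x. c) = (\<lambda>x. 0)"
  by (rule ext) (simp add: partial_deriv_eq[OF has_derivative_const])

lemma partial_deriv_add:
  assumes "f differentiable (at x)" "g differentiable (at x)"
  shows "partial_deriv i (\<lambda>x. f x + g x) x = partial_deriv i f x + partial_deriv i g x"
  using partial_deriv_eq[OF has_derivative_add[OF assms[THEN frechet_derivative_works[THEN iffD1]]]]
  by (simp add: partial_deriv_def)

lemma partial_deriv_mult:
  assumes "f differentiable (at x)" "g differentiable (at x)"
  shows "partial_deriv i (\<lambda>x. f x * g x) x = f x * partial_deriv i g x + partial_deriv i f x * g x"
  using partial_deriv_eq[OF has_derivative_mult[OF assms[THEN frechet_derivative_works[THEN iffD1]]]]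
  by (simp add: partial_deriv_def)

text \<open>Kernels enter the weak gradient identity as functions \<open>\<rho> (x - y)\<close> of
  the integration variable y. The sign produced here cancels the one from integration by
  parts.\<close>

lemma partial_deriv_reflect:
  fixes f :: "real^'d \<Rightarrow> real"
  assumes "f differentiable (at (a - x))"
  shows "partial_deriv i (\<lambda>y. f (a - y)) x = - partial_deriv i f (a - x)"
proof -
  have "(f has_derivative frechet_derivative f (at (a - x))) (at (a - x))"
    using assms by (simp add: frechet_derivative_works)
  moreover have "((\<lambda>y. a - y) has_derivative (\<lambda>h. - h)) (at x)"
    by (auto intro!: derivative_eq_intros)
  ultimately have "((\<lambda>y. f (a - y)) has_derivative (\<lambda>h. frechet_derivative f (at (a - x)) (- h))) (at x)"
    using has_derivative_compose by fastforce
  from partial_deriv_eq[OF this] show ?thesis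
    using linear_frechet_derivative[OF assms] by (simp add: partial_deriv_def linear_neg)
qed

text \<open>The recursion for \<open>Ck (Suc k)\<close> has no continuity clause for f itself; the
  base case recovers it from differentiability.\<close>

lemma Ck_Suc_imp_Ck: "Ck (Suc k) f \<Longrightarrow> Ck k f"
proof (induction k arbitrary: f)
  case 0
  then show ?case
    by (simp add: continuous_at_imp_continuous_on differentiable_imp_continuous_within)
qed auto

lemma Ck_const: "Ck k (\<lambda>x. c)"
  by (induction k arbitrary: c) auto

lemma Ck_add: "Ck k f \<Longrightarrow> Ck k g \<Longrightarrow> Ck k (\<lambda>x. f x + g x)"
proof (induction k arbitrary: f g)
  case (Suc k)
  then have "partial_deriv i (\<lambda>x. f x + g x) = (\<lambda>x. partial_deriv i f x + partial_deriv i g x)" for i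
    by (intro ext partial_deriv_add) auto
  with Suc show ?case by auto
qed (simp add: continuous_on_add continuous_on_mult)

lemma Ck_mult: "Ck k f \<Longrightarrow> Ck k g \<Longrightarrow> Ck k (\<lambda>x. f x * g x)"
proof (induction k arbitrary: f g)
  case (Suc k)
  then have "partial_deriv i (\<lambda>x. f x * g x) =
      (\<lambda>x. f x * partial_deriv i g x + partial_deriv i f x * g x)" for i
    by (intro ext partial_deriv_mult) auto
  moreover have "Ck k (\<lambda>x. f x * partial_deriv i g x + partial_deriv i f x * g x)" for i
    using Suc.prems by (intro Ck_add Suc.IH Ck_Suc_imp_Ck[of k f] Ck_Suc_imp_Ck[of k g]) auto
  ultimately show ?case using Suc.prems by auto
qed (simp add: continuous_on_add continuous_on_mult)

lemma Ck_reflect: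
  fixes f :: "real^'d \<Rightarrow> real"
  shows "Ck k f \<Longrightarrow> Ck k (\<lambda>y. f (a - y))"
proof (induction k arbitrary: f)
  case 0
  then show ?case
    by (auto intro!: continuous_on_compose2[where f="\<lambda>y. a - y"] continuous_intros)
next
  case (Suc k)
  then have "partial_deriv i (\<lambda>y. f (a - y)) = (\<lambda>y. (-1) * partial_deriv i f (a - y))" for i
    by (intro ext) (simp add: partial_deriv_reflect)
  moreover have "Ck k (\<lambda>y. (-1) * partial_deriv i f (a - y))" for i
    using Suc by (intro Ck_mult Ck_const) auto
  moreover have "(\<lambda>y. f (a - y)) differentiable (at x)" for x
    using differentiable_chain_at[of "\<lambda>y. a - y" x f] Suc.prems
    by (auto simp: o_def intro!: derivative_intros)
  ultimately show ?case by auto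
qed

lemma smooth_const: "smooth (\<lambda>x. c)"
  and smooth_add: "smooth f \<Longrightarrow> smooth g \<Longrightarrow> smooth (\<lambda>x. f x + g x)"
  and smooth_mult: "smooth f \<Longrightarrow> smooth g \<Longrightarrow> smooth (\<lambda>x. f x * g x)"
  and smooth_reflect: "smooth f \<Longrightarrow> smooth (\<lambda>y. f (a - y))"
  by (auto simp: smooth_def Ck_const Ck_add Ck_mult Ck_reflect)

lemma smooth_diff: "smooth f \<Longrightarrow> smooth g \<Longrightarrow> smooth (\<lambda>x. f x - g x)"
  using smooth_add[OF _ smooth_mult[OF smooth_const[of "-1"]], of f g] by simp

lemma smooth_differentiable: "smooth f \<Longrightarrow> f differentiable (at x)"
  using Ck.simps(2)[of 0 f] unfolding smooth_def by blast

lemma smooth_partial_deriv: "smooth f \<Longrightarrow> smooth (partial_deriv i f)"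
  unfolding smooth_def using Ck.simps(2) by blast

lemma smooth_continuous: "smooth f \<Longrightarrow> continuous_on S f"
  unfolding smooth_def by (metis Ck.simps(1) continuous_on_subset subset_UNIV)

lemma continuous_on_gradient: "smooth f \<Longrightarrow> continuous_on S (gradient f)"
  unfolding gradient_def by (intro continuous_on_vec_lambda smooth_continuous smooth_partial_deriv)

lemma smooth_prod:
  "finite I \<Longrightarrow> (\<And>i. i \<in> I \<Longrightarrow> smooth (f i)) \<Longrightarrow> smooth (\<lambda>x. \<Prod>i\<in>I. f i x)"
  by (induction I rule: finite_induct) (auto intro: smooth_const smooth_mult)

subsection \<open>Smooth mollifiers\<close>

text \<open>The factors \<open>1 / t ^ j\<close> make the family closed under differentiation up to
  linear combinations, so that smoothness of \<open>exp (- 1 / t)\<close> extended by zero becomes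
  an induction with j arbitrary.\<close>

definition flat_exp :: "nat \<Rightarrow> real \<Rightarrow> real" where
  "flat_exp j t = (if t \<le> 0 then 0 else exp (- (1 / t)) / t ^ j)"

lemma flat_exp_tendsto_0: "(flat_exp j \<longlongrightarrow> 0) (at_right 0)"
proof -
  have "((\<lambda>s::real. s ^ j / exp s) \<longlongrightarrow> 0) at_top"
    by (rule tendsto_power_div_exp_0)
  then have "((\<lambda>t::real. (inverse t) ^ j / exp (inverse t)) \<longlongrightarrow> 0) (at_right 0)"
    by (rule filterlim_compose) (rule filterlim_inverse_at_top_right)
  then show ?thesis
    by (rule Lim_transform_eventually)
       (auto simp: eventually_at_right_field flat_exp_def exp_minus field_simps intro!: exI[of _ 1])
qed

lemma flat_exp_deriv:
  "(flat_exp j has_real_derivative (flat_exp (j + 2) t - j * flat_exp (j + 1) t)) (at t)"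
proof -
  consider "t < 0" | "t = 0" | "t > 0" by linarith
  then show ?thesis
  proof cases
    case 1
    have "((\<lambda>t. 0) has_real_derivative 0) (at t)" by simp
    then have "(flat_exp j has_real_derivative 0) (at t)"
      by (rule has_field_derivative_transform_within_open[of _ _ _ "{..<0}"])
         (use 1 in \<open>auto simp: flat_exp_def\<close>)
    with 1 show ?thesis by (simp add: flat_exp_def)
  next
    case 2
    have "((\<lambda>h. (flat_exp j h - flat_exp j 0) / h) \<longlongrightarrow> 0) (at 0)"
      unfolding filterlim_at_split
    proof
      show "((\<lambda>h. (flat_exp j h - flat_exp j 0) / h) \<longlongrightarrow> 0) (at_left 0)"
        by (rule Lim_transform_eventually[of "\<lambda>_. 0"])
           (auto simp: eventually_at_left_field flat_exp_def intro!: exI[of _ "-1"])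
      \<comment> \<open>From the right, the difference quotient at 0 is
        \<open>flat_exp (Suc j)\<close> itself, whose limit is already known.\<close>
      show "((\<lambda>h. (flat_exp j h - flat_exp j 0) / h) \<longlongrightarrow> 0) (at_right 0)"
        by (rule Lim_transform_eventually[OF flat_exp_tendsto_0[of "Suc j"]])
           (auto simp: eventually_at_right_field flat_exp_def field_simps intro!: exI[of _ 1])
    qed
    with 2 show ?thesis by (simp add: DERIV_def flat_exp_def)
  next
    case 3
    have "((\<lambda>t. exp (- (1 / t)) / t ^ j) has_real_derivative
       (flat_exp (j + 2) t - j * flat_exp (j + 1) t)) (at t)"
    proof (rule DERIV_cong)
      show "((\<lambda>t. exp (- (1 / t)) / t ^ j) has_real_derivative
          (exp (- (1 / t)) * (1 / t\<^sup>2) * t ^ j - exp (- (1 / t)) * (real j * t ^ (j - 1))) / (t ^ j * t ^ j)) (at t)"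
        using 3 by (auto intro!: derivative_eq_intros simp: power2_eq_square)
      \<comment> \<open>At \<open>j = 0\<close> the exponent \<open>j - 1\<close> is cut off at 0,
        but the coefficient j removes the term.\<close>
      have "real j * t ^ (j - 1) = real j * t ^ j / t"
        using 3 by (cases j) auto
      then show "(exp (- (1 / t)) * (1 / t\<^sup>2) * t ^ j - exp (- (1 / t)) * (real j * t ^ (j - 1))) / (t ^ j * t ^ j)
          = flat_exp (j + 2) t - j * flat_exp (j + 1) t"
        using 3 by (simp only: flat_exp_def) (simp add: field_simps power2_eq_square)
    qed
    then show ?thesis
      by (rule has_field_derivative_transform_within_open[of _ _ _ "{0<..}"])
         (use 3 in \<open>auto simp: flat_exp_def\<close>)
  qed
qed

text \<open>The slope s is kept general so that one statement covers both ends of the interval on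
  which a coordinate factor of the bump function is positive.\<close>

lemma Ck_flat_exp:
  fixes i :: "'d::finite"
  shows "Ck k (\<lambda>x::real^'d. flat_exp j (s * x $ i + c))"
proof (induction k arbitrary: j)
  case 0
  have "isCont (flat_exp j) t" for t
    using flat_exp_deriv DERIV_isCont by blast
  then have "continuous_on UNIV (flat_exp j)"
    by (simp add: continuous_at_imp_continuous_on)
  then show ?case
    by (auto intro!: continuous_on_compose2[of UNIV "flat_exp j"] continuous_intros)
next
  case (Suc k)
  let ?l = "\<lambda>x::real^'d. s * x $ i + c"
  have D: "((\<lambda>x. flat_exp j (?l x)) has_derivative
      (\<lambda>h. (flat_exp (j + 2) (?l x) - j * flat_exp (j + 1) (?l x)) * (s * h $ i))) (at x)" for x
  proof (rule has_derivative_compose[where f="?l" and g="flat_exp j" and f'="\<lambda>h. s * h $ i"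
        and g'="\<lambda>t. (flat_exp (j + 2) (?l x) - j * flat_exp (j + 1) (?l x)) * t"])
    show "(?l has_derivative (\<lambda>h. s * h $ i)) (at x)"
      by (auto intro!: derivative_eq_intros bounded_linear_imp_has_derivative)
    show "(flat_exp j has_derivative
        (\<lambda>t. (flat_exp (j + 2) (?l x) - j * flat_exp (j + 1) (?l x)) * t)) (at (?l x))"
      using flat_exp_deriv[of j "?l x"] by (simp add: has_field_derivative_def)
  qed
  have "partial_deriv l (\<lambda>x. flat_exp j (?l x)) = (\<lambda>x.
      (flat_exp (j + 2) (?l x) + (- real j) * flat_exp (j + 1) (?l x)) * (s * axis l 1 $ i))" for l
    by (intro ext) (simp add: partial_deriv_eq[OF D])
  then have "Ck k (partial_deriv l (\<lambda>x. flat_exp j (?l x)))" for l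
    by (simp only:) (intro Ck_mult Ck_add Ck_const Suc.IH)
  moreover have "(\<lambda>x. flat_exp j (?l x)) differentiable (at x)" for x
    using D unfolding differentiable_def by blast
  ultimately show ?case by simp
qed

text \<open>Both measures are served: Sobolev spaces integrate over \<open>lebesgue\<close>, whereas
  translation, reflection and Fubini arguments run over \<open>lborel\<close>.\<close>

lemma integrable_continuous_compact_support:
  fixes f :: "'a::euclidean_space \<Rightarrow> 'b::euclidean_space"
  assumes "continuous_on UNIV f" "compact K" "\<And>x. x \<notin> K \<Longrightarrow> f x = 0"
  shows "integrable lebesgue f" "integrable lborel f"
proof -
  have "f = (\<lambda>x. indicator K x *\<^sub>R f x)"
    using assms(3) by (auto simp: indicator_def)
  then show "integrable lborel f"
    using borel_integrable_compact[OF assms(2) continuous_on_subset[OF assms(1)]] by simp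
  then show "integrable lebesgue f"
    using integrable_completion[of f lborel] borel_measurable_integrable[of lborel f] by simp
qed

text \<open>The bump is a product over the coordinates of two one-sided flat exponentials, positive
  exactly on an open cube; it is then divided by its integral.\<close>

lemma exists_mollifier:
  assumes "r > 0"
  obtains \<rho> :: "real^'d \<Rightarrow> real" where
    "smooth \<rho>" "\<And>x. 0 \<le> \<rho> x" "\<And>x. r \<le> norm x \<Longrightarrow> \<rho> x = 0"
    "integral\<^sup>L lebesgue \<rho> = 1"
proof -
  \<comment> \<open>The Euclidean norm is at most the sum of the coordinate moduli, so the open cube
    of half side \<open>r / d\<close> lies in the open ball of radius r.\<close>
  define s where "s = r / real CARD('d)"
  have s: "s > 0" using assms by (simp add: s_def)
  define b :: "real^'d \<Rightarrow> real" where
    "b x = (\<Prod>i\<in>UNIV. flat_exp 0 (1 * x $ i + s) * flat_exp 0 ((-1) * x $ i + s))" for x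
  have smooth: "smooth b"
    unfolding b_def by (intro smooth_prod smooth_mult) (auto simp only: smooth_def Ck_flat_exp finite)
  have nonneg: "0 \<le> b x" for x
    unfolding b_def by (intro prod_nonneg) (auto simp: flat_exp_def)
  have supp: "b x = 0" if "r \<le> norm x" for x
  proof (rule ccontr)
    assume "b x \<noteq> 0"
    then have "\<forall>i. flat_exp 0 (1 * x $ i + s) \<noteq> 0 \<and> flat_exp 0 ((-1) * x $ i + s) \<noteq> 0"
      unfolding b_def by auto
    then have "\<bar>x $ i\<bar> < s" for i
      by (auto simp: flat_exp_def abs_less_iff not_le dest!: spec[of _ i] split: if_splits)
    then have "(\<Sum>i\<in>UNIV. \<bar>x $ i\<bar>) < (\<Sum>i\<in>(UNIV::'d set). s)"
      by (intro sum_strict_mono) auto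
    also have "\<dots> = r" by (simp add: s_def)
    finally show False using that norm_le_l1_cart[of x] by linarith
  qed
  have int: "integrable lebesgue b"
    using integrable_continuous_compact_support[OF smooth_continuous[OF smooth] compact_cball[of 0 r]] supp
    by (auto simp: dist_norm)
  have "integral\<^sup>L lebesgue b \<noteq> 0"
  proof
    assume "integral\<^sup>L lebesgue b = 0"
    then have ae: "AE x in lebesgue. b x = 0"
      using integral_nonneg_eq_0_iff_AE[OF int] nonneg by simp
    \<comment> \<open>A vanishing integral would make b zero almost everywhere, but b is positive on
      an open set around 0, which is not negligible.\<close>
    define U where "U = {x. b x > 0}"
    have "open U"
      unfolding U_def by (intro open_Collect_less smooth_continuous[OF smooth] continuous_intros)
    moreover have "0 \<in> U"
      unfolding U_def b_def using s by (auto simp: flat_exp_def intro!: prod_pos)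
    moreover have "U \<in> null_sets lebesgue"
      using ae \<open>open U\<close> by (subst AE_iff_null_sets) (auto simp: U_def elim: eventually_mono)
    ultimately show False
      using open_not_negligible negligible_iff_null_sets by blast
  qed
  then have pos: "integral\<^sup>L lebesgue b > 0"
    using Bochner_Integration.integral_nonneg[of lebesgue b] nonneg by (simp add: order_less_le)
  show thesis
  proof (rule that[of "\<lambda>x. (1 / integral\<^sup>L lebesgue b) * b x"])
    show "smooth (\<lambda>x. (1 / integral\<^sup>L lebesgue b) * b x)"
      by (intro smooth_mult smooth_const smooth)
  qed (use pos nonneg supp in auto)
qed

subsection \<open>Convolution with a mollifier\<close>

lemma borel_measurable_lebesgue_continuous:
  fixes f :: "'a::euclidean_space \<Rightarrow> 'b::euclidean_space"
  shows "continuous_on UNIV f \<Longrightarrow> f \<in> borel_measurable lebesgue"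
  by (simp add: borel_measurable_continuous_onI measurable_completion)

lemma integrable_mult_bounded:
  fixes f g :: "'a \<Rightarrow> real"
  assumes "integrable M g" "f \<in> borel_measurable M" "AE x in M. \<bar>f x\<bar> \<le> B"
  shows "integrable M (\<lambda>x. f x * g x)"
proof (rule Bochner_Integration.integrable_bound)
  show "integrable M (\<lambda>x. B * g x)" using assms(1) by simp
  show "(\<lambda>x. f x * g x) \<in> borel_measurable M" using assms(1,2) by simp
  show "AE x in M. norm (f x * g x) \<le> norm (B * g x)"
    using assms(3)
  proof eventually_elim
    case (elim x)
    then have "\<bar>f x\<bar> * \<bar>g x\<bar> \<le> \<bar>B\<bar> * \<bar>g x\<bar>" by (intro mult_right_mono) auto
    then show ?case by (simp add: abs_mult)
  qed
qed

lemma lborel_integral_reflect: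
  fixes f :: "'a::euclidean_space \<Rightarrow> real"
  assumes [measurable]: "f \<in> borel_measurable borel"
  shows "(LINT y|lborel. f (a - y)) = (LINT y|lborel. f y)"
proof -
  have "(LINT y|lborel. f y) = (LINT y|density (distr lborel borel (\<lambda>x. a + (-1) *\<^sub>R x)) (\<lambda>_. \<bar>-1::real\<bar> ^ DIM('a)). f y)"
    by (subst lborel_affine[of "-1" a]) auto
  also have "\<dots> = (LINT y|lborel. f (a - y))"
    by (simp add: density_1 integral_distr)
  finally show ?thesis by simp
qed

lemma lborel_integral_translate:
  fixes f :: "'a::euclidean_space \<Rightarrow> real"
  assumes [measurable]: "f \<in> borel_measurable borel"
  shows "(LINT y|lborel. f (a + y)) = (LINT y|lborel. f y)"
  by (subst (2) lborel_distr_plus[of a, symmetric]) (simp add: integral_distr)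

definition convolve :: "(real^'d \<Rightarrow> real) \<Rightarrow> (real^'d \<Rightarrow> real) \<Rightarrow> real^'d \<Rightarrow> real" where
  "convolve \<rho> v x = (LINT y|lebesgue. \<rho> (x - y) * v y)"

lemma compact_support_bounded:
  fixes f :: "real^'d \<Rightarrow> 'b::euclidean_space"
  assumes "continuous_on UNIV f" "\<And>x. r < norm x \<Longrightarrow> f x = 0"
  obtains B where "B > 0" "\<And>x. norm (f x) \<le> B"
proof -
  have "compact (f ` cball 0 r)"
    using assms(1) by (intro compact_continuous_image) (auto intro: continuous_on_subset)
  then obtain B where B: "B > 0" "\<And>x. x \<in> cball 0 r \<Longrightarrow> norm (f x) \<le> B"
    using compact_imp_bounded bounded_pos by (metis image_eqI)
  have "norm (f x) \<le> B" for x
    using B assms(2)[of x] by (cases "r < norm x") (auto simp: dist_norm)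
  with B(1) show thesis by (rule that)
qed

lemma partial_deriv_support:
  fixes f :: "real^'d \<Rightarrow> real"
  assumes "open U" "x \<in> U" "\<And>y. y \<in> U \<Longrightarrow> f y = 0"
  shows "partial_deriv i f x = 0"
proof -
  have "(f has_derivative (\<lambda>h. 0)) (at x)"
    by (rule has_derivative_transform_within_open[OF has_derivative_const assms(1,2)]) (simp add: assms(3))
  from partial_deriv_eq[OF this] show ?thesis .
qed

lemma partial_deriv_outside_cball:
  fixes f :: "real^'d \<Rightarrow> real"
  assumes "\<And>x. r < norm x \<Longrightarrow> f x = 0" "r < norm x"
  shows "partial_deriv i f x = 0"
  using assms by (intro partial_deriv_support[of "{x. r < norm x}"] open_Collect_less continuous_intros) auto

lemma convolve_integrable:
  fixes \<rho> v :: "real^'d \<Rightarrow> real"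
  assumes "continuous_on UNIV \<rho>" "\<And>x. r < norm x \<Longrightarrow> \<rho> x = 0" "integrable lebesgue v"
  shows "integrable lebesgue (\<lambda>y. \<rho> (x - y) * v y)"
proof -
  obtain B where "\<And>x. norm (\<rho> x) \<le> B"
    using compact_support_bounded[OF assms(1,2)] by blast
  then show ?thesis
    by (intro integrable_mult_bounded[where B=B] assms(3) borel_measurable_lebesgue_continuous
        continuous_on_compose2[OF assms(1)] continuous_intros) auto
qed

text \<open>Differentiation under the integral sign. By the mean value theorem the remainder
  quotient of \<rho> is bounded by \<open>2 * L\<close>, with L a bound for its gradient; thus
  \<open>2 * L * \<bar>v\<bar>\<close> dominates and mere integrability of v suffices.\<close>

lemma convolve_has_derivative:
  fixes \<rho> v :: "real^'d \<Rightarrow> real"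
  assumes "smooth \<rho>" and supp: "\<And>x. r < norm x \<Longrightarrow> \<rho> x = 0" and v: "integrable lebesgue v"
  shows "(convolve \<rho> v has_derivative (\<lambda>h. (\<chi> i. convolve (partial_deriv i \<rho>) v x) \<bullet> h)) (at x)"
proof -
  have gsupp: "gradient \<rho> x = 0" if "r < norm x" for x
    using partial_deriv_outside_cball[OF supp that] by (simp add: vec_eq_iff)
  obtain L where "L > 0" and L: "\<And>x. norm (gradient \<rho> x) \<le> L"
    using compact_support_bounded[OF continuous_on_gradient[OF assms(1)] gsupp] by blast
  have der: "(\<rho> has_derivative (\<lambda>h. gradient \<rho> x \<bullet> h)) (at x)" for x
    using assms(1) by (intro has_derivative_gradient smooth_differentiable)
  have lip: "\<bar>\<rho> (z + h) - \<rho> z\<bar> \<le> L * norm h" for z h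
  proof -
    have "norm (\<rho> (z + h) - \<rho> z) \<le> L * norm (z + h - z)"
    proof (rule differentiable_bound[where S=UNIV and f=\<rho> and f'="\<lambda>x h. gradient \<rho> x \<bullet> h"])
      show "onorm (\<lambda>h. gradient \<rho> x \<bullet> h) \<le> L" for x
        using L by (intro onorm_le) (metis Cauchy_Schwarz_ineq2 mult_right_mono norm_ge_zero order_trans real_norm_def)
    qed (use der in auto)
    then show ?thesis by simp
  qed
  let ?R = "\<lambda>h y. (\<rho> (x + h - y) - \<rho> (x - y) - gradient \<rho> (x - y) \<bullet> h) / norm h"
  have int1: "integrable lebesgue (\<lambda>y. \<rho> (z - y) * v y)" for z
    using smooth_continuous[OF assms(1)] supp v by (rule convolve_integrable)
  have int2: "integrable lebesgue (\<lambda>y. partial_deriv i \<rho> (z - y) * v y)" for z i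
    using smooth_continuous[OF smooth_partial_deriv[OF assms(1)]] partial_deriv_outside_cball[OF supp] v
    by (rule convolve_integrable)
  have eq: "(convolve \<rho> v (x + h) - convolve \<rho> v x - (\<chi> i. convolve (partial_deriv i \<rho>) v x) \<bullet> h) / norm h
      = (LINT y|lebesgue. ?R h y * v y)" for h
  proof -
    have "(\<chi> i. convolve (partial_deriv i \<rho>) v x) \<bullet> h
        = (LINT y|lebesgue. (\<Sum>i\<in>UNIV. h $ i * (partial_deriv i \<rho> (x - y) * v y)))"
      using int2 by (subst Bochner_Integration.integral_sum) (auto simp: inner_vec_def convolve_def mult.commute)
    also have "\<dots> = (LINT y|lebesgue. (gradient \<rho> (x - y) \<bullet> h) * v y)"
      by (simp add: inner_vec_def sum_distrib_left mult_ac)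
    finally have "(\<chi> i. convolve (partial_deriv i \<rho>) v x) \<bullet> h
        = (LINT y|lebesgue. (gradient \<rho> (x - y) \<bullet> h) * v y)" .
    moreover have "integrable lebesgue (\<lambda>y. (gradient \<rho> (x - y) \<bullet> h) * v y)"
    proof -
      have "integrable lebesgue (\<lambda>y. \<Sum>i\<in>UNIV. h $ i * (partial_deriv i \<rho> (x - y) * v y))"
        using int2 by simp
      then show ?thesis
        by (simp add: inner_vec_def sum_distrib_left mult_ac)
    qed
    ultimately have "convolve \<rho> v (x + h) - convolve \<rho> v x - (\<chi> i. convolve (partial_deriv i \<rho>) v x) \<bullet> h
        = (LINT y|lebesgue. \<rho> (x + h - y) * v y - \<rho> (x - y) * v y - (gradient \<rho> (x - y) \<bullet> h) * v y)"
      using int1 by (simp add: convolve_def)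
    then have "(convolve \<rho> v (x + h) - convolve \<rho> v x - (\<chi> i. convolve (partial_deriv i \<rho>) v x) \<bullet> h) / norm h
        = (LINT y|lebesgue. (\<rho> (x + h - y) * v y - \<rho> (x - y) * v y - (gradient \<rho> (x - y) \<bullet> h) * v y) / norm h)"
      by (simp only: integral_divide_zero)
    also have "\<dots> = (LINT y|lebesgue. ?R h y * v y)"
      by (simp only: left_diff_distrib times_divide_eq_left)
    finally show ?thesis .
  qed
  have "((\<lambda>h. (convolve \<rho> v (x + h) - convolve \<rho> v x - (\<chi> i. convolve (partial_deriv i \<rho>) v x) \<bullet> h) / norm h)
      \<longlongrightarrow> 0) (at 0)"
    unfolding tendsto_at_iff_sequentially
  proof (intro allI impI)
    fix X :: "nat \<Rightarrow> real^'d"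
    assume X: "\<forall>n. X n \<in> UNIV - {0}" "X \<longlonglongrightarrow> 0"
    have "(\<lambda>n. LINT y|lebesgue. ?R (X n) y * v y) \<longlonglongrightarrow> (LINT y|(lebesgue::(real^'d) measure). 0)"
    proof (rule integral_dominated_convergence[where w="\<lambda>y. 2 * L * \<bar>v y\<bar>"])
      show "integrable lebesgue (\<lambda>y. 2 * L * \<bar>v y\<bar>)"
        using v by auto
      show "(\<lambda>y. ?R (X n) y * v y) \<in> borel_measurable lebesgue" for n
      proof (intro borel_measurable_times borel_measurable_integrable[OF v])
        show "?R (X n) \<in> borel_measurable lebesgue"
          using X(1) by (intro borel_measurable_lebesgue_continuous continuous_intros
              continuous_on_compose2[OF smooth_continuous[OF assms(1)]]
              continuous_on_compose2[OF continuous_on_gradient[OF assms(1)]]) auto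
      qed
      show "AE y in lebesgue. (\<lambda>n. ?R (X n) y * v y) \<longlonglongrightarrow> 0"
      proof (rule AE_I2)
        fix y
        have "((\<lambda>h. ?R h y) \<longlongrightarrow> 0) (at 0)"
        proof (rule tendsto_norm_zero_cancel)
          have "x + h - y = x - y + h" for h by simp
          then show "((\<lambda>h. norm (?R h y)) \<longlongrightarrow> 0) (at 0)"
            using der[of "x - y"] unfolding has_derivative_at by (simp only: real_norm_def abs_divide abs_norm_cancel)
        qed
        then have "(\<lambda>n. ?R (X n) y) \<longlonglongrightarrow> 0"
          using X unfolding tendsto_at_iff_sequentially o_def by blast
        then show "(\<lambda>n. ?R (X n) y * v y) \<longlonglongrightarrow> 0"
          using tendsto_mult_left_zero by blast
      qed
      show "AE y in lebesgue. norm (?R (X n) y * v y) \<le> 2 * L * \<bar>v y\<bar>" for n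
      proof (rule AE_I2)
        fix y
        have "\<bar>gradient \<rho> (x - y) \<bullet> X n\<bar> \<le> L * norm (X n)"
          using L by (metis Cauchy_Schwarz_ineq2 mult_right_mono norm_ge_zero order_trans)
        moreover have "\<bar>\<rho> (x + X n - y) - \<rho> (x - y)\<bar> \<le> L * norm (X n)"
          using lip[of "x - y" "X n"] by (simp add: algebra_simps)
        ultimately have "\<bar>\<rho> (x + X n - y) - \<rho> (x - y) - gradient \<rho> (x - y) \<bullet> X n\<bar> \<le> 2 * L * norm (X n)"
          by linarith
        then have "\<bar>?R (X n) y\<bar> \<le> 2 * L"
          using X(1) by (simp add: abs_divide divide_le_eq)
        then show "norm (?R (X n) y * v y) \<le> 2 * L * \<bar>v y\<bar>"
          unfolding real_norm_def abs_mult[of "?R (X n) y"] by (rule mult_right_mono) simp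
      qed
    qed auto
    then show "((\<lambda>h. (convolve \<rho> v (x + h) - convolve \<rho> v x -
        (\<chi> i. convolve (partial_deriv i \<rho>) v x) \<bullet> h) / norm h) \<circ> X) \<longlonglongrightarrow> 0"
      by (simp add: o_def eq)
  qed
  then show ?thesis
    unfolding has_derivative_at using tendsto_norm_zero
    by (fastforce simp: norm_divide bounded_linear_inner_right)
qed

lemma partial_deriv_convolve:
  assumes "smooth \<rho>" "\<And>x. r < norm x \<Longrightarrow> \<rho> x = 0" "integrable lebesgue v"
  shows "partial_deriv i (convolve \<rho> v) x = convolve (partial_deriv i \<rho>) v x"
  by (simp add: partial_deriv_eq[OF convolve_has_derivative[OF assms]] inner_axis)

text \<open>All derivatives fall on the kernel, so the induction is over arbitrary kernels: each
  partial derivative of \<rho> is again smooth with support in the same ball.\<close>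

lemma smooth_convolve:
  assumes "smooth \<rho>" "\<And>x. r < norm x \<Longrightarrow> \<rho> x = 0" "integrable lebesgue v"
  shows "smooth (convolve \<rho> v)"
proof -
  have "Ck k (convolve \<rho> v)" for k
    using assms
  proof (induction k arbitrary: \<rho>)
    case 0
    show ?case
      using has_derivative_continuous_on[OF has_derivative_at_withinI[OF convolve_has_derivative[OF 0]], of UNIV]
      by simp
  next
    case (Suc k)
    have "partial_deriv i (convolve \<rho> v) = convolve (partial_deriv i \<rho>) v" for i
      using partial_deriv_convolve[OF Suc.prems] by blast
    moreover have "Ck k (convolve (partial_deriv i \<rho>) v)" for i
      using Suc.prems by (intro Suc.IH smooth_partial_deriv partial_deriv_outside_cball[of r]) auto
    ultimately show ?case
      using differentiableI[OF convolve_has_derivative[OF Suc.prems]] by simp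
  qed
  then show ?thesis by (simp add: smooth_def)
qed

lemma convolve_nonzeroD:
  fixes \<rho> v :: "real^'d \<Rightarrow> real"
  assumes "\<And>x. r < norm x \<Longrightarrow> \<rho> x = 0" "convolve \<rho> v x \<noteq> 0"
  obtains y where "v y \<noteq> 0" "dist x y \<le> r"
proof -
  have "\<exists>y. \<rho> (x - y) * v y \<noteq> 0"
    using assms(2) unfolding convolve_def
    by (metis (no_types, lifting) Bochner_Integration.integral_cong integral_zero)
  then show thesis
    using assms(1) that by (metis dist_norm mult_eq_0_iff not_le)
qed

locale mollifier =
  fixes \<rho> :: "real^'d \<Rightarrow> real" and r :: real
  assumes smooth: "smooth \<rho>" and nonneg: "0 \<le> \<rho> x" and supp: "r < norm x \<Longrightarrow> \<rho> x = 0"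
    and integral_1: "integral\<^sup>L lebesgue \<rho> = 1"
begin

lemma continuous: "continuous_on S \<rho>"
  by (rule smooth_continuous[OF smooth])

lemma integrable: "integrable lborel \<rho>"
  using integrable_continuous_compact_support(2)[OF continuous compact_cball[of 0 r]] supp by auto

lemma borel: "\<rho> \<in> borel_measurable borel"
  using integrable by auto

lemma integral_reflect: "(LINT y|lebesgue. \<rho> (x - y)) = 1"
proof -
  have [measurable]: "\<rho> \<in> borel_measurable borel" by (rule borel)
  have "(LINT y|lebesgue. \<rho> (x - y)) = (LINT y|lborel. \<rho> (x - y))"
    by (subst integral_completion) auto
  also have "\<dots> = integral\<^sup>L lborel \<rho>"
    by (rule lborel_integral_reflect) simp
  finally show ?thesis
    using integral_1 by (simp add: integral_completion)
qed

lemma integral_translate: "(LINT x|lborel. \<rho> (x - y)) = 1"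
proof -
  have "(LINT x|lborel. \<rho> (x - y)) = integral\<^sup>L lborel \<rho>"
    using lborel_integral_translate[OF borel, of "-y"] by simp
  then show ?thesis
    using integral_1 borel by (simp add: integral_completion)
qed

lemma convolve_abs_le:
  assumes "integrable lebesgue v" "\<And>x. \<bar>v x\<bar> \<le> B"
  shows "\<bar>convolve \<rho> v x\<bar> \<le> B"
proof -
  have int: "integrable lebesgue (\<lambda>y. \<rho> (x - y))"
    by (rule integrable_continuous_compact_support(1)[of _ "cball x r"])
       (auto intro!: continuous_on_compose2[OF continuous] continuous_intros supp simp: dist_norm)
  have "\<bar>convolve \<rho> v x\<bar> \<le> (LINT y|lebesgue. \<bar>\<rho> (x - y) * v y\<bar>)"
    unfolding convolve_def by (rule integral_abs_bound)
  also have "\<dots> \<le> (LINT y|lebesgue. \<rho> (x - y) * B)"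
  proof (rule integral_mono)
    show "integrable lebesgue (\<lambda>y. \<bar>\<rho> (x - y) * v y\<bar>)"
      by (intro integrable_abs convolve_integrable[OF continuous supp assms(1)])
    show "\<bar>\<rho> (x - y) * v y\<bar> \<le> \<rho> (x - y) * B" for y
      using assms(2)[of y] by (auto simp: abs_mult nonneg intro!: mult_left_mono)
  qed (use int in simp)
  finally show ?thesis
    by (simp add: integral_reflect)
qed

text \<open>Fubini moves the averaging from v, which is only measurable, onto the continuous factor
  c, where it can be controlled pointwise.\<close>

lemma integral_mult_convolve:
  assumes v: "v \<in> borel_measurable lebesgue" and vB: "\<And>x. \<bar>v x\<bar> \<le> B"
    and vR: "\<And>x. R < norm x \<Longrightarrow> v x = 0"
    and c: "continuous_on UNIV c" "\<And>x. \<bar>c x\<bar> \<le> K"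
  shows "(LINT x|lebesgue. c x * convolve \<rho> v x) = (LINT y|lebesgue. v y * (LINT x|lborel. c x * \<rho> (x - y)))"
proof -
  have [measurable]: "\<rho> \<in> borel_measurable borel" "c \<in> borel_measurable borel"
    using borel c(1) by (auto intro: borel_measurable_continuous_onI)
  obtain v0 where v0: "v0 \<in> borel_measurable lborel" "AE x in lborel. v x = v0 x"
    using completion_ex_borel_measurable_real[OF v] by blast
  \<comment> \<open>Fubini over \<open>lborel\<close> requires a Borel representative of v. Clipping
    it to \<open>[- B, B]\<close> and to the ball makes the bounds of v hold everywhere instead of
    almost everywhere.\<close>
  define w where "w x = indicator (cball 0 R) x * max (- B) (min B (v0 x))" for x
  have [measurable]: "w \<in> borel_measurable borel"
    using v0(1) unfolding w_def
    by (intro borel_measurable_times borel_measurable_indicator borel_measurable_max borel_measurable_min) auto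
  have "AE x in lborel. v x = w x"
    using v0(2)
  proof eventually_elim
    case (elim x)
    then show ?case
      using vB[of x] vR[of x] unfolding w_def by (cases "x \<in> cball 0 R") (auto simp: abs_le_iff)
  qed
  then have vw: "AE x in lebesgue. v x = w x"
    by (rule AE_completion)
  have B0: "0 \<le> B" using vB[of 0] by linarith
  have K0: "0 \<le> K" using c(2)[of 0] by linarith
  have wB: "\<bar>w x\<bar> \<le> B * indicator (cball 0 R) x" for x
    using B0 unfolding w_def by (auto simp: indicator_def)
  obtain P where "P > 0" and P: "\<And>x. norm (\<rho> x) \<le> P"
    using compact_support_bounded[OF continuous supp] by blast
  let ?F = "\<lambda>x y. c x * (\<rho> (x - y) * w y)"
  let ?I = "\<lambda>z. (K * P * B) * indicator (cball (0::real^'d) (R + r) \<times> cball (0::real^'d) R) z :: real"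
  have int: "integrable (lborel \<Otimes>\<^sub>M lborel) (case_prod ?F)"
  proof (rule Bochner_Integration.integrable_bound)
    have "emeasure (lborel \<Otimes>\<^sub>M lborel) (cball (0::real^'d) (R + r) \<times> cball (0::real^'d) R) < \<infinity>"
      using emeasure_bounded_finite[OF bounded_cball[of "0::real^'d" "R + r"]]
        emeasure_bounded_finite[OF bounded_cball[of "0::real^'d" R]]
      by (subst lborel.emeasure_pair_measure_Times) (auto simp: ennreal_mult_less_top)
    then show "integrable (lborel \<Otimes>\<^sub>M lborel) ?I"
      by (intro integrable_mult_right integrable_real_indicator) auto
    show "AE z in lborel \<Otimes>\<^sub>M lborel. norm (case_prod ?F z) \<le> norm (?I z)"
    proof (rule AE_I2, clarify)
      fix x y :: "real^'d"
      show "norm (?F x y) \<le> norm (?I (x, y))"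
      proof (cases "norm y \<le> R \<and> norm (x - y) \<le> r")
        case True
        then have "norm x \<le> R + r"
          using norm_triangle_sub[of x y] by linarith
        have "\<bar>?F x y\<bar> \<le> K * (P * B)"
          unfolding abs_mult using wB[of y] P[of "x - y"] c(2)[of x] True B0 K0
          by (intro mult_mono) (auto simp: dist_norm)
        with True \<open>norm x \<le> R + r\<close> show ?thesis
          using B0 K0 \<open>P > 0\<close> by (simp add: dist_norm mult.assoc)
      next
        case False
        then have "?F x y = 0"
          using wB[of y] supp[of "x - y"] by (auto simp: not_le dist_norm)
        then show ?thesis by (simp only: prod.case norm_zero norm_ge_zero)
      qed
    qed
  qed measurable
  have convw: "convolve \<rho> v x = (LINT y|lborel. \<rho> (x - y) * w y)" for x
  proof -
    have "convolve \<rho> v x = (LINT y|lebesgue. \<rho> (x - y) * w y)"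
      unfolding convolve_def
    proof (rule integral_cong_AE)
      have "(\<lambda>y. \<rho> (x - y)) \<in> borel_measurable lebesgue" "w \<in> borel_measurable lebesgue"
        by (auto intro: measurable_completion)
      then show "(\<lambda>y. \<rho> (x - y) * v y) \<in> borel_measurable lebesgue"
        and "(\<lambda>y. \<rho> (x - y) * w y) \<in> borel_measurable lebesgue"
        by (simp_all only: borel_measurable_times v)
      show "AE y in lebesgue. \<rho> (x - y) * v y = \<rho> (x - y) * w y"
        using vw by eventually_elim simp
    qed
    then show ?thesis by (subst (asm) integral_completion) auto
  qed
  have "(LINT x|lebesgue. c x * convolve \<rho> v x) = (LINT x|lborel. (LINT y|lborel. ?F x y))"
    unfolding convw by (subst integral_completion) auto
  also have "\<dots> = (LINT y|lborel. (LINT x|lborel. ?F x y))"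
    using lborel_pair.Fubini_integral[OF int] by simp
  also have "\<dots> = (LINT y|lborel. w y * (LINT x|lborel. c x * \<rho> (x - y)))"
    by (simp add: mult_ac flip: Bochner_Integration.integral_mult_right_zero)
  also have "\<dots> = (LINT y|lebesgue. w y * (LINT x|lborel. c x * \<rho> (x - y)))"
    by (subst integral_completion) auto
  also have "\<dots> = (LINT y|lebesgue. v y * (LINT x|lborel. c x * \<rho> (x - y)))"
  proof (rule integral_cong_AE)
    have "(\<lambda>y. LINT x|lborel. c x * \<rho> (x - y)) \<in> borel_measurable lebesgue" "w \<in> borel_measurable lebesgue"
      by (auto intro: measurable_completion)
    then show "(\<lambda>y. w y * (LINT x|lborel. c x * \<rho> (x - y))) \<in> borel_measurable lebesgue"
      and "(\<lambda>y. v y * (LINT x|lborel. c x * \<rho> (x - y))) \<in> borel_measurable lebesgue"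
      by (simp_all only: borel_measurable_times v)
    show "AE y in lebesgue. w y * (LINT x|lborel. c x * \<rho> (x - y)) = v y * (LINT x|lborel. c x * \<rho> (x - y))"
      using vw by eventually_elim simp
  qed
  finally show ?thesis .
qed

text \<open>An average with weights of total mass 1 is bounded by the bound of c and differs from
  \<open>c y\<close> by at most the oscillation of c over the support of the weights.\<close>

lemma integral_against_continuous:
  assumes c: "continuous_on UNIV c" "\<And>x. \<bar>c x\<bar> \<le> K"
  shows "\<bar>LINT x|lborel. c x * \<rho> (x - y)\<bar> \<le> K"
    and "(\<And>x. dist x y \<le> r \<Longrightarrow> \<bar>c x - c y\<bar> \<le> e) \<Longrightarrow> \<bar>(LINT x|lborel. c x * \<rho> (x - y)) - c y\<bar> \<le> e"
proof -
  have [measurable]: "\<rho> \<in> borel_measurable borel" "c \<in> borel_measurable borel"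
    using borel c(1) by (auto intro: borel_measurable_continuous_onI)
  have int: "integrable lborel (\<lambda>x. \<rho> (x - y))"
    by (rule integrable_continuous_compact_support(2)[of _ "cball y r"])
       (auto intro!: continuous_on_compose2[OF continuous] continuous_intros supp simp: dist_norm norm_minus_commute)
  have intc: "integrable lborel (\<lambda>x. c x * \<rho> (x - y))"
    by (rule integrable_mult_bounded[where B=K]) (use int c in auto)
  have "\<bar>LINT x|lborel. c x * \<rho> (x - y)\<bar> \<le> (LINT x|lborel. \<bar>c x * \<rho> (x - y)\<bar>)"
    by (rule integral_abs_bound)
  also have "\<dots> \<le> (LINT x|lborel. K * \<rho> (x - y))"
  proof (rule integral_mono)
    show "\<bar>c x * \<rho> (x - y)\<bar> \<le> K * \<rho> (x - y)" for x
      using c(2)[of x] by (auto simp: abs_mult nonneg intro!: mult_right_mono)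
  qed (use int integrable_abs[OF intc] in auto)
  finally show "\<bar>LINT x|lborel. c x * \<rho> (x - y)\<bar> \<le> K"
    by (simp add: integral_translate)
  assume e: "\<And>x. dist x y \<le> r \<Longrightarrow> \<bar>c x - c y\<bar> \<le> e"
  have "(LINT x|lborel. c x * \<rho> (x - y)) - c y = (LINT x|lborel. c x * \<rho> (x - y)) - (LINT x|lborel. c y * \<rho> (x - y))"
    by (simp add: integral_translate)
  also have "\<dots> = (LINT x|lborel. (c x - c y) * \<rho> (x - y))"
    using int intc by (subst Bochner_Integration.integral_diff[symmetric]) (auto simp: left_diff_distrib)
  also have "\<bar>\<dots>\<bar> \<le> (LINT x|lborel. \<bar>(c x - c y) * \<rho> (x - y)\<bar>)"
    by (rule integral_abs_bound)
  also have "\<dots> \<le> (LINT x|lborel. e * \<rho> (x - y))"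
  proof (rule integral_mono)
    show "integrable lborel (\<lambda>x. \<bar>(c x - c y) * \<rho> (x - y)\<bar>)"
      using int intc by (intro integrable_abs) (auto simp: left_diff_distrib)
    show "\<bar>(c x - c y) * \<rho> (x - y)\<bar> \<le> e * \<rho> (x - y)" for x
    proof (cases "dist x y \<le> r")
      case True
      then show ?thesis using e[of x] by (auto simp: abs_mult nonneg intro!: mult_right_mono)
    next
      case False
      then show ?thesis using supp[of "x - y"] by (simp add: dist_norm)
    qed
  qed (use int in simp)
  finally show "\<bar>(LINT x|lborel. c x * \<rho> (x - y)) - c y\<bar> \<le> e"
    by (simp add: integral_translate)
qed

end

section \<open>Weak convergence of mollified functions\<close>

lemma weak_limit_closed:
  fixes h :: "nat \<Rightarrow> 'a::euclidean_space \<Rightarrow> real"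
  assumes S: "S \<in> sets lebesgue"
    and h: "\<And>n. h n \<in> borel_measurable lebesgue" "\<And>n x. \<bar>h n x\<bar> \<le> B * indicator S x"
    and l: "l \<in> borel_measurable lebesgue" "\<And>x. \<bar>l x\<bar> \<le> B * indicator S x"
    and G: "integrable (lebesgue_on S) G"
    and c: "\<And>j. integrable (lebesgue_on S) (c j)"
      "\<And>j. (\<lambda>n. LINT x|lebesgue. c j x * h n x) \<longlonglongrightarrow> (LINT x|lebesgue. c j x * l x)"
      "(\<lambda>j. LINT x|lebesgue_on S. \<bar>G x - c j x\<bar>) \<longlonglongrightarrow> 0"
  shows "(\<lambda>n. LINT x|lebesgue. G x * h n x) \<longlonglongrightarrow> (LINT x|lebesgue. G x * l x)"
proof -
  have restr: "(LINT x|lebesgue. F x * k x) = (LINT x|lebesgue_on S. F x * k x)"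
    if "\<And>x. \<bar>k x\<bar> \<le> B * indicator S x" for F k :: "'a \<Rightarrow> real"
  proof -
    have "F x * k x = (if x \<in> S then F x * k x else 0)" for x
      using that[of x] by (auto simp: indicator_def)
    then show ?thesis
      using Lebesgue_Measure.integral_restrict_UNIV[OF S, of "\<lambda>x. F x * k x"] by simp
  qed
  have int: "integrable (lebesgue_on S) (\<lambda>x. F x * k x)"
    if "integrable (lebesgue_on S) F" "k \<in> borel_measurable lebesgue" "\<And>x. \<bar>k x\<bar> \<le> B * indicator S x" for F k
  proof -
    have "integrable (lebesgue_on S) (\<lambda>x. k x * F x)"
    proof (rule integrable_mult_bounded[OF that(1)])
      show "k \<in> borel_measurable (lebesgue_on S)"
        by (intro measurable_restrict_space1 that(2))
      show "AE x in lebesgue_on S. \<bar>k x\<bar> \<le> \<bar>B\<bar>"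
        using that(3) by (intro AE_I2) (metis abs_ge_self abs_ge_zero indicator_simps mult.right_neutral mult_zero_right order_trans)
    qed
    then show ?thesis by (simp add: mult.commute)
  qed
  \<comment> \<open>Exchanging the weight G for \<open>c j\<close> costs at most
    \<open>\<bar>B\<bar>\<close> times their L1 distance on S, uniformly over all functions obeying
    the common bound. The admissible weights therefore form a closed set in L1.\<close>
  have diff: "\<bar>(LINT x|lebesgue. G x * k x) - (LINT x|lebesgue. c j x * k x)\<bar>
      \<le> \<bar>B\<bar> * (LINT x|lebesgue_on S. \<bar>G x - c j x\<bar>)"
    if k: "k \<in> borel_measurable lebesgue" "\<And>x. \<bar>k x\<bar> \<le> B * indicator S x" for k j
  proof -
    have "(LINT x|lebesgue. G x * k x) - (LINT x|lebesgue. c j x * k x)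
        = (LINT x|lebesgue_on S. G x * k x - c j x * k x)"
      using int[OF G k] int[OF c(1) k] by (simp add: restr[OF k(2)])
    also have "\<bar>\<dots>\<bar> \<le> (LINT x|lebesgue_on S. \<bar>G x * k x - c j x * k x\<bar>)"
      by (rule integral_abs_bound)
    also have "\<dots> \<le> (LINT x|lebesgue_on S. \<bar>B\<bar> * \<bar>G x - c j x\<bar>)"
    proof (rule integral_mono)
      fix x assume "x \<in> space (lebesgue_on S)"
      then have "\<bar>k x\<bar> \<le> \<bar>B\<bar>" using k(2)[of x] by simp
      then have "\<bar>G x - c j x\<bar> * \<bar>k x\<bar> \<le> \<bar>G x - c j x\<bar> * \<bar>B\<bar>" by (rule mult_left_mono) simp
      then show "\<bar>G x * k x - c j x * k x\<bar> \<le> \<bar>B\<bar> * \<bar>G x - c j x\<bar>"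
        by (simp add: abs_mult mult.commute[of _ "\<bar>B\<bar>"] flip: left_diff_distrib)
    qed (use G c(1)[of j] int[OF G k] int[OF c(1) k] in auto)
    finally show ?thesis by simp
  qed
  show ?thesis
  proof (rule LIMSEQ_I)
    fix e :: real assume "e > 0"
    \<comment> \<open>Two exchanges of weights at \<open>(\<bar>B\<bar> + 1) * e'\<close> each and
      one error \<open>e'\<close> from the limit for \<open>c j\<close> add up to e.\<close>
    define e' where "e' = e / (2 * (\<bar>B\<bar> + 1) + 1)"
    have "e' > 0" using \<open>e > 0\<close> by (simp add: e'_def)
    then obtain j where "norm ((LINT x|lebesgue_on S. \<bar>G x - c j x\<bar>) - 0) < e'"
      using LIMSEQ_D[OF c(3)] by blast
    then have j: "(LINT x|lebesgue_on S. \<bar>G x - c j x\<bar>) < e'" by simp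
    have j': "\<bar>B\<bar> * (LINT x|lebesgue_on S. \<bar>G x - c j x\<bar>) \<le> (\<bar>B\<bar> + 1) * e'"
      using j \<open>e' > 0\<close> by (intro mult_mono) auto
    obtain N where N: "\<And>n. n \<ge> N \<Longrightarrow> norm ((LINT x|lebesgue. c j x * h n x) - (LINT x|lebesgue. c j x * l x)) < e'"
      using LIMSEQ_D[OF c(2) \<open>e' > 0\<close>] by blast
    have "norm ((LINT x|lebesgue. G x * h n x) - (LINT x|lebesgue. G x * l x)) < e" if "n \<ge> N" for n
    proof -
      have "\<bar>(LINT x|lebesgue. G x * h n x) - (LINT x|lebesgue. G x * l x)\<bar> < 2 * ((\<bar>B\<bar> + 1) * e') + e'"
        using diff[OF h, of n j] diff[OF l, of j] N[OF that] j' by (simp add: real_norm_def)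
      also have "\<dots> = (2 * (\<bar>B\<bar> + 1) + 1) * e'" by (simp add: algebra_simps)
      also have "\<dots> = e" by (simp add: e'_def)
      finally show ?thesis by simp
    qed
    then show "\<exists>N. \<forall>n\<ge>N. norm ((LINT x|lebesgue. G x * h n x) - (LINT x|lebesgue. G x * l x)) < e" by blast
  qed
qed

lemma truncation_tendsto_L1:
  fixes G :: "'a::euclidean_space \<Rightarrow> real"
  assumes "integrable (lebesgue_on S) G"
  shows "(\<lambda>m. LINT x|lebesgue_on S. \<bar>G x - max (- real m) (min (real m) (G x))\<bar>) \<longlonglongrightarrow> 0"
proof -
  have [measurable]: "G \<in> borel_measurable (lebesgue_on S)"
    using assms by simp
  have "(\<lambda>m. LINT x|lebesgue_on S. \<bar>G x - max (- real m) (min (real m) (G x))\<bar>)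
      \<longlonglongrightarrow> (LINT x|lebesgue_on S. 0)"
  proof (rule integral_dominated_convergence[where w="\<lambda>x. \<bar>G x\<bar>"])
    show "AE x in lebesgue_on S. (\<lambda>m. \<bar>G x - max (- real m) (min (real m) (G x))\<bar>) \<longlonglongrightarrow> 0"
    proof (rule AE_I2)
      fix x
      obtain N :: nat where "\<bar>G x\<bar> \<le> real N" using real_arch_simple by blast
      then have "\<forall>\<^sub>F m in sequentially. \<bar>G x - max (- real m) (min (real m) (G x))\<bar> = 0"
        by (intro eventually_sequentiallyI[of N]) (auto simp: abs_le_iff)
      then show "(\<lambda>m. \<bar>G x - max (- real m) (min (real m) (G x))\<bar>) \<longlonglongrightarrow> 0"
        by (rule tendsto_eventually)
    qed
    show "AE x in lebesgue_on S. norm \<bar>G x - max (- real m) (min (real m) (G x))\<bar> \<le> \<bar>G x\<bar>" for m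
      by (intro AE_I2) (auto simp: max_def min_def)
  qed (use assms in auto)
  then show ?thesis by simp
qed

text \<open>Convergence against fixed weights is the right mode here, because equations are linear
  in the test function. The weights are enlarged from bounded continuous ones (averages of c
  converge pointwise) to bounded measurable ones (almost everywhere limits of continuous ones) and
  finally to integrable ones (truncation).\<close>

theorem convolve_weak_limit:
  fixes v :: "real^'d \<Rightarrow> real"
  assumes mol: "\<And>n. mollifier (\<rho> n) (r n)" and r: "r \<longlonglongrightarrow> 0" "\<And>n. r n \<le> 1"
    and v: "v \<in> borel_measurable lebesgue" "\<And>x. \<bar>v x\<bar> \<le> B" "\<And>x. R < norm x \<Longrightarrow> v x = 0"
    and G: "integrable (lebesgue_on (cball 0 (R + 1))) G"
  shows "(\<lambda>n. LINT x|lebesgue. G x * convolve (\<rho> n) v x) \<longlonglongrightarrow> (LINT x|lebesgue. G x * v x)"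
proof -
  \<comment> \<open>As no kernel has a radius above 1, this ball contains the supports of v and of
    all its mollifications.\<close>
  define S where "S = cball (0::real^'d) (R + 1)"
  have S: "S \<in> sets lebesgue" "emeasure lebesgue S < \<infinity>"
    using emeasure_bounded_finite[of S] by (auto simp: S_def)
  have fin: "finite_measure (lebesgue_on S)"
    using S by (intro finite_measureI) (simp add: emeasure_restrict_space)
  have vint: "integrable lebesgue v"
  proof -
    have "integrable (lebesgue_on S) v"
      by (rule finite_measure.integrable_const_bound[OF fin, where B=B])
         (use v(1,2) in \<open>auto intro: measurable_restrict_space1\<close>)
    then have "integrable lebesgue (\<lambda>x. if x \<in> S then v x else 0)"
      by (rule Lebesgue_Measure.integrable_restrict_UNIV[OF S(1), THEN iffD2])
    moreover have "(\<lambda>x. if x \<in> S then v x else 0) = v"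
      using v(3) by (auto simp: S_def dist_norm)
    ultimately show ?thesis by simp
  qed
  have smooth: "smooth (convolve (\<rho> n) v)" for n
    using mol[of n] vint by (intro smooth_convolve[of _ "r n"]) (auto simp: mollifier_def)
  have h: "convolve (\<rho> n) v \<in> borel_measurable lebesgue" for n
    by (intro borel_measurable_lebesgue_continuous smooth_continuous smooth)
  have B0: "0 \<le> B" using v(2)[of 0] by linarith
  have hB: "\<bar>convolve (\<rho> n) v x\<bar> \<le> B * indicator S x" for n x
  proof (cases "convolve (\<rho> n) v x = 0")
    case False
    then obtain y where "v y \<noteq> 0" "dist x y \<le> r n"
      using convolve_nonzeroD[of "r n" "\<rho> n"] mol[of n] by (auto simp: mollifier_def)
    then have "norm x \<le> R + 1"
      using v(3)[of y] r(2)[of n] norm_triangle_sub[of x y] by (force simp: dist_norm not_less)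
    then show ?thesis
      using mollifier.convolve_abs_le[OF mol vint v(2)] by (simp add: S_def dist_norm)
  qed (use B0 in simp)
  have vS: "\<bar>v x\<bar> \<le> B * indicator S x" for x
    using v(2,3)[of x] by (auto simp: S_def indicator_def dist_norm)
  have cont: "(\<lambda>n. LINT x|lebesgue. c x * convolve (\<rho> n) v x) \<longlonglongrightarrow> (LINT x|lebesgue. c x * v x)"
    if c: "continuous_on UNIV c" "\<And>x. \<bar>c x\<bar> \<le> K" for c K
  proof -
    have bor: "(\<lambda>y. LINT x|lborel. c x * \<rho> n (x - y)) \<in> borel_measurable borel" for n
    proof -
      have [measurable]: "\<rho> n \<in> borel_measurable borel" "c \<in> borel_measurable borel"
        using mollifier.borel[OF mol] c(1) by (auto intro: borel_measurable_continuous_onI)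
      show ?thesis by measurable
    qed
    have "(\<lambda>n. LINT y|lebesgue. v y * (LINT x|lborel. c x * \<rho> n (x - y)))
        \<longlonglongrightarrow> (LINT y|lebesgue. v y * c y)"
    proof (rule integral_dominated_convergence[where w="\<lambda>x. K * \<bar>v x\<bar>"])
      show "AE y in lebesgue. (\<lambda>n. v y * (LINT x|lborel. c x * \<rho> n (x - y))) \<longlonglongrightarrow> v y * c y"
      proof (intro AE_I2 tendsto_mult tendsto_const LIMSEQ_I)
        fix y and e :: real assume "e > 0"
        then obtain d where "d > 0" and d: "\<And>x. dist x y < d \<Longrightarrow> dist (c x) (c y) < e / 2"
          using c(1) unfolding continuous_on_iff by (metis UNIV_I half_gt_zero)
        obtain N where N: "\<And>n. n \<ge> N \<Longrightarrow> norm (r n - 0) < d"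
          using LIMSEQ_D[OF r(1) \<open>d > 0\<close>] by blast
        have "norm ((LINT x|lborel. c x * \<rho> n (x - y)) - c y) < e" if "n \<ge> N" for n
        proof -
          have "\<bar>(LINT x|lborel. c x * \<rho> n (x - y)) - c y\<bar> \<le> e / 2"
          proof (rule mollifier.integral_against_continuous(2)[OF mol c])
            fix x assume "dist x y \<le> r n"
            then show "\<bar>c x - c y\<bar> \<le> e / 2"
              using d[of x] N[OF that] by (smt (verit) dist_real_def field_sum_of_halves real_norm_def)
          qed
          then show ?thesis using \<open>e > 0\<close> by simp
        qed
        then show "\<exists>N. \<forall>n\<ge>N. norm ((LINT x|lborel. c x * \<rho> n (x - y)) - c y) < e" by blast
      qed
      show "AE y in lebesgue. norm (v y * (LINT x|lborel. c x * \<rho> n (x - y))) \<le> K * \<bar>v y\<bar>" for n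
        using mollifier.integral_against_continuous(1)[OF mol c]
        by (intro AE_I2) (auto simp: abs_mult mult.commute[of K] intro!: mult_left_mono)
      show "(\<lambda>y. v y * (LINT x|lborel. c x * \<rho> n (x - y))) \<in> borel_measurable lebesgue" for n
        by (intro borel_measurable_times v(1) measurable_completion) (simp add: bor)
    qed (use v(1) vint borel_measurable_lebesgue_continuous[OF c(1)] in auto)
    then show ?thesis
      using mollifier.integral_mult_convolve[OF mol v c] by (simp add: mult.commute)
  qed
  have bdd: "(\<lambda>n. LINT x|lebesgue. F x * convolve (\<rho> n) v x) \<longlonglongrightarrow> (LINT x|lebesgue. F x * v x)"
    if F: "F \<in> borel_measurable (lebesgue_on S)" "\<And>x. \<bar>F x\<bar> \<le> real m" for F m
  proof -
    obtain N g where N: "negligible N" and g: "\<And>n. continuous_on UNIV (g n)"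
      and lim: "\<And>x. x \<notin> N \<Longrightarrow> (\<lambda>n. g n x) \<longlonglongrightarrow> (if x \<in> S then F x else 0)"
      using measurable_on_iff_borel_measurable[OF S(1), of F] F(1) unfolding measurable_on_def by auto
    \<comment> \<open>Clipping at m makes the continuous approximants uniformly bounded, hence
      dominated, and leaves the limit alone because F already lies in
      \<open>[- m, m]\<close>.\<close>
    define c where "c j x = max (- real m) (min (real m) (g j x))" for j x
    have c: "continuous_on UNIV (c j)" "\<bar>c j x\<bar> \<le> real m" for j x
      unfolding c_def using g by (auto intro!: continuous_intros)
    have cm: "c j \<in> borel_measurable (lebesgue_on S)" for j
      by (intro measurable_restrict_space1 borel_measurable_lebesgue_continuous c)
    have Fint: "integrable (lebesgue_on S) F"
      by (rule finite_measure.integrable_const_bound[OF fin, where B="real m"]) (use F in auto)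
    have cint: "integrable (lebesgue_on S) (c j)" for j
      by (rule finite_measure.integrable_const_bound[OF fin, where B="real m"]) (use c cm in auto)
    have "(\<lambda>j. LINT x|lebesgue_on S. \<bar>F x - c j x\<bar>) \<longlonglongrightarrow> (LINT x|lebesgue_on S. 0)"
    proof (rule integral_dominated_convergence[where w="\<lambda>x. 2 * real m"])
      have "AE x in lebesgue_on S. x \<notin> N"
        using AE_not_in[of N lebesgue] N S(1)
        by (simp add: AE_restrict_space_iff negligible_iff_null_sets eventually_mono)
      then show "AE x in lebesgue_on S. (\<lambda>j. \<bar>F x - c j x\<bar>) \<longlonglongrightarrow> 0"
        using AE_space
      proof eventually_elim
        case (elim x)
        then have "(\<lambda>j. g j x) \<longlonglongrightarrow> F x"
          using lim[of x] by simp
        then have "(\<lambda>j. c j x) \<longlonglongrightarrow> max (- real m) (min (real m) (F x))"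
          unfolding c_def by (intro tendsto_intros)
        also have "max (- real m) (min (real m) (F x)) = F x"
          using F(2)[of x] by (auto simp: abs_le_iff)
        finally have "(\<lambda>j. \<bar>F x - c j x\<bar>) \<longlonglongrightarrow> \<bar>F x - F x\<bar>"
          by (intro tendsto_intros)
        then show ?case by simp
      qed
      show "AE x in lebesgue_on S. norm \<bar>F x - c j x\<bar> \<le> 2 * real m" for j
        using F(2) c(2)[of j] by (intro AE_I2) (smt (verit) real_norm_def)
      show "integrable (lebesgue_on S) (\<lambda>x. 2 * real m)"
        by (intro finite_measure.integrable_const fin)
    qed (use F(1) cm in auto)
    then have lim0: "(\<lambda>j. LINT x|lebesgue_on S. \<bar>F x - c j x\<bar>) \<longlonglongrightarrow> 0" by simp
    show ?thesis
      by (rule weak_limit_closed[OF S(1) h hB v(1) vS Fint cint cont[OF c] lim0])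
  qed
  have G': "integrable (lebesgue_on S) G" using G by (simp add: S_def)
  have [measurable]: "G \<in> borel_measurable (lebesgue_on S)" using G' by simp
  let ?G = "\<lambda>m x. max (- real m) (min (real m) (G x))"
  have Gint: "integrable (lebesgue_on S) (?G m)" for m
    by (rule finite_measure.integrable_const_bound[OF fin, where B="real m"]) auto
  show ?thesis
  proof (rule weak_limit_closed[OF S(1) h hB v(1) vS G' Gint _ truncation_tendsto_L1[OF G']])
    show "(\<lambda>n. LINT x|lebesgue. ?G m x * convolve (\<rho> n) v x) \<longlonglongrightarrow> (LINT x|lebesgue. ?G m x * v x)" for m
      by (rule bdd[of _ m]) auto
  qed
qed

section \<open>Test functions and the fundamental lemma of the calculus of variations\<close>

lemma finite_measure_lebesgue_on:
  fixes S :: "'a::euclidean_space set"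
  assumes "bounded S" "S \<in> sets lebesgue"
  shows "finite_measure (lebesgue_on S)"
proof (rule finite_measureI)
  obtain e where S: "S \<subseteq> cball 0 e"
    using assms(1) unfolding bounded_iff by (auto simp: dist_norm subset_eq)
  have "emeasure lebesgue S \<le> emeasure lebesgue (cball (0::'a) e)"
    using S by (intro emeasure_mono) auto
  also have "\<dots> < \<infinity>"
    using emeasure_bounded_finite[OF bounded_cball[of "0::'a" e]] by simp
  finally show "emeasure (lebesgue_on S) (space (lebesgue_on S)) \<noteq> \<infinity>"
    using assms(2) by (simp add: emeasure_restrict_space)
qed

text \<open>The bound 1 keeps all mollifications in one ball; the bound d keeps them within distance
  d of the original support.\<close>

lemma exists_mollifier_sequence:
  assumes "d > 0"
  obtains \<rho> :: "nat \<Rightarrow> real^'d \<Rightarrow> real" and r :: "nat \<Rightarrow> real" where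
    "\<And>n. mollifier (\<rho> n) (r n)" "r \<longlonglongrightarrow> 0" "\<And>n. r n \<le> 1" "\<And>n. r n \<le> d"
proof -
  define r where "r n = min 1 d * inverse (real (Suc n))" for n
  have r: "r n > 0" for n using assms by (simp add: r_def)
  have "\<exists>\<rho>::real^'d \<Rightarrow> real. mollifier \<rho> (r n)" for n
  proof -
    obtain \<rho> :: "real^'d \<Rightarrow> real" where "smooth \<rho>" "\<And>x. 0 \<le> \<rho> x"
      "\<And>x. r n \<le> norm x \<Longrightarrow> \<rho> x = 0" "integral\<^sup>L lebesgue \<rho> = 1"
      using exists_mollifier[OF r] by blast
    then have "mollifier \<rho> (r n)" by unfold_locales auto
    then show ?thesis by blast
  qed
  then obtain \<rho> :: "nat \<Rightarrow> real^'d \<Rightarrow> real" where "\<And>n. mollifier (\<rho> n) (r n)"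
    by metis
  moreover have "r \<longlonglongrightarrow> min 1 d * 0"
    unfolding r_def by (intro tendsto_intros LIMSEQ_inverse_real_of_nat)
  moreover have "r n \<le> min 1 d" for n
    using assms unfolding r_def by (intro mult_left_le) (auto simp: inverse_le_1_iff)
  ultimately show thesis by (intro that[of \<rho> r]) auto
qed

lemma compact_neighbourhood:
  fixes D :: "'a::euclidean_space set"
  assumes "open D" "compact K" "K \<subseteq> D"
  obtains d K' where "d > 0" "compact K'" "K' \<subseteq> D" "\<And>x y. y \<in> K \<Longrightarrow> dist x y \<le> d \<Longrightarrow> x \<in> K'"
proof -
  obtain d where d: "d > 0" "(\<Union>x\<in>K. cball x d) \<subseteq> D"
    using compact_subset_open_imp_cball_epsilon_subset[OF assms(2,1,3)] by blast
  show thesis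
  proof (rule that[OF d(1)])
    show "compact {x + y | x y. x \<in> K \<and> y \<in> cball 0 d}"
      by (intro compact_sums assms(2) compact_cball)
    have "x + y \<in> cball x d" if "y \<in> cball 0 d" for x y :: 'a
      using that by (simp add: dist_norm norm_minus_commute)
    then show "{x + y | x y. x \<in> K \<and> y \<in> cball 0 d} \<subseteq> D"
      using d(2) by blast
    show "x \<in> {x + y | x y. x \<in> K \<and> y \<in> cball 0 d}" if "y \<in> K" "dist x y \<le> d" for x y
      using that by (intro CollectI exI[of _ y] exI[of _ "x - y"]) (simp add: dist_norm norm_minus_commute)
  qed
qed

lemma test_functionI:
  assumes "smooth f" "compact K" "K \<subseteq> D" "\<And>x. f x \<noteq> 0 \<Longrightarrow> x \<in> K"
  shows "test_function D f"
proof -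
  have "closure {x. f x \<noteq> 0} \<subseteq> K"
    using assms by (intro closure_minimal compact_imp_closed) auto
  then show ?thesis
    using assms unfolding test_function_def by (meson closed_closure compact_closure bounded_subset compact_imp_bounded order_trans compact_eq_bounded_closed)
qed

lemma test_function_support:
  assumes "test_function D f"
  obtains K where "compact K" "K \<subseteq> D" "\<And>x. x \<notin> K \<Longrightarrow> f x = 0" "\<And>x i. x \<notin> K \<Longrightarrow> partial_deriv i f x = 0"
proof -
  let ?K = "closure {x. f x \<noteq> 0}"
  have 0: "f x = 0" if "x \<notin> ?K" for x
    using that closure_subset[of "{x. f x \<noteq> 0}"] by blast
  show thesis
  proof (rule that[of ?K])
    show "partial_deriv i f x = 0" if "x \<notin> ?K" for x i
    proof (rule partial_deriv_support[of "- ?K"])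
      show "f y = 0" if "y \<in> - ?K" for y
        using that by (intro 0) simp
    qed (use that in auto)
    show "f x = 0" if "x \<notin> ?K" for x
      using that by (rule 0)
  qed (use assms in \<open>simp_all only: test_function_def\<close>)
qed

text \<open>The test functions are mollifications of the sign of \<open>g\<close>, cut off to a compact set.\<close>

theorem AE_zero_if_orthogonal_test_functions:
  fixes g :: "real^'d \<Rightarrow> real"
  assumes D: "open D"
    and g: "locally_integrable D g"
    and 0: "\<And>\<theta>. test_function D \<theta> \<Longrightarrow> (LINT x|lebesgue_on D. g x * \<theta> x) = 0"
  shows "AE x in lebesgue_on D. g x = 0"
proof -
  have Q: "AE x in lebesgue. x \<in> Q \<longrightarrow> g x = 0" if Q: "compact Q" "Q \<subseteq> D" for Q
  proof -
    obtain d K where d: "d > 0" and K: "compact K" "K \<subseteq> D" "\<And>x y. y \<in> Q \<Longrightarrow> dist x y \<le> d \<Longrightarrow> x \<in> K"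
      using compact_neighbourhood[OF D Q] by blast
    obtain \<rho> :: "nat \<Rightarrow> real^'d \<Rightarrow> real" and r :: "nat \<Rightarrow> real" where
      mol: "\<And>n. mollifier (\<rho> n) (r n)" and r: "r \<longlonglongrightarrow> 0" "\<And>n. r n \<le> 1" "\<And>n. r n \<le> d"
      using exists_mollifier_sequence[OF d] by metis
    have meas: "Q \<in> sets lebesgue" "K \<in> sets lebesgue" "D \<in> sets lebesgue"
      using Q(1) K(1) D by (auto simp: compact_imp_closed borel_closed)
    have gQ: "integrable (lebesgue_on Q) g" and gK: "integrable (lebesgue_on K) g"
      using g Q K by (auto simp: locally_integrable_def)
    define v where "v x = (if x \<in> Q then sgn (g x) else 0)" for x
    define G where "G x = (if x \<in> K then g x else 0)" for x
    have vm: "v \<in> borel_measurable lebesgue"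
    proof -
      have "(\<lambda>x. if x \<in> Q then g x else 0) \<in> borel_measurable lebesgue"
        using gQ meas by (simp add: borel_measurable_if_I)
      then have "(\<lambda>x. sgn (if x \<in> Q then g x else 0)) \<in> borel_measurable lebesgue"
        by (rule measurable_compose[OF _ borel_measurable_sgn])
      moreover have "(\<lambda>x. sgn (if x \<in> Q then g x else 0)) = v"
        by (auto simp: v_def)
      ultimately show ?thesis by simp
    qed
    have v1: "\<bar>v x\<bar> \<le> 1" for x by (simp add: v_def abs_sgn_eq)
    obtain R where "\<forall>x\<in>Q. norm x \<le> R"
      using compact_imp_bounded[OF Q(1)] unfolding bounded_iff by blast
    then have R: "Q \<subseteq> cball 0 R"
      by (auto simp: dist_norm)
    have vR: "v x = 0" if "R < norm x" for x
      using that R by (auto simp: v_def dist_norm)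
    have Gint: "integrable lebesgue G"
      using gK Lebesgue_Measure.integrable_restrict_UNIV[OF meas(2), of g] by (simp add: G_def[abs_def])
    have vint: "integrable lebesgue v"
    proof -
      have "integrable (lebesgue_on Q) (\<lambda>x. 1::real)"
        using Q(1) meas(1)
        by (intro finite_measure.integrable_const finite_measure_lebesgue_on compact_imp_bounded)
      then have "integrable lebesgue (\<lambda>x. if x \<in> Q then 1 else 0 :: real)"
        by (rule Lebesgue_Measure.integrable_restrict_UNIV[OF meas(1), THEN iffD2])
      then show ?thesis
        by (rule Bochner_Integration.integrable_bound) (use vm v1 in \<open>auto simp: v_def\<close>)
    qed
    have zero: "(LINT x|lebesgue. G x * convolve (\<rho> n) v x) = 0" for n
    proof -
      have K': "x \<in> K" if nz: "convolve (\<rho> n) v x \<noteq> 0" for x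
      proof -
        obtain y where "v y \<noteq> 0" "dist x y \<le> r n"
          using mollifier.supp[OF mol] nz by (rule convolve_nonzeroD)
        then show ?thesis
          using K(3)[of y x] r(3)[of n] by (simp add: v_def split: if_splits)
      qed
      have "smooth (convolve (\<rho> n) v)"
        using mollifier.smooth[OF mol] mollifier.supp[OF mol] vint by (rule smooth_convolve)
      then have "test_function D (convolve (\<rho> n) v)"
        using K' by (intro test_functionI[OF _ K(1,2)])
      then have "0 = (LINT x|lebesgue_on D. g x * convolve (\<rho> n) v x)"
        using 0 by simp
      also have "\<dots> = (LINT x|lebesgue. (if x \<in> D then g x * convolve (\<rho> n) v x else 0))"
        by (rule Lebesgue_Measure.integral_restrict_UNIV[OF meas(3), symmetric])
      also have "\<dots> = (LINT x|lebesgue. G x * convolve (\<rho> n) v x)"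
        using K' K(2) by (intro Bochner_Integration.integral_cong) (auto simp: G_def)
      finally show ?thesis by simp
    qed
    have "(\<lambda>n. LINT x|lebesgue. G x * convolve (\<rho> n) v x) \<longlonglongrightarrow> (LINT x|lebesgue. G x * v x)"
    proof (rule convolve_weak_limit[OF mol r(1,2) vm v1 vR])
      show "integrable (lebesgue_on (cball 0 (R + 1))) G"
        using integrable_mult_indicator[OF _ Gint, of "cball 0 (R + 1)"]
        by (subst integrable_restrict_space) auto
    qed
    then have "(LINT x|lebesgue. G x * v x) = 0"
      unfolding zero by (simp add: LIMSEQ_const_iff)
    moreover have Gv: "G x * v x = (if x \<in> Q then \<bar>g x\<bar> else 0)" for x
      using K(3)[of x x] d by (auto simp: G_def v_def abs_sgn mult.commute)
    moreover have "integrable lebesgue (\<lambda>x. if x \<in> Q then \<bar>g x\<bar> else 0)"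
      using integrable_abs[OF gQ] by (rule Lebesgue_Measure.integrable_restrict_UNIV[OF meas(1), THEN iffD2])
    ultimately have "AE x in lebesgue. (if x \<in> Q then \<bar>g x\<bar> else 0) = 0"
      by (subst (asm) integral_nonneg_eq_0_iff_AE) auto
    then show ?thesis by (auto elim: eventually_mono)
  qed
  \<comment> \<open>Countably many compact boxes exhaust D, so the exceptional null sets can be
    united.\<close>
  obtain F where F: "countable F" "F \<subseteq> Pow D" "\<And>Q. Q \<in> F \<Longrightarrow> \<exists>a b. Q = cbox a b" "\<Union>F = D"
    by (rule open_countable_Union_open_cbox[OF D], rule that) (assumption | blast)+
  have "AE x in lebesgue. \<forall>Q\<in>F. x \<in> Q \<longrightarrow> g x = 0"
    unfolding AE_ball_countable[OF F(1)]
  proof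
    fix Q assume "Q \<in> F"
    then have "compact Q" "Q \<subseteq> D" using F(2) F(3)[OF \<open>Q \<in> F\<close>] by (auto intro: compact_cbox)
    then show "AE x in lebesgue. x \<in> Q \<longrightarrow> g x = 0" by (rule Q)
  qed
  then have "AE x in lebesgue. x \<in> D \<longrightarrow> g x = 0"
    using F(4) by (auto elim!: eventually_mono)
  then show ?thesis
    using D by (subst AE_restrict_space_iff) auto
qed

subsection \<open>Square-integrable functions\<close>

lemma integrable_lebesgue_on_subset:
  fixes f :: "'a::euclidean_space \<Rightarrow> 'b::euclidean_space"
  assumes "integrable (lebesgue_on T) f" "S \<subseteq> T" "S \<in> sets lebesgue" "T \<in> sets lebesgue"
  shows "integrable (lebesgue_on S) f"
proof -
  have "integrable lebesgue (\<lambda>x. indicator T x *\<^sub>R f x)"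
    using assms(1,4) by (simp add: integrable_restrict_space)
  then have "integrable lebesgue (\<lambda>x. indicator S x *\<^sub>R (indicator T x *\<^sub>R f x))"
    by (rule integrable_mult_indicator[OF assms(3)])
  moreover have "(\<lambda>x. indicator S x *\<^sub>R (indicator T x *\<^sub>R f x)) = (\<lambda>x. indicator S x *\<^sub>R f x)"
    using assms(2) by (intro ext) (auto simp: indicator_def)
  ultimately show ?thesis
    using assms(3) by (simp only: integrable_restrict_space space_completion space_lborel space_borel Int_UNIV_right)
qed

lemma measurable_lebesgue_on_subset:
  fixes S :: "'a::euclidean_space set"
  assumes "f \<in> measurable (lebesgue_on T) N" "S \<subseteq> T"
  shows "f \<in> measurable (lebesgue_on S) N"
  using measurable_restrict_mono[OF assms] .

lemma AE_lebesgue_on_subset: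
  fixes S :: "'a::euclidean_space set"
  assumes "AE x in lebesgue_on T. P x" "S \<subseteq> T" "S \<in> sets lebesgue" "T \<in> sets lebesgue"
  shows "AE x in lebesgue_on S. P x"
  using assms by (auto simp: AE_restrict_space_iff elim!: eventually_mono)

lemma measurable_lebesgue_on_continuous:
  fixes f :: "'a::euclidean_space \<Rightarrow> 'b::euclidean_space"
  assumes "continuous_on S f" "S \<in> sets lebesgue"
  shows "f \<in> borel_measurable (lebesgue_on S)"
  using assms by (rule continuous_imp_measurable_on_sets_lebesgue)

text \<open>Young's inequality with a free weight t, optimal at \<open>t = b / a\<close>. If one of
  the norms is 0, an extreme choice of t, scaled by the supposedly nonzero integral, gives a
  contradiction.\<close>

lemma Cauchy_Schwarz_integral:
  fixes f g :: "'a \<Rightarrow> real"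
  assumes "integrable M (\<lambda>x. (f x)\<^sup>2)" "integrable M (\<lambda>x. (g x)\<^sup>2)" "integrable M (\<lambda>x. f x * g x)"
  shows "\<bar>LINT x|M. f x * g x\<bar> \<le> sqrt (LINT x|M. (f x)\<^sup>2) * sqrt (LINT x|M. (g x)\<^sup>2)"
proof -
  define a b where "a = sqrt (LINT x|M. (f x)\<^sup>2)" and "b = sqrt (LINT x|M. (g x)\<^sup>2)"
  have a: "a \<ge> 0" "(LINT x|M. (f x)\<^sup>2) = a\<^sup>2" and b: "b \<ge> 0" "(LINT x|M. (g x)\<^sup>2) = b\<^sup>2"
    by (auto simp: a_def b_def Bochner_Integration.integral_nonneg)
  have bound: "\<bar>LINT x|M. f x * g x\<bar> \<le> (t * a\<^sup>2 + b\<^sup>2 / t) / 2" if "t > 0" for t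
  proof -
    have "\<bar>LINT x|M. f x * g x\<bar> \<le> (LINT x|M. \<bar>f x * g x\<bar>)"
      by (rule integral_abs_bound)
    also have "\<dots> \<le> (LINT x|M. (t * (f x)\<^sup>2 + (g x)\<^sup>2 / t) / 2)"
    proof (rule integral_mono)
      fix x
      have "0 \<le> (t * \<bar>f x\<bar> - \<bar>g x\<bar>)\<^sup>2" by simp
      then have "2 * t * (\<bar>f x\<bar> * \<bar>g x\<bar>) \<le> t\<^sup>2 * (f x)\<^sup>2 + (g x)\<^sup>2"
        by (simp add: power2_eq_square algebra_simps)
      then have "2 * (\<bar>f x\<bar> * \<bar>g x\<bar>) \<le> (t\<^sup>2 * (f x)\<^sup>2 + (g x)\<^sup>2) / t"
        using \<open>t > 0\<close> by (simp add: field_simps)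
      also have "\<dots> = t * (f x)\<^sup>2 + (g x)\<^sup>2 / t"
        using \<open>t > 0\<close> by (simp add: field_simps power2_eq_square)
      finally show "\<bar>f x * g x\<bar> \<le> (t * (f x)\<^sup>2 + (g x)\<^sup>2 / t) / 2"
        by (simp add: abs_mult)
    qed (use assms in auto)
    also have "\<dots> = (t * a\<^sup>2 + b\<^sup>2 / t) / 2"
      using assms(1,2) by (simp add: a b)
    finally show ?thesis .
  qed
  let ?I = "\<bar>LINT x|M. f x * g x\<bar>"
  consider "a = 0" | "b = 0" | "a > 0" "b > 0" using a(1) b(1) by linarith
  then have "\<bar>LINT x|M. f x * g x\<bar> \<le> a * b"
  proof cases
    case 1
    have "?I = 0"
    proof (rule ccontr)
      assume "?I \<noteq> 0"
      then have "?I > 0" by simp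
      moreover have "b\<^sup>2 + 1 > 0" by (simp add: add_nonneg_pos)
      ultimately have "?I * (2 * (b\<^sup>2 + 1)) \<le> b\<^sup>2 * ?I"
        using bound[of "(b\<^sup>2 + 1) / ?I"] 1 by (simp add: field_simps)
      with \<open>?I > 0\<close> have "2 * (b\<^sup>2 + 1) \<le> b\<^sup>2" by (metis mult.commute mult_le_cancel_left_pos)
      then show False using zero_le_power2[of b] by (simp add: algebra_simps)
    qed
    then show ?thesis using 1 by simp
  next
    case 2
    have "?I = 0"
    proof (rule ccontr)
      assume "?I \<noteq> 0"
      then have "?I > 0" by simp
      moreover have "a\<^sup>2 + 1 > 0" by (simp add: add_nonneg_pos)
      ultimately have "?I * (2 * (a\<^sup>2 + 1)) \<le> a\<^sup>2 * ?I"
        using bound[of "?I / (a\<^sup>2 + 1)"] 2 by (simp add: field_simps)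
      with \<open>?I > 0\<close> have "2 * (a\<^sup>2 + 1) \<le> a\<^sup>2" by (metis mult.commute mult_le_cancel_left_pos)
      then show False using zero_le_power2[of a] by (simp add: algebra_simps)
    qed
    then show ?thesis using 2 by simp
  next
    case 3
    then show ?thesis
      using bound[of "b / a"] by (simp add: field_simps power2_eq_square)
  qed
  then show ?thesis by (simp add: a_def b_def)
qed

lemma L2_D: "f \<in> L2 D \<Longrightarrow> f \<in> borel_measurable (lebesgue_on D)"
    "f \<in> L2 D \<Longrightarrow> integrable (lebesgue_on D) (\<lambda>x. (norm (f x))\<^sup>2)"
  by (auto simp: L2_def)

lemma L2_norm_nonneg: "0 \<le> L2_norm D f"
  by (simp add: L2_norm_def Bochner_Integration.integral_nonneg)

lemma L2_norm_squared: "(L2_norm D f)\<^sup>2 = (LINT x|lebesgue_on D. (norm (f x))\<^sup>2)"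
  by (simp add: L2_norm_def Bochner_Integration.integral_nonneg)

lemma L2_norm_cong_AE:
  assumes "AE x in lebesgue_on D. norm (f x) = norm (g x)" "f \<in> borel_measurable (lebesgue_on D)"
    "g \<in> borel_measurable (lebesgue_on D)"
  shows "L2_norm D f = L2_norm D g"
  unfolding L2_norm_def using assms by (intro arg_cong[where f=sqrt] integral_cong_AE) auto

lemma L2_cong_AE:
  assumes "AE x in lebesgue_on D. f x = g x" "f \<in> L2 D" "g \<in> borel_measurable (lebesgue_on D)"
  shows "g \<in> L2 D"
proof -
  have "AE x in lebesgue_on D. norm ((norm (g x))\<^sup>2) \<le> norm ((norm (f x))\<^sup>2)"
    using assms(1) by eventually_elim simp
  moreover have "(\<lambda>x. (norm (g x))\<^sup>2) \<in> borel_measurable (lebesgue_on D)"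
    using assms(3) by measurable
  ultimately have "integrable (lebesgue_on D) (\<lambda>x. (norm (g x))\<^sup>2)"
    using Bochner_Integration.integrable_bound L2_D(2)[OF assms(2)] by blast
  then show ?thesis
    using assms(3) by (simp add: L2_def)
qed

lemma L2_bounded_by:
  fixes f :: "real^'d \<Rightarrow> 'b::euclidean_space" and g :: "real^'d \<Rightarrow> 'c::euclidean_space"
  assumes "g \<in> L2 D" "f \<in> borel_measurable (lebesgue_on D)" "AE x in lebesgue_on D. norm (f x) \<le> B * norm (g x)"
  shows "f \<in> L2 D"
proof -
  have "integrable (lebesgue_on D) (\<lambda>x. (norm (f x))\<^sup>2)"
  proof (rule Bochner_Integration.integrable_bound)
    show "integrable (lebesgue_on D) (\<lambda>x. B\<^sup>2 * (norm (g x))\<^sup>2)"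
      using L2_D(2)[OF assms(1)] by simp
    show "AE x in lebesgue_on D. norm ((norm (f x))\<^sup>2) \<le> norm (B\<^sup>2 * (norm (g x))\<^sup>2)"
      using assms(3)
    proof eventually_elim
      case (elim x)
      then have "(norm (f x))\<^sup>2 \<le> (B * norm (g x))\<^sup>2" by (intro power_mono) auto
      then show ?case by (simp add: power_mult_distrib)
    qed
  qed (use assms(2) in auto)
  with assms(2) show ?thesis by (simp add: L2_def)
qed

lemma L2_add:
  assumes "f \<in> L2 D" "g \<in> L2 D"
  shows "(\<lambda>x. f x + g x) \<in> L2 D"
proof -
  have "integrable (lebesgue_on D) (\<lambda>x. (norm (f x + g x))\<^sup>2)"
  proof (rule Bochner_Integration.integrable_bound)
    show "integrable (lebesgue_on D) (\<lambda>x. 2 * (norm (f x))\<^sup>2 + 2 * (norm (g x))\<^sup>2)"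
      using assms by (auto simp: L2_def)
    show "AE x in lebesgue_on D. norm ((norm (f x + g x))\<^sup>2) \<le> norm (2 * (norm (f x))\<^sup>2 + 2 * (norm (g x))\<^sup>2)"
    proof (rule AE_I2)
      fix x
      have "(norm (f x + g x))\<^sup>2 \<le> (norm (f x) + norm (g x))\<^sup>2"
        by (intro power_mono norm_triangle_ineq) auto
      also have "\<dots> \<le> 2 * (norm (f x))\<^sup>2 + 2 * (norm (g x))\<^sup>2"
        using sum_squares_bound[of "norm (f x)" "norm (g x)"] by (simp add: power2_sum)
      finally show "norm ((norm (f x + g x))\<^sup>2) \<le> norm (2 * (norm (f x))\<^sup>2 + 2 * (norm (g x))\<^sup>2)"
        by simp
    qed
  qed (use assms in \<open>auto simp: L2_def\<close>)
  then show ?thesis using assms by (auto simp: L2_def)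
qed

lemma L2_minus: "f \<in> L2 D \<Longrightarrow> (\<lambda>x. - f x) \<in> L2 D"
  by (auto simp: L2_def)

lemma L2_diff: "f \<in> L2 D \<Longrightarrow> g \<in> L2 D \<Longrightarrow> (\<lambda>x. f x - g x) \<in> L2 D"
  using L2_add[OF _ L2_minus, of f D g] by simp

lemma L2_sum: "finite I \<Longrightarrow> (\<And>i. i \<in> I \<Longrightarrow> f i \<in> L2 D) \<Longrightarrow> (\<lambda>x. \<Sum>i\<in>I. f i x) \<in> L2 D"
proof (induction I rule: finite_induct)
  case empty
  then show ?case by (simp add: L2_def)
next
  case (insert i I)
  then have "(\<lambda>x. f i x + (\<Sum>i\<in>I. f i x)) \<in> L2 D" by (intro L2_add) auto
  with insert.hyps show ?case by simp
qed

lemma L2_subset: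
  fixes f :: "real^'d \<Rightarrow> 'b::euclidean_space"
  assumes "f \<in> L2 D" "D' \<subseteq> D" "D' \<in> sets lebesgue" "D \<in> sets lebesgue"
  shows "f \<in> L2 D'" "L2_norm D' f \<le> L2_norm D f"
proof -
  show "f \<in> L2 D'"
    using assms integrable_lebesgue_on_subset[OF L2_D(2)[OF assms(1)] assms(2-4)]
    by (auto simp: L2_def intro: measurable_lebesgue_on_subset)
  show "L2_norm D' f \<le> L2_norm D f"
    unfolding L2_norm_def using assms
    by (intro real_sqrt_le_mono integral_mono_lebesgue_on_AE L2_D(2)) auto
qed

text \<open>Formulated for an integrand h dominated by a product, so that it applies alike to
  products, inner products and expressions weighted by A or by cut-offs.\<close>

lemma integrable_mult_L2:
  fixes f :: "real^'d \<Rightarrow> 'b::euclidean_space" and g :: "real^'d \<Rightarrow> 'c::euclidean_space"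
    and h :: "real^'d \<Rightarrow> real"
  assumes "f \<in> L2 D" "g \<in> L2 D" "h \<in> borel_measurable (lebesgue_on D)"
    "AE x in lebesgue_on D. \<bar>h x\<bar> \<le> B * (norm (f x) * norm (g x))"
  shows "integrable (lebesgue_on D) h"
proof (rule Bochner_Integration.integrable_bound[OF _ assms(3)])
  show "integrable (lebesgue_on D) (\<lambda>x. \<bar>B\<bar> * ((norm (f x))\<^sup>2 + (norm (g x))\<^sup>2))"
    using assms(1,2) by (auto simp: L2_def)
  show "AE x in lebesgue_on D. norm (h x) \<le> norm (\<bar>B\<bar> * ((norm (f x))\<^sup>2 + (norm (g x))\<^sup>2))"
    using assms(4)
  proof eventually_elim
    case (elim x)
    have "norm (f x) * norm (g x) \<le> (norm (f x))\<^sup>2 + (norm (g x))\<^sup>2"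
    proof -
      have "0 \<le> norm (f x) * norm (g x)" by simp
      moreover have "2 * (norm (f x) * norm (g x)) \<le> (norm (f x))\<^sup>2 + (norm (g x))\<^sup>2"
        using sum_squares_bound[of "norm (f x)" "norm (g x)"] by (simp only: mult.assoc)
      ultimately show ?thesis by linarith
    qed
    then have "\<bar>B\<bar> * (norm (f x) * norm (g x)) \<le> \<bar>B\<bar> * ((norm (f x))\<^sup>2 + (norm (g x))\<^sup>2)"
      by (rule mult_left_mono) simp
    moreover have "B * (norm (f x) * norm (g x)) \<le> \<bar>B\<bar> * (norm (f x) * norm (g x))"
      by (intro mult_right_mono) auto
    ultimately show ?case using elim by simp
  qed
qed

lemma integral_mult_L2_le:
  fixes f :: "real^'d \<Rightarrow> 'b::euclidean_space" and g :: "real^'d \<Rightarrow> 'c::euclidean_space"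
    and h :: "real^'d \<Rightarrow> real"
  assumes "f \<in> L2 D" "g \<in> L2 D" "h \<in> borel_measurable (lebesgue_on D)"
    "AE x in lebesgue_on D. \<bar>h x\<bar> \<le> B * (norm (f x) * norm (g x))" "B \<ge> 0"
  shows "\<bar>LINT x|lebesgue_on D. h x\<bar> \<le> B * (L2_norm D f * L2_norm D g)"
proof -
  have [measurable]: "f \<in> borel_measurable (lebesgue_on D)" "g \<in> borel_measurable (lebesgue_on D)"
    using assms by (auto simp: L2_def)
  have int: "integrable (lebesgue_on D) (\<lambda>x. norm (f x) * norm (g x))"
    by (rule integrable_mult_L2[OF assms(1,2), where B=1]) auto
  have "\<bar>LINT x|lebesgue_on D. h x\<bar> \<le> (LINT x|lebesgue_on D. \<bar>h x\<bar>)"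
    by (rule integral_abs_bound)
  also have "\<dots> \<le> (LINT x|lebesgue_on D. B * (norm (f x) * norm (g x)))"
    using assms(4) int integrable_mult_L2[OF assms(1-4)] by (intro integral_mono_AE) auto
  also have "\<dots> = B * (LINT x|lebesgue_on D. norm (f x) * norm (g x))"
    by simp
  also have "\<dots> \<le> B * (L2_norm D f * L2_norm D g)"
    using Cauchy_Schwarz_integral[of "lebesgue_on D" "\<lambda>x. norm (f x)" "\<lambda>x. norm (g x)"] int assms
    by (intro mult_left_mono) (auto simp: L2_norm_def L2_def)
  finally show ?thesis .
qed

lemma const_L2:
  assumes "bounded D" "D \<in> sets lebesgue"
  shows "(\<lambda>x. c) \<in> L2 D"
  using finite_measure.integrable_const[OF finite_measure_lebesgue_on[OF assms]] by (simp add: L2_def)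

lemma bounded_L2:
  fixes f :: "real^'d \<Rightarrow> 'b::euclidean_space"
  assumes "bounded D" "D \<in> sets lebesgue" "f \<in> borel_measurable (lebesgue_on D)"
    "AE x in lebesgue_on D. norm (f x) \<le> B"
  shows "f \<in> L2 D"
  by (rule L2_bounded_by[OF const_L2[OF assms(1,2), of "1::real"] assms(3), where B=B]) (use assms(4) in simp)

lemma L2_imp_integrable:
  fixes f :: "real^'d \<Rightarrow> 'b::euclidean_space"
  assumes "bounded D" "D \<in> sets lebesgue" "f \<in> L2 D"
  shows "integrable (lebesgue_on D) f"
proof -
  have "integrable (lebesgue_on D) (\<lambda>x. norm (f x))"
    by (rule integrable_mult_L2[OF assms(3) const_L2[OF assms(1,2), of "1::real"], where B=1])
       (use assms(3) in \<open>auto simp: L2_def\<close>)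
  then show ?thesis
    using assms(3) integrable_norm_cancel by (auto simp: L2_def)
qed

text \<open>P stands for any pointwise pairing that is subtractive in its first argument and
  bounded; its dependence on x lets it carry coefficients such as \<open>(chi x)\<^sup>2\<close> or
  \<open>c x\<close>. All passages to the limit along smooth approximations of w are
  instances.\<close>

lemma L2_norm_tendsto_imp_integral:
  fixes f :: "nat \<Rightarrow> real^'d \<Rightarrow> 'b::euclidean_space" and l :: "real^'d \<Rightarrow> 'b"
    and g :: "real^'d \<Rightarrow> 'c::euclidean_space" and P :: "'b \<Rightarrow> 'c \<Rightarrow> real^'d \<Rightarrow> real"
  assumes f: "\<And>n. f n \<in> L2 D" and l: "l \<in> L2 D" and g: "g \<in> L2 D"
    and lim: "(\<lambda>n. L2_norm D (\<lambda>x. f n x - l x)) \<longlonglongrightarrow> 0"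
    and P: "\<And>k. k \<in> L2 D \<Longrightarrow> (\<lambda>x. P (k x) (g x) x) \<in> borel_measurable (lebesgue_on D)"
      "\<And>a b c x. P (a - b) c x = P a c x - P b c x"
      "AE x in lebesgue_on D. \<forall>a b. \<bar>P a b x\<bar> \<le> B * (norm a * norm b)"
    and B: "B \<ge> 0"
  shows "(\<lambda>n. LINT x|lebesgue_on D. P (f n x) (g x) x) \<longlonglongrightarrow> (LINT x|lebesgue_on D. P (l x) (g x) x)"
proof (rule Lim_null[THEN iffD2], rule Lim_null_comparison)
  have bd: "AE x in lebesgue_on D. \<bar>P (k x) (g x) x\<bar> \<le> B * (norm (k x) * norm (g x))" for k
    using P(3) by eventually_elim blast
  have int: "integrable (lebesgue_on D) (\<lambda>x. P (k x) (g x) x)" if "k \<in> L2 D" for k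
    by (rule integrable_mult_L2[OF that g P(1)[OF that] bd])
  show "\<forall>\<^sub>F n in sequentially. norm ((LINT x|lebesgue_on D. P (f n x) (g x) x) - (LINT x|lebesgue_on D. P (l x) (g x) x))
      \<le> B * (L2_norm D (\<lambda>x. f n x - l x) * L2_norm D g)"
  proof (rule always_eventually, rule allI)
    fix n
    have d: "(\<lambda>x. f n x - l x) \<in> L2 D" by (intro L2_diff f l)
    have "(LINT x|lebesgue_on D. P (f n x) (g x) x) - (LINT x|lebesgue_on D. P (l x) (g x) x)
        = (LINT x|lebesgue_on D. P (f n x - l x) (g x) x)"
      using int[OF f] int[OF l] by (simp add: P(2))
    with integral_mult_L2_le[OF d g P(1)[OF d] bd B]
    show "norm ((LINT x|lebesgue_on D. P (f n x) (g x) x) - (LINT x|lebesgue_on D. P (l x) (g x) x))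
      \<le> B * (L2_norm D (\<lambda>x. f n x - l x) * L2_norm D g)" by simp
  qed
  show "(\<lambda>n. B * (L2_norm D (\<lambda>x. f n x - l x) * L2_norm D g)) \<longlonglongrightarrow> 0"
    using tendsto_mult[OF tendsto_const tendsto_mult[OF lim tendsto_const]] by simp
qed

subsection \<open>Weak gradients\<close>

lemma open_sets_lebesgue [simp]: "open S \<Longrightarrow> S \<in> sets lebesgue"
  by auto

lemma compact_sets_lebesgue: "compact S \<Longrightarrow> S \<in> sets lebesgue"
  by (simp add: compact_imp_closed)

lemma integral_lebesgue_on_support:
  fixes f :: "'a::euclidean_space \<Rightarrow> real"
  assumes "S \<subseteq> T" "S \<in> sets lebesgue" "T \<in> sets lebesgue" "\<And>x. x \<in> T - S \<Longrightarrow> f x = 0"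
  shows "(LINT x|lebesgue_on T. f x) = (LINT x|lebesgue_on S. f x)"
proof -
  have "(LINT x|lebesgue_on T. f x) = (LINT x|lebesgue_on T. (if x \<in> S then f x else 0))"
    using assms(4) by (intro Bochner_Integration.integral_cong) auto
  also have "\<dots> = (LINT x|lebesgue_on S. f x)"
    by (rule Lebesgue_Measure.integral_restrict[OF assms(1-3)])
  finally show ?thesis .
qed

lemma integrable_lebesgue_on_support:
  fixes f :: "'a::euclidean_space \<Rightarrow> real"
  assumes "integrable (lebesgue_on S) f" "S \<subseteq> T" "S \<in> sets lebesgue" "T \<in> sets lebesgue"
    "\<And>x. x \<in> T - S \<Longrightarrow> f x = 0"
  shows "integrable (lebesgue_on T) f"
proof -
  have "integrable lebesgue (\<lambda>x. if x \<in> S then f x else 0)"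
    by (rule Lebesgue_Measure.integrable_restrict_UNIV[OF assms(3), THEN iffD2, OF assms(1)])
  then have "integrable (lebesgue_on UNIV) (\<lambda>x. if x \<in> S then f x else 0)"
    by (simp only: lebesgue_on_UNIV_eq)
  then have "integrable (lebesgue_on T) (\<lambda>x. if x \<in> S then f x else 0)"
    by (rule integrable_lebesgue_on_subset) (use assms(4) in auto)
  then show ?thesis
    using assms(5) by (subst Bochner_Integration.integrable_cong[where g="\<lambda>x. if x \<in> S then f x else 0"]) auto
qed

lemma locally_integrableI:
  assumes "integrable (lebesgue_on D) f" "D \<in> sets lebesgue"
  shows "locally_integrable D f"
  using integrable_lebesgue_on_subset[OF assms(1) _ compact_sets_lebesgue assms(2)]
  by (simp add: locally_integrable_def)

lemma locally_integrable_add: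
  "locally_integrable D f \<Longrightarrow> locally_integrable D g \<Longrightarrow> locally_integrable D (\<lambda>x. f x + g x)"
  by (simp add: locally_integrable_def)

lemma locally_integrable_scaleR: "locally_integrable D f \<Longrightarrow> locally_integrable D (\<lambda>x. c *\<^sub>R f x)"
  by (simp add: locally_integrable_def)

lemma borel_measurable_vec_nth:
  fixes f :: "'a \<Rightarrow> real^'d"
  assumes "f \<in> borel_measurable M"
  shows "(\<lambda>x. f x $ i) \<in> borel_measurable M"
proof -
  have "(\<lambda>y::real^'d. y $ i) \<in> borel_measurable borel"
    by (intro borel_measurable_continuous_onI continuous_intros)
  then show ?thesis
    using assms by (rule measurable_compose_rev)
qed

lemma locally_integrable_nth:
  fixes g :: "real^'d \<Rightarrow> real^'d"
  shows "locally_integrable D g \<Longrightarrow> locally_integrable D (\<lambda>x. g x $ i)"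
  using integrable_bounded_linear[OF bounded_linear_vec_nth] by (auto simp: locally_integrable_def)

lemma locally_integrable_continuous:
  fixes f :: "real^'d \<Rightarrow> 'b::euclidean_space"
  assumes "continuous_on D f"
  shows "locally_integrable D f"
  unfolding locally_integrable_def
proof (intro allI impI, elim conjE)
  fix K assume K: "compact K" "K \<subseteq> D"
  have "integrable lborel (\<lambda>x. indicator K x *\<^sub>R f x)"
    by (rule borel_integrable_compact[OF K(1) continuous_on_subset[OF assms K(2)]])
  then have "integrable lebesgue (\<lambda>x. indicator K x *\<^sub>R f x)"
    using integrable_completion[of "\<lambda>x. indicator K x *\<^sub>R f x" lborel]
      borel_measurable_integrable[of lborel "\<lambda>x. indicator K x *\<^sub>R f x"] by simp
  then show "integrable (lebesgue_on K) f"
    using compact_sets_lebesgue[OF K(1)] by (simp add: integrable_restrict_space)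
qed

lemma locally_integrable_cong_AE:
  fixes f g :: "real^'d \<Rightarrow> 'b::euclidean_space"
  assumes "locally_integrable D f" "AE x in lebesgue_on D. f x = g x" "g \<in> borel_measurable (lebesgue_on D)"
    "D \<in> sets lebesgue"
  shows "locally_integrable D g"
  unfolding locally_integrable_def
proof (intro allI impI, elim conjE)
  fix K assume K: "compact K" "K \<subseteq> D"
  have "integrable (lebesgue_on K) f"
    using assms(1) K by (simp add: locally_integrable_def)
  moreover have "g \<in> borel_measurable (lebesgue_on K)"
    by (rule measurable_lebesgue_on_subset[OF assms(3) K(2)])
  moreover have "AE x in lebesgue_on K. f x = g x"
    by (rule AE_lebesgue_on_subset[OF assms(2) K(2) compact_sets_lebesgue[OF K(1)] assms(4)])
  ultimately show "integrable (lebesgue_on K) g"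
    by (rule integrable_cong_AE_imp) 
qed

lemma integrable_mult_test:
  fixes u h :: "real^'d \<Rightarrow> real"
  assumes "open D" "locally_integrable D u" "compact K" "K \<subseteq> D" "continuous_on UNIV h" "\<And>x. x \<notin> K \<Longrightarrow> h x = 0"
  shows "integrable (lebesgue_on D) (\<lambda>x. u x * h x)"
proof -
  have "compact (h ` K)"
    using assms(3,5) by (intro compact_continuous_image) (auto intro: continuous_on_subset)
  then have "bounded (h ` K)"
    by (rule compact_imp_bounded)
  then obtain B where "\<forall>y\<in>h ` K. norm y \<le> B"
    unfolding bounded_iff by blast
  then have B: "\<And>x. x \<in> K \<Longrightarrow> norm (h x) \<le> B"
    by auto
  have "integrable (lebesgue_on K) (\<lambda>x. h x * u x)"
  proof (rule integrable_mult_bounded)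
    show "integrable (lebesgue_on K) u"
      using assms by (simp add: locally_integrable_def)
    show "h \<in> borel_measurable (lebesgue_on K)"
      by (intro measurable_restrict_space1 borel_measurable_lebesgue_continuous assms)
    show "AE x in lebesgue_on K. \<bar>h x\<bar> \<le> B"
      using B by (intro AE_I2) simp
  qed
  then have "integrable (lebesgue_on K) (\<lambda>x. u x * h x)"
    by (simp only: mult.commute)
  then show ?thesis
    by (rule integrable_lebesgue_on_support) (use assms compact_sets_lebesgue in auto)
qed

lemma weak_gradient_integrable:
  assumes "open D" "is_weak_gradient D u g" "test_function D \<phi>"
  shows "integrable (lebesgue_on D) (\<lambda>x. u x * partial_deriv i \<phi> x)"
    "integrable (lebesgue_on D) (\<lambda>x. g x $ i * \<phi> x)"
proof -
  obtain K where K: "compact K" "K \<subseteq> D" "\<And>x. x \<notin> K \<Longrightarrow> \<phi> x = 0" "\<And>x i. x \<notin> K \<Longrightarrow> partial_deriv i \<phi> x = 0"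
    using assms(3) by (rule test_function_support) blast
  have "smooth \<phi>" using assms(3) by (simp add: test_function_def)
  show "integrable (lebesgue_on D) (\<lambda>x. u x * partial_deriv i \<phi> x)"
    by (rule integrable_mult_test[OF assms(1) _ K(1,2) _ K(4)])
       (use assms(2) \<open>smooth \<phi>\<close> in \<open>auto simp: is_weak_gradient_def intro: smooth_continuous smooth_partial_deriv\<close>)
  show "integrable (lebesgue_on D) (\<lambda>x. g x $ i * \<phi> x)"
    by (rule integrable_mult_test[OF assms(1) _ K(1,2) _ K(3)])
       (use assms(2) \<open>smooth \<phi>\<close> in \<open>auto simp: is_weak_gradient_def intro: smooth_continuous locally_integrable_nth\<close>)
qed

lemma weak_gradientD:
  "is_weak_gradient D u g \<Longrightarrow> test_function D \<phi> \<Longrightarrow>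
     (LINT x|lebesgue_on D. u x * partial_deriv i \<phi> x) = - (LINT x|lebesgue_on D. g x $ i * \<phi> x)"
  by (simp add: is_weak_gradient_def)

lemma weak_gradient_add:
  assumes "open D" "is_weak_gradient D u g" "is_weak_gradient D v h"
  shows "is_weak_gradient D (\<lambda>x. u x + v x) (\<lambda>x. g x + h x)"
  unfolding is_weak_gradient_def
proof (intro conjI allI impI)
  show "locally_integrable D (\<lambda>x. u x + v x)" "locally_integrable D (\<lambda>x. g x + h x)"
    using assms by (auto simp: is_weak_gradient_def intro: locally_integrable_add)
  fix \<phi> i assume \<phi>: "test_function D \<phi>"
  show "(LINT x|lebesgue_on D. (u x + v x) * partial_deriv i \<phi> x) = - (LINT x|lebesgue_on D. (g x + h x) $ i * \<phi> x)"
    using weak_gradient_integrable[OF assms(1,2) \<phi>, of i] weak_gradient_integrable[OF assms(1,3) \<phi>, of i]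
      weak_gradientD[OF assms(2) \<phi>, of i] weak_gradientD[OF assms(3) \<phi>, of i]
    by (simp add: distrib_right)
qed

lemma weak_gradient_cmult:
  assumes "is_weak_gradient D u g"
  shows "is_weak_gradient D (\<lambda>x. c * u x) (\<lambda>x. c *\<^sub>R g x)"
  unfolding is_weak_gradient_def
proof (intro conjI allI impI)
  show "locally_integrable D (\<lambda>x. c * u x)" "locally_integrable D (\<lambda>x. c *\<^sub>R g x)"
    using assms locally_integrable_scaleR[of D u c] locally_integrable_scaleR[of D g c]
    by (auto simp: is_weak_gradient_def)
  fix \<phi> i assume \<phi>: "test_function D \<phi>"
  show "(LINT x|lebesgue_on D. c * u x * partial_deriv i \<phi> x) = - (LINT x|lebesgue_on D. (c *\<^sub>R g x) $ i * \<phi> x)"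
    using weak_gradientD[OF assms \<phi>, of i] by (simp add: mult.assoc)
qed

lemma weak_gradient_diff:
  assumes "open D" "is_weak_gradient D u g" "is_weak_gradient D v h"
  shows "is_weak_gradient D (\<lambda>x. u x - v x) (\<lambda>x. g x - h x)"
  using weak_gradient_add[OF assms(1,2) weak_gradient_cmult[OF assms(3), of "-1"]] by simp

lemma weak_gradient_0: "is_weak_gradient D (\<lambda>x. 0) (\<lambda>x. 0)"
  by (simp add: is_weak_gradient_def locally_integrable_def)

lemma weak_gradient_sum:
  assumes "open D" "finite I" "\<And>i. i \<in> I \<Longrightarrow> is_weak_gradient D (u i) (g i)"
  shows "is_weak_gradient D (\<lambda>x. \<Sum>i\<in>I. u i x) (\<lambda>x. \<Sum>i\<in>I. g i x)"
  using assms(2,3)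
proof (induction I rule: finite_induct)
  case (insert i I)
  then have "is_weak_gradient D (\<lambda>x. u i x + (\<Sum>i\<in>I. u i x)) (\<lambda>x. g i x + (\<Sum>i\<in>I. g i x))"
    by (intro weak_gradient_add assms(1)) auto
  with insert.hyps show ?case by simp
qed (simp add: weak_gradient_0)

lemma weak_gradient_cong_AE:
  assumes "open D" "is_weak_gradient D u g" "AE x in lebesgue_on D. u x = v x" "AE x in lebesgue_on D. g x = h x"
    "v \<in> borel_measurable (lebesgue_on D)" "h \<in> borel_measurable (lebesgue_on D)"
  shows "is_weak_gradient D v h"
  unfolding is_weak_gradient_def
proof (intro conjI allI impI)
  show "locally_integrable D v" "locally_integrable D h"
    using assms by (auto simp: is_weak_gradient_def intro: locally_integrable_cong_AE)
  fix \<phi> i assume \<phi>: "test_function D \<phi>"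
  then have sm: "smooth \<phi>" by (simp add: test_function_def)
  have [measurable]: "\<phi> \<in> borel_measurable (lebesgue_on D)" "partial_deriv i \<phi> \<in> borel_measurable (lebesgue_on D)"
    by (intro measurable_restrict_space1 borel_measurable_lebesgue_continuous smooth_continuous smooth_partial_deriv sm)+
  have [measurable]: "v \<in> borel_measurable (lebesgue_on D)" "(\<lambda>x. h x $ i) \<in> borel_measurable (lebesgue_on D)"
    using assms(5,6) by (auto intro: borel_measurable_vec_nth)
  have "(LINT x|lebesgue_on D. v x * partial_deriv i \<phi> x) = (LINT x|lebesgue_on D. u x * partial_deriv i \<phi> x)"
  proof (rule integral_cong_AE)
    show "(\<lambda>x. u x * partial_deriv i \<phi> x) \<in> borel_measurable (lebesgue_on D)"
      using weak_gradient_integrable(1)[OF assms(1,2) \<phi>] by auto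
    show "AE x in lebesgue_on D. v x * partial_deriv i \<phi> x = u x * partial_deriv i \<phi> x"
      using assms(3) by eventually_elim simp
  qed measurable
  moreover have "(LINT x|lebesgue_on D. h x $ i * \<phi> x) = (LINT x|lebesgue_on D. g x $ i * \<phi> x)"
  proof (rule integral_cong_AE)
    show "(\<lambda>x. g x $ i * \<phi> x) \<in> borel_measurable (lebesgue_on D)"
      using weak_gradient_integrable(2)[OF assms(1,2) \<phi>] by auto
    show "AE x in lebesgue_on D. h x $ i * \<phi> x = g x $ i * \<phi> x"
      using assms(4) by eventually_elim simp
  qed measurable
  ultimately show "(LINT x|lebesgue_on D. v x * partial_deriv i \<phi> x) = - (LINT x|lebesgue_on D. h x $ i * \<phi> x)"
    using weak_gradientD[OF assms(2) \<phi>, of i] by simp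
qed

text \<open>Each component of \<open>g - h\<close> is orthogonal to all test functions, being a weak
  derivative of a function that is 0 almost everywhere; the fundamental lemma applies.\<close>

lemma weak_gradient_unique:
  assumes "open D" "is_weak_gradient D u g" "is_weak_gradient D v h" "AE x in lebesgue_on D. u x = v x"
  shows "AE x in lebesgue_on D. g x = h x"
proof -
  have d: "is_weak_gradient D (\<lambda>x. u x - v x) (\<lambda>x. g x - h x)"
    by (rule weak_gradient_diff[OF assms(1-3)])
  have "AE x in lebesgue_on D. (g x - h x) $ i = 0" for i
  proof (rule AE_zero_if_orthogonal_test_functions[OF assms(1)])
    show "locally_integrable D (\<lambda>x. (g x - h x) $ i)"
      using d by (auto simp only: is_weak_gradient_def intro: locally_integrable_nth)
    fix \<theta> assume \<theta>: "test_function D \<theta>"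
    have "(LINT x|lebesgue_on D. (u x - v x) * partial_deriv i \<theta> x) = 0"
      using assms(4) by (intro integral_eq_zero_AE) (auto elim: eventually_mono)
    then show "(LINT x|lebesgue_on D. (g x - h x) $ i * \<theta> x) = 0"
      using weak_gradientD[OF d \<theta>, of i] by simp
  qed
  then have "AE x in lebesgue_on D. \<forall>i\<in>UNIV. (g x - h x) $ i = 0"
    by (intro AE_finite_allI) auto
  then show ?thesis
    by eventually_elim (simp add: vec_eq_iff)
qed

lemma weak_grad_weak_gradient:
  assumes "is_weak_gradient D u g"
  shows "is_weak_gradient D u (weak_grad D u)"
  unfolding weak_grad_def by (rule someI[of _ g]) (rule assms)

lemma weak_grad_AE:
  assumes "open D" "is_weak_gradient D u g"
  shows "AE x in lebesgue_on D. weak_grad D u x = g x"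
  by (rule weak_gradient_unique[OF assms(1) weak_grad_weak_gradient[OF assms(2)] assms(2)]) simp

section \<open>Integration by parts for continuously differentiable functions\<close>

text \<open>Translation invariance makes the integral of every difference quotient vanish.\<close>

lemma integral_partial_deriv_eq_0:
  fixes h :: "real^'d \<Rightarrow> real" and G :: "real^'d \<Rightarrow> real^'d"
  assumes der: "\<And>x. (h has_derivative (\<lambda>y. G x \<bullet> y)) (at x)" and G: "continuous_on UNIV G"
    and K: "compact K" "\<And>x. x \<notin> K \<Longrightarrow> h x = 0" "\<And>x. x \<notin> K \<Longrightarrow> G x = 0"
  shows "(LINT x|lebesgue. G x $ i) = 0"
proof -
  define e :: "real^'d" where "e = axis i 1"
  define t where "t n = inverse (real (Suc n))" for n
  have t: "t n > 0" "t n \<le> 1" "t \<longlonglongrightarrow> 0" for n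
    using LIMSEQ_inverse_real_of_nat by (auto simp: t_def[abs_def] inverse_le_1_iff)
  have hc: "continuous_on UNIV h"
    by (rule has_derivative_continuous_on[OF has_derivative_at_withinI[OF der]])
  have [measurable]: "h \<in> borel_measurable borel" "G \<in> borel_measurable borel"
    using hc G by (auto intro: borel_measurable_continuous_onI)
  obtain R where R: "\<And>x. x \<in> K \<Longrightarrow> norm x \<le> R"
    using compact_imp_bounded[OF K(1)] unfolding bounded_iff by blast
  obtain L where "L > 0" and L: "\<And>x. norm (G x) \<le> L"
    using compact_support_bounded[OF G, of R] R K(3) by (metis not_le)
  have lip: "\<bar>h (z + y) - h z\<bar> \<le> L * norm y" for z y
  proof -
    have "norm (h (z + y) - h z) \<le> L * norm (z + y - z)"
    proof (rule differentiable_bound[where S=UNIV and f=h and f'="\<lambda>x y. G x \<bullet> y"])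
      show "onorm (\<lambda>y. G x \<bullet> y) \<le> L" for x
        using L by (intro onorm_le) (metis Cauchy_Schwarz_ineq2 mult_right_mono norm_ge_zero order_trans real_norm_def)
    qed (use der in auto)
    then show ?thesis by simp
  qed
  let ?q = "\<lambda>n x. (h (t n *\<^sub>R e + x) - h x) / t n"
  have int: "integrable lborel h"
    by (rule integrable_continuous_compact_support(2)[OF hc K(1,2)])
  have "integrable lborel (\<lambda>x. h (a + x))" for a
  proof (rule integrable_continuous_compact_support(2)[of _ "(\<lambda>x. x - a) ` K"])
    show "continuous_on UNIV (\<lambda>x. h (a + x))"
      by (intro continuous_on_compose2[OF hc] continuous_intros) auto
    show "compact ((\<lambda>x. x - a) ` K)"
      by (intro compact_continuous_image continuous_intros K)
    show "h (a + x) = 0" if "x \<notin> (\<lambda>x. x - a) ` K" for x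
    proof (rule K(2))
      show "a + x \<notin> K" using that image_eqI[of x "\<lambda>x. x - a" "a + x" K] by auto
    qed
  qed
  then have q0: "(LINT x|lborel. ?q n x) = 0" for n
    using int lborel_integral_translate[of h "t n *\<^sub>R e"] by simp
  have "(\<lambda>n. LINT x|lborel. ?q n x) \<longlonglongrightarrow> (LINT x|lborel. G x $ i)"
  \<comment> \<open>Steps of length at most 1 keep the quotients supported in the ball of radius
    \<open>R + 1\<close>, and the Lipschitz constant L bounds them there.\<close>
  proof (rule integral_dominated_convergence[where w="\<lambda>x. L * indicator (cball 0 (R + 1)) x"])
    show "integrable lborel (\<lambda>x. L * indicator (cball (0::real^'d) (R + 1)) x)"
      using emeasure_bounded_finite[OF bounded_cball[of "0::real^'d" "R + 1"]]
      by (intro integrable_mult_right integrable_real_indicator) auto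
    show "AE x in lborel. (\<lambda>n. ?q n x) \<longlonglongrightarrow> G x $ i"
    proof (rule AE_I2)
      fix x
      have "((\<lambda>s. h (s *\<^sub>R e + x)) has_derivative (\<lambda>s. G x \<bullet> (s *\<^sub>R e))) (at 0)"
        by (rule has_derivative_compose[where f="\<lambda>s. s *\<^sub>R e + x" and f'="\<lambda>s. s *\<^sub>R e" and g=h and g'="\<lambda>y. G x \<bullet> y"])
           (use der[of x] in \<open>auto intro!: derivative_eq_intros\<close>)
      then have "((\<lambda>s. h (s *\<^sub>R e + x)) has_real_derivative G x $ i) (at 0)"
        by (rule has_derivative_imp_has_field_derivative) (simp add: e_def inner_axis mult.commute)
      then have "((\<lambda>s. (h (s *\<^sub>R e + x) - h x) / s) \<longlongrightarrow> G x $ i) (at 0)"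
        by (simp add: DERIV_def)
      then show "(\<lambda>n. ?q n x) \<longlonglongrightarrow> G x $ i"
        using t(3) unfolding tendsto_at_iff_sequentially
      proof (elim allE[of _ t] impE)
        show "\<forall>n. t n \<in> UNIV - {0}" using t(1) by (metis DiffI UNIV_I less_irrefl singletonD)
      qed (simp_all add: o_def)
    qed
    show "AE x in lborel. norm (?q n x) \<le> L * indicator (cball 0 (R + 1)) x" for n
    proof (rule AE_I2)
      fix x
      show "norm (?q n x) \<le> L * indicator (cball 0 (R + 1)) x"
      proof (cases "norm x \<le> R + 1")
        case True
        have "\<bar>h (t n *\<^sub>R e + x) - h x\<bar> \<le> L * t n"
          using lip[of x "t n *\<^sub>R e"] t(1)[of n] by (simp add: add.commute e_def)
        with t(1)[of n] True show ?thesis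
          by (simp add: dist_norm abs_divide divide_le_eq)
      next
        case False
        have "norm x \<le> norm (t n *\<^sub>R e + x) + norm (t n *\<^sub>R e)"
          using norm_triangle_sub[of x "t n *\<^sub>R e + x"] by (simp add: algebra_simps)
        then have "norm (t n *\<^sub>R e + x) > R"
          using t(1,2)[of n] False by (simp add: e_def)
        then have "h (t n *\<^sub>R e + x) = 0" "h x = 0"
          using R K(2) False by (smt (verit) not_le)+
        then show ?thesis using \<open>L > 0\<close> by simp
      qed
    qed
  qed (auto intro!: borel_measurable_vec_nth)
  then have "(LINT x|lborel. G x $ i) = 0"
    unfolding q0 by (rule LIMSEQ_unique[OF _ tendsto_const])
  moreover have "(\<lambda>x. G x $ i) \<in> borel_measurable lborel"
    by (auto intro!: borel_measurable_vec_nth)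
  ultimately show ?thesis by (simp add: integral_completion)
qed

text \<open>The product of v with a test function, extended by zero outside D, is continuously
  differentiable on the whole space with compact support, so its partial derivatives integrate to 0.
  Nothing is asked of v near the boundary of D.\<close>

lemma weak_gradient_C1:
  fixes v :: "real^'d \<Rightarrow> real"
  assumes D: "open D" and der: "\<And>x. x \<in> D \<Longrightarrow> (v has_derivative (\<lambda>h. g x \<bullet> h)) (at x)"
    and g: "continuous_on D g"
  shows "is_weak_gradient D v g"
  unfolding is_weak_gradient_def
proof (intro conjI allI impI)
  have vc: "continuous_on D v"
    by (rule has_derivative_continuous_on[OF has_derivative_at_withinI[OF der]])
  show "locally_integrable D v" "locally_integrable D g"
    by (intro locally_integrable_continuous vc g)+
  fix \<theta> i assume \<theta>: "test_function D \<theta>"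
  then have sm: "smooth \<theta>" by (simp add: test_function_def)
  obtain K where K: "compact K" "K \<subseteq> D" "\<And>x. x \<notin> K \<Longrightarrow> \<theta> x = 0" "\<And>x i. x \<notin> K \<Longrightarrow> partial_deriv i \<theta> x = 0"
    using \<theta> by (rule test_function_support) blast
  have gradK: "gradient \<theta> x = 0" if "x \<notin> K" for x
    using K(4)[OF that] by (simp add: vec_eq_iff)
  define h where "h x = (if x \<in> D then v x * \<theta> x else 0)" for x
  define G where "G x = (if x \<in> D then v x *\<^sub>R gradient \<theta> x + \<theta> x *\<^sub>R g x else 0)" for x
  have hK: "h x = 0" "G x = 0" if "x \<notin> K" for x
    using that K(3) gradK by (auto simp: h_def G_def)
  have oK: "open (- K)" using compact_imp_closed[OF K(1)] by auto
  \<comment> \<open>Two open sets cover the space: on D the product rule holds, off K everything is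
    0. Continuity of G is glued from both.\<close>
  have UN: "D \<union> - K = UNIV" using K(2) by auto
  have "(h has_derivative (\<lambda>y. G x \<bullet> y)) (at x)" for x
  proof (cases "x \<in> D")
    case True
    have "((\<lambda>x. v x * \<theta> x) has_derivative (\<lambda>y. v x * (gradient \<theta> x \<bullet> y) + (g x \<bullet> y) * \<theta> x)) (at x)"
      by (rule has_derivative_mult[OF der[OF True] has_derivative_gradient[OF smooth_differentiable[OF sm]]])
    moreover have "(\<lambda>y. v x * (gradient \<theta> x \<bullet> y) + (g x \<bullet> y) * \<theta> x) = (\<lambda>y. G x \<bullet> y)"
      using True by (auto simp: G_def inner_add_left mult.commute)
    ultimately have "((\<lambda>x. v x * \<theta> x) has_derivative (\<lambda>y. G x \<bullet> y)) (at x)" by simp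
    then show ?thesis
      by (rule has_derivative_transform_within_open[OF _ D True]) (simp add: h_def)
  next
    case False
    then have "x \<in> - K" using K(2) by auto
    have "(h has_derivative (\<lambda>y. 0)) (at x)"
      by (rule has_derivative_transform_within_open[OF has_derivative_const oK \<open>x \<in> - K\<close>]) (simp add: hK)
    then show ?thesis using False by (simp add: G_def)
  qed
  moreover have "continuous_on UNIV G"
  proof -
    have "continuous_on D G"
    proof (rule continuous_on_eq)
      show "continuous_on D (\<lambda>x. v x *\<^sub>R gradient \<theta> x + \<theta> x *\<^sub>R g x)"
        by (intro continuous_intros vc g smooth_continuous[OF sm] continuous_on_gradient[OF sm])
    qed (simp add: G_def)
    moreover have "continuous_on (- K) G"
      by (rule continuous_on_eq[of _ "\<lambda>x. 0"]) (auto simp: hK)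
    ultimately have "continuous_on (D \<union> - K) G"
      using D oK by (intro continuous_on_open_Un)
    then show ?thesis by (simp only: UN)
  qed
  ultimately have "(LINT x|lebesgue. G x $ i) = 0"
    by (rule integral_partial_deriv_eq_0[OF _ _ K(1) hK])
  moreover have "(LINT x|lebesgue. G x $ i) = (LINT x|lebesgue. (if x \<in> D then v x * partial_deriv i \<theta> x + g x $ i * \<theta> x else 0))"
    by (intro Bochner_Integration.integral_cong) (auto simp: G_def)
  moreover have "\<dots> = (LINT x|lebesgue_on D. v x * partial_deriv i \<theta> x + g x $ i * \<theta> x)"
    using D by (intro Lebesgue_Measure.integral_restrict_UNIV) auto
  moreover have "integrable (lebesgue_on D) (\<lambda>x. v x * partial_deriv i \<theta> x)"
    by (rule integrable_mult_test[OF D _ K(1,2) _ K(4)])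
       (intro locally_integrable_continuous vc smooth_continuous smooth_partial_deriv sm)+
  moreover have "integrable (lebesgue_on D) (\<lambda>x. g x $ i * \<theta> x)"
    by (rule integrable_mult_test[OF D _ K(1,2) _ K(3)])
       (intro locally_integrable_nth locally_integrable_continuous g smooth_continuous sm)+
  ultimately show "(LINT x|lebesgue_on D. v x * partial_deriv i \<theta> x) = - (LINT x|lebesgue_on D. g x $ i * \<theta> x)"
    by simp
qed

lemma weak_gradient_smooth: "open D \<Longrightarrow> smooth v \<Longrightarrow> is_weak_gradient D v (gradient v)"
  by (intro weak_gradient_C1 has_derivative_gradient smooth_differentiable continuous_on_gradient)

lemma weak_gradient_limit:
  assumes D: "open D" and wg: "\<And>n. is_weak_gradient D (u n) (g n)"
    and l: "locally_integrable D v" "locally_integrable D h"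
    and lim: "\<And>i \<theta>. test_function D \<theta> \<Longrightarrow> (\<lambda>n. LINT x|lebesgue_on D. u n x * partial_deriv i \<theta> x)
        \<longlonglongrightarrow> (LINT x|lebesgue_on D. v x * partial_deriv i \<theta> x)"
      "\<And>i \<theta>. test_function D \<theta> \<Longrightarrow> (\<lambda>n. LINT x|lebesgue_on D. g n x $ i * \<theta> x)
        \<longlonglongrightarrow> (LINT x|lebesgue_on D. h x $ i * \<theta> x)"
  shows "is_weak_gradient D v h"
  unfolding is_weak_gradient_def
proof (intro conjI allI impI l)
  fix \<theta> i assume \<theta>: "test_function D \<theta>"
  have "(\<lambda>n. - (LINT x|lebesgue_on D. g n x $ i * \<theta> x)) \<longlonglongrightarrow> (LINT x|lebesgue_on D. v x * partial_deriv i \<theta> x)"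
    using lim(1)[OF \<theta>, of i] weak_gradientD[OF wg \<theta>, of _ i] by simp
  moreover have "(\<lambda>n. - (LINT x|lebesgue_on D. g n x $ i * \<theta> x)) \<longlonglongrightarrow> - (LINT x|lebesgue_on D. h x $ i * \<theta> x)"
    by (intro tendsto_minus lim(2) \<theta>)
  ultimately show "(LINT x|lebesgue_on D. v x * partial_deriv i \<theta> x) = - (LINT x|lebesgue_on D. h x $ i * \<theta> x)"
    by (rule LIMSEQ_unique)
qed

subsection \<open>Bounded functions with bounded weak gradient\<close>

text \<open>The bounds hold at every point of D and for an explicit representative g, so products,
  powers and limits can be handled pointwise instead of through essential suprema.\<close>

definition bounded_weak_gradient :: "(real^'d) set \<Rightarrow> (real^'d \<Rightarrow> real) \<Rightarrow> (real^'d \<Rightarrow> real^'d) \<Rightarrow> bool" where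
  "bounded_weak_gradient D v g \<longleftrightarrow> is_weak_gradient D v g \<and>
     v \<in> borel_measurable (lebesgue_on D) \<and> g \<in> borel_measurable (lebesgue_on D) \<and>
     (\<exists>B. \<forall>x\<in>D. \<bar>v x\<bar> \<le> B \<and> norm (g x) \<le> B)"

lemma bounded_weak_gradientI:
  assumes "is_weak_gradient D v g" "v \<in> borel_measurable (lebesgue_on D)" "g \<in> borel_measurable (lebesgue_on D)"
    "\<And>x. x \<in> D \<Longrightarrow> \<bar>v x\<bar> \<le> B" "\<And>x. x \<in> D \<Longrightarrow> norm (g x) \<le> B'"
  shows "bounded_weak_gradient D v g"
proof -
  have "\<forall>x\<in>D. \<bar>v x\<bar> \<le> max B B' \<and> norm (g x) \<le> max B B'"
    using assms(4,5) by (auto simp: le_max_iff_disj)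
  with assms(1-3) show ?thesis unfolding bounded_weak_gradient_def by blast
qed

lemma bounded_weak_gradientE:
  assumes "bounded_weak_gradient D v g"
  obtains B where "B > 0" "is_weak_gradient D v g" "v \<in> borel_measurable (lebesgue_on D)"
    "g \<in> borel_measurable (lebesgue_on D)" "\<And>x. x \<in> D \<Longrightarrow> \<bar>v x\<bar> \<le> B" "\<And>x. x \<in> D \<Longrightarrow> norm (g x) \<le> B"
proof -
  obtain B where B: "\<forall>x\<in>D. \<bar>v x\<bar> \<le> B \<and> norm (g x) \<le> B"
    using assms by (auto simp: bounded_weak_gradient_def)
  have "B \<le> \<bar>B\<bar> + 1" by simp
  then have "\<bar>v x\<bar> \<le> \<bar>B\<bar> + 1" "norm (g x) \<le> \<bar>B\<bar> + 1" if "x \<in> D" for x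
    using B that order_trans by blast+
  then show thesis
    using assms by (intro that[of "\<bar>B\<bar> + 1"]) (auto simp: bounded_weak_gradient_def)
qed

section \<open>Mollification of bounded weakly differentiable functions and the product rule\<close>

lemma integrable_bounded_on:
  fixes f :: "real^'d \<Rightarrow> 'b::euclidean_space"
  assumes "bounded D" "open D" "f \<in> borel_measurable (lebesgue_on D)" "\<And>x. x \<in> D \<Longrightarrow> norm (f x) \<le> B"
  shows "integrable (lebesgue_on D) f"
  by (rule finite_measure.integrable_const_bound[OF finite_measure_lebesgue_on[OF assms(1) open_sets_lebesgue[OF assms(2)]], where B=B])
     (use assms(3,4) in auto)

lemma measurable_if_lebesgue:
  fixes f :: "real^'d \<Rightarrow> real"
  assumes "open D" "f \<in> borel_measurable (lebesgue_on D)"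
  shows "(\<lambda>x. if x \<in> D then f x else 0) \<in> borel_measurable lebesgue"
  using assms by (intro borel_measurable_if_I) auto

lemma convolve_lebesgue_on:
  fixes v :: "real^'d \<Rightarrow> real"
  assumes "open D"
  shows "convolve \<rho> (\<lambda>x. if x \<in> D then v x else 0) x = (LINT y|lebesgue_on D. \<rho> (x - y) * v y)"
proof -
  have "convolve \<rho> (\<lambda>x. if x \<in> D then v x else 0) x
      = (LINT y|lebesgue. (if y \<in> D then \<rho> (x - y) * v y else 0))"
    unfolding convolve_def by (intro Bochner_Integration.integral_cong) auto
  also have "\<dots> = (LINT y|lebesgue_on D. \<rho> (x - y) * v y)"
    using assms by (intro Lebesgue_Measure.integral_restrict_UNIV) auto
  finally show ?thesis .
qed

text \<open>Differentiation and mollification commute only at points whose distance to the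
  complement of D exceeds the kernel radius: there the reflected kernel is a test function of D.
  Hence values converge against weights on all of D, gradients only against weights on the compact
  set K.\<close>

lemma mollify_bounded_weak_gradient:
  fixes v :: "real^'d \<Rightarrow> real"
  assumes D: "open D" "bounded D" and v: "bounded_weak_gradient D v g"
    and K: "compact K" "K \<subseteq> D" and d: "d > 0"
  obtains vn :: "nat \<Rightarrow> real^'d \<Rightarrow> real" where
    "\<And>n. smooth (vn n)"
    "\<And>G. integrable (lebesgue_on D) G \<Longrightarrow>
       (\<lambda>n. LINT x|lebesgue_on D. G x * vn n x) \<longlonglongrightarrow> (LINT x|lebesgue_on D. G x * v x)"
    "\<And>G i. integrable (lebesgue_on K) G \<Longrightarrow>
       (\<lambda>n. LINT x|lebesgue_on K. G x * partial_deriv i (vn n) x) \<longlonglongrightarrow> (LINT x|lebesgue_on K. G x * g x $ i)"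
    "\<And>n x. vn n x \<noteq> 0 \<Longrightarrow> \<exists>y\<in>D. v y \<noteq> 0 \<and> dist x y \<le> d"
proof -
  obtain B where B: "B > 0" "is_weak_gradient D v g" "v \<in> borel_measurable (lebesgue_on D)"
    "g \<in> borel_measurable (lebesgue_on D)" "\<And>x. x \<in> D \<Longrightarrow> \<bar>v x\<bar> \<le> B" "\<And>x. x \<in> D \<Longrightarrow> norm (g x) \<le> B"
    using v by (rule bounded_weak_gradientE) blast
  obtain \<delta> K' where \<delta>: "\<delta> > 0" and K': "compact K'" "K' \<subseteq> D" "\<And>x y. y \<in> K \<Longrightarrow> dist x y \<le> \<delta> \<Longrightarrow> x \<in> K'"
    using compact_neighbourhood[OF D(1) K] by blast
  \<comment> \<open>The radius \<delta> keeps kernels centred in K inside D; the radius d localises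
    the supports of the mollifications.\<close>
  have "min d \<delta> > 0" using d \<delta> by simp
  then obtain \<rho> :: "nat \<Rightarrow> real^'d \<Rightarrow> real" and r where
    mol: "\<And>n. mollifier (\<rho> n) (r n)" and r: "r \<longlonglongrightarrow> 0" "\<And>n. r n \<le> 1" "\<And>n. r n \<le> min d \<delta>"
    by (rule exists_mollifier_sequence) blast
  obtain R where "\<forall>x\<in>D. norm x \<le> R"
    using D(2) unfolding bounded_iff by blast
  then have R: "x \<notin> D" if "R < norm x" for x
    using that by (auto simp: not_le)
  define V where "V x = (if x \<in> D then v x else 0)" for x
  define W where "W i x = (if x \<in> D then g x $ i else 0)" for i x
  have Vm: "V \<in> borel_measurable lebesgue" and Wm: "W i \<in> borel_measurable lebesgue" for i
    unfolding V_def[abs_def] W_def[abs_def]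
    by (intro measurable_if_lebesgue D(1) B(3) borel_measurable_vec_nth B(4))+
  have Vb: "\<bar>V x\<bar> \<le> B" and Wb: "\<bar>W i x\<bar> \<le> B" for i x
    using B(1) B(5)[of x] B(6)[of x] component_le_norm_cart[of "g x" i] by (auto simp: V_def W_def)
  have VR: "V x = 0" and WR: "W i x = 0" if "R < norm x" for i x
    using R[OF that] by (auto simp: V_def W_def)
  have Vint: "integrable lebesgue V"
  proof -
    have "integrable (lebesgue_on D) v"
      by (rule integrable_bounded_on[OF D(2,1) B(3)]) (use B(5) in simp)
    then show ?thesis
      unfolding V_def[abs_def] using D(1)
      by (intro Lebesgue_Measure.integrable_restrict_UNIV[THEN iffD2]) auto
  qed
  define vn where "vn n = convolve (\<rho> n) V" for n
  have grad: "partial_deriv i (vn n) x = convolve (\<rho> n) (W i) x" if x: "x \<in> K" for i n x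
  proof -
    have "partial_deriv i (vn n) x = convolve (partial_deriv i (\<rho> n)) V x"
      unfolding vn_def using mollifier.smooth[OF mol] mollifier.supp[OF mol] Vint by (rule partial_deriv_convolve)
    also have "\<dots> = (LINT y|lebesgue_on D. partial_deriv i (\<rho> n) (x - y) * v y)"
      unfolding V_def[abs_def] by (rule convolve_lebesgue_on[OF D(1)])
    also have "\<dots> = - (LINT y|lebesgue_on D. v y * partial_deriv i (\<lambda>y. \<rho> n (x - y)) y)"
      by (simp add: partial_deriv_reflect smooth_differentiable[OF mollifier.smooth[OF mol]] mult.commute)
    also have "\<dots> = (LINT y|lebesgue_on D. g y $ i * \<rho> n (x - y))"
    proof -
      have "test_function D (\<lambda>y. \<rho> n (x - y))"
      proof (rule test_functionI[OF smooth_reflect[OF mollifier.smooth[OF mol]] K'(1,2)])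
        fix y assume "\<rho> n (x - y) \<noteq> 0"
        then have "norm (x - y) \<le> r n"
          using mollifier.supp[OF mol, of n "x - y"] by (meson not_le)
        then show "y \<in> K'"
          using r(3)[of n] by (intro K'(3)[OF x]) (simp add: dist_norm norm_minus_commute)
      qed
      from weak_gradientD[OF B(2) this, of i] show ?thesis by simp
    qed
    also have "\<dots> = convolve (\<rho> n) (W i) x"
      unfolding W_def[abs_def] convolve_lebesgue_on[OF D(1)] by (simp only: mult.commute)
    finally show ?thesis .
  qed
  have restr: "integrable (lebesgue_on (cball 0 (R + 1))) G" if "integrable lebesgue G" for G :: "real^'d \<Rightarrow> real"
    by (rule integrable_lebesgue_on_subset[of UNIV]) (use that lebesgue_on_UNIV_eq in \<open>auto simp: lebesgue_on_UNIV_eq\<close>)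
  have wk: "(\<lambda>n. LINT x|lebesgue_on S. G x * convolve (\<rho> n) w x) \<longlonglongrightarrow> (LINT x|lebesgue_on S. G x * w x)"
    if S: "S \<in> sets lebesgue" and G: "integrable (lebesgue_on S) G"
      and w: "w \<in> borel_measurable lebesgue" "\<And>x. \<bar>w x\<bar> \<le> B" "\<And>x. R < norm x \<Longrightarrow> w x = 0"
    for S G w
  proof -
    let ?G = "\<lambda>x. if x \<in> S then G x else 0"
    have Gint: "integrable lebesgue ?G"
      using S G by (intro Lebesgue_Measure.integrable_restrict_UNIV[THEN iffD2])
    have "(\<lambda>n. LINT x|lebesgue. ?G x * convolve (\<rho> n) w x) \<longlonglongrightarrow> (LINT x|lebesgue. ?G x * w x)"
      using convolve_weak_limit[OF mol r(1,2) w restr[OF Gint]] .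
    moreover have "(LINT x|lebesgue. ?G x * k x) = (LINT x|lebesgue_on S. G x * k x)" for k
    proof -
      have "(LINT x|lebesgue. ?G x * k x) = (LINT x|lebesgue. (if x \<in> S then G x * k x else 0))"
        by (intro Bochner_Integration.integral_cong) auto
      also have "\<dots> = (LINT x|lebesgue_on S. G x * k x)"
        using S by (intro Lebesgue_Measure.integral_restrict_UNIV)
      finally show ?thesis .
    qed
    ultimately show ?thesis by simp
  qed
  show thesis
  proof (rule that[of vn])
    show "smooth (vn n)" for n
      unfolding vn_def using mollifier.smooth[OF mol] mollifier.supp[OF mol] Vint by (rule smooth_convolve)
  next
    fix G :: "real^'d \<Rightarrow> real" assume G: "integrable (lebesgue_on D) G"
    have "(LINT x|lebesgue_on D. G x * V x) = (LINT x|lebesgue_on D. G x * v x)"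
      by (intro Bochner_Integration.integral_cong) (auto simp: V_def)
    with wk[OF open_sets_lebesgue[OF D(1)] G Vm Vb VR]
    show "(\<lambda>n. LINT x|lebesgue_on D. G x * vn n x) \<longlonglongrightarrow> (LINT x|lebesgue_on D. G x * v x)"
      by (simp add: vn_def)
  next
    fix G :: "real^'d \<Rightarrow> real" and i assume G: "integrable (lebesgue_on K) G"
    have "(LINT x|lebesgue_on K. G x * W i x) = (LINT x|lebesgue_on K. G x * g x $ i)"
      using K(2) by (intro Bochner_Integration.integral_cong) (auto simp: W_def)
    moreover have "(LINT x|lebesgue_on K. G x * partial_deriv i (vn n) x)
        = (LINT x|lebesgue_on K. G x * convolve (\<rho> n) (W i) x)" for n
      by (intro Bochner_Integration.integral_cong) (auto simp: grad)
    ultimately show "(\<lambda>n. LINT x|lebesgue_on K. G x * partial_deriv i (vn n) x) \<longlonglongrightarrow> (LINT x|lebesgue_on K. G x * g x $ i)"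
      using wk[OF compact_sets_lebesgue[OF K(1)] G Wm[of i] Wb WR] by (simp only:)
  next
    fix n x assume nz: "vn n x \<noteq> 0"
    obtain y where "V y \<noteq> 0" "dist x y \<le> r n"
      using mollifier.supp[OF mol] nz[unfolded vn_def] by (rule convolve_nonzeroD)
    then show "\<exists>y\<in>D. v y \<noteq> 0 \<and> dist x y \<le> d"
      using r(3)[of n] by (intro bexI[of _ y]) (auto simp: V_def split: if_splits)
  qed
qed

lemma test_function_mult:
  assumes "smooth f" "test_function D \<theta>"
  shows "test_function D (\<lambda>x. f x * \<theta> x)"
proof -
  obtain K where K: "compact K" "K \<subseteq> D" "\<And>x. x \<notin> K \<Longrightarrow> \<theta> x = 0"
    using assms(2) by (rule test_function_support) blast
  show ?thesis
    by (rule test_functionI[OF _ K(1,2)])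
       (use assms K(3) in \<open>auto intro: smooth_mult simp: test_function_def\<close>)
qed

lemma test_function_bounded:
  assumes "test_function D \<theta>"
  obtains T where "T > 0" "\<And>x. \<bar>\<theta> x\<bar> \<le> T" "\<And>x i. \<bar>partial_deriv i \<theta> x\<bar> \<le> T"
proof -
  obtain K where K: "compact K" "K \<subseteq> D" "\<And>x. x \<notin> K \<Longrightarrow> \<theta> x = 0" "\<And>x i. x \<notin> K \<Longrightarrow> partial_deriv i \<theta> x = 0"
    using assms by (rule test_function_support) blast
  obtain R where R: "\<forall>x\<in>K. norm x \<le> R"
    using compact_imp_bounded[OF K(1)] unfolding bounded_iff by blast
  have sm: "smooth \<theta>" using assms by (simp add: test_function_def)
  have 0: "\<theta> x = 0" "gradient \<theta> x = 0" if "R < norm x" for x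
  proof -
    have "x \<notin> K" using R that by (auto simp: not_le)
    then show "\<theta> x = 0" "gradient \<theta> x = 0" using K(3,4) by (auto simp: vec_eq_iff)
  qed
  obtain T1 where T1: "T1 > 0" "\<And>x. norm (\<theta> x) \<le> T1"
    using compact_support_bounded[OF smooth_continuous[OF sm] 0(1)] by blast
  obtain T2 where T2: "T2 > 0" "\<And>x. norm (gradient \<theta> x) \<le> T2"
    using compact_support_bounded[OF continuous_on_gradient[OF sm] 0(2)] by blast
  show thesis
  proof (rule that[of "max T1 T2"])
    show "\<bar>\<theta> x\<bar> \<le> max T1 T2" for x using T1(2)[of x] by simp
    show "\<bar>partial_deriv i \<theta> x\<bar> \<le> max T1 T2" for x i
      using T2(2)[of x] component_le_norm_cart[of "gradient \<theta> x" i] by simp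
  qed (use T1 in simp)
qed

text \<open>Neither factor is smooth. Mollifying v turns \<open>vn n * \<theta>\<close> into a test
  function for the weak gradient of w, and the resulting identity is linear in \<open>vn n\<close>
  and its derivatives, so weak convergence carries it to v.\<close>

lemma bounded_weak_gradient_mult:
  assumes D: "open D" "bounded D"
    and v: "bounded_weak_gradient D v g" and w: "bounded_weak_gradient D w h"
  shows "bounded_weak_gradient D (\<lambda>x. v x * w x) (\<lambda>x. v x *\<^sub>R h x + w x *\<^sub>R g x)"
proof -
  obtain B where B: "B > 0" "is_weak_gradient D v g" "v \<in> borel_measurable (lebesgue_on D)"
    "g \<in> borel_measurable (lebesgue_on D)" "\<And>x. x \<in> D \<Longrightarrow> \<bar>v x\<bar> \<le> B" "\<And>x. x \<in> D \<Longrightarrow> norm (g x) \<le> B"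
    using v by (rule bounded_weak_gradientE) blast
  obtain C where C: "C > 0" "is_weak_gradient D w h" "w \<in> borel_measurable (lebesgue_on D)"
    "h \<in> borel_measurable (lebesgue_on D)" "\<And>x. x \<in> D \<Longrightarrow> \<bar>w x\<bar> \<le> C" "\<And>x. x \<in> D \<Longrightarrow> norm (h x) \<le> C"
    using w by (rule bounded_weak_gradientE) blast
  have [measurable]: "v \<in> borel_measurable (lebesgue_on D)" "w \<in> borel_measurable (lebesgue_on D)"
    "g \<in> borel_measurable (lebesgue_on D)" "h \<in> borel_measurable (lebesgue_on D)"
    using B C by auto
  have [measurable]: "(\<lambda>x. g x $ i) \<in> borel_measurable (lebesgue_on D)" "(\<lambda>x. h x $ i) \<in> borel_measurable (lebesgue_on D)" for i
    by (intro borel_measurable_vec_nth; measurable)+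
  have bd1: "\<bar>v x * w x\<bar> \<le> B * C" if "x \<in> D" for x
    unfolding abs_mult using that B C by (intro mult_mono) auto
  have bd2: "norm (v x *\<^sub>R h x + w x *\<^sub>R g x) \<le> B * C + C * B" if "x \<in> D" for x
  proof -
    have "norm (v x *\<^sub>R h x + w x *\<^sub>R g x) \<le> \<bar>v x\<bar> * norm (h x) + \<bar>w x\<bar> * norm (g x)"
      by (rule order_trans[OF norm_triangle_ineq]) simp
    also have "\<dots> \<le> B * C + C * B"
      using that B C by (intro add_mono mult_mono) auto
    finally show ?thesis .
  qed
  have m1: "(\<lambda>x. v x * w x) \<in> borel_measurable (lebesgue_on D)"
    and m2: "(\<lambda>x. v x *\<^sub>R h x + w x *\<^sub>R g x) \<in> borel_measurable (lebesgue_on D)"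
    by measurable
  show ?thesis
  proof (rule bounded_weak_gradientI[OF _ m1 m2 bd1 bd2])
    show "is_weak_gradient D (\<lambda>x. v x * w x) (\<lambda>x. v x *\<^sub>R h x + w x *\<^sub>R g x)"
      unfolding is_weak_gradient_def
    proof (intro conjI allI impI)
      show "locally_integrable D (\<lambda>x. v x * w x)" "locally_integrable D (\<lambda>x. v x *\<^sub>R h x + w x *\<^sub>R g x)"
        using bd1 bd2 m1 m2 by (auto intro!: locally_integrableI integrable_bounded_on D simp: D)
      fix \<theta> i assume \<theta>: "test_function D \<theta>"
      then have sm: "smooth \<theta>" by (simp add: test_function_def)
      obtain K where K: "compact K" "K \<subseteq> D" "\<And>x. x \<notin> K \<Longrightarrow> \<theta> x = 0" "\<And>x i. x \<notin> K \<Longrightarrow> partial_deriv i \<theta> x = 0"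
        using \<theta> by (rule test_function_support) blast
      obtain T where T: "T > 0" "\<And>x. \<bar>\<theta> x\<bar> \<le> T" "\<And>x i. \<bar>partial_deriv i \<theta> x\<bar> \<le> T"
        using \<theta> by (rule test_function_bounded) blast
      have [measurable]: "\<theta> \<in> borel_measurable (lebesgue_on D)" "partial_deriv i \<theta> \<in> borel_measurable (lebesgue_on D)"
        by (intro measurable_restrict_space1 borel_measurable_lebesgue_continuous smooth_continuous smooth_partial_deriv sm)+
      obtain vn where vn: "\<And>n. smooth (vn n)"
        "\<And>G. integrable (lebesgue_on D) G \<Longrightarrow>
           (\<lambda>n. LINT x|lebesgue_on D. G x * vn n x) \<longlonglongrightarrow> (LINT x|lebesgue_on D. G x * v x)"
        "\<And>G i. integrable (lebesgue_on K) G \<Longrightarrow>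
           (\<lambda>n. LINT x|lebesgue_on K. G x * partial_deriv i (vn n) x) \<longlonglongrightarrow> (LINT x|lebesgue_on K. G x * g x $ i)"
        by (rule mollify_bounded_weak_gradient[OF D v K(1,2) zero_less_one]) (rule that)
      have I1: "integrable (lebesgue_on D) (\<lambda>x. w x * partial_deriv i \<theta> x)"
      proof (rule integrable_bounded_on[OF D(2,1)])
        show "norm (w x * partial_deriv i \<theta> x) \<le> C * T" if "x \<in> D" for x
          unfolding real_norm_def abs_mult using that C T by (intro mult_mono) auto
      qed measurable
      have I2: "integrable (lebesgue_on D) (\<lambda>x. h x $ i * \<theta> x)"
        by (rule weak_gradient_integrable(2)[OF D(1) C(2) \<theta>])
      have I3: "integrable (lebesgue_on D) (\<lambda>x. w x * \<theta> x)"
      proof (rule integrable_bounded_on[OF D(2,1)])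
        show "norm (w x * \<theta> x) \<le> C * T" if "x \<in> D" for x
          unfolding real_norm_def abs_mult using that C T by (intro mult_mono) auto
      qed measurable
      have I3K: "integrable (lebesgue_on K) (\<lambda>x. w x * \<theta> x)"
        by (rule integrable_lebesgue_on_subset[OF I3 K(2) compact_sets_lebesgue[OF K(1)] open_sets_lebesgue[OF D(1)]])
      have KD: "(LINT x|lebesgue_on D. f x) = (LINT x|lebesgue_on K. f x)" if "\<And>x. x \<notin> K \<Longrightarrow> f x = 0" for f :: "real^'a \<Rightarrow> real"
        using K(2) that by (intro integral_lebesgue_on_support compact_sets_lebesgue K(1) open_sets_lebesgue D(1)) auto
      \<comment> \<open>The derivative of \<open>vn n\<close> appears only multiplied by \<theta>,
        hence only on K, which is where mollified gradients are known to converge.\<close>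
      have step: "(LINT x|lebesgue_on D. w x * partial_deriv i \<theta> x * vn n x)
          = - (LINT x|lebesgue_on D. h x $ i * \<theta> x * vn n x) - (LINT x|lebesgue_on K. w x * \<theta> x * partial_deriv i (vn n) x)" for n
      proof -
        have \<theta>': "test_function D (\<lambda>x. vn n x * \<theta> x)"
          by (rule test_function_mult[OF vn(1) \<theta>])
        have pd: "partial_deriv i (\<lambda>x. vn n x * \<theta> x) x = vn n x * partial_deriv i \<theta> x + partial_deriv i (vn n) x * \<theta> x" for x
          by (intro partial_deriv_mult smooth_differentiable vn(1) sm)
        have wloc: "locally_integrable D w"
          using C(2) by (simp add: is_weak_gradient_def)
        have J1: "integrable (lebesgue_on D) (\<lambda>x. w x * (vn n x * partial_deriv i \<theta> x))"
          by (rule integrable_mult_test[OF D(1) wloc K(1,2)])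
             (auto simp: K intro!: smooth_continuous smooth_mult smooth_partial_deriv vn(1) sm)
        have J2: "integrable (lebesgue_on D) (\<lambda>x. w x * (partial_deriv i (vn n) x * \<theta> x))"
          by (rule integrable_mult_test[OF D(1) wloc K(1,2)])
             (auto simp: K intro!: smooth_continuous smooth_mult smooth_partial_deriv vn(1) sm)
        have "(LINT x|lebesgue_on D. w x * (vn n x * partial_deriv i \<theta> x)) + (LINT x|lebesgue_on D. w x * (partial_deriv i (vn n) x * \<theta> x))
            = - (LINT x|lebesgue_on D. h x $ i * (vn n x * \<theta> x))"
          using weak_gradientD[OF C(2) \<theta>', of i] J1 J2 by (simp add: pd distrib_left)
        moreover have "(LINT x|lebesgue_on D. w x * (partial_deriv i (vn n) x * \<theta> x))
            = (LINT x|lebesgue_on K. w x * \<theta> x * partial_deriv i (vn n) x)"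
          by (subst KD) (auto simp: K mult_ac)
        ultimately show ?thesis by (simp add: mult_ac)
      qed
      have "(\<lambda>n. LINT x|lebesgue_on D. w x * partial_deriv i \<theta> x * vn n x)
          \<longlonglongrightarrow> (LINT x|lebesgue_on D. w x * partial_deriv i \<theta> x * v x)"
        by (rule vn(2)[OF I1])
      moreover have "(\<lambda>n. LINT x|lebesgue_on D. w x * partial_deriv i \<theta> x * vn n x)
          \<longlonglongrightarrow> - (LINT x|lebesgue_on D. h x $ i * \<theta> x * v x) - (LINT x|lebesgue_on K. w x * \<theta> x * g x $ i)"
        unfolding step by (intro tendsto_intros vn(2)[OF I2] vn(3)[OF I3K])
      ultimately have "(LINT x|lebesgue_on D. w x * partial_deriv i \<theta> x * v x)
          = - (LINT x|lebesgue_on D. h x $ i * \<theta> x * v x) - (LINT x|lebesgue_on K. w x * \<theta> x * g x $ i)"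
        by (rule LIMSEQ_unique)
      moreover have "(LINT x|lebesgue_on K. w x * \<theta> x * g x $ i) = (LINT x|lebesgue_on D. w x * \<theta> x * g x $ i)"
        by (rule KD[symmetric]) (simp add: K)
      moreover have "integrable (lebesgue_on D) (\<lambda>x. h x $ i * \<theta> x * v x)"
      proof (rule integrable_bounded_on[OF D(2,1)])
        show "norm (h x $ i * \<theta> x * v x) \<le> C * T * B" if "x \<in> D" for x
          unfolding real_norm_def abs_mult using that B C(1) T C(6)[OF that] component_le_norm_cart[of "h x" i]
          by (intro mult_mono) auto
      qed measurable
      moreover have "integrable (lebesgue_on D) (\<lambda>x. w x * \<theta> x * g x $ i)"
      proof (rule integrable_bounded_on[OF D(2,1)])
        show "norm (w x * \<theta> x * g x $ i) \<le> C * T * B" if "x \<in> D" for x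
          unfolding real_norm_def abs_mult using that C B(1) T B(6)[OF that] component_le_norm_cart[of "g x" i]
          by (intro mult_mono) auto
      qed measurable
      ultimately show "(LINT x|lebesgue_on D. v x * w x * partial_deriv i \<theta> x)
          = - (LINT x|lebesgue_on D. (v x *\<^sub>R h x + w x *\<^sub>R g x) $ i * \<theta> x)"
        by (simp add: algebra_simps)
    qed
  qed
qed

lemma bounded_weak_gradient_const:
  "open D \<Longrightarrow> bounded_weak_gradient D (\<lambda>x. c) (\<lambda>x. 0)"
  by (rule bounded_weak_gradientI[OF weak_gradient_C1, where B="\<bar>c\<bar>" and B'=0]) auto

lemma bounded_weak_gradient_linear:
  assumes "open D" "bounded_weak_gradient D v g" "bounded_weak_gradient D w h"
  shows "bounded_weak_gradient D (\<lambda>x. a * v x + b * w x) (\<lambda>x. a *\<^sub>R g x + b *\<^sub>R h x)"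
proof -
  obtain B where B: "B > 0" "is_weak_gradient D v g" "v \<in> borel_measurable (lebesgue_on D)"
    "g \<in> borel_measurable (lebesgue_on D)" "\<And>x. x \<in> D \<Longrightarrow> \<bar>v x\<bar> \<le> B" "\<And>x. x \<in> D \<Longrightarrow> norm (g x) \<le> B"
    using assms(2) by (rule bounded_weak_gradientE) blast
  obtain C where C: "C > 0" "is_weak_gradient D w h" "w \<in> borel_measurable (lebesgue_on D)"
    "h \<in> borel_measurable (lebesgue_on D)" "\<And>x. x \<in> D \<Longrightarrow> \<bar>w x\<bar> \<le> C" "\<And>x. x \<in> D \<Longrightarrow> norm (h x) \<le> C"
    using assms(3) by (rule bounded_weak_gradientE) blast
  have [measurable]: "v \<in> borel_measurable (lebesgue_on D)" "w \<in> borel_measurable (lebesgue_on D)"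
    "g \<in> borel_measurable (lebesgue_on D)" "h \<in> borel_measurable (lebesgue_on D)"
    using B C by auto
  show ?thesis
  proof (rule bounded_weak_gradientI)
    show "is_weak_gradient D (\<lambda>x. a * v x + b * w x) (\<lambda>x. a *\<^sub>R g x + b *\<^sub>R h x)"
      by (intro weak_gradient_add weak_gradient_cmult assms B C)
    fix x assume x: "x \<in> D"
    have "\<bar>a * v x + b * w x\<bar> \<le> \<bar>a\<bar> * \<bar>v x\<bar> + \<bar>b\<bar> * \<bar>w x\<bar>"
      using abs_triangle_ineq[of "a * v x" "b * w x"] by (simp add: abs_mult)
    also have "\<dots> \<le> \<bar>a\<bar> * B + \<bar>b\<bar> * C"
      using B(5)[OF x] C(5)[OF x] by (intro add_mono mult_left_mono) auto
    finally show "\<bar>a * v x + b * w x\<bar> \<le> \<bar>a\<bar> * B + \<bar>b\<bar> * C" .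
    have "norm (a *\<^sub>R g x + b *\<^sub>R h x) \<le> \<bar>a\<bar> * norm (g x) + \<bar>b\<bar> * norm (h x)"
      using norm_triangle_ineq[of "a *\<^sub>R g x" "b *\<^sub>R h x"] by simp
    also have "\<dots> \<le> \<bar>a\<bar> * B + \<bar>b\<bar> * C"
      using B(6)[OF x] C(6)[OF x] by (intro add_mono mult_left_mono) auto
    finally show "norm (a *\<^sub>R g x + b *\<^sub>R h x) \<le> \<bar>a\<bar> * B + \<bar>b\<bar> * C" .
  qed measurable
qed

section \<open>Weak gradients on the zero set of a function\<close>

lemma bounded_weak_gradient_power:
  assumes "open D" "bounded D" "bounded_weak_gradient D v g"
  shows "bounded_weak_gradient D (\<lambda>x. v x ^ k) (\<lambda>x. (real k * v x ^ (k - 1)) *\<^sub>R g x)"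
proof (induction k)
  case 0
  then show ?case using bounded_weak_gradient_const[OF assms(1), of 1] by simp
next
  case (Suc k)
  have "v x ^ k *\<^sub>R g x + v x *\<^sub>R ((real k * v x ^ (k - 1)) *\<^sub>R g x) = (real (Suc k) * v x ^ (Suc k - 1)) *\<^sub>R g x" for x
    by (cases k) (simp_all add: algebra_simps flip: scaleR_add_left)
  then show ?case
    using bounded_weak_gradient_mult[OF assms(1,2) Suc assms(3)] by (simp add: mult.commute)
qed

text \<open>The expression is the probability of exactly one success in \<open>Suc k\<close>
  independent trials of success probability x; the induction adds the probability of no success. It
  bounds the gradient factors below uniformly in k.\<close>

lemma Bernoulli_term_le_1:
  fixes x :: real
  assumes "0 \<le> x" "x \<le> 1"
  shows "real (Suc k) * x * (1 - x) ^ k \<le> 1"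
proof -
  have "real (Suc k) * x * (1 - x) ^ k + (1 - x) ^ Suc k \<le> 1"
  proof (induction k)
    case (Suc k)
    have "real (Suc (Suc k)) * x * (1 - x) ^ Suc k + (1 - x) ^ Suc (Suc k)
        = (1 - x) * (real (Suc k) * x * (1 - x) ^ k + (1 - x) ^ Suc k) + x * (1 - x) ^ Suc k"
      by (simp add: algebra_simps)
    also have "\<dots> \<le> (1 - x) * 1 + x * 1"
      using assms Suc by (intro add_mono mult_left_mono power_le_one) auto
    finally show ?case by simp
  qed simp
  moreover have "0 \<le> (1 - x) ^ Suc k" using assms by simp
  ultimately show ?thesis by linarith
qed

text \<open>The gradients of \<open>v (1 - v\<^sup>2) ^ Suc k\<close> converge to \<open>g\<close> on the zero set of \<open>v\<close> and to 0 off it,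
  while the functions converge to 0.\<close>

lemma weak_gradient_zero_on_zero_set:
  assumes D: "open D" "bounded D" and v: "bounded_weak_gradient D v g"
  shows "AE x in lebesgue_on D. v x = 0 \<longrightarrow> g x = 0"
proof -
  \<comment> \<open>Normalising to \<open>\<bar>v\<bar> \<le> 1\<close> puts
    \<open>1 - (v x)\<^sup>2\<close> into \<open>[0, 1]\<close>, so that its powers stay bounded and
    tend to 0 wherever v is nonzero.\<close>
  have main: "AE x in lebesgue_on D. v x = 0 \<longrightarrow> g x = 0"
    if v: "bounded_weak_gradient D v g" and v1: "\<And>x. x \<in> D \<Longrightarrow> \<bar>v x\<bar> \<le> 1" for v g
  proof -
    obtain B where B: "B > 0" "is_weak_gradient D v g" "v \<in> borel_measurable (lebesgue_on D)"
      "g \<in> borel_measurable (lebesgue_on D)" "\<And>x. x \<in> D \<Longrightarrow> norm (g x) \<le> B"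
      using v by (rule bounded_weak_gradientE) blast
    have [measurable]: "v \<in> borel_measurable (lebesgue_on D)" "g \<in> borel_measurable (lebesgue_on D)"
      using B by auto
    have [measurable]: "(\<lambda>x. g x $ i) \<in> borel_measurable (lebesgue_on D)" for i
      by (intro borel_measurable_vec_nth; measurable)
    define q where "q k x = v x * (1 - (v x)\<^sup>2) ^ Suc k" for k x
    \<comment> \<open>This factor is the derivative of \<open>s * (1 - s^2) ^ Suc k\<close> at
      \<open>s = v x\<close>, as the chain rule requires.\<close>
    define m where "m k x = (1 - (v x)\<^sup>2) ^ Suc k - 2 * (v x)\<^sup>2 * (real (Suc k) * (1 - (v x)\<^sup>2) ^ k)" for k x
    have wg: "is_weak_gradient D (q k) (\<lambda>x. m k x *\<^sub>R g x)" for k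
    proof -
      have "bounded_weak_gradient D (\<lambda>x. 1 * 1 + (-1) * (v x * v x)) (\<lambda>x. 1 *\<^sub>R 0 + (-1) *\<^sub>R (v x *\<^sub>R g x + v x *\<^sub>R g x))"
        by (intro bounded_weak_gradient_linear bounded_weak_gradient_const bounded_weak_gradient_mult D v)
      from bounded_weak_gradient_mult[OF D v bounded_weak_gradient_power[OF D this, of "Suc k"]]
      have "is_weak_gradient D (\<lambda>x. v x * (1 * 1 + (-1) * (v x * v x)) ^ Suc k)
          (\<lambda>x. v x *\<^sub>R ((real (Suc k) * (1 * 1 + - 1 * (v x * v x)) ^ (Suc k - 1)) *\<^sub>R (1 *\<^sub>R 0 + - 1 *\<^sub>R (v x *\<^sub>R g x + v x *\<^sub>R g x)))
             + (1 * 1 + - 1 * (v x * v x)) ^ Suc k *\<^sub>R g x)"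
        by (simp only: bounded_weak_gradient_def)
      moreover have "v x * (1 * 1 + (-1) * (v x * v x)) ^ Suc k = q k x" for x
        by (simp add: q_def power2_eq_square)
      moreover have "v x *\<^sub>R ((real (Suc k) * (1 * 1 + - 1 * (v x * v x)) ^ (Suc k - 1)) *\<^sub>R (1 *\<^sub>R 0 + - 1 *\<^sub>R (v x *\<^sub>R g x + v x *\<^sub>R g x)))
             + (1 * 1 + - 1 * (v x * v x)) ^ Suc k *\<^sub>R g x = m k x *\<^sub>R g x" for x
      proof -
        let ?P = "1 - (v x)\<^sup>2"
        have "1 * 1 + - 1 * (v x * v x) = ?P" by (simp add: power2_eq_square)
        moreover have "1 *\<^sub>R 0 + - 1 *\<^sub>R (v x *\<^sub>R g x + v x *\<^sub>R g x) = (- 2 * v x) *\<^sub>R g x"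
          by (simp add: vec_eq_iff)
        moreover have "v x *\<^sub>R ((real (Suc k) * ?P ^ (Suc k - 1)) *\<^sub>R ((- 2 * v x) *\<^sub>R g x)) + ?P ^ Suc k *\<^sub>R g x = m k x *\<^sub>R g x"
          unfolding m_def by (simp add: vec_eq_iff power2_eq_square) (simp add: algebra_simps)
        ultimately show ?thesis by (simp only:)
      qed
      ultimately show ?thesis by (simp only:)
    qed
    have q1: "\<bar>q k x\<bar> \<le> 1" if "x \<in> D" for k x
    proof -
      have "(v x)\<^sup>2 \<le> 1" using v1[OF that] by (simp add: abs_square_le_1)
      then have "\<bar>1 - (v x)\<^sup>2\<bar> \<le> 1"
        using zero_le_power2[of "v x"] unfolding abs_le_iff by linarith
      then have "\<bar>1 - (v x)\<^sup>2\<bar> ^ Suc k \<le> 1"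
        by (rule power_le_one[OF abs_ge_zero])
      then have "\<bar>v x\<bar> * \<bar>1 - (v x)\<^sup>2\<bar> ^ Suc k \<le> 1 * 1"
        by (intro mult_mono v1[OF that] zero_le_power abs_ge_zero) (assumption | rule zero_le_one)+
      then show ?thesis by (simp only: q_def abs_mult power_abs mult_1)
    qed
    \<comment> \<open>The first term lies in \<open>[0, 1]\<close> and the subtracted one is twice a
      Bernoulli probability, hence in \<open>[0, 2]\<close>.\<close>
    have m3: "\<bar>m k x\<bar> \<le> 3" if "x \<in> D" for k x
    proof -
      have s: "0 \<le> (v x)\<^sup>2" "(v x)\<^sup>2 \<le> 1" using v1[OF that] by (auto simp: abs_square_le_1)
      then have s': "0 \<le> 1 - (v x)\<^sup>2" "1 - (v x)\<^sup>2 \<le> 1" by linarith+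
      have "0 \<le> (1 - (v x)\<^sup>2) ^ Suc k" "(1 - (v x)\<^sup>2) ^ Suc k \<le> 1"
        by (rule zero_le_power[OF s'(1)], rule power_le_one[OF s'])
      moreover have "0 \<le> real (Suc k) * (v x)\<^sup>2 * (1 - (v x)\<^sup>2) ^ k"
        by (intro mult_nonneg_nonneg of_nat_0_le_iff zero_le_power2 zero_le_power[OF s'(1)])
      moreover have "m k x = (1 - (v x)\<^sup>2) ^ Suc k - 2 * (real (Suc k) * (v x)\<^sup>2 * (1 - (v x)\<^sup>2) ^ k)"
        by (simp add: m_def)
      ultimately show ?thesis
        using Bernoulli_term_le_1[OF s, of k] unfolding abs_le_iff by linarith
    qed
    have lim: "(\<lambda>k. q k x) \<longlonglongrightarrow> 0" "(\<lambda>k. m k x) \<longlonglongrightarrow> (if v x = 0 then 1 else 0)" if x: "x \<in> D" for x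
    proof -
      have "(\<lambda>k. q k x) \<longlonglongrightarrow> 0 \<and> (\<lambda>k. m k x) \<longlonglongrightarrow> (if v x = 0 then 1 else 0)"
      proof (cases "v x = 0")
        case True
        then show ?thesis by (simp add: q_def m_def)
      next
        case False
        have "0 < (v x)\<^sup>2" "(v x)\<^sup>2 \<le> 1" using v1[OF x] False by (auto simp: abs_square_le_1)
        then have y: "norm (1 - (v x)\<^sup>2) < 1" by simp
        have p: "(\<lambda>k. (1 - (v x)\<^sup>2) ^ k) \<longlonglongrightarrow> 0"
          by (rule LIMSEQ_power_zero[OF y])
        have np: "(\<lambda>k. real k * (1 - (v x)\<^sup>2) ^ k) \<longlonglongrightarrow> 0"
          using powser_times_n_limit_0[OF y] by simp
        have "(\<lambda>k. v x * (1 - (v x)\<^sup>2) ^ Suc k) \<longlonglongrightarrow> v x * 0"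
          by (intro tendsto_mult tendsto_const LIMSEQ_Suc p)
        moreover have "(\<lambda>k. (1 - (v x)\<^sup>2) ^ Suc k - 2 * (v x)\<^sup>2 * (real k * (1 - (v x)\<^sup>2) ^ k + (1 - (v x)\<^sup>2) ^ k))
            \<longlonglongrightarrow> 0 - 2 * (v x)\<^sup>2 * (0 + 0)"
          by (intro tendsto_diff tendsto_mult tendsto_add tendsto_const LIMSEQ_Suc p np)
        ultimately show ?thesis
          using False by (simp add: q_def m_def distrib_right add.commute)
      qed
      then show "(\<lambda>k. q k x) \<longlonglongrightarrow> 0" "(\<lambda>k. m k x) \<longlonglongrightarrow> (if v x = 0 then 1 else 0)" by auto
    qed
    \<comment> \<open>h is the pointwise limit of the gradients of \<open>q k\<close>. Since
      \<open>q k\<close> itself tends to 0, h is a weak gradient of the zero function and vanishes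
      almost everywhere by uniqueness.\<close>
    define h where "h x = (if v x = 0 then 1 else 0 :: real) *\<^sub>R g x" for x
    have [measurable]: "h \<in> borel_measurable (lebesgue_on D)"
      unfolding h_def[abs_def] by measurable
    have hB: "norm (h x) \<le> B" if "x \<in> D" for x
      using B(1) B(5)[OF that] by (simp add: h_def)
    have cint: "integrable (lebesgue_on D) (\<lambda>x. c :: real)" for c
      by (intro finite_measure.integrable_const finite_measure_lebesgue_on D open_sets_lebesgue)
    have "is_weak_gradient D (\<lambda>x. 0) h"
    proof (rule weak_gradient_limit[OF D(1) wg])
      show "locally_integrable D (\<lambda>x. 0::real)" by (simp add: locally_integrable_def)
      show "locally_integrable D h"
        by (intro locally_integrableI integrable_bounded_on[where B=B] D hB open_sets_lebesgue) measurable
    next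
      fix i \<theta> assume \<theta>: "test_function D \<theta>"
      obtain T where T: "T > 0" "\<And>x. \<bar>\<theta> x\<bar> \<le> T" "\<And>x i. \<bar>partial_deriv i \<theta> x\<bar> \<le> T"
        using \<theta> by (rule test_function_bounded) blast
      have sm: "smooth \<theta>" using \<theta> by (simp add: test_function_def)
      have [measurable]: "\<theta> \<in> borel_measurable (lebesgue_on D)" "partial_deriv i \<theta> \<in> borel_measurable (lebesgue_on D)" for i
        by (intro measurable_restrict_space1 borel_measurable_lebesgue_continuous smooth_continuous smooth_partial_deriv sm)+
      show "(\<lambda>k. LINT x|lebesgue_on D. q k x * partial_deriv i \<theta> x) \<longlonglongrightarrow> (LINT x|lebesgue_on D. 0 * partial_deriv i \<theta> x)"
      proof (rule integral_dominated_convergence[where w="\<lambda>x. 1 * T"])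
        show "AE x in lebesgue_on D. (\<lambda>k. q k x * partial_deriv i \<theta> x) \<longlonglongrightarrow> 0 * partial_deriv i \<theta> x"
          using lim(1) by (intro AE_I2 tendsto_mult tendsto_const) simp
        show "AE x in lebesgue_on D. norm (q k x * partial_deriv i \<theta> x) \<le> 1 * T" for k
          unfolding real_norm_def abs_mult using q1 T by (intro AE_I2 mult_mono) auto
      qed (use cint in \<open>simp_all add: q_def\<close>)
      show "(\<lambda>k. LINT x|lebesgue_on D. (m k x *\<^sub>R g x) $ i * \<theta> x) \<longlonglongrightarrow> (LINT x|lebesgue_on D. h x $ i * \<theta> x)"
      proof (rule integral_dominated_convergence[where w="\<lambda>x. 3 * B * T"])
        show "AE x in lebesgue_on D. (\<lambda>k. (m k x *\<^sub>R g x) $ i * \<theta> x) \<longlonglongrightarrow> h x $ i * \<theta> x"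
          unfolding h_def vector_scaleR_component real_scaleR_def
          by (intro AE_I2 tendsto_mult tendsto_const lim(2)) simp
        show "AE x in lebesgue_on D. norm ((m k x *\<^sub>R g x) $ i * \<theta> x) \<le> 3 * B * T" for k
        proof (rule AE_I2)
          fix x assume x: "x \<in> space (lebesgue_on D)"
          then have "\<bar>g x $ i\<bar> \<le> B"
            using B(5)[of x] component_le_norm_cart[of "g x" i] by simp
          then show "norm ((m k x *\<^sub>R g x) $ i * \<theta> x) \<le> 3 * B * T"
            unfolding real_norm_def vector_scaleR_component real_scaleR_def abs_mult using x m3[of x k] T B(1)
            by (intro mult_mono) auto
        qed
        show "(\<lambda>x. h x $ i * \<theta> x) \<in> borel_measurable (lebesgue_on D)"
          by (intro borel_measurable_times borel_measurable_vec_nth; measurable)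
        show "(\<lambda>x. (m k x *\<^sub>R g x) $ i * \<theta> x) \<in> borel_measurable (lebesgue_on D)" for k
          unfolding m_def vector_scaleR_component by measurable
      qed (rule cint)
    qed
    then have "AE x in lebesgue_on D. h x = 0"
      by (rule weak_gradient_unique[OF D(1) _ weak_gradient_0]) simp
    then show ?thesis
      by eventually_elim (auto simp: h_def)
  qed
  \<comment> \<open>Dividing by a bound of v reduces the general case to the normalised one without
    changing the zero set.\<close>
  obtain B where B: "B > 0" "\<And>x. x \<in> D \<Longrightarrow> \<bar>v x\<bar> \<le> B"
    using v by (rule bounded_weak_gradientE) blast
  have "bounded_weak_gradient D (\<lambda>x. (1 / B) * v x + 0 * v x) (\<lambda>x. (1 / B) *\<^sub>R g x + 0 *\<^sub>R g x)"
    by (intro bounded_weak_gradient_linear D v)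
  then have "bounded_weak_gradient D (\<lambda>x. v x / B) (\<lambda>x. (1 / B) *\<^sub>R g x)" by simp
  then have "AE x in lebesgue_on D. v x / B = 0 \<longrightarrow> (1 / B) *\<^sub>R g x = 0"
    by (rule main) (use B in \<open>simp add: abs_divide divide_le_eq\<close>)
  then show ?thesis
    by eventually_elim (use B(1) in auto)
qed

section \<open>Bounded representatives of essentially bounded gradients\<close>

lemma measurable_lebesgue_on_cong_AE:
  fixes f g :: "real^'d \<Rightarrow> 'b::euclidean_space"
  assumes "open D" "f \<in> borel_measurable (lebesgue_on D)" "AE x in lebesgue_on D. f x = g x"
  shows "g \<in> borel_measurable (lebesgue_on D)"
proof -
  have D: "D \<in> sets lebesgue" using assms(1) by simp
  have "(\<lambda>x. if x \<in> D then f x else 0) \<in> borel_measurable lebesgue"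
    by (rule borel_measurable_if_I[OF assms(2) D])
  moreover have "AE x in lebesgue. (if x \<in> D then f x else 0) = (if x \<in> D then g x else 0)"
    using assms(3) D by (auto simp: AE_restrict_space_iff elim: eventually_mono)
  ultimately have "(\<lambda>x. if x \<in> D then g x else 0) \<in> borel_measurable lebesgue"
    by (rule borel_measurable_AE)
  then have "(\<lambda>x. if x \<in> D then g x else 0) \<in> borel_measurable (lebesgue_on D)"
    by (rule measurable_restrict_space1)
  then show ?thesis
    by (subst measurable_lebesgue_cong[where g="\<lambda>x. if x \<in> D then g x else 0"]) auto
qed

text \<open>A weak gradient set to 0 wherever it exceeds its essential bound differs only on a null
  set, and obeys the bound at every point.\<close>

lemma W1inf_bounded_weak_gradient:
  assumes D: "open D" and v: "v \<in> W1inf D" "\<And>x. x \<in> D \<Longrightarrow> \<bar>v x\<bar> \<le> B"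
  obtains g where "bounded_weak_gradient D v g" "AE x in lebesgue_on D. weak_grad D v x = g x"
    "weak_grad D v \<in> Linf D"
proof -
  obtain g0 where g0: "is_weak_gradient D v g0" "g0 \<in> Linf D"
    using v(1) by (auto simp: W1inf_def)
  have m: "v \<in> borel_measurable (lebesgue_on D)" "g0 \<in> borel_measurable (lebesgue_on D)"
    using v(1) g0(2) by (auto simp: W1inf_def Linf_def)
  obtain b where b: "b \<ge> 0" "esssup (lebesgue_on D) (\<lambda>x. ereal (norm (g0 x))) \<le> ereal b"
  proof (cases "esssup (lebesgue_on D) (\<lambda>x. ereal (norm (g0 x)))")
    case (real r)
    then show thesis by (intro that[of "max 0 r"]) auto
  next
    case PInf
    then show thesis using g0(2) by (simp add: Linf_def)
  next
    \<comment> \<open>Over a null set the essential supremum is \<open>- \<infinity>\<close>; the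
      bound b still has to be a nonnegative real.\<close>
    case MInf
    then show thesis by (intro that[of 0]) auto
  qed
  have "AE x in lebesgue_on D. ereal (norm (g0 x)) \<le> ereal b"
    using esssup_AE[of "\<lambda>x. ereal (norm (g0 x))" "lebesgue_on D"]
    by eventually_elim (rule order_trans[OF _ b(2)])
  then have gb: "AE x in lebesgue_on D. norm (g0 x) \<le> b" by simp
  define g where "g x = (if norm (g0 x) \<le> b then g0 x else 0)" for x
  have [measurable]: "g0 \<in> borel_measurable (lebesgue_on D)" by (rule m)
  have gm: "g \<in> borel_measurable (lebesgue_on D)"
    unfolding g_def[abs_def] by measurable
  have eq: "AE x in lebesgue_on D. g0 x = g x"
    using gb by eventually_elim (simp add: g_def)
  have wg: "is_weak_gradient D v g"
    by (rule weak_gradient_cong_AE[OF D g0(1) _ eq m(1) gm]) simp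
  have AE0: "AE x in lebesgue_on D. weak_grad D v x = g0 x"
    by (rule weak_grad_AE[OF D g0(1)])
  have wm: "weak_grad D v \<in> borel_measurable (lebesgue_on D)"
    by (rule measurable_lebesgue_on_cong_AE[OF D m(2)]) (use AE0 in \<open>auto elim: eventually_mono\<close>)
  show thesis
  proof (rule that)
    show "bounded_weak_gradient D v g"
      by (rule bounded_weak_gradientI[OF wg m(1) gm v(2), where B'=b]) (use b in \<open>auto simp: g_def\<close>)
    show "AE x in lebesgue_on D. weak_grad D v x = g x"
      by (rule weak_grad_AE[OF D wg])
    have "esssup (lebesgue_on D) (\<lambda>x. ereal (norm (weak_grad D v x))) = esssup (lebesgue_on D) (\<lambda>x. ereal (norm (g0 x)))"
      using AE0 wm by (intro esssup_AE_cong) (auto elim: eventually_mono)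
    then show "weak_grad D v \<in> Linf D"
      using g0(2) wm by (simp add: Linf_def)
  qed
qed

subsection \<open>Testing an equation with bounded weakly differentiable functions\<close>

text \<open>The mollifications of a compactly supported v are genuine test functions with supports
  in one fixed compact set, and both sides of the equation are continuous under their weak
  convergence. F and s need only be integrable since v and its gradient are bounded.\<close>

lemma weak_equation_bounded_test:
  fixes F :: "real^'d \<Rightarrow> real^'d" and s v :: "real^'d \<Rightarrow> real"
  assumes D: "open D" "bounded D"
    and F: "integrable (lebesgue_on D) F" and s: "integrable (lebesgue_on D) s"
    and eq: "\<And>\<theta>. test_function D \<theta> \<Longrightarrow>
      (LINT x|lebesgue_on D. F x \<bullet> gradient \<theta> x) = (LINT x|lebesgue_on D. s x * \<theta> x)"
    and v: "bounded_weak_gradient D v g"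
    and K: "compact K" "K \<subseteq> D" "\<And>x. x \<in> D - K \<Longrightarrow> v x = 0"
  shows "(LINT x|lebesgue_on D. F x \<bullet> g x) = (LINT x|lebesgue_on D. s x * v x)"
proof -
  obtain d K' where d: "d > 0" and K': "compact K'" "K' \<subseteq> D" "\<And>x y. y \<in> K \<Longrightarrow> dist x y \<le> d \<Longrightarrow> x \<in> K'"
    using compact_neighbourhood[OF D(1) K(1,2)] by blast
  obtain vn where vn: "\<And>n. smooth (vn n)"
    "\<And>G. integrable (lebesgue_on D) G \<Longrightarrow>
       (\<lambda>n. LINT x|lebesgue_on D. G x * vn n x) \<longlonglongrightarrow> (LINT x|lebesgue_on D. G x * v x)"
    "\<And>G i. integrable (lebesgue_on K') G \<Longrightarrow>
       (\<lambda>n. LINT x|lebesgue_on K'. G x * partial_deriv i (vn n) x) \<longlonglongrightarrow> (LINT x|lebesgue_on K'. G x * g x $ i)"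
    "\<And>n x. vn n x \<noteq> 0 \<Longrightarrow> \<exists>y\<in>D. v y \<noteq> 0 \<and> dist x y \<le> d"
    by (rule mollify_bounded_weak_gradient[OF D v K'(1,2) d]) (rule that)
  have supp: "x \<in> K'" if nz: "vn n x \<noteq> 0" for n x
  proof -
    obtain y where "y \<in> D" "v y \<noteq> 0" "dist x y \<le> d" using vn(4)[OF nz] by blast
    then show ?thesis using K(3)[of y] K'(3)[of y x] by blast
  qed
  have supp': "partial_deriv i (vn n) x = 0" if "x \<notin> K'" for i n x
    using compact_imp_closed[OF K'(1)] that supp by (intro partial_deriv_support[of "- K'"]) auto
  have test: "test_function D (vn n)" for n
    using supp by (rule test_functionI[OF vn(1) K'(1,2)])
  have Ki: "integrable (lebesgue_on K') (\<lambda>x. F x $ i)" for i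
    by (intro integrable_lebesgue_on_subset[OF integrable_bounded_linear[OF bounded_linear_vec_nth F] K'(2)]
        compact_sets_lebesgue K'(1) open_sets_lebesgue D(1))
  have Fn: "(LINT x|lebesgue_on D. F x \<bullet> gradient (vn n) x) = (\<Sum>i\<in>UNIV. LINT x|lebesgue_on K'. F x $ i * partial_deriv i (vn n) x)" for n
  proof -
    have "(LINT x|lebesgue_on D. F x \<bullet> gradient (vn n) x) = (LINT x|lebesgue_on K'. F x \<bullet> gradient (vn n) x)"
    proof (rule integral_lebesgue_on_support)
      show "F x \<bullet> gradient (vn n) x = 0" if "x \<in> D - K'" for x
        using that supp' by (simp add: inner_vec_def)
    qed (use K' D compact_sets_lebesgue in auto)
    also have "\<dots> = (LINT x|lebesgue_on K'. (\<Sum>i\<in>UNIV. F x $ i * partial_deriv i (vn n) x))"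
      by (simp add: inner_vec_def)
    also have "\<dots> = (\<Sum>i\<in>UNIV. LINT x|lebesgue_on K'. F x $ i * partial_deriv i (vn n) x)"
    proof (rule Bochner_Integration.integral_sum)
      fix i :: 'd
      have "locally_integrable D (\<lambda>x. F x $ i)"
        by (intro locally_integrableI integrable_bounded_linear[OF bounded_linear_vec_nth F] open_sets_lebesgue D(1))
      then have "integrable (lebesgue_on D) (\<lambda>x. F x $ i * partial_deriv i (vn n) x)"
        by (rule integrable_mult_test[OF D(1) _ K'(1,2) _ supp'])
           (intro smooth_continuous smooth_partial_deriv vn(1))
      then show "integrable (lebesgue_on K') (\<lambda>x. F x $ i * partial_deriv i (vn n) x)"
        by (rule integrable_lebesgue_on_subset) (use K' D compact_sets_lebesgue in auto)
    qed
    finally show ?thesis .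
  qed
  have "(\<lambda>n. LINT x|lebesgue_on D. F x \<bullet> gradient (vn n) x) \<longlonglongrightarrow> (\<Sum>i\<in>UNIV. LINT x|lebesgue_on K'. F x $ i * g x $ i)"
    unfolding Fn by (intro tendsto_sum vn(3) Ki)
  moreover have "(\<lambda>n. LINT x|lebesgue_on D. F x \<bullet> gradient (vn n) x) \<longlonglongrightarrow> (LINT x|lebesgue_on D. s x * v x)"
    unfolding eq[OF test] by (rule vn(2)[OF s])
  ultimately have lim: "(\<Sum>i\<in>UNIV. LINT x|lebesgue_on K'. F x $ i * g x $ i) = (LINT x|lebesgue_on D. s x * v x)"
    by (rule LIMSEQ_unique)
  obtain B where B: "B > 0" "g \<in> borel_measurable (lebesgue_on D)" "\<And>x. x \<in> D \<Longrightarrow> norm (g x) \<le> B"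
    using v by (rule bounded_weak_gradientE) blast
  have [measurable]: "F \<in> borel_measurable (lebesgue_on D)" "g \<in> borel_measurable (lebesgue_on D)"
    using F B by auto
  have Km: "K' \<in> sets lebesgue" "D \<in> sets lebesgue" using K' D by (auto intro: compact_sets_lebesgue)
  \<comment> \<open>Outside K' the function v is zero, hence so is g almost everywhere; this
    identifies the limit over K' with the integral over D.\<close>
  have z: "AE x in lebesgue_on D. (if x \<in> K' then F x \<bullet> g x else 0) = F x \<bullet> g x"
    using weak_gradient_zero_on_zero_set[OF D v] AE_space
  proof eventually_elim
    case (elim x)
    then show ?case using K(3)[of x] K'(3)[of x x] d by (cases "x \<in> K") auto
  qed
  have "(LINT x|lebesgue_on D. F x \<bullet> g x) = (LINT x|lebesgue_on D. (if x \<in> K' then F x \<bullet> g x else 0))"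
  proof (rule integral_cong_AE)
    show m: "(\<lambda>x. F x \<bullet> g x) \<in> borel_measurable (lebesgue_on D)" by measurable
    show "(\<lambda>x. if x \<in> K' then F x \<bullet> g x else 0) \<in> borel_measurable (lebesgue_on D)"
      by (rule measurable_lebesgue_on_cong_AE[OF D(1) m]) (use z in \<open>auto elim: eventually_mono\<close>)
    show "AE x in lebesgue_on D. F x \<bullet> g x = (if x \<in> K' then F x \<bullet> g x else 0)"
      using z by eventually_elim simp
  qed
  also have "\<dots> = (LINT x|lebesgue_on K'. F x \<bullet> g x)"
    by (rule Lebesgue_Measure.integral_restrict[OF K'(2) Km])
  also have "\<dots> = (LINT x|lebesgue_on K'. (\<Sum>i\<in>UNIV. F x $ i * g x $ i))"
    by (simp add: inner_vec_def)
  also have "\<dots> = (\<Sum>i\<in>UNIV. LINT x|lebesgue_on K'. F x $ i * g x $ i)"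
  proof (rule Bochner_Integration.integral_sum)
    fix i :: 'd
    have "integrable (lebesgue_on K') (\<lambda>x. g x $ i * F x $ i)"
    proof (rule integrable_mult_bounded[OF Ki])
      show "(\<lambda>x. g x $ i) \<in> borel_measurable (lebesgue_on K')"
        by (intro borel_measurable_vec_nth measurable_lebesgue_on_subset[OF B(2) K'(2)])
      show "AE x in lebesgue_on K'. \<bar>g x $ i\<bar> \<le> B"
      proof (rule AE_I2)
        fix x assume "x \<in> space (lebesgue_on K')"
        then show "\<bar>g x $ i\<bar> \<le> B"
          using B(3)[of x] K'(2) component_le_norm_cart[of "g x" i] by auto
      qed
    qed
    then show "integrable (lebesgue_on K') (\<lambda>x. F x $ i * g x $ i)" by (simp only: mult.commute)
  qed
  finally show ?thesis using lim by simp
qed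

subsection \<open>A continuously differentiable truncation\<close>

text \<open>Beyond the threshold this is \<open>s - 2 * a * sgn s + a^2 / s\<close>. The double zero
  of the numerator at \<open>\<bar>s\<bar> = a\<close> makes it continuously differentiable, which
  plain soft thresholding is not, so a composition with a smooth function has a classical
  gradient.\<close>

definition trunc :: "real \<Rightarrow> real \<Rightarrow> real" where
  "trunc a s = (if \<bar>s\<bar> \<le> a then 0 else (\<bar>s\<bar> - a)\<^sup>2 / s)"

text \<open>The maximum merges the branch 0 for \<open>\<bar>s\<bar> \<le> a\<close> and the branch
  \<open>1 - a^2 / s^2\<close> beyond into one visibly continuous formula.\<close>

definition trunc' :: "real \<Rightarrow> real \<Rightarrow> real" where
  "trunc' a s = 1 - a\<^sup>2 / (max a \<bar>s\<bar>)\<^sup>2"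

lemma trunc_abs_le: "a > 0 \<Longrightarrow> \<bar>trunc a s\<bar> \<le> \<bar>s\<bar>"
proof (cases "\<bar>s\<bar> \<le> a")
  case False
  assume "a > 0"
  with False have "\<bar>s\<bar> > 0" "(\<bar>s\<bar> - a)\<^sup>2 \<le> \<bar>s\<bar>\<^sup>2" by (linarith, intro power_mono) auto
  then show ?thesis using False
    by (simp add: trunc_def abs_divide divide_le_eq power2_eq_square)
qed (simp add: trunc_def)

lemma trunc'_bounds: "a > 0 \<Longrightarrow> 0 \<le> trunc' a s" "a > 0 \<Longrightarrow> trunc' a s \<le> 1"
  by (auto simp: trunc'_def divide_le_eq intro!: power_mono)

lemma DERIV_trunc:
  assumes "a > 0"
  shows "(trunc a has_real_derivative trunc' a s) (at s)"
proof -
  consider "\<bar>s\<bar> \<le> a" | "s > a" | "s < - a" by linarith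
  then show ?thesis
  proof cases
    case 1
    \<comment> \<open>A quadratic bound around every s in the closed interval
      \<open>[- a, a]\<close> gives derivative 0 there, including the junctions at its ends.\<close>
    have bd: "\<bar>trunc a t\<bar> \<le> (t - s)\<^sup>2 / a" for t
    proof (cases "\<bar>t\<bar> \<le> a")
      case False
      then have "(\<bar>t\<bar> - a)\<^sup>2 \<le> \<bar>t - s\<bar>\<^sup>2"
        using 1 by (intro power_mono) auto
      then have "(\<bar>t\<bar> - a)\<^sup>2 / \<bar>t\<bar> \<le> (t - s)\<^sup>2 / a"
        using False assms by (intro frac_le) auto
      then show ?thesis using False by (simp add: trunc_def abs_divide)
    qed (use assms in \<open>simp add: trunc_def\<close>)
    have "((\<lambda>h. (trunc a (s + h) - trunc a s) / h) \<longlongrightarrow> 0) (at 0)"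
    proof (rule Lim_null_comparison)
      show "\<forall>\<^sub>F h in at 0. norm ((trunc a (s + h) - trunc a s) / h) \<le> \<bar>h\<bar> / a"
        unfolding eventually_at_filter
      proof (intro always_eventually allI impI)
        fix h :: real assume "h \<noteq> 0"
        have "trunc a s = 0" using 1 by (simp add: trunc_def)
        moreover have "\<bar>trunc a (s + h)\<bar> / \<bar>h\<bar> \<le> (h\<^sup>2 / a) / \<bar>h\<bar>"
          using bd[of "s + h"] by (intro divide_right_mono) auto
        moreover have "(h\<^sup>2 / a) / \<bar>h\<bar> = \<bar>h\<bar> / a"
          using \<open>h \<noteq> 0\<close> by (simp add: power2_eq_square abs_if)
        ultimately show "norm ((trunc a (s + h) - trunc a s) / h) \<le> \<bar>h\<bar> / a"
          by (simp add: abs_divide)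
      qed
      have "((\<lambda>h::real. \<bar>h\<bar> / a) \<longlongrightarrow> \<bar>0\<bar> / a) (at 0)"
        using assms by (intro tendsto_intros) auto
      then show "((\<lambda>h::real. \<bar>h\<bar> / a) \<longlongrightarrow> 0) (at 0)" by simp
    qed
    moreover have "trunc' a s = 0"
      using 1 assms by (simp add: trunc'_def max_absorb1)
    ultimately show ?thesis by (simp add: DERIV_def)
  next
    case 2
    have "((\<lambda>s. (s - a)\<^sup>2 / s) has_real_derivative trunc' a s) (at s)"
      using 2 assms by (auto intro!: derivative_eq_intros simp: trunc'_def field_simps power2_eq_square)
    then show ?thesis
      by (rule has_field_derivative_transform_within_open[of _ _ _ "{a<..}"])
         (use 2 assms in \<open>auto simp: trunc_def\<close>)
  next
    case 3
    have "((\<lambda>s. (- s - a)\<^sup>2 / s) has_real_derivative trunc' a s) (at s)"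
      using 3 assms by (auto intro!: derivative_eq_intros simp: trunc'_def field_simps power2_eq_square)
    then show ?thesis
      by (rule has_field_derivative_transform_within_open[of _ _ _ "{..<- a}"])
         (use 3 assms in \<open>auto simp: trunc_def\<close>)
  qed
qed

text \<open>The derivatives tend to 1 except at \<open>s = 0\<close>. The exception does no harm,
  because the gradient of a smooth function is 0 almost everywhere on its zero set.\<close>

lemma trunc_tendsto: "(\<lambda>n. trunc (inverse (real (Suc n))) s) \<longlonglongrightarrow> s"
  and trunc'_tendsto: "(\<lambda>n. trunc' (inverse (real (Suc n))) s) \<longlonglongrightarrow> (if s = 0 then 0 else 1)"
proof -
  have "(\<lambda>n. trunc (inverse (real (Suc n))) s) \<longlonglongrightarrow> s \<and>
    (\<lambda>n. trunc' (inverse (real (Suc n))) s) \<longlonglongrightarrow> (if s = 0 then 0 else 1)"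
  proof (cases "s = 0")
    case True
    then show ?thesis by (simp add: trunc_def trunc'_def)
  next
    case False
    let ?a = "\<lambda>n. inverse (real (Suc n))"
    have a0: "?a \<longlonglongrightarrow> 0" by (rule LIMSEQ_inverse_real_of_nat)
    have ev: "\<forall>\<^sub>F n in sequentially. ?a n < \<bar>s\<bar>"
      using order_tendstoD(2)[OF a0, of "\<bar>s\<bar>"] False by simp
    have "(\<lambda>n. (\<bar>s\<bar> - ?a n)\<^sup>2 / s) \<longlonglongrightarrow> (\<bar>s\<bar> - 0)\<^sup>2 / s"
      using False by (intro tendsto_intros a0)
    then have "(\<lambda>n. (\<bar>s\<bar> - ?a n)\<^sup>2 / s) \<longlonglongrightarrow> s"
      using False by (simp add: power2_eq_square)
    then have "(\<lambda>n. trunc (?a n) s) \<longlonglongrightarrow> s"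
      by (rule Lim_transform_eventually) (use ev in eventually_elim, simp add: trunc_def)
    moreover have "(\<lambda>n. 1 - (?a n)\<^sup>2 / \<bar>s\<bar>\<^sup>2) \<longlonglongrightarrow> 1 - 0\<^sup>2 / \<bar>s\<bar>\<^sup>2"
      using False by (intro tendsto_intros a0) auto
    then have "(\<lambda>n. trunc' (?a n) s) \<longlonglongrightarrow> 1 - 0\<^sup>2 / \<bar>s\<bar>\<^sup>2"
      by (rule Lim_transform_eventually) (use ev in eventually_elim, simp add: trunc'_def max_absorb2)
    ultimately show ?thesis using False by simp
  qed
  then show "(\<lambda>n. trunc (inverse (real (Suc n))) s) \<longlonglongrightarrow> s"
    "(\<lambda>n. trunc' (inverse (real (Suc n))) s) \<longlonglongrightarrow> (if s = 0 then 0 else 1)" by auto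
qed

lemma smooth_bounded_on:
  assumes "bounded D" "smooth p"
  obtains B where "B > 0" "\<And>x. x \<in> D \<Longrightarrow> \<bar>p x\<bar> \<le> B" "\<And>x. x \<in> D \<Longrightarrow> norm (gradient p x) \<le> B"
proof -
  have "compact (closure D)" using assms(1) by (simp add: compact_closure)
  then have "bounded (p ` closure D)" "bounded (gradient p ` closure D)"
    by (auto intro!: compact_imp_bounded compact_continuous_image smooth_continuous continuous_on_gradient assms(2))
  then obtain B1 B2 where B: "\<forall>y\<in>p ` closure D. norm y \<le> B1" "\<forall>y\<in>gradient p ` closure D. norm y \<le> B2"
    unfolding bounded_iff by blast
  show thesis
  proof (rule that[of "\<bar>B1\<bar> + \<bar>B2\<bar> + 1"])
    fix x assume "x \<in> D"
    then have "x \<in> closure D" using closure_subset by blast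
    then have "norm (p x) \<le> B1" "norm (gradient p x) \<le> B2" using B by auto
    then show "\<bar>p x\<bar> \<le> \<bar>B1\<bar> + \<bar>B2\<bar> + 1" "norm (gradient p x) \<le> \<bar>B1\<bar> + \<bar>B2\<bar> + 1" by auto
  qed simp
qed

lemma measurable_smooth:
  assumes "smooth p"
  shows "p \<in> borel_measurable (lebesgue_on D)" "gradient p \<in> borel_measurable (lebesgue_on D)"
  by (intro measurable_restrict_space1 borel_measurable_lebesgue_continuous smooth_continuous continuous_on_gradient assms)+

lemma smooth_L2:
  fixes p :: "real^'d \<Rightarrow> real"
  assumes "bounded D" "open D" "smooth p"
  shows "p \<in> L2 D" "gradient p \<in> L2 D"
proof -
  obtain B where B: "B > 0" "\<And>x. x \<in> D \<Longrightarrow> \<bar>p x\<bar> \<le> B" "\<And>x. x \<in> D \<Longrightarrow> norm (gradient p x) \<le> B"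
    using smooth_bounded_on[OF assms(1,3)] by blast
  show "p \<in> L2 D"
    by (rule bounded_L2[OF assms(1) open_sets_lebesgue[OF assms(2)] measurable_smooth(1)[OF assms(3)], of B], rule AE_I2)
       (use B(2) in simp)
  show "gradient p \<in> L2 D"
    by (rule bounded_L2[OF assms(1) open_sets_lebesgue[OF assms(2)] measurable_smooth(2)[OF assms(3)], of B], rule AE_I2)
       (use B(3) in simp)
qed

lemma bounded_weak_gradient_smooth:
  fixes p :: "real^'d \<Rightarrow> real"
  assumes "bounded D" "open D" "smooth p"
  shows "bounded_weak_gradient D p (gradient p)"
proof -
  obtain B where B: "B > 0" "\<And>x. x \<in> D \<Longrightarrow> \<bar>p x\<bar> \<le> B" "\<And>x. x \<in> D \<Longrightarrow> norm (gradient p x) \<le> B"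
    using smooth_bounded_on[OF assms(1,3)] by blast
  show ?thesis
    by (rule bounded_weak_gradientI[OF weak_gradient_smooth measurable_smooth B(2,3)]) (use assms in auto)
qed

lemma bounded_weak_gradient_trunc:
  fixes p :: "real^'d \<Rightarrow> real"
  assumes "bounded D" "open D" "smooth p" "a > 0"
  shows "bounded_weak_gradient D (\<lambda>x. trunc a (p x)) (\<lambda>x. trunc' a (p x) *\<^sub>R gradient p x)"
proof -
  obtain B where B: "B > 0" "\<And>x. x \<in> D \<Longrightarrow> \<bar>p x\<bar> \<le> B" "\<And>x. x \<in> D \<Longrightarrow> norm (gradient p x) \<le> B"
    using smooth_bounded_on[OF assms(1,3)] by blast
  have der: "((\<lambda>x. trunc a (p x)) has_derivative (\<lambda>h. (trunc' a (p x) *\<^sub>R gradient p x) \<bullet> h)) (at x)" for x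
    using has_derivative_compose[OF has_derivative_gradient[OF smooth_differentiable[OF assms(3)]]
        DERIV_trunc[OF assms(4), unfolded has_field_derivative_def], of x] by simp
  have cont: "continuous_on S (\<lambda>x. trunc' a (p x) *\<^sub>R gradient p x)" for S
    unfolding trunc'_def using assms(4)
    by (intro continuous_intros smooth_continuous continuous_on_gradient assms(3)) auto
  have cont': "continuous_on S (\<lambda>x. trunc a (p x))" for S
    by (rule has_derivative_continuous_on[OF has_derivative_at_withinI[OF der]])
  show ?thesis
  proof (rule bounded_weak_gradientI[where B=B and B'=B])
    show "is_weak_gradient D (\<lambda>x. trunc a (p x)) (\<lambda>x. trunc' a (p x) *\<^sub>R gradient p x)"
      by (intro weak_gradient_C1 assms der cont)
    show "\<bar>trunc a (p x)\<bar> \<le> B" if "x \<in> D" for x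
      using trunc_abs_le[OF assms(4), of "p x"] B(2)[OF that] by linarith
    show "norm (trunc' a (p x) *\<^sub>R gradient p x) \<le> B" if "x \<in> D" for x
    proof -
      have "\<bar>trunc' a (p x)\<bar> * norm (gradient p x) \<le> 1 * B"
        using trunc'_bounds[OF assms(4), of "p x"] B(3)[OF that] by (intro mult_mono) auto
      then show ?thesis by simp
    qed
  qed (intro measurable_restrict_space1 borel_measurable_lebesgue_continuous cont cont')+
qed

subsection \<open>The Caccioppoli identity\<close>

lemma measurable_extend_by_zero:
  fixes h :: "real^'d \<Rightarrow> 'b::euclidean_space"
  assumes "open D'" "h \<in> borel_measurable (lebesgue_on D')"
  shows "(\<lambda>x. if x \<in> D' then h x else 0) \<in> borel_measurable (lebesgue_on D)"
  using borel_measurable_if_I[OF assms(2) open_sets_lebesgue[OF assms(1)]]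
  by (rule measurable_restrict_space1)

lemma L2_extend_by_zero:
  fixes h :: "real^'d \<Rightarrow> 'b::euclidean_space"
  assumes "open D" "open D'" "D' \<subseteq> D" "h \<in> L2 D'"
  shows "(\<lambda>x. if x \<in> D' then h x else 0) \<in> L2 D"
proof -
  have "integrable (lebesgue_on D') (\<lambda>x. (norm (if x \<in> D' then h x else 0))\<^sup>2)"
    using L2_D(2)[OF assms(4)] by (subst Bochner_Integration.integrable_cong[where g="\<lambda>x. (norm (h x))\<^sup>2"]) auto
  then have "integrable (lebesgue_on D) (\<lambda>x. (norm (if x \<in> D' then h x else 0))\<^sup>2)"
    by (rule integrable_lebesgue_on_support) (use assms in auto)
  then show ?thesis
    using measurable_extend_by_zero[OF assms(2) L2_D(1)[OF assms(4)]] by (simp add: L2_def)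
qed

text \<open>w and wg are given as limits on D' of functions smooth on the whole space. No derivative
  of w across the boundary of D' is ever formed, and boundary values can be imposed on the
  approximations pointwise.\<close>

locale H1_limit =
  fixes D D' :: "(real^'d) set" and w :: "real^'d \<Rightarrow> real" and wg :: "real^'d \<Rightarrow> real^'d"
    and p :: "nat \<Rightarrow> real^'d \<Rightarrow> real" and chi :: "real^'d \<Rightarrow> real" and c :: "real^'d \<Rightarrow> real^'d"
  assumes D: "open D" "bounded D" and D': "open D'" "D' \<subseteq> D"
    and w: "w \<in> L2 D'" "wg \<in> L2 D'"
    and p: "smooth (p n)"
    and lim: "(\<lambda>n. L2_norm D' (\<lambda>x. p n x - w x)) \<longlonglongrightarrow> 0"
      "(\<lambda>n. L2_norm D' (\<lambda>x. gradient (p n) x - wg x)) \<longlonglongrightarrow> 0"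
    and chi: "bounded_weak_gradient D chi c" "x \<in> D - D' \<Longrightarrow> chi x = 0"
begin

lemma D'_bounded: "bounded D'"
  using D(2) D'(2) bounded_subset by blast

lemma measurable:
  "chi \<in> borel_measurable (lebesgue_on D)" "c \<in> borel_measurable (lebesgue_on D)"
  "chi \<in> borel_measurable (lebesgue_on D')" "c \<in> borel_measurable (lebesgue_on D')"
  "w \<in> borel_measurable (lebesgue_on D')" "wg \<in> borel_measurable (lebesgue_on D')"
  "p n \<in> borel_measurable (lebesgue_on S)" "gradient (p n) \<in> borel_measurable (lebesgue_on S)"
proof -
  show "chi \<in> borel_measurable (lebesgue_on D)" "c \<in> borel_measurable (lebesgue_on D)"
    using chi(1) by (auto simp: bounded_weak_gradient_def)
  then show "chi \<in> borel_measurable (lebesgue_on D')" "c \<in> borel_measurable (lebesgue_on D')"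
    using D'(2) by (auto intro: measurable_lebesgue_on_subset)
qed (use w p in \<open>auto simp: L2_def intro: measurable_smooth\<close>)

lemma p_L2: "p n \<in> L2 D'" "gradient (p n) \<in> L2 D'"
  using smooth_L2[OF D'_bounded D'(1) p] by auto

lemma bound:
  obtains C where "C > 0" "\<And>x. x \<in> D \<Longrightarrow> \<bar>chi x\<bar> \<le> C" "\<And>x. x \<in> D \<Longrightarrow> norm (c x) \<le> C"
  using chi(1) by (rule bounded_weak_gradientE) blast

text \<open>Every \<open>chi * p n\<close> is weakly differentiable on all of D since
  \<open>p n\<close> is smooth everywhere; the limit on D' transfers this to \<open>chi * w\<close>,
  extended by zero because chi vanishes off D'.\<close>

lemma product:
  shows "is_weak_gradient D (\<lambda>x. chi x * w x) (\<lambda>x. if x \<in> D' then chi x *\<^sub>R wg x + w x *\<^sub>R c x else 0)"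
    and "(\<lambda>x. chi x * w x) \<in> L2 D"
    and "(\<lambda>x. if x \<in> D' then chi x *\<^sub>R wg x + w x *\<^sub>R c x else 0) \<in> L2 D"
proof -
  obtain C where C: "C > 0" "\<And>x. x \<in> D \<Longrightarrow> \<bar>chi x\<bar> \<le> C" "\<And>x. x \<in> D \<Longrightarrow> norm (c x) \<le> C"
    using bound by blast
  have CD': "\<bar>chi x\<bar> \<le> C" "norm (c x) \<le> C" if "x \<in> D'" for x
    using C D'(2) that by auto
  note [measurable] = measurable
  have L1: "(\<lambda>x. chi x * w x) \<in> L2 D'"
    by (rule L2_bounded_by[OF w(1), where B=C]) (use CD' in \<open>auto simp: abs_mult intro!: AE_I2 mult_right_mono\<close>)
  have L2: "(\<lambda>x. chi x *\<^sub>R wg x + w x *\<^sub>R c x) \<in> L2 D'"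
  proof (rule L2_add)
    show "(\<lambda>x. chi x *\<^sub>R wg x) \<in> L2 D'"
      by (rule L2_bounded_by[OF w(2), where B=C]) (use CD' in \<open>auto intro!: AE_I2 mult_right_mono\<close>)
    show "(\<lambda>x. w x *\<^sub>R c x) \<in> L2 D'"
    proof (rule L2_bounded_by[OF w(1), where B=C])
      show "AE x in lebesgue_on D'. norm (w x *\<^sub>R c x) \<le> C * norm (w x)"
        using CD' by (intro AE_I2) (auto simp: mult.commute[of C] intro!: mult_left_mono)
    qed measurable
  qed
  show Lg: "(\<lambda>x. if x \<in> D' then chi x *\<^sub>R wg x + w x *\<^sub>R c x else 0) \<in> L2 D"
    by (rule L2_extend_by_zero[OF D(1) D' L2])
  have Lw: "(\<lambda>x. if x \<in> D' then chi x * w x else 0) \<in> L2 D"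
    by (rule L2_extend_by_zero[OF D(1) D' L1])
  have m: "(\<lambda>x. chi x * w x) \<in> borel_measurable (lebesgue_on D)"
    using L2_D(1)[OF Lw] chi(2) by (subst measurable_lebesgue_cong[where g="\<lambda>x. if x \<in> D' then chi x * w x else 0"]) simp_all
  show Lw': "(\<lambda>x. chi x * w x) \<in> L2 D"
    by (rule L2_cong_AE[OF _ Lw m], rule AE_I2) (simp add: chi(2))
  show "is_weak_gradient D (\<lambda>x. chi x * w x) (\<lambda>x. if x \<in> D' then chi x *\<^sub>R wg x + w x *\<^sub>R c x else 0)"
  proof (rule weak_gradient_limit[OF D(1)])
    show "is_weak_gradient D (\<lambda>x. chi x * p n x) (\<lambda>x. chi x *\<^sub>R gradient (p n) x + p n x *\<^sub>R c x)" for n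
      using bounded_weak_gradient_mult[OF D chi(1) bounded_weak_gradient_smooth[OF D(2,1) p]]
      by (simp add: bounded_weak_gradient_def)
    show "locally_integrable D (\<lambda>x. chi x * w x)"
      "locally_integrable D (\<lambda>x. if x \<in> D' then chi x *\<^sub>R wg x + w x *\<^sub>R c x else 0)"
      using D Lw' Lg by (auto intro!: locally_integrableI L2_imp_integrable)
  next
    fix i \<theta> assume \<theta>: "test_function D \<theta>"
    obtain T where T: "T > 0" "\<And>x. \<bar>\<theta> x\<bar> \<le> T" "\<And>x i. \<bar>partial_deriv i \<theta> x\<bar> \<le> T"
      using \<theta> by (rule test_function_bounded) blast
    have sm: "smooth \<theta>" using \<theta> by (simp add: test_function_def)
    have [measurable]: "\<theta> \<in> borel_measurable (lebesgue_on S)" "partial_deriv i \<theta> \<in> borel_measurable (lebesgue_on S)" for S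
      by (intro measurable_restrict_space1 borel_measurable_lebesgue_continuous smooth_continuous smooth_partial_deriv sm)+
    have bl: "h \<in> L2 D'" if "h \<in> borel_measurable (lebesgue_on D')" "\<And>x. x \<in> D' \<Longrightarrow> \<bar>h x\<bar> \<le> b" for h :: "real^'d \<Rightarrow> real" and b
      by (rule bounded_L2[OF D'_bounded open_sets_lebesgue[OF D'(1)] that(1), of b], rule AE_I2) (use that(2) in simp)
    have restrict: "(LINT x|lebesgue_on D. h x) = (LINT x|lebesgue_on D'. h x)" if "\<And>x. x \<in> D - D' \<Longrightarrow> h x = 0" for h :: "real^'d \<Rightarrow> real"
      by (rule integral_lebesgue_on_support[OF D'(2)]) (use D(1) D'(1) that in auto)
    have lin: "(\<lambda>n. LINT x|lebesgue_on D'. p n x * h x) \<longlonglongrightarrow> (LINT x|lebesgue_on D'. w x * h x)" if h: "h \<in> L2 D'" for h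
    proof (rule L2_norm_tendsto_imp_integral[OF p_L2(1) w(1) h lim(1), of "\<lambda>a b x. a * b" 1])
      show "(\<lambda>x. k x * h x) \<in> borel_measurable (lebesgue_on D')" if "k \<in> L2 D'" for k
        by (intro borel_measurable_times L2_D(1) that h)
    qed (auto simp: abs_mult left_diff_distrib)
    have g1: "(\<lambda>x. chi x * partial_deriv i \<theta> x) \<in> L2 D'"
      by (rule bl[where b="C * T"]) (use CD' T C in \<open>auto simp: abs_mult intro!: mult_mono\<close>)
    have r: "(LINT x|lebesgue_on D. chi x * k x * partial_deriv i \<theta> x) = (LINT x|lebesgue_on D'. k x * (chi x * partial_deriv i \<theta> x))" for k
    proof -
      have "(LINT x|lebesgue_on D. chi x * k x * partial_deriv i \<theta> x) = (LINT x|lebesgue_on D'. chi x * k x * partial_deriv i \<theta> x)"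
        by (rule restrict) (simp add: chi(2))
      then show ?thesis by (simp only: mult_ac)
    qed
    have "(\<lambda>n. LINT x|lebesgue_on D'. p n x * (chi x * partial_deriv i \<theta> x)) \<longlonglongrightarrow> (LINT x|lebesgue_on D'. w x * (chi x * partial_deriv i \<theta> x))"
      by (rule lin[OF g1])
    then show "(\<lambda>n. LINT x|lebesgue_on D. chi x * p n x * partial_deriv i \<theta> x) \<longlonglongrightarrow> (LINT x|lebesgue_on D. chi x * w x * partial_deriv i \<theta> x)"
      unfolding r .
    have g2: "(\<lambda>x. chi x * \<theta> x) \<in> L2 D'"
      by (rule bl[where b="C * T"]) (use CD' T C in \<open>auto simp: abs_mult intro!: mult_mono\<close>)
    have [measurable]: "(\<lambda>x. c x $ i) \<in> borel_measurable (lebesgue_on D')" "(\<lambda>x. c x $ i) \<in> borel_measurable (lebesgue_on D)"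
      by (intro borel_measurable_vec_nth; measurable)+
    have g3: "(\<lambda>x. c x $ i * \<theta> x) \<in> L2 D'"
    proof (rule bl[where b="C * T"])
      show "\<bar>c x $ i * \<theta> x\<bar> \<le> C * T" if "x \<in> D'" for x
        unfolding abs_mult using CD'(2)[OF that] component_le_norm_cart[of "c x" i] T C(1) by (intro mult_mono) auto
    qed measurable
    have l2: "(\<lambda>n. LINT x|lebesgue_on D'. gradient (p n) x $ i * (chi x * \<theta> x)) \<longlonglongrightarrow> (LINT x|lebesgue_on D'. wg x $ i * (chi x * \<theta> x))"
    proof (rule L2_norm_tendsto_imp_integral[OF p_L2(2) w(2) g2 lim(2), of "\<lambda>a b x. a $ i * b" 1])
      show "(\<lambda>x. k x $ i * (chi x * \<theta> x)) \<in> borel_measurable (lebesgue_on D')" if "k \<in> L2 D'" for k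
        by (intro borel_measurable_times borel_measurable_vec_nth L2_D(1)[OF that]) measurable
      show "AE x in lebesgue_on D'. \<forall>a b. \<bar>a $ i * b\<bar> \<le> 1 * (norm a * norm b)"
        by (intro AE_I2) (auto simp: abs_mult component_le_norm_cart intro!: mult_right_mono)
    qed (auto simp: left_diff_distrib)
    have l3: "(\<lambda>n. LINT x|lebesgue_on D'. p n x * (c x $ i * \<theta> x)) \<longlonglongrightarrow> (LINT x|lebesgue_on D'. w x * (c x $ i * \<theta> x))"
      by (rule lin[OF g3])
    have I: "integrable (lebesgue_on D') (\<lambda>x. k x $ i * (chi x * \<theta> x))" if "k \<in> L2 D'" for k
      by (rule integrable_mult_L2[OF that g2, where B=1])
         (use L2_D(1)[OF that] in \<open>auto simp: abs_mult component_le_norm_cart intro!: borel_measurable_times borel_measurable_vec_nth AE_I2 mult_right_mono\<close>)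
    have I': "integrable (lebesgue_on D') (\<lambda>x. k x * (c x $ i * \<theta> x))" if "k \<in> L2 D'" for k
      by (rule integrable_mult_L2[OF that g3, where B=1])
         (use L2_D(1)[OF that] in \<open>auto simp: abs_mult\<close>)
    have left: "(LINT x|lebesgue_on D. (chi x *\<^sub>R gradient (p n) x + p n x *\<^sub>R c x) $ i * \<theta> x)
        = (LINT x|lebesgue_on D'. gradient (p n) x $ i * (chi x * \<theta> x)) + (LINT x|lebesgue_on D'. p n x * (c x $ i * \<theta> x))" for n
    proof -
      let ?h = "\<lambda>x. (chi x *\<^sub>R gradient (p n) x + p n x *\<^sub>R c x) $ i * \<theta> x"
      \<comment> \<open>Off D' both chi and, almost everywhere, its gradient c are 0, so the product
        rule on D reduces to an integral over D'.\<close>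
      have "(LINT x|lebesgue_on D. ?h x) = (LINT x|lebesgue_on D. (if x \<in> D' then ?h x else 0))"
      proof (rule integral_cong_AE)
        show "AE x in lebesgue_on D. ?h x = (if x \<in> D' then ?h x else 0)"
          using weak_gradient_zero_on_zero_set[OF D chi(1)] AE_space
        proof eventually_elim
          case (elim x)
          then show ?case using chi(2)[of x] by auto
        qed
        show "?h \<in> borel_measurable (lebesgue_on D)"
          by (intro borel_measurable_times borel_measurable_vec_nth; measurable)
        show "(\<lambda>x. if x \<in> D' then ?h x else 0) \<in> borel_measurable (lebesgue_on D)"
          by (intro measurable_extend_by_zero D'(1) borel_measurable_times borel_measurable_vec_nth; measurable)
      qed
      also have "\<dots> = (LINT x|lebesgue_on D'. ?h x)"
        by (rule Lebesgue_Measure.integral_restrict[OF D'(2)]) (use D(1) D'(1) in auto)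
      also have "\<dots> = (LINT x|lebesgue_on D'. gradient (p n) x $ i * (chi x * \<theta> x) + p n x * (c x $ i * \<theta> x))"
        by (simp add: algebra_simps)
      also have "\<dots> = (LINT x|lebesgue_on D'. gradient (p n) x $ i * (chi x * \<theta> x)) + (LINT x|lebesgue_on D'. p n x * (c x $ i * \<theta> x))"
        by (rule Bochner_Integration.integral_add[OF I[OF p_L2(2)] I'[OF p_L2(1)]])
      finally show ?thesis .
    qed
    have right: "(LINT x|lebesgue_on D. (if x \<in> D' then chi x *\<^sub>R wg x + w x *\<^sub>R c x else 0) $ i * \<theta> x)
        = (LINT x|lebesgue_on D'. wg x $ i * (chi x * \<theta> x)) + (LINT x|lebesgue_on D'. w x * (c x $ i * \<theta> x))"
    proof -
      have "(LINT x|lebesgue_on D. (if x \<in> D' then chi x *\<^sub>R wg x + w x *\<^sub>R c x else 0) $ i * \<theta> x)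
          = (LINT x|lebesgue_on D'. (if x \<in> D' then chi x *\<^sub>R wg x + w x *\<^sub>R c x else 0) $ i * \<theta> x)"
        by (rule restrict) simp
      also have "\<dots> = (LINT x|lebesgue_on D'. wg x $ i * (chi x * \<theta> x) + w x * (c x $ i * \<theta> x))"
        by (intro Bochner_Integration.integral_cong) (auto simp: algebra_simps)
      also have "\<dots> = (LINT x|lebesgue_on D'. wg x $ i * (chi x * \<theta> x)) + (LINT x|lebesgue_on D'. w x * (c x $ i * \<theta> x))"
        by (rule Bochner_Integration.integral_add[OF I[OF w(2)] I'[OF w(1)]])
      finally show ?thesis .
    qed
    show "(\<lambda>n. LINT x|lebesgue_on D. (chi x *\<^sub>R gradient (p n) x + p n x *\<^sub>R c x) $ i * \<theta> x)
        \<longlonglongrightarrow> (LINT x|lebesgue_on D. (if x \<in> D' then chi x *\<^sub>R wg x + w x *\<^sub>R c x else 0) $ i * \<theta> x)"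
      unfolding left right by (intro tendsto_add l2 l3)
  qed
qed

text \<open>The test function is \<open>\<chi>\<^sup>2\<close> times a truncation of a smooth approximation of \<open>w\<close>: the truncation
  keeps its support away from the boundary of \<open>D\<close>.\<close>

lemma Caccioppoli_identity:
  fixes F :: "real^'d \<Rightarrow> real^'d"
  assumes F: "F \<in> L2 D'"
    and p0: "\<And>n x. x \<in> frontier D' \<inter> frontier D \<Longrightarrow> p n x = 0"
    and E: "\<And>v g K. bounded_weak_gradient D v g \<Longrightarrow> compact K \<Longrightarrow> K \<subseteq> D \<Longrightarrow> (\<And>x. x \<in> D - K \<Longrightarrow> v x = 0) \<Longrightarrow>
        (\<And>x. x \<in> D - D' \<Longrightarrow> v x = 0) \<Longrightarrow>
        (LINT x|lebesgue_on D'. F x \<bullet> g x) + (LINT x|lebesgue_on D'. w x * v x) = 0"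
  shows "(LINT x|lebesgue_on D'. F x \<bullet> ((chi x)\<^sup>2 *\<^sub>R wg x)) + (LINT x|lebesgue_on D'. F x \<bullet> ((2 * chi x * w x) *\<^sub>R c x))
    + (LINT x|lebesgue_on D'. w x * ((chi x)\<^sup>2 * w x)) = 0"
proof -
  obtain C where C: "C > 0" "\<And>x. x \<in> D \<Longrightarrow> \<bar>chi x\<bar> \<le> C" "\<And>x. x \<in> D \<Longrightarrow> norm (c x) \<le> C"
    using bound by blast
  have CD': "\<bar>chi x\<bar> \<le> C" "norm (c x) \<le> C" if "x \<in> D'" for x
    using C D'(2) that by auto
  note [measurable] = measurable
  have [measurable]: "F \<in> borel_measurable (lebesgue_on D')" by (rule L2_D(1)[OF F])
  have chi2: "\<bar>(chi x)\<^sup>2 * t\<bar> \<le> C\<^sup>2 * \<bar>t\<bar>" if "x \<in> D'" for x t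
    unfolding abs_mult using power_mono[OF CD'(1)[OF that], of 2] by (intro mult_right_mono) auto
  have chic: "norm ((2 * chi x * t) *\<^sub>R c x) \<le> 2 * C\<^sup>2 * \<bar>t\<bar>" if "x \<in> D'" for x t
  proof -
    have "\<bar>chi x\<bar> * norm (c x) \<le> C * C"
      using CD'[OF that] C(1) by (intro mult_mono) auto
    then have "2 * \<bar>t\<bar> * (\<bar>chi x\<bar> * norm (c x)) \<le> 2 * \<bar>t\<bar> * (C * C)"
      by (intro mult_left_mono) auto
    then show ?thesis by (simp add: abs_mult power2_eq_square mult_ac)
  qed
  have I1: "integrable (lebesgue_on D') (\<lambda>x. F x \<bullet> ((chi x)\<^sup>2 *\<^sub>R k x))" if "k \<in> L2 D'" for k
  proof (rule integrable_mult_L2[OF F that, where B="C\<^sup>2"])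
    show "AE x in lebesgue_on D'. \<bar>F x \<bullet> ((chi x)\<^sup>2 *\<^sub>R k x)\<bar> \<le> C\<^sup>2 * (norm (F x) * norm (k x))"
    proof (rule AE_I2)
      fix x assume "x \<in> space (lebesgue_on D')"
      then have "\<bar>(chi x)\<^sup>2 * (F x \<bullet> k x)\<bar> \<le> C\<^sup>2 * \<bar>F x \<bullet> k x\<bar>" by (intro chi2) simp
      also have "\<dots> \<le> C\<^sup>2 * (norm (F x) * norm (k x))" by (intro mult_left_mono Cauchy_Schwarz_ineq2) simp
      finally show "\<bar>F x \<bullet> ((chi x)\<^sup>2 *\<^sub>R k x)\<bar> \<le> C\<^sup>2 * (norm (F x) * norm (k x))" by simp
    qed
    have [measurable]: "k \<in> borel_measurable (lebesgue_on D')" by (rule L2_D(1)[OF that])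
    show "(\<lambda>x. F x \<bullet> ((chi x)\<^sup>2 *\<^sub>R k x)) \<in> borel_measurable (lebesgue_on D')" by measurable
  qed
  have B2: "\<bar>F x \<bullet> ((2 * chi x * t) *\<^sub>R c x)\<bar> \<le> 2 * C\<^sup>2 * (norm (F x) * norm t)" if "x \<in> D'" for x t
  proof -
    have "\<bar>F x \<bullet> ((2 * chi x * t) *\<^sub>R c x)\<bar> \<le> norm (F x) * norm ((2 * chi x * t) *\<^sub>R c x)"
      by (rule Cauchy_Schwarz_ineq2)
    also have "\<dots> \<le> norm (F x) * (2 * C\<^sup>2 * \<bar>t\<bar>)"
      by (intro mult_left_mono chic that) simp
    finally show ?thesis by (simp add: mult_ac)
  qed
  have I2: "integrable (lebesgue_on D') (\<lambda>x. F x \<bullet> ((2 * chi x * k x) *\<^sub>R c x))" if "k \<in> L2 D'" for k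
  proof (rule integrable_mult_L2[OF F that, where B="2 * C\<^sup>2"])
    show "AE x in lebesgue_on D'. \<bar>F x \<bullet> ((2 * chi x * k x) *\<^sub>R c x)\<bar> \<le> 2 * C\<^sup>2 * (norm (F x) * norm (k x))"
      by (intro AE_I2 B2) simp
    have [measurable]: "k \<in> borel_measurable (lebesgue_on D')" by (rule L2_D(1)[OF that])
    show "(\<lambda>x. F x \<bullet> ((2 * chi x * k x) *\<^sub>R c x)) \<in> borel_measurable (lebesgue_on D')" by measurable
  qed
  have step1: "(LINT x|lebesgue_on D'. F x \<bullet> ((chi x)\<^sup>2 *\<^sub>R (trunc' a (p n x) *\<^sub>R gradient (p n) x)) + F x \<bullet> ((2 * chi x * trunc a (p n x)) *\<^sub>R c x))
      + (LINT x|lebesgue_on D'. w x * ((chi x)\<^sup>2 * trunc a (p n x))) = 0" if a: "a > 0" for a n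
  proof -
    \<comment> \<open>Off this set either chi or the truncation is 0, so the test function is
      supported in it.\<close>
    let ?K = "{x \<in> closure D'. a \<le> \<bar>p n x\<bar>}"
    have "closed (closure D' \<inter> {x. a \<le> \<bar>p n x\<bar>})"
      by (intro closed_Int closed_closure closed_Collect_le continuous_intros smooth_continuous p)
    moreover have "closure D' \<inter> {x. a \<le> \<bar>p n x\<bar>} = ?K" by blast
    moreover have "bounded ?K"
      using bounded_closure[OF D'_bounded] by (rule bounded_subset) auto
    ultimately have K: "compact ?K" by (simp add: compact_eq_bounded_closed)
    \<comment> \<open>A point of the closure of D' outside D lies on both frontiers, where
      \<open>p n\<close> is 0, contradicting \<open>a \<le> \<bar>p n x\<bar>\<close>. This is where
      the boundary condition does its work.\<close>
    have KD: "?K \<subseteq> D"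
    proof
      fix x assume x: "x \<in> ?K"
      show "x \<in> D"
      proof (rule ccontr)
        assume "x \<notin> D"
        moreover have "x \<in> closure D" using x D'(2) closure_mono by blast
        ultimately have "x \<in> frontier D" using D(1) by (simp add: frontier_def interior_open)
        moreover have "x \<in> frontier D'"
          using x \<open>x \<notin> D\<close> D' by (auto simp: frontier_def interior_open)
        ultimately have "p n x = 0" using p0 by blast
        then show False using x a by simp
      qed
    qed
    let ?v = "\<lambda>x. trunc a (p n x) * (chi x * chi x)"
    let ?g = "\<lambda>x. trunc a (p n x) *\<^sub>R (chi x *\<^sub>R c x + chi x *\<^sub>R c x) + (chi x * chi x) *\<^sub>R (trunc' a (p n x) *\<^sub>R gradient (p n) x)"
    have "bounded_weak_gradient D ?v ?g"
      by (intro bounded_weak_gradient_mult bounded_weak_gradient_trunc D p a chi)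
    moreover have "?v x = 0" if "x \<in> D - ?K" for x
    proof (cases "x \<in> D'")
      case True
      then have "\<bar>p n x\<bar> \<le> a" using that closure_subset[of D'] by auto
      then show ?thesis by (simp add: trunc_def)
    next
      case False
      then show ?thesis using chi(2)[of x] that by simp
    qed
    moreover have "?v x = 0" if "x \<in> D - D'" for x
      using chi(2)[OF that] by simp
    ultimately have "(LINT x|lebesgue_on D'. F x \<bullet> ?g x) + (LINT x|lebesgue_on D'. w x * ?v x) = 0"
      by (intro E[OF _ K KD])
    moreover have "F x \<bullet> ?g x = F x \<bullet> ((chi x)\<^sup>2 *\<^sub>R (trunc' a (p n x) *\<^sub>R gradient (p n) x)) + F x \<bullet> ((2 * chi x * trunc a (p n x)) *\<^sub>R c x)" for x
    proof -
      have "chi x *\<^sub>R c x + chi x *\<^sub>R c x = (2 * chi x) *\<^sub>R c x"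
        by (simp flip: scaleR_add_left)
      then show ?thesis
        by (simp only: inner_add_right inner_scaleR_right power2_eq_square) (simp only: mult_ac add_ac)
    qed
    moreover have "w x * ?v x = w x * ((chi x)\<^sup>2 * trunc a (p n x))" for x
      by (simp add: power2_eq_square)
    ultimately show ?thesis by (simp only:)
  qed
  \<comment> \<open>Here the threshold tends to 0 for fixed n, by dominated convergence; only
    afterwards does n tend to infinity, by L2 convergence.\<close>
  have step2: "(LINT x|lebesgue_on D'. F x \<bullet> ((chi x)\<^sup>2 *\<^sub>R gradient (p n) x)) + (LINT x|lebesgue_on D'. F x \<bullet> ((2 * chi x * p n x) *\<^sub>R c x))
      + (LINT x|lebesgue_on D'. w x * ((chi x)\<^sup>2 * p n x)) = 0" for n
  proof -
    let ?a = "\<lambda>m. inverse (real (Suc m))"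
    have a: "?a m > 0" for m by simp
    obtain B where B: "B > 0" "\<And>x. x \<in> D' \<Longrightarrow> \<bar>p n x\<bar> \<le> B" "\<And>x. x \<in> D' \<Longrightarrow> norm (gradient (p n) x) \<le> B"
      using smooth_bounded_on[OF D'_bounded p] by blast
    have tm [measurable]: "(\<lambda>x. trunc (?a m) (p n x)) \<in> borel_measurable (lebesgue_on D')"
        "(\<lambda>x. trunc' (?a m) (p n x)) \<in> borel_measurable (lebesgue_on D')" for m
      unfolding trunc_def trunc'_def by measurable
    have tb: "\<bar>trunc (?a m) (p n x)\<bar> \<le> B" if "x \<in> D'" for x m
      using trunc_abs_le[OF a, of m "p n x"] B(2)[OF that] by linarith
    have tb': "norm (trunc' (?a m) (p n x) *\<^sub>R gradient (p n) x) \<le> B" if "x \<in> D'" for x m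
    proof -
      have "\<bar>trunc' (?a m) (p n x)\<bar> * norm (gradient (p n) x) \<le> 1 * B"
        using trunc'_bounds[OF a, of m "p n x"] B(3)[OF that] by (intro mult_mono) auto
      then show ?thesis by simp
    qed
    \<comment> \<open>On the zero set of \<open>p n\<close> the factors \<open>trunc'\<close> tend
      to 0 rather than 1, but there the gradient is 0 almost everywhere anyway.\<close>
    have "AE x in lebesgue_on D'. p n x = 0 \<longrightarrow> gradient (p n) x = 0"
      by (intro weak_gradient_zero_on_zero_set D' D'_bounded bounded_weak_gradient_smooth p)
    then have tl: "AE x in lebesgue_on D'. (\<lambda>m. trunc' (?a m) (p n x) *\<^sub>R gradient (p n) x) \<longlonglongrightarrow> gradient (p n) x"
    proof eventually_elim
      case (elim x)
      have "(\<lambda>m. trunc' (?a m) (p n x) *\<^sub>R gradient (p n) x) \<longlonglongrightarrow> (if p n x = 0 then 0 else 1) *\<^sub>R gradient (p n) x"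
        by (intro tendsto_scaleR tendsto_const trunc'_tendsto)
      with elim show ?case by (auto split: if_splits)
    qed
    have Fi: "integrable (lebesgue_on D') (\<lambda>x. norm (F x))" and wi: "integrable (lebesgue_on D') (\<lambda>x. \<bar>w x\<bar>)"
      using L2_imp_integrable[OF D'_bounded open_sets_lebesgue[OF D'(1)]] F w(1) by auto
    have "(\<lambda>m. LINT x|lebesgue_on D'. F x \<bullet> ((chi x)\<^sup>2 *\<^sub>R (trunc' (?a m) (p n x) *\<^sub>R gradient (p n) x)) + F x \<bullet> ((2 * chi x * trunc (?a m) (p n x)) *\<^sub>R c x))
        \<longlonglongrightarrow> (LINT x|lebesgue_on D'. F x \<bullet> ((chi x)\<^sup>2 *\<^sub>R gradient (p n) x) + F x \<bullet> ((2 * chi x * p n x) *\<^sub>R c x))"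
    \<comment> \<open>The gradient term contributes one multiple of \<open>C\<^sup>2 * B\<close>,
      the term with the factor \<open>2 * chi x\<close> two.\<close>
    proof (rule integral_dominated_convergence[where w="\<lambda>x. (3 * C\<^sup>2 * B) * norm (F x)"])
      show "AE x in lebesgue_on D'. (\<lambda>m. F x \<bullet> ((chi x)\<^sup>2 *\<^sub>R (trunc' (?a m) (p n x) *\<^sub>R gradient (p n) x)) + F x \<bullet> ((2 * chi x * trunc (?a m) (p n x)) *\<^sub>R c x))
          \<longlonglongrightarrow> F x \<bullet> ((chi x)\<^sup>2 *\<^sub>R gradient (p n) x) + F x \<bullet> ((2 * chi x * p n x) *\<^sub>R c x)"
        using tl
      proof eventually_elim
        case (elim x)
        show ?case
          by (intro tendsto_add tendsto_inner tendsto_scaleR tendsto_mult tendsto_const elim trunc_tendsto)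
      qed
      show "AE x in lebesgue_on D'. norm (F x \<bullet> ((chi x)\<^sup>2 *\<^sub>R (trunc' (?a m) (p n x) *\<^sub>R gradient (p n) x)) + F x \<bullet> ((2 * chi x * trunc (?a m) (p n x)) *\<^sub>R c x))
          \<le> (3 * C\<^sup>2 * B) * norm (F x)" for m
      proof (rule AE_I2)
        fix x assume "x \<in> space (lebesgue_on D')"
        then have x: "x \<in> D'" by simp
        let ?G = "trunc' (?a m) (p n x) *\<^sub>R gradient (p n) x"
        have "\<bar>F x \<bullet> ((chi x)\<^sup>2 *\<^sub>R ?G)\<bar> \<le> C\<^sup>2 * \<bar>F x \<bullet> ?G\<bar>"
          using chi2[OF x, of "F x \<bullet> ?G"] by (simp only: inner_scaleR_right)
        also have "\<dots> \<le> C\<^sup>2 * (norm (F x) * B)"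
          by (intro mult_left_mono order_trans[OF Cauchy_Schwarz_ineq2] tb'[OF x]) auto
        finally have 1: "\<bar>F x \<bullet> ((chi x)\<^sup>2 *\<^sub>R ?G)\<bar> \<le> C\<^sup>2 * (norm (F x) * B)" .
        have "\<bar>F x \<bullet> ((2 * chi x * trunc (?a m) (p n x)) *\<^sub>R c x)\<bar> \<le> 2 * C\<^sup>2 * (norm (F x) * norm (trunc (?a m) (p n x)))"
          by (rule B2[OF x])
        also have "\<dots> \<le> 2 * C\<^sup>2 * (norm (F x) * B)"
          using tb[OF x, of m] by (intro mult_left_mono) auto
        finally show "norm (F x \<bullet> ((chi x)\<^sup>2 *\<^sub>R ?G) + F x \<bullet> ((2 * chi x * trunc (?a m) (p n x)) *\<^sub>R c x)) \<le> (3 * C\<^sup>2 * B) * norm (F x)"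
          using 1 by (simp add: mult_ac)
      qed
      show "integrable (lebesgue_on D') (\<lambda>x. (3 * C\<^sup>2 * B) * norm (F x))"
        using Fi by simp
    qed measurable
    moreover have "(\<lambda>m. LINT x|lebesgue_on D'. w x * ((chi x)\<^sup>2 * trunc (?a m) (p n x))) \<longlonglongrightarrow> (LINT x|lebesgue_on D'. w x * ((chi x)\<^sup>2 * p n x))"
    proof (rule integral_dominated_convergence[where w="\<lambda>x. (C\<^sup>2 * B) * \<bar>w x\<bar>"])
      show "AE x in lebesgue_on D'. (\<lambda>m. w x * ((chi x)\<^sup>2 * trunc (?a m) (p n x))) \<longlonglongrightarrow> w x * ((chi x)\<^sup>2 * p n x)"
        by (intro AE_I2 tendsto_mult tendsto_const trunc_tendsto)
      show "AE x in lebesgue_on D'. norm (w x * ((chi x)\<^sup>2 * trunc (?a m) (p n x))) \<le> (C\<^sup>2 * B) * \<bar>w x\<bar>" for m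
      proof (rule AE_I2)
        fix x assume "x \<in> space (lebesgue_on D')"
        then have x: "x \<in> D'" by simp
        have "\<bar>(chi x)\<^sup>2 * trunc (?a m) (p n x)\<bar> \<le> C\<^sup>2 * B"
          by (rule order_trans[OF chi2[OF x]]) (intro mult_left_mono tb[OF x], simp)
        then have "\<bar>w x\<bar> * \<bar>(chi x)\<^sup>2 * trunc (?a m) (p n x)\<bar> \<le> \<bar>w x\<bar> * (C\<^sup>2 * B)"
          by (rule mult_left_mono) simp
        then show "norm (w x * ((chi x)\<^sup>2 * trunc (?a m) (p n x))) \<le> (C\<^sup>2 * B) * \<bar>w x\<bar>"
          by (simp only: real_norm_def abs_mult[of "w x"] mult.commute[of "\<bar>w x\<bar>"])
      qed
      show "integrable (lebesgue_on D') (\<lambda>x. (C\<^sup>2 * B) * \<bar>w x\<bar>)"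
        using wi by simp
    qed measurable
    ultimately have "(\<lambda>m. (LINT x|lebesgue_on D'. F x \<bullet> ((chi x)\<^sup>2 *\<^sub>R (trunc' (?a m) (p n x) *\<^sub>R gradient (p n) x)) + F x \<bullet> ((2 * chi x * trunc (?a m) (p n x)) *\<^sub>R c x))
          + (LINT x|lebesgue_on D'. w x * ((chi x)\<^sup>2 * trunc (?a m) (p n x))))
        \<longlonglongrightarrow> (LINT x|lebesgue_on D'. F x \<bullet> ((chi x)\<^sup>2 *\<^sub>R gradient (p n) x) + F x \<bullet> ((2 * chi x * p n x) *\<^sub>R c x))
          + (LINT x|lebesgue_on D'. w x * ((chi x)\<^sup>2 * p n x))"
      by (rule tendsto_add)
    then have "(LINT x|lebesgue_on D'. F x \<bullet> ((chi x)\<^sup>2 *\<^sub>R gradient (p n) x) + F x \<bullet> ((2 * chi x * p n x) *\<^sub>R c x))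
          + (LINT x|lebesgue_on D'. w x * ((chi x)\<^sup>2 * p n x)) = 0"
      unfolding step1[OF a] by (rule LIMSEQ_unique[OF _ tendsto_const])
    then show ?thesis
      using I1[OF p_L2(2)] I2[OF p_L2(1)] by (simp add: Bochner_Integration.integral_add)
  qed
  have "(\<lambda>n. LINT x|lebesgue_on D'. F x \<bullet> ((chi x)\<^sup>2 *\<^sub>R gradient (p n) x)) \<longlonglongrightarrow> (LINT x|lebesgue_on D'. F x \<bullet> ((chi x)\<^sup>2 *\<^sub>R wg x))"
  proof (rule L2_norm_tendsto_imp_integral[OF p_L2(2) w(2) F lim(2), of "\<lambda>a b x. b \<bullet> ((chi x)\<^sup>2 *\<^sub>R a)" "C\<^sup>2"])
    show "AE x in lebesgue_on D'. \<forall>(a::real^'d) b. \<bar>b \<bullet> ((chi x)\<^sup>2 *\<^sub>R a)\<bar> \<le> C\<^sup>2 * (norm a * norm b)"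
    proof (intro AE_I2 allI)
      fix x and a b :: "real^'d" assume "x \<in> space (lebesgue_on D')"
      then have "\<bar>(chi x)\<^sup>2 * (b \<bullet> a)\<bar> \<le> C\<^sup>2 * \<bar>b \<bullet> a\<bar>" by (intro chi2) simp
      also have "\<dots> \<le> C\<^sup>2 * (norm b * norm a)" by (intro mult_left_mono Cauchy_Schwarz_ineq2) simp
      finally show "\<bar>b \<bullet> ((chi x)\<^sup>2 *\<^sub>R a)\<bar> \<le> C\<^sup>2 * (norm a * norm b)" by (simp add: mult.commute)
    qed
  qed (use I1 in \<open>auto simp: inner_diff_right scaleR_diff_right\<close>)
  moreover have "(\<lambda>n. LINT x|lebesgue_on D'. F x \<bullet> ((2 * chi x * p n x) *\<^sub>R c x)) \<longlonglongrightarrow> (LINT x|lebesgue_on D'. F x \<bullet> ((2 * chi x * w x) *\<^sub>R c x))"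
  proof (rule L2_norm_tendsto_imp_integral[OF p_L2(1) w(1) F lim(1), of "\<lambda>a b x. b \<bullet> ((2 * chi x * a) *\<^sub>R c x)" "2 * C\<^sup>2"])
    show "AE x in lebesgue_on D'. \<forall>a b. \<bar>b \<bullet> ((2 * chi x * a) *\<^sub>R c x)\<bar> \<le> 2 * C\<^sup>2 * (norm a * norm b)"
    proof (intro AE_I2 allI)
      fix x a and b :: "real^'d" assume "x \<in> space (lebesgue_on D')"
      then have x: "x \<in> D'" by simp
      have "\<bar>b \<bullet> ((2 * chi x * a) *\<^sub>R c x)\<bar> \<le> norm b * norm ((2 * chi x * a) *\<^sub>R c x)"
        by (rule Cauchy_Schwarz_ineq2)
      also have "\<dots> \<le> norm b * (2 * C\<^sup>2 * \<bar>a\<bar>)"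
        by (intro mult_left_mono chic x) simp
      finally show "\<bar>b \<bullet> ((2 * chi x * a) *\<^sub>R c x)\<bar> \<le> 2 * C\<^sup>2 * (norm a * norm b)" by (simp add: mult_ac)
    qed
  qed (use I2 in \<open>auto simp: inner_diff_right scaleR_diff_left left_diff_distrib right_diff_distrib\<close>)
  moreover have "(\<lambda>n. LINT x|lebesgue_on D'. w x * ((chi x)\<^sup>2 * p n x)) \<longlonglongrightarrow> (LINT x|lebesgue_on D'. w x * ((chi x)\<^sup>2 * w x))"
  proof (rule L2_norm_tendsto_imp_integral[OF p_L2(1) w(1) w(1) lim(1), of "\<lambda>a b x. b * ((chi x)\<^sup>2 * a)" "C\<^sup>2"])
    show "AE x in lebesgue_on D'. \<forall>a b. \<bar>b * ((chi x)\<^sup>2 * a)\<bar> \<le> C\<^sup>2 * (norm a * norm b)"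
    proof (intro AE_I2 allI)
      fix x a b assume "x \<in> space (lebesgue_on D')"
      then have "\<bar>(chi x)\<^sup>2 * (b * a)\<bar> \<le> C\<^sup>2 * \<bar>b * a\<bar>" by (intro chi2) simp
      then show "\<bar>b * ((chi x)\<^sup>2 * a)\<bar> \<le> C\<^sup>2 * (norm a * norm b)" by (simp add: abs_mult mult_ac)
    qed
    show "(\<lambda>x. w x * ((chi x)\<^sup>2 * k x)) \<in> borel_measurable (lebesgue_on D')" if "k \<in> L2 D'" for k
      using L2_D(1)[OF that] by measurable
  qed (auto simp: algebra_simps)
  ultimately have "(\<lambda>n. (LINT x|lebesgue_on D'. F x \<bullet> ((chi x)\<^sup>2 *\<^sub>R gradient (p n) x)) + (LINT x|lebesgue_on D'. F x \<bullet> ((2 * chi x * p n x) *\<^sub>R c x))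
      + (LINT x|lebesgue_on D'. w x * ((chi x)\<^sup>2 * p n x)))
    \<longlonglongrightarrow> (LINT x|lebesgue_on D'. F x \<bullet> ((chi x)\<^sup>2 *\<^sub>R wg x)) + (LINT x|lebesgue_on D'. F x \<bullet> ((2 * chi x * w x) *\<^sub>R c x))
      + (LINT x|lebesgue_on D'. w x * ((chi x)\<^sup>2 * w x))"
    by (intro tendsto_add)
  then show ?thesis
    unfolding step2 by (rule LIMSEQ_unique[OF _ tendsto_const])
qed

end

subsection \<open>Elliptic coefficients\<close>

text \<open>Polarisation: for \<eta> in the direction of \<open>A *v \<xi>\<close> and of the length
  of \<xi>, four times \<open>(A *v \<xi>) \<bullet> \<eta>\<close> is at most the quadratic form at
  \<open>\<xi> + \<eta>\<close>, since the form at \<open>\<xi> - \<eta>\<close> is nonnegative;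
  that in turn is at most \<open>4 * M * (norm \<xi>)\<^sup>2\<close>.\<close>

lemma elliptic_norm_le:
  fixes A :: "real^'d^'d"
  assumes sym: "transpose A = A" and Q: "\<And>\<xi>. 0 \<le> (A *v \<xi>) \<bullet> \<xi>" "\<And>\<xi>. (A *v \<xi>) \<bullet> \<xi> \<le> M * (norm \<xi>)\<^sup>2"
  shows "norm (A *v \<xi>) \<le> M * norm \<xi>"
proof (cases "A *v \<xi> = 0 \<or> \<xi> = 0")
  case True
  have "0 \<le> M * norm \<xi>"
  proof (cases "\<xi> = 0")
    case False
    have "0 \<le> M * (norm \<xi>)\<^sup>2" using Q[of \<xi>] by linarith
    then have "0 \<le> M" using False by (simp add: zero_le_mult_iff)
    then show ?thesis by simp
  qed simp
  then show ?thesis using True by auto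
next
  case False
  define b where "b x y = (A *v x) \<bullet> y" for x y
  have bsym: "b x y = b y x" for x y
    unfolding b_def by (metis dot_lmul_matrix inner_commute sym transpose_matrix_vector)
  define \<eta> where "\<eta> = (norm \<xi> / norm (A *v \<xi>)) *\<^sub>R (A *v \<xi>)"
  have \<eta>: "norm \<eta> = norm \<xi>" using False by (simp add: \<eta>_def)
  have "b (\<xi> + \<eta>) (\<xi> + \<eta>) - b (\<xi> - \<eta>) (\<xi> - \<eta>) = 4 * b \<xi> \<eta>"
    using bsym[of \<eta> \<xi>] unfolding b_def
    by (simp add: matrix_vector_right_distrib matrix_vector_mult_diff_distrib inner_add_left inner_add_right inner_diff_left inner_diff_right)
  moreover have "b (\<xi> + \<eta>) (\<xi> + \<eta>) \<le> M * (norm (\<xi> + \<eta>))\<^sup>2" "0 \<le> b (\<xi> - \<eta>) (\<xi> - \<eta>)"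
    using Q by (auto simp: b_def)
  moreover have "M * (norm (\<xi> + \<eta>))\<^sup>2 \<le> M * (2 * norm \<xi>)\<^sup>2"
  proof (intro mult_left_mono power_mono)
    show "norm (\<xi> + \<eta>) \<le> 2 * norm \<xi>" using norm_triangle_ineq[of \<xi> \<eta>] \<eta> by simp
    have "0 \<le> M * (norm \<xi>)\<^sup>2" using Q[of \<xi>] by linarith
    then show "0 \<le> M" using False by (simp add: zero_le_mult_iff)
  qed simp
  ultimately have "b \<xi> \<eta> \<le> M * (norm \<xi>)\<^sup>2" by (simp add: power_mult_distrib)
  moreover have "b \<xi> \<eta> = norm \<xi> * norm (A *v \<xi>)"
    using False by (simp add: b_def \<eta>_def dot_square_norm power2_eq_square)
  ultimately have "norm \<xi> * norm (A *v \<xi>) \<le> norm \<xi> * (M * norm \<xi>)"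
    by (simp add: power2_eq_square mult_ac)
  then show ?thesis using False by simp
qed

lemma borel_measurable_vec_lambda:
  fixes f :: "'a \<Rightarrow> real^'d"
  assumes "\<And>i. (\<lambda>x. f x $ i) \<in> borel_measurable M"
  shows "f \<in> borel_measurable M"
  unfolding borel_measurable_euclidean_space[of f]
proof
  fix b :: "real^'d" assume "b \<in> Basis"
  then obtain i where "b = axis i 1" by (auto simp: Basis_vec_def)
  then show "(\<lambda>x. f x \<bullet> b) \<in> borel_measurable M"
    using assms[of i] by (simp add: inner_axis)
qed

locale elliptic =
  fixes \<Omega> :: "(real^'d) set" and A :: "real^'d \<Rightarrow> real^'d^'d" and amin amax :: real
  assumes Om: "open \<Omega>" "bounded \<Omega>" and amin_amax: "0 < amin" "amin < amax"
    and A: "elliptic_coefficient \<Omega> amin amax A"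
begin

lemma amax_pos: "0 < amax"
  using amin_amax by linarith

lemma A_sym: "x \<in> \<Omega> \<Longrightarrow> (A x *v \<xi>) \<bullet> \<eta> = (A x *v \<eta>) \<bullet> \<xi>"
  using A unfolding elliptic_coefficient_def
  by (metis dot_lmul_matrix inner_commute transpose_matrix_vector)

lemma A_nonneg: "x \<in> \<Omega> \<Longrightarrow> 0 \<le> (A x *v \<xi>) \<bullet> \<xi>"
proof -
  assume "x \<in> \<Omega>"
  then have "amin * (norm \<xi>)\<^sup>2 \<le> (A x *v \<xi>) \<bullet> \<xi>" using A by (auto simp: elliptic_coefficient_def)
  moreover have "0 \<le> amin * (norm \<xi>)\<^sup>2" using amin_amax by simp
  ultimately show ?thesis by linarith
qed

lemma A_le: "x \<in> \<Omega> \<Longrightarrow> (A x *v \<xi>) \<bullet> \<xi> \<le> amax * (norm \<xi>)\<^sup>2"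
  using A by (auto simp: elliptic_coefficient_def)

lemma A_norm: "x \<in> \<Omega> \<Longrightarrow> norm (A x *v \<xi>) \<le> amax * norm \<xi>"
  using A A_nonneg A_le by (intro elliptic_norm_le) (auto simp: elliptic_coefficient_def)

lemma A_measurable:
  assumes "D \<subseteq> \<Omega>" "g \<in> borel_measurable (lebesgue_on D)"
  shows "(\<lambda>x. A x *v g x) \<in> borel_measurable (lebesgue_on D)"
proof (rule borel_measurable_vec_lambda)
  fix i
  have [measurable]: "(\<lambda>x. A x $ i $ j) \<in> borel_measurable (lebesgue_on D)" for j
    using A assms(1) by (auto simp: elliptic_coefficient_def Linf_def intro: measurable_lebesgue_on_subset)
  have [measurable]: "(\<lambda>x. g x $ j) \<in> borel_measurable (lebesgue_on D)" for j
    by (rule borel_measurable_vec_nth[OF assms(2)])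
  show "(\<lambda>x. (A x *v g x) $ i) \<in> borel_measurable (lebesgue_on D)"
    unfolding matrix_vector_mult_def by simp
qed

lemma A_L2:
  assumes "D \<subseteq> \<Omega>" "g \<in> L2 D"
  shows "(\<lambda>x. A x *v g x) \<in> L2 D"
  by (rule L2_bounded_by[OF assms(2) A_measurable[OF assms(1) L2_D(1)[OF assms(2)]], of amax], rule AE_I2)
     (use assms(1) A_norm in auto)

end

subsection \<open>Sobolev functions and their approximation\<close>

text \<open>Membership in \<open>H1\<close> provides some square-integrable weak gradient;
  uniqueness up to null sets passes integrability on to the chosen \<open>weak_grad\<close>.\<close>

lemma H1_D:
  assumes "open D" "u \<in> H1 D"
  shows "u \<in> L2 D" "is_weak_gradient D u (weak_grad D u)" "weak_grad D u \<in> L2 D"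
proof -
  obtain g where g: "is_weak_gradient D u g" "g \<in> L2 D" and u: "u \<in> L2 D"
    using assms(2) by (auto simp: H1_def)
  show "u \<in> L2 D" by (rule u)
  show "is_weak_gradient D u (weak_grad D u)" by (rule weak_grad_weak_gradient[OF g(1)])
  have ae: "AE x in lebesgue_on D. g x = weak_grad D u x"
    using weak_grad_AE[OF assms(1) g(1)] by eventually_elim simp
  show "weak_grad D u \<in> L2 D"
    by (rule L2_cong_AE[OF ae g(2) measurable_lebesgue_on_cong_AE[OF assms(1) L2_D(1)[OF g(2)] ae]])
qed

lemma weak_grad_L2:
  assumes "open D" "is_weak_gradient D u g" "g \<in> L2 D"
  shows "weak_grad D u \<in> L2 D"
proof -
  have ae: "AE x in lebesgue_on D. g x = weak_grad D u x"
    using weak_grad_AE[OF assms(1,2)] by eventually_elim simp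
  show ?thesis
    by (rule L2_cong_AE[OF ae assms(3) measurable_lebesgue_on_cong_AE[OF assms(1) L2_D(1)[OF assms(3)] ae]])
qed

lemma L2_norm_le_H1_norm: "L2_norm D v \<le> H1_norm D v" "L2_norm D (weak_grad D v) \<le> H1_norm D v"
  unfolding H1_norm_def by (rule real_le_rsqrt; simp)+

text \<open>The factor 2 is cruder than Minkowski's inequality, but the estimate serves only to show
  that norms tend to 0.\<close>

lemma L2_norm_add_le:
  fixes f g :: "real^'d \<Rightarrow> 'b::euclidean_space"
  assumes "f \<in> L2 D" "g \<in> L2 D"
  shows "L2_norm D (\<lambda>x. f x + g x) \<le> 2 * (L2_norm D f + L2_norm D g)"
proof (rule power2_le_imp_le)
  have "(L2_norm D (\<lambda>x. f x + g x))\<^sup>2 \<le> (LINT x|lebesgue_on D. 2 * (norm (f x))\<^sup>2 + 2 * (norm (g x))\<^sup>2)"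
    unfolding L2_norm_squared
  proof (rule integral_mono)
    fix x
    have "(norm (f x + g x))\<^sup>2 \<le> (norm (f x) + norm (g x))\<^sup>2"
      by (intro power_mono norm_triangle_ineq) auto
    also have "\<dots> \<le> 2 * (norm (f x))\<^sup>2 + 2 * (norm (g x))\<^sup>2"
      using sum_squares_bound[of "norm (f x)" "norm (g x)"] by (simp add: power2_sum)
    finally show "(norm (f x + g x))\<^sup>2 \<le> 2 * (norm (f x))\<^sup>2 + 2 * (norm (g x))\<^sup>2" .
  qed (use assms L2_add[OF assms] in \<open>auto simp: L2_def\<close>)
  also have "\<dots> = 2 * (L2_norm D f)\<^sup>2 + 2 * (L2_norm D g)\<^sup>2"
    using assms by (simp add: L2_norm_squared L2_def)
  also have "\<dots> \<le> (2 * (L2_norm D f + L2_norm D g))\<^sup>2"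
  proof -
    have "0 \<le> L2_norm D f * L2_norm D g" using L2_norm_nonneg by (intro mult_nonneg_nonneg)
    then show ?thesis by (simp add: power2_eq_square algebra_simps)
  qed
  finally show "(L2_norm D (\<lambda>x. f x + g x))\<^sup>2 \<le> (2 * (L2_norm D f + L2_norm D g))\<^sup>2" .
  show "0 \<le> 2 * (L2_norm D f + L2_norm D g)"
    using L2_norm_nonneg[of D f] L2_norm_nonneg[of D g] by simp
qed

lemma H1_smooth:
  fixes p :: "real^'d \<Rightarrow> real"
  assumes "bounded D" "open D" "smooth p"
  shows "p \<in> H1 D"
  using smooth_L2[OF assms] weak_gradient_smooth[OF assms(2,3)] by (auto simp: H1_def)

text \<open>The predicate P stands for the boundary condition of the approximants: being a test
  function for u, vanishing on the shared frontier for \<psi>.\<close>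

lemma H1_approximation:
  fixes v :: "real^'d \<Rightarrow> real"
  assumes D: "open D" "bounded D" and v: "v \<in> H1 D"
    and ap: "\<And>e. e > 0 \<Longrightarrow> \<exists>\<phi>. smooth \<phi> \<and> P \<phi> \<and> H1_norm D (\<lambda>x. v x - \<phi> x) < e"
  obtains \<phi> where "\<And>n. smooth (\<phi> n)" "\<And>n. P (\<phi> n)"
    "(\<lambda>n. L2_norm D (\<lambda>x. v x - \<phi> n x)) \<longlonglongrightarrow> 0"
    "(\<lambda>n. L2_norm D (\<lambda>x. weak_grad D v x - gradient (\<phi> n) x)) \<longlonglongrightarrow> 0"
proof -
  have "\<forall>n. \<exists>\<phi>. smooth \<phi> \<and> P \<phi> \<and> H1_norm D (\<lambda>x. v x - \<phi> x) < inverse (real (Suc n))"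
    using ap by simp
  then obtain \<phi> where \<phi>: "\<And>n. smooth (\<phi> n)" "\<And>n. P (\<phi> n)"
    "\<And>n. H1_norm D (\<lambda>x. v x - \<phi> n x) < inverse (real (Suc n))"
    by metis
  have lim: "h \<longlonglongrightarrow> 0" if "\<And>n. 0 \<le> h n" "\<And>n. h n \<le> H1_norm D (\<lambda>x. v x - \<phi> n x)" for h
  proof (rule tendsto_sandwich[OF _ _ tendsto_const LIMSEQ_inverse_real_of_nat])
    show "\<forall>\<^sub>F n in sequentially. h n \<le> inverse (real (Suc n))"
      using that(2) \<phi>(3) by (intro always_eventually allI) (meson less_imp_le order_trans)
  qed (use that(1) in auto)
  have eq: "L2_norm D (\<lambda>x. weak_grad D v x - gradient (\<phi> n) x) = L2_norm D (weak_grad D (\<lambda>x. v x - \<phi> n x))" for n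
  proof -
    have wg: "is_weak_gradient D (\<lambda>x. v x - \<phi> n x) (\<lambda>x. weak_grad D v x - gradient (\<phi> n) x)"
      by (intro weak_gradient_diff D H1_D v weak_gradient_smooth \<phi>)
    have L: "(\<lambda>x. weak_grad D v x - gradient (\<phi> n) x) \<in> L2 D"
      by (intro L2_diff H1_D v D smooth_L2 \<phi>)
    show ?thesis
    proof (rule L2_norm_cong_AE)
      show "AE x in lebesgue_on D. norm (weak_grad D v x - gradient (\<phi> n) x) = norm (weak_grad D (\<lambda>x. v x - \<phi> n x) x)"
        using weak_grad_AE[OF D(1) wg] by eventually_elim simp
    qed (intro L2_D L weak_grad_L2[OF D(1) wg])+
  qed
  show thesis
  proof (rule that[OF \<phi>(1,2)])
    show "(\<lambda>n. L2_norm D (\<lambda>x. v x - \<phi> n x)) \<longlonglongrightarrow> 0"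
      by (intro lim L2_norm_nonneg L2_norm_le_H1_norm)
    show "(\<lambda>n. L2_norm D (\<lambda>x. weak_grad D v x - gradient (\<phi> n) x)) \<longlonglongrightarrow> 0"
      unfolding eq by (intro lim L2_norm_nonneg L2_norm_le_H1_norm)
  qed
qed

lemma H1_zero_on_smooth:
  fixes p :: "real^'d \<Rightarrow> real"
  assumes "bounded D" "open D" "smooth p" "\<And>x. x \<in> S \<Longrightarrow> p x = 0"
  shows "p \<in> H1_zero_on S D"
proof -
  \<comment> \<open>Even the zero function has a chosen weak gradient, which is known to be 0 only
    almost everywhere.\<close>
  have "AE x in lebesgue_on D. weak_grad D (\<lambda>x. 0) x = (0 :: real^'d)"
    by (rule weak_grad_AE[OF assms(2) weak_gradient_0])
  then have "(LINT x|lebesgue_on D. (norm (weak_grad D (\<lambda>x. 0) x))\<^sup>2) = 0"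
    by (intro integral_eq_zero_AE) (auto elim: eventually_mono)
  then have "H1_norm D (\<lambda>x. p x - p x) = 0"
    by (simp add: H1_norm_def L2_norm_def)
  then show ?thesis
    using H1_smooth[OF assms(1-3)] assms(3,4) unfolding H1_zero_on_def by auto
qed

lemma H10_test_function:
  fixes p :: "real^'d \<Rightarrow> real"
  assumes "bounded D" "open D" "test_function D p"
  shows "p \<in> H10 D"
proof -
  have sm: "smooth p" using assms(3) by (simp add: test_function_def)
  have "AE x in lebesgue_on D. weak_grad D (\<lambda>x. 0) x = (0 :: real^'d)"
    by (rule weak_grad_AE[OF assms(2) weak_gradient_0])
  then have "(LINT x|lebesgue_on D. (norm (weak_grad D (\<lambda>x. 0) x))\<^sup>2) = 0"
    by (intro integral_eq_zero_AE) (auto elim: eventually_mono)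
  then have "H1_norm D (\<lambda>x. p x - p x) = 0"
    by (simp add: H1_norm_def L2_norm_def)
  then show ?thesis
    using H1_smooth[OF assms(1,2) sm] assms(3) unfolding H10_def by auto
qed

section \<open>Energy estimate and smooth test functions\<close>

context elliptic
begin

text \<open>Testing with the solution itself and dropping the nonnegative gradient term leaves
  \<open>u * u\<close> against \<open>f * u\<close>; Cauchy-Schwarz does the rest, with a constant
  independent of \<epsilon>.\<close>

lemma variational_solution_L2_norm_le:
  assumes D: "open D" "D \<subseteq> \<Omega>" and f: "f \<in> L2 \<Omega>" and V: "V \<subseteq> H1 D"
    and u: "variational_solution A \<epsilon> D V f u"
  shows "L2_norm D u \<le> L2_norm D f"
proof -
  have uV: "u \<in> V" and eq: "a_form A \<epsilon> D u u = (LINT x|lebesgue_on D. f x * u x)"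
    using u by (auto simp: variational_solution_def)
  have uL: "u \<in> L2 D" using H1_D(1)[OF D(1)] uV V by blast
  have fL: "f \<in> L2 D" using L2_subset(1)[OF f D(2)] D(1) Om by auto
  have "0 \<le> (LINT x|lebesgue_on D. (A x *v weak_grad D u x) \<bullet> weak_grad D u x)"
    using A_nonneg D(2) by (intro Bochner_Integration.integral_nonneg) auto
  then have "0 \<le> \<epsilon>\<^sup>2 * (LINT x|lebesgue_on D. (A x *v weak_grad D u x) \<bullet> weak_grad D u x)"
    by simp
  then have "(LINT x|lebesgue_on D. u x * u x) \<le> (LINT x|lebesgue_on D. f x * u x)"
    using eq by (simp add: a_form_def)
  also have "\<dots> \<le> \<bar>LINT x|lebesgue_on D. f x * u x\<bar>" by simp
  also have "\<dots> \<le> 1 * (L2_norm D f * L2_norm D u)"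
    by (rule integral_mult_L2_le[OF fL uL]) (use fL uL in \<open>auto simp: L2_def abs_mult\<close>)
  finally have "(LINT x|lebesgue_on D. u x * u x) \<le> L2_norm D u * L2_norm D f"
    by (simp add: mult.commute)
  moreover have "(LINT x|lebesgue_on D. u x * u x) = L2_norm D u * L2_norm D u"
    using L2_norm_squared[of D u] by (simp add: power2_eq_square[of "_ :: real"])
  ultimately have "L2_norm D u * L2_norm D u \<le> L2_norm D u * L2_norm D f" by simp
  then show ?thesis
    using L2_norm_nonneg[of D u] L2_norm_nonneg[of D f]
    by (cases "L2_norm D u = 0") (auto simp: mult_le_cancel_left)
qed

text \<open>The zero-order term is moved to the right, so the equation takes the flux and source
  form in which it can be extended to bounded test functions.\<close>

lemma variational_solution_test:
  assumes D: "open D" "D \<subseteq> \<Omega>" and f: "f \<in> L2 \<Omega>" and V: "V \<subseteq> H1 D"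
    and u: "variational_solution A \<epsilon> D V f u" and \<theta>: "smooth \<theta>" "\<theta> \<in> V"
  shows "(LINT x|lebesgue_on D. (\<epsilon>\<^sup>2 *\<^sub>R (A x *v weak_grad D u x)) \<bullet> gradient \<theta> x)
    = (LINT x|lebesgue_on D. (f x - u x) * \<theta> x)"
proof -
  have Db: "bounded D" using Om(2) D(2) bounded_subset by blast
  have uH: "u \<in> H1 D" using u V by (auto simp: variational_solution_def)
  have fL: "f \<in> L2 D" using L2_subset(1)[OF f D(2)] D(1) Om by auto
  have \<theta>L: "\<theta> \<in> L2 D" "gradient \<theta> \<in> L2 D" using smooth_L2[OF Db D(1) \<theta>(1)] by auto
  have AL: "(\<lambda>x. A x *v weak_grad D u x) \<in> L2 D" by (intro A_L2 D H1_D uH)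
  have i1: "integrable (lebesgue_on D) (\<lambda>x. f x * \<theta> x)"
    by (rule integrable_mult_L2[OF fL \<theta>L(1), where B=1]) (use fL \<theta>L in \<open>auto simp: L2_def abs_mult\<close>)
  have uL: "u \<in> L2 D" by (rule H1_D(1)[OF D(1) uH])
  have i2: "integrable (lebesgue_on D) (\<lambda>x. u x * \<theta> x)"
    by (rule integrable_mult_L2[OF uL \<theta>L(1), where B=1]) (use uL \<theta>L in \<open>auto simp: L2_def abs_mult\<close>)
  have ae: "AE x in lebesgue_on D. weak_grad D \<theta> x = gradient \<theta> x"
    by (intro weak_grad_AE D weak_gradient_smooth \<theta>)
  have "(LINT x|lebesgue_on D. (A x *v weak_grad D u x) \<bullet> weak_grad D \<theta> x) = (LINT x|lebesgue_on D. (A x *v weak_grad D u x) \<bullet> gradient \<theta> x)"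
  proof (rule integral_cong_AE)
    have "weak_grad D \<theta> \<in> L2 D"
      by (rule weak_grad_L2[OF D(1) weak_gradient_smooth[OF D(1) \<theta>(1)] \<theta>L(2)])
    then show "(\<lambda>x. (A x *v weak_grad D u x) \<bullet> weak_grad D \<theta> x) \<in> borel_measurable (lebesgue_on D)"
      using L2_D(1)[OF AL] L2_D(1) by (intro borel_measurable_inner) auto
    show "(\<lambda>x. (A x *v weak_grad D u x) \<bullet> gradient \<theta> x) \<in> borel_measurable (lebesgue_on D)"
      using L2_D(1)[OF AL] L2_D(1)[OF \<theta>L(2)] by (intro borel_measurable_inner)
    show "AE x in lebesgue_on D. (A x *v weak_grad D u x) \<bullet> weak_grad D \<theta> x = (A x *v weak_grad D u x) \<bullet> gradient \<theta> x"
      using ae by eventually_elim simp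
  qed
  moreover have "a_form A \<epsilon> D u \<theta> = (LINT x|lebesgue_on D. f x * \<theta> x)"
    using u \<theta>(2) by (auto simp: variational_solution_def)
  ultimately show ?thesis
    using i1 i2 by (simp add: a_form_def left_diff_distrib)
qed

end

subsection \<open>The local error\<close>

locale local_problem = elliptic \<Omega> A amin amax
  for \<Omega> :: "(real^'d) set" and A amin amax +
  fixes \<epsilon> :: real and f u \<psi> :: "real^'d \<Rightarrow> real" and D' :: "(real^'d) set"
  assumes eps: "0 < \<epsilon>" and f: "f \<in> L2 \<Omega>"
    and u: "variational_solution A \<epsilon> \<Omega> (H10 \<Omega>) f u"
    and D': "open D'" "D' \<subseteq> \<Omega>"
    and \<psi>: "variational_solution A \<epsilon> D' (H1_Gamma \<Omega> D') f \<psi>"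
begin

definition w :: "real^'d \<Rightarrow> real" where "w x = u x - \<psi> x"

text \<open>Each gradient is taken on the domain of its own equation, \<Omega> for u and D' for
  \<psi>.\<close>

definition wg :: "real^'d \<Rightarrow> real^'d" where "wg x = weak_grad \<Omega> u x - weak_grad D' \<psi> x"

lemma D'_bounded: "bounded D'"
  using Om(2) D'(2) bounded_subset by blast

lemma spaces: "H10 \<Omega> \<subseteq> H1 \<Omega>" "H1_Gamma \<Omega> D' \<subseteq> H1 D'"
  by (auto simp: H10_def H1_Gamma_def H1_zero_on_def)

lemma u_H1: "u \<in> H1 \<Omega>" and \<psi>_H1: "\<psi> \<in> H1 D'"
  using u \<psi> spaces by (auto simp: variational_solution_def)

lemma restrict_L2:
  fixes h :: "real^'d \<Rightarrow> 'b::euclidean_space"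
  assumes "h \<in> L2 \<Omega>"
  shows "h \<in> L2 D'" "L2_norm D' h \<le> L2_norm \<Omega> h"
  using L2_subset[OF assms D'(2)] D'(1) Om(1) by auto

lemma w_L2: "w \<in> L2 D'" "wg \<in> L2 D'"
  unfolding w_def[abs_def] wg_def[abs_def]
  by (intro L2_diff restrict_L2 H1_D Om D' u_H1 \<psi>_H1)+

text \<open>Approximants of u are test functions of \<Omega> and vanish on its whole frontier; those
  of \<psi> vanish on the part shared with D'. Their difference approximates w on D' and has honest
  zero values on the shared part.\<close>

lemma approximation:
  obtains p where "\<And>n. smooth (p n)" "\<And>n x. x \<in> frontier D' \<inter> frontier \<Omega> \<Longrightarrow> p n x = 0"
    "(\<lambda>n. L2_norm D' (\<lambda>x. p n x - w x)) \<longlonglongrightarrow> 0" "(\<lambda>n. L2_norm D' (\<lambda>x. gradient (p n) x - wg x)) \<longlonglongrightarrow> 0"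
proof -
  have "u \<in> H10 \<Omega>" using u by (simp add: variational_solution_def)
  then have ap: "\<exists>\<phi>. smooth \<phi> \<and> test_function \<Omega> \<phi> \<and> H1_norm \<Omega> (\<lambda>x. u x - \<phi> x) < e" if "e > 0" for e
    using that unfolding H10_def test_function_def by auto
  obtain \<theta> where \<theta>: "\<And>n. smooth (\<theta> n)" "\<And>n. test_function \<Omega> (\<theta> n)"
    "(\<lambda>n. L2_norm \<Omega> (\<lambda>x. u x - \<theta> n x)) \<longlonglongrightarrow> 0" "(\<lambda>n. L2_norm \<Omega> (\<lambda>x. weak_grad \<Omega> u x - gradient (\<theta> n) x)) \<longlonglongrightarrow> 0"
    by (rule H1_approximation[OF Om u_H1 ap]) (assumption, rule that)
  have "\<psi> \<in> H1_zero_on (frontier D' \<inter> frontier \<Omega>) D'"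
    using \<psi> by (simp add: variational_solution_def H1_Gamma_def)
  then have ap': "\<exists>\<phi>. smooth \<phi> \<and> (\<forall>x\<in>frontier D' \<inter> frontier \<Omega>. \<phi> x = 0) \<and> H1_norm D' (\<lambda>x. \<psi> x - \<phi> x) < e" if "e > 0" for e
    using that unfolding H1_zero_on_def by blast
  obtain \<phi> where \<phi>: "\<And>n. smooth (\<phi> n)" "\<And>n. \<forall>x\<in>frontier D' \<inter> frontier \<Omega>. \<phi> n x = 0"
    "(\<lambda>n. L2_norm D' (\<lambda>x. \<psi> x - \<phi> n x)) \<longlonglongrightarrow> 0" "(\<lambda>n. L2_norm D' (\<lambda>x. weak_grad D' \<psi> x - gradient (\<phi> n) x)) \<longlonglongrightarrow> 0"
    by (rule H1_approximation[OF D'(1) D'_bounded \<psi>_H1 ap']) (assumption, rule that)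
  have null: "(\<lambda>n. L2_norm D' (h n)) \<longlonglongrightarrow> 0"
    if a: "\<And>n. a n \<in> L2 \<Omega>" "(\<lambda>n. L2_norm \<Omega> (a n)) \<longlonglongrightarrow> 0"
      and b: "\<And>n. b n \<in> L2 D'" "(\<lambda>n. L2_norm D' (b n)) \<longlonglongrightarrow> 0"
      and h: "\<And>n x. h n x = b n x - a n x"
    for a b h :: "nat \<Rightarrow> real^'d \<Rightarrow> 'b::euclidean_space"
  proof (rule tendsto_sandwich[OF _ _ tendsto_const])
    show "\<forall>\<^sub>F n in sequentially. 0 \<le> L2_norm D' (h n)"
      by (intro always_eventually allI L2_norm_nonneg)
    show "\<forall>\<^sub>F n in sequentially. L2_norm D' (h n) \<le> 2 * (L2_norm D' (b n) + L2_norm \<Omega> (a n))"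
    proof (intro always_eventually allI)
      fix n
      have "h n = (\<lambda>x. b n x + - a n x)" using h by auto
      then have "L2_norm D' (h n) \<le> 2 * (L2_norm D' (b n) + L2_norm D' (\<lambda>x. - a n x))"
        using L2_norm_add_le[OF b(1) L2_minus[OF restrict_L2(1)[OF a(1)]]] by simp
      also have "L2_norm D' (\<lambda>x. - a n x) = L2_norm D' (a n)" by (simp add: L2_norm_def)
      finally show "L2_norm D' (h n) \<le> 2 * (L2_norm D' (b n) + L2_norm \<Omega> (a n))"
        using restrict_L2(2)[OF a(1), of n] by simp
    qed
    show "(\<lambda>n. 2 * (L2_norm D' (b n) + L2_norm \<Omega> (a n))) \<longlonglongrightarrow> 0"
      using tendsto_mult[OF tendsto_const tendsto_add[OF b(2) a(2)], of 2] by simp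
  qed
  have gr: "gradient (\<lambda>x. \<theta> n x - \<phi> n x) x = gradient (\<theta> n) x - gradient (\<phi> n) x" for n x
  proof (rule gradient_eq)
    show "((\<lambda>x. \<theta> n x - \<phi> n x) has_derivative (\<lambda>h. (gradient (\<theta> n) x - gradient (\<phi> n) x) \<bullet> h)) (at x)"
      unfolding inner_diff_left
      by (intro has_derivative_diff has_derivative_gradient smooth_differentiable \<theta> \<phi>)
  qed
  have La: "(\<lambda>x. u x - \<theta> n x) \<in> L2 \<Omega>" "(\<lambda>x. weak_grad \<Omega> u x - gradient (\<theta> n) x) \<in> L2 \<Omega>" for n
    by (intro L2_diff H1_D(1)[OF Om(1) u_H1] H1_D(3)[OF Om(1) u_H1] smooth_L2 Om \<theta>)+
  have Lb: "(\<lambda>x. \<psi> x - \<phi> n x) \<in> L2 D'" "(\<lambda>x. weak_grad D' \<psi> x - gradient (\<phi> n) x) \<in> L2 D'" for n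
    by (intro L2_diff H1_D(1)[OF D'(1) \<psi>_H1] H1_D(3)[OF D'(1) \<psi>_H1] smooth_L2 D' D'_bounded \<phi>)+
  show thesis
  proof (rule that[of "\<lambda>n x. \<theta> n x - \<phi> n x"])
    show "smooth (\<lambda>x. \<theta> n x - \<phi> n x)" for n by (intro smooth_diff \<theta> \<phi>)
    fix n x assume x: "x \<in> frontier D' \<inter> frontier \<Omega>"
    then have "x \<notin> \<Omega>" using Om(1) by (simp add: frontier_def interior_open)
    moreover have "{x. \<theta> n x \<noteq> 0} \<subseteq> \<Omega>"
      using \<theta>(2)[of n] order_trans[OF closure_subset] unfolding test_function_def by metis
    ultimately have "\<theta> n x = 0" by (metis (mono_tags, lifting) mem_Collect_eq subsetD)
    then show "\<theta> n x - \<phi> n x = 0" using \<phi>(2)[of n] x by simp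
  next
    show "(\<lambda>n. L2_norm D' (\<lambda>x. \<theta> n x - \<phi> n x - w x)) \<longlonglongrightarrow> 0"
      by (rule null[OF La(1) \<theta>(3) Lb(1) \<phi>(3)]) (simp add: w_def)
    show "(\<lambda>n. L2_norm D' (\<lambda>x. gradient (\<lambda>x. \<theta> n x - \<phi> n x) x - wg x)) \<longlonglongrightarrow> 0"
      unfolding gr
      by (rule null[OF La(2) \<theta>(4) Lb(2) \<phi>(4)]) (simp add: wg_def)
  qed
qed

text \<open>The space for \<psi> imposes no condition on the inner boundary of D', so every test
  function of \<Omega> may be used in both equations and f cancels on D'. The difference is an
  equation on all of \<Omega>, which extends to bounded v; the vanishing of v off D' then discards
  what remains of the equation for u there.\<close>

lemma error_equation:
  assumes v: "bounded_weak_gradient \<Omega> v g" and K: "compact K" "K \<subseteq> \<Omega>" "\<And>x. x \<in> \<Omega> - K \<Longrightarrow> v x = 0"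
    and v0: "\<And>x. x \<in> \<Omega> - D' \<Longrightarrow> v x = 0"
  shows "(LINT x|lebesgue_on D'. (\<epsilon>\<^sup>2 *\<^sub>R (A x *v wg x)) \<bullet> g x) + (LINT x|lebesgue_on D'. w x * v x) = 0"
proof -
  have sets: "D' \<in> sets lebesgue" "\<Omega> \<in> sets lebesgue" using D'(1) Om(1) by auto
  define Fu where "Fu x = \<epsilon>\<^sup>2 *\<^sub>R (A x *v weak_grad \<Omega> u x)" for x
  \<comment> \<open>Flux and source of the equation for \<psi> are extended by zero, which turns it
    into an equation on \<Omega> with the same test functions as the one for u.\<close>
  define Fp where "Fp x = (if x \<in> D' then \<epsilon>\<^sup>2 *\<^sub>R (A x *v weak_grad D' \<psi> x) else 0)" for x
  define sp where "sp x = (if x \<in> D' then f x - \<psi> x else 0)" for x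
  have scale: "(\<lambda>x. \<epsilon>\<^sup>2 *\<^sub>R h x) \<in> L2 D" if "h \<in> L2 D" for h :: "real^'d \<Rightarrow> real^'d" and D
    by (rule L2_bounded_by[OF that, where B="\<epsilon>\<^sup>2"]) (use L2_D(1)[OF that] in auto)
  have FuL: "Fu \<in> L2 \<Omega>"
    unfolding Fu_def[abs_def] by (intro scale A_L2 H1_D Om u_H1 order_refl)
  have FpL': "(\<lambda>x. \<epsilon>\<^sup>2 *\<^sub>R (A x *v weak_grad D' \<psi> x)) \<in> L2 D'"
    by (intro scale A_L2 H1_D D' \<psi>_H1)
  have FpL: "Fp \<in> L2 \<Omega>"
    unfolding Fp_def[abs_def] by (intro L2_extend_by_zero Om D' FpL')
  have suL: "(\<lambda>x. f x - u x) \<in> L2 \<Omega>" by (intro L2_diff f H1_D Om u_H1)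
  have spL': "(\<lambda>x. f x - \<psi> x) \<in> L2 D'" by (intro L2_diff restrict_L2 f H1_D D' \<psi>_H1)
  have spL: "sp \<in> L2 \<Omega>"
    unfolding sp_def[abs_def] by (intro L2_extend_by_zero Om D' spL')
  have inner_int: "integrable (lebesgue_on \<Omega>) (\<lambda>x. F x \<bullet> G x)" if "F \<in> L2 \<Omega>" "G \<in> L2 \<Omega>" for F G :: "real^'d \<Rightarrow> real^'d"
    by (rule integrable_mult_L2[OF that, where B=1])
       (use that in \<open>auto simp: L2_def intro: Cauchy_Schwarz_ineq2\<close>)
  have mult_int: "integrable (lebesgue_on \<Omega>) (\<lambda>x. F x * G x)" if "F \<in> L2 \<Omega>" "G \<in> L2 \<Omega>" for F G :: "real^'d \<Rightarrow> real"
    by (rule integrable_mult_L2[OF that, where B=1]) (use that in \<open>auto simp: L2_def abs_mult\<close>)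
  have "(LINT x|lebesgue_on \<Omega>. (Fu x - Fp x) \<bullet> g x) = (LINT x|lebesgue_on \<Omega>. (f x - u x - sp x) * v x)"
  proof (rule weak_equation_bounded_test[OF Om _ _ _ v K])
    show "integrable (lebesgue_on \<Omega>) (\<lambda>x. Fu x - Fp x)" "integrable (lebesgue_on \<Omega>) (\<lambda>x. f x - u x - sp x)"
      by (intro L2_imp_integrable Om sets L2_diff FuL FpL suL spL)+
    fix \<theta> assume \<theta>: "test_function \<Omega> \<theta>"
    then have sm: "smooth \<theta>" by (simp add: test_function_def)
    have \<theta>0: "\<theta> x = 0" if "x \<notin> \<Omega>" for x
      using \<theta> closure_subset[of "{x. \<theta> x \<noteq> 0}"] that unfolding test_function_def by blast
    have \<theta>G: "\<theta> \<in> H1_Gamma \<Omega> D'"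
      unfolding H1_Gamma_def
    proof (rule H1_zero_on_smooth[OF D'_bounded D'(1) sm])
      fix x assume "x \<in> frontier D' \<inter> frontier \<Omega>"
      then show "\<theta> x = 0" using Om(1) by (intro \<theta>0) (simp add: frontier_def interior_open)
    qed
    have \<theta>L: "\<theta> \<in> L2 \<Omega>" "gradient \<theta> \<in> L2 \<Omega>" by (intro smooth_L2 Om sm)+
    have "(LINT x|lebesgue_on \<Omega>. Fu x \<bullet> gradient \<theta> x) = (LINT x|lebesgue_on \<Omega>. (f x - u x) * \<theta> x)"
      unfolding Fu_def by (rule variational_solution_test[OF Om(1) order_refl f spaces(1) u sm H10_test_function[OF Om(2,1) \<theta>]])
    moreover have "(LINT x|lebesgue_on \<Omega>. Fp x \<bullet> gradient \<theta> x) = (LINT x|lebesgue_on \<Omega>. sp x * \<theta> x)"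
    proof -
      have "(LINT x|lebesgue_on \<Omega>. Fp x \<bullet> gradient \<theta> x) = (LINT x|lebesgue_on D'. Fp x \<bullet> gradient \<theta> x)"
        by (rule integral_lebesgue_on_support[OF D'(2) sets]) (simp add: Fp_def)
      also have "\<dots> = (LINT x|lebesgue_on D'. (\<epsilon>\<^sup>2 *\<^sub>R (A x *v weak_grad D' \<psi> x)) \<bullet> gradient \<theta> x)"
        by (intro Bochner_Integration.integral_cong) (auto simp: Fp_def)
      also have "\<dots> = (LINT x|lebesgue_on D'. (f x - \<psi> x) * \<theta> x)"
        by (rule variational_solution_test[OF D' f spaces(2) \<psi> sm \<theta>G])
      also have "\<dots> = (LINT x|lebesgue_on D'. sp x * \<theta> x)"
        by (intro Bochner_Integration.integral_cong) (auto simp: sp_def)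
      also have "\<dots> = (LINT x|lebesgue_on \<Omega>. sp x * \<theta> x)"
        by (rule integral_lebesgue_on_support[OF D'(2) sets, symmetric]) (simp add: sp_def)
      finally show ?thesis .
    qed
    ultimately show "(LINT x|lebesgue_on \<Omega>. (Fu x - Fp x) \<bullet> gradient \<theta> x) = (LINT x|lebesgue_on \<Omega>. (f x - u x - sp x) * \<theta> x)"
      using inner_int[OF FuL \<theta>L(2)] inner_int[OF FpL \<theta>L(2)] mult_int[OF suL \<theta>L(1)] mult_int[OF spL \<theta>L(1)]
      by (simp add: inner_diff_left left_diff_distrib[of "f _ - u _"])
  qed
  moreover have "(LINT x|lebesgue_on \<Omega>. (Fu x - Fp x) \<bullet> g x) = (LINT x|lebesgue_on D'. (\<epsilon>\<^sup>2 *\<^sub>R (A x *v wg x)) \<bullet> g x)"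
  proof -
    have m: "(\<lambda>x. (Fu x - Fp x) \<bullet> g x) \<in> borel_measurable (lebesgue_on \<Omega>)"
      using v FuL FpL by (intro borel_measurable_inner borel_measurable_diff) (auto simp: L2_def bounded_weak_gradient_def)
    \<comment> \<open>The gradient of v is 0 almost everywhere off D' because v is zero
      there.\<close>
    have z: "AE x in lebesgue_on \<Omega>. (Fu x - Fp x) \<bullet> g x = (if x \<in> D' then (Fu x - Fp x) \<bullet> g x else 0)"
      using weak_gradient_zero_on_zero_set[OF Om v] AE_space
    proof eventually_elim
      case (elim x)
      then show ?case using v0[of x] by auto
    qed
    have "(LINT x|lebesgue_on \<Omega>. (Fu x - Fp x) \<bullet> g x) = (LINT x|lebesgue_on \<Omega>. (if x \<in> D' then (Fu x - Fp x) \<bullet> g x else 0))"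
      by (rule integral_cong_AE[OF m measurable_lebesgue_on_cong_AE[OF Om(1) m z] z])
    also have "\<dots> = (LINT x|lebesgue_on D'. (Fu x - Fp x) \<bullet> g x)"
      by (rule Lebesgue_Measure.integral_restrict[OF D'(2) sets])
    also have "\<dots> = (LINT x|lebesgue_on D'. (\<epsilon>\<^sup>2 *\<^sub>R (A x *v wg x)) \<bullet> g x)"
      by (intro Bochner_Integration.integral_cong)
         (auto simp: Fu_def Fp_def wg_def matrix_vector_mult_diff_distrib scaleR_diff_right)
    finally show ?thesis .
  qed
  moreover have "(LINT x|lebesgue_on \<Omega>. (f x - u x - sp x) * v x) = - (LINT x|lebesgue_on D'. w x * v x)"
  proof -
    have "(LINT x|lebesgue_on \<Omega>. (f x - u x - sp x) * v x) = (LINT x|lebesgue_on D'. (f x - u x - sp x) * v x)"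
      by (rule integral_lebesgue_on_support[OF D'(2) sets]) (simp add: v0)
    also have "\<dots> = (LINT x|lebesgue_on D'. - (w x * v x))"
      by (intro Bochner_Integration.integral_cong) (auto simp: sp_def w_def algebra_simps)
    finally show ?thesis by simp
  qed
  ultimately show ?thesis by simp
qed

text \<open>Expanding the energy of q gives a square in chi, a cross term and the square with c;
  symmetry of A makes the two mixed terms equal. The tested error equation says exactly that the
  first two together with the zero-order term cancel, so only the square with c survives, and it is
  bounded by amax.\<close>

lemma
  assumes chi: "bounded_weak_gradient \<Omega> chi c" "\<And>x. x \<in> \<Omega> - D' \<Longrightarrow> chi x = 0"
  defines "q \<equiv> \<lambda>x. chi x *\<^sub>R wg x + w x *\<^sub>R c x"
  shows product_weak_gradient: "is_weak_gradient \<Omega> (\<lambda>x. chi x * w x) (\<lambda>x. if x \<in> D' then q x else 0)"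
    and product_L2: "(\<lambda>x. chi x * w x) \<in> L2 \<Omega>" "(\<lambda>x. if x \<in> D' then q x else 0) \<in> L2 \<Omega>"
    and Caccioppoli: "\<epsilon>\<^sup>2 * (LINT x|lebesgue_on D'. (A x *v q x) \<bullet> q x) + (LINT x|lebesgue_on D'. (chi x * w x)\<^sup>2)
      \<le> \<epsilon>\<^sup>2 * amax * (LINT x|lebesgue_on D'. (w x)\<^sup>2 * (norm (c x))\<^sup>2)"
proof -
  obtain p where p: "\<And>n. smooth (p n)" "\<And>n x. x \<in> frontier D' \<inter> frontier \<Omega> \<Longrightarrow> p n x = 0"
    "(\<lambda>n. L2_norm D' (\<lambda>x. p n x - w x)) \<longlonglongrightarrow> 0" "(\<lambda>n. L2_norm D' (\<lambda>x. gradient (p n) x - wg x)) \<longlonglongrightarrow> 0"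
    using approximation by blast
  interpret H: H1_limit \<Omega> D' w wg p chi c
    by unfold_locales (fact Om D' w_L2 p chi)+
  show "is_weak_gradient \<Omega> (\<lambda>x. chi x * w x) (\<lambda>x. if x \<in> D' then q x else 0)"
    "(\<lambda>x. chi x * w x) \<in> L2 \<Omega>" "(\<lambda>x. if x \<in> D' then q x else 0) \<in> L2 \<Omega>"
    unfolding q_def by (fact H.product)+
  obtain C where C: "C > 0" "\<And>x. x \<in> \<Omega> \<Longrightarrow> \<bar>chi x\<bar> \<le> C" "\<And>x. x \<in> \<Omega> \<Longrightarrow> norm (c x) \<le> C"
    using H.bound by blast
  have CD': "\<bar>chi x\<bar> \<le> C" "norm (c x) \<le> C" if "x \<in> D'" for x
    using C D'(2) that by auto
  note [measurable] = H.measurable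
  have AL: "(\<lambda>x. A x *v wg x) \<in> L2 D'" by (intro A_L2 D' w_L2)
  have scale: "(\<lambda>x. \<epsilon>\<^sup>2 *\<^sub>R h x) \<in> L2 D'" if "h \<in> L2 D'" for h :: "real^'d \<Rightarrow> real^'d"
    by (rule L2_bounded_by[OF that, where B="\<epsilon>\<^sup>2"]) (use L2_D(1)[OF that] in auto)
  have id: "(LINT x|lebesgue_on D'. (\<epsilon>\<^sup>2 *\<^sub>R (A x *v wg x)) \<bullet> ((chi x)\<^sup>2 *\<^sub>R wg x))
      + (LINT x|lebesgue_on D'. (\<epsilon>\<^sup>2 *\<^sub>R (A x *v wg x)) \<bullet> ((2 * chi x * w x) *\<^sub>R c x))
      + (LINT x|lebesgue_on D'. w x * ((chi x)\<^sup>2 * w x)) = 0"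
    by (rule H.Caccioppoli_identity[OF scale[OF AL] p(2) error_equation]) assumption+
  have cw: "(\<lambda>x. chi x *\<^sub>R wg x) \<in> L2 D'"
    by (rule L2_bounded_by[OF w_L2(2), where B=C]) (use CD' in \<open>auto intro!: AE_I2 mult_right_mono\<close>)
  have wc: "(\<lambda>x. w x *\<^sub>R c x) \<in> L2 D'"
  proof (rule L2_bounded_by[OF w_L2(1), where B=C])
    show "AE x in lebesgue_on D'. norm (w x *\<^sub>R c x) \<le> C * norm (w x)"
      using CD' by (intro AE_I2) (auto simp: mult.commute[of C] intro!: mult_left_mono)
  qed measurable
  have inner_int: "integrable (lebesgue_on D') (\<lambda>x. F x \<bullet> G x)" if "F \<in> L2 D'" "G \<in> L2 D'" for F G :: "real^'d \<Rightarrow> real^'d"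
    by (rule integrable_mult_L2[OF that, where B=1])
       (use that in \<open>auto simp: L2_def intro: Cauchy_Schwarz_ineq2\<close>)
  have I: "integrable (lebesgue_on D') (\<lambda>x. (A x *v (chi x *\<^sub>R wg x)) \<bullet> (chi x *\<^sub>R wg x))"
    "integrable (lebesgue_on D') (\<lambda>x. (A x *v (chi x *\<^sub>R wg x)) \<bullet> (w x *\<^sub>R c x))"
    "integrable (lebesgue_on D') (\<lambda>x. (A x *v (w x *\<^sub>R c x)) \<bullet> (w x *\<^sub>R c x))"
    by (intro inner_int A_L2 D' cw wc)+
  have "(LINT x|lebesgue_on D'. (A x *v q x) \<bullet> q x)
      = (LINT x|lebesgue_on D'. (A x *v (chi x *\<^sub>R wg x)) \<bullet> (chi x *\<^sub>R wg x) + 2 * ((A x *v (chi x *\<^sub>R wg x)) \<bullet> (w x *\<^sub>R c x))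
          + (A x *v (w x *\<^sub>R c x)) \<bullet> (w x *\<^sub>R c x))"
  proof (rule Bochner_Integration.integral_cong[OF refl])
    fix x assume "x \<in> space (lebesgue_on D')"
    then have x: "x \<in> \<Omega>" using D'(2) by auto
    show "(A x *v q x) \<bullet> q x = (A x *v (chi x *\<^sub>R wg x)) \<bullet> (chi x *\<^sub>R wg x) + 2 * ((A x *v (chi x *\<^sub>R wg x)) \<bullet> (w x *\<^sub>R c x))
          + (A x *v (w x *\<^sub>R c x)) \<bullet> (w x *\<^sub>R c x)"
      using A_sym[OF x, of "w x *\<^sub>R c x" "chi x *\<^sub>R wg x"]
      by (simp only: q_def matrix_vector_right_distrib inner_add_left inner_add_right)
  qed
  also have "\<dots> = (LINT x|lebesgue_on D'. (A x *v (chi x *\<^sub>R wg x)) \<bullet> (chi x *\<^sub>R wg x))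
      + 2 * (LINT x|lebesgue_on D'. (A x *v (chi x *\<^sub>R wg x)) \<bullet> (w x *\<^sub>R c x))
      + (LINT x|lebesgue_on D'. (A x *v (w x *\<^sub>R c x)) \<bullet> (w x *\<^sub>R c x))"
    using I by simp
  finally have q: "(LINT x|lebesgue_on D'. (A x *v q x) \<bullet> q x)
      = (LINT x|lebesgue_on D'. (A x *v (chi x *\<^sub>R wg x)) \<bullet> (chi x *\<^sub>R wg x))
      + 2 * (LINT x|lebesgue_on D'. (A x *v (chi x *\<^sub>R wg x)) \<bullet> (w x *\<^sub>R c x))
      + (LINT x|lebesgue_on D'. (A x *v (w x *\<^sub>R c x)) \<bullet> (w x *\<^sub>R c x))" .
  have "(LINT x|lebesgue_on D'. (\<epsilon>\<^sup>2 *\<^sub>R (A x *v wg x)) \<bullet> ((chi x)\<^sup>2 *\<^sub>R wg x))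
      = (LINT x|lebesgue_on D'. \<epsilon>\<^sup>2 * ((A x *v (chi x *\<^sub>R wg x)) \<bullet> (chi x *\<^sub>R wg x)))"
    by (intro Bochner_Integration.integral_cong) (simp_all add: matrix_vector_mult_scaleR power2_eq_square mult_ac)
  then have 1: "(LINT x|lebesgue_on D'. (\<epsilon>\<^sup>2 *\<^sub>R (A x *v wg x)) \<bullet> ((chi x)\<^sup>2 *\<^sub>R wg x))
      = \<epsilon>\<^sup>2 * (LINT x|lebesgue_on D'. (A x *v (chi x *\<^sub>R wg x)) \<bullet> (chi x *\<^sub>R wg x))" by simp
  have "(LINT x|lebesgue_on D'. (\<epsilon>\<^sup>2 *\<^sub>R (A x *v wg x)) \<bullet> ((2 * chi x * w x) *\<^sub>R c x))
      = (LINT x|lebesgue_on D'. (2 * \<epsilon>\<^sup>2) * ((A x *v (chi x *\<^sub>R wg x)) \<bullet> (w x *\<^sub>R c x)))"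
    by (intro Bochner_Integration.integral_cong) (simp_all add: matrix_vector_mult_scaleR mult_ac)
  then have 2: "(LINT x|lebesgue_on D'. (\<epsilon>\<^sup>2 *\<^sub>R (A x *v wg x)) \<bullet> ((2 * chi x * w x) *\<^sub>R c x))
      = (2 * \<epsilon>\<^sup>2) * (LINT x|lebesgue_on D'. (A x *v (chi x *\<^sub>R wg x)) \<bullet> (w x *\<^sub>R c x))"
    by (simp only: integral_mult_right_zero)
  have 3: "(LINT x|lebesgue_on D'. w x * ((chi x)\<^sup>2 * w x)) = (LINT x|lebesgue_on D'. (chi x * w x)\<^sup>2)"
    by (intro Bochner_Integration.integral_cong) (simp_all add: power2_eq_square mult_ac)
  have eq: "\<epsilon>\<^sup>2 * (LINT x|lebesgue_on D'. (A x *v q x) \<bullet> q x) + (LINT x|lebesgue_on D'. (chi x * w x)\<^sup>2)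
      = \<epsilon>\<^sup>2 * (LINT x|lebesgue_on D'. (A x *v (w x *\<^sub>R c x)) \<bullet> (w x *\<^sub>R c x))"
    using id unfolding q 1 2 3 by (simp add: distrib_left)
  have "(LINT x|lebesgue_on D'. (A x *v (w x *\<^sub>R c x)) \<bullet> (w x *\<^sub>R c x)) \<le> (LINT x|lebesgue_on D'. amax * (norm (w x *\<^sub>R c x))\<^sup>2)"
  proof (rule integral_mono[OF I(3)])
    show "integrable (lebesgue_on D') (\<lambda>x. amax * (norm (w x *\<^sub>R c x))\<^sup>2)"
      by (intro integrable_mult_right L2_D(2) wc)
    show "(A x *v (w x *\<^sub>R c x)) \<bullet> (w x *\<^sub>R c x) \<le> amax * (norm (w x *\<^sub>R c x))\<^sup>2" if "x \<in> space (lebesgue_on D')" for x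
      using that D'(2) by (intro A_le) auto
  qed
  also have "\<dots> = amax * (LINT x|lebesgue_on D'. (w x)\<^sup>2 * (norm (c x))\<^sup>2)"
    by (simp add: power_mult_distrib)
  finally show "\<epsilon>\<^sup>2 * (LINT x|lebesgue_on D'. (A x *v q x) \<bullet> q x) + (LINT x|lebesgue_on D'. (chi x * w x)\<^sup>2)
      \<le> \<epsilon>\<^sup>2 * amax * (LINT x|lebesgue_on D'. (w x)\<^sup>2 * (norm (c x))\<^sup>2)"
    unfolding eq by (simp add: mult.assoc mult_left_mono)
qed

end

subsection \<open>Decay of the local error\<close>

text \<open>The shift by 1/4 leaves a layer near the value 0 on which the function vanishes
  identically; it joins the layer with zero slope because \<open>cosh\<close> has a horizontal
  tangent at 0 and the constant 1 is subtracted.\<close>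

definition cosh_cut :: "real \<Rightarrow> real \<Rightarrow> real" where
  "cosh_cut k t = cosh (k * max 0 (t - 1/4)) - 1"

definition cosh_cut' :: "real \<Rightarrow> real \<Rightarrow> real" where
  "cosh_cut' k t = k * sinh (k * max 0 (t - 1/4))"

lemma DERIV_cut: "(cosh_cut k has_real_derivative cosh_cut' k t) (at t)"
proof -
  have right: "((\<lambda>t. cosh (k * (t - 1/4)) - 1) has_real_derivative k * sinh (k * (t - 1/4))) (at t)" for t
    by (auto intro!: derivative_eq_intros)
  consider "t < 1/4" | "t = 1/4" | "t > 1/4" by linarith
  then show ?thesis
  proof cases
    case 1
    have "(cosh_cut k has_real_derivative 0) (at t)"
      by (rule has_field_derivative_transform_within_open[of "\<lambda>_. 0" _ _ "{..<1/4}"])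
         (use 1 in \<open>auto simp: cosh_cut_def max_def\<close>)
    with 1 show ?thesis by (simp add: cosh_cut'_def max_def)
  next
    case 2
    have "((\<lambda>h. (cosh_cut k (t + h) - cosh_cut k t) / h) \<longlongrightarrow> 0) (at 0)"
      unfolding filterlim_at_split
    proof
      show "((\<lambda>h. (cosh_cut k (t + h) - cosh_cut k t) / h) \<longlongrightarrow> 0) (at_left 0)"
        by (rule Lim_transform_eventually[of "\<lambda>_. 0"])
           (auto simp: eventually_at_left_field cosh_cut_def 2 max_def intro!: exI[of _ "-1"])
      have "((\<lambda>h. (cosh (k * h) - 1) / h) \<longlongrightarrow> 0) (at 0)"
        using right[of "1/4"] by (simp add: DERIV_def)
      then have "((\<lambda>h. (cosh (k * h) - 1) / h) \<longlongrightarrow> 0) (at_right 0)"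
        by (simp add: filterlim_at_split)
      then show "((\<lambda>h. (cosh_cut k (t + h) - cosh_cut k t) / h) \<longlongrightarrow> 0) (at_right 0)"
        by (rule Lim_transform_eventually)
           (auto simp: eventually_at_right_field cosh_cut_def 2 max_def intro!: exI[of _ 1])
    qed
    with 2 show ?thesis by (simp add: DERIV_def cosh_cut'_def)
  next
    case 3
    show ?thesis
      by (rule has_field_derivative_transform_within_open[of "\<lambda>t. cosh (k * (t - 1/4)) - 1" _ _ "{1/4<..}"])
         (use 3 right[of t] in \<open>auto simp: cosh_cut_def cosh_cut'_def max_def\<close>)
  qed
qed

text \<open>In terms of \<open>X = cosh\<close> the difference is at most a concave quadratic with
  maximum 9/10, attained at \<open>X = 5/2\<close>. The value 3/5 is a rational upper bound for
  \<open>4 / e^2\<close>, the square of \<open>s * k\<close> in the application.\<close>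

lemma cosh_cut_estimate:
  assumes "(s * k)\<^sup>2 \<le> 3 / 5"
  shows "(s * cosh_cut' k t)\<^sup>2 - (cosh_cut k t)\<^sup>2 \<le> 1"
proof -
  define X where "X = cosh (k * max 0 (t - 1/4))"
  have X: "(sinh (k * max 0 (t - 1/4)))\<^sup>2 = X\<^sup>2 - 1" "X \<ge> 1"
    using cosh_square_eq[of "k * max 0 (t - 1/4)"] cosh_real_ge_1 by (auto simp: X_def)
  have "(s * cosh_cut' k t)\<^sup>2 - (cosh_cut k t)\<^sup>2 = (s * k)\<^sup>2 * (X\<^sup>2 - 1) - (X - 1)\<^sup>2"
    unfolding cosh_cut_def cosh_cut'_def X(1)[symmetric] by (simp add: power_mult_distrib X_def)
  also have "\<dots> \<le> 3 / 5 * (X\<^sup>2 - 1) - (X - 1)\<^sup>2"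
    using assms X(2) by (intro diff_right_mono mult_right_mono) (auto simp: power2_eq_square mult_ge1_I)
  also have "\<dots> = 1 - (2 / 5 * (X - 5 / 2)\<^sup>2 + 1 / 10)"
    by (simp add: power2_eq_square field_simps)
  also have "\<dots> \<le> 1" using zero_le_power2[of "X - 5 / 2"] by linarith
  finally show ?thesis .
qed

text \<open>13/8 is the quadratic Taylor polynomial of \<open>exp\<close> at 1/2, and its square
  exceeds 13/5. These bounds are just fine enough for \<open>(2 / e)^2 \<le> 3/5\<close> and for the
  comparison with \<open>cosh\<close> below.\<close>

lemma exp_1_ge: "(13 / 5 :: real) \<le> exp 1" and exp_half_ge: "(13 / 8 :: real) \<le> exp (1 / 2)"
proof -
  show h: "(13 / 8 :: real) \<le> exp (1 / 2)"
    using exp_lower_Taylor_quadratic[of "1 / 2 :: real"] by (simp add: power2_eq_square)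
  have "(13 / 8 :: real) * (13 / 8) \<le> exp (1 / 2) * exp (1 / 2)"
    by (intro mult_mono h) auto
  also have "\<dots> = exp 1" by (simp flip: exp_add)
  finally show "(13 / 5 :: real) \<le> exp 1" by simp
qed

text \<open>At 1 the argument of \<open>cosh\<close> is \<open>2 * \<gamma> * (3/4)\<close>, half a
  \<gamma> more than the target exponent. The surplus \<open>exp (\<gamma> / 2)\<close> pays for the
  factor 1/2 in \<open>cosh\<close> and for the subtracted 1: \<open>13/16 - 5/13\<close> times
  \<open>exp \<gamma>\<close> is at least 1.\<close>

lemma cosh_cut_1_ge:
  assumes "\<gamma> \<ge> 1"
  shows "exp (\<gamma> - 1) \<le> cosh_cut (2 * \<gamma>) 1"
proof -
  have E: "exp 1 \<le> exp \<gamma>" "exp (1 / 2) \<le> exp (\<gamma> / 2)" using assms by auto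
  have "exp \<gamma> * (13 / 8) \<le> exp \<gamma> * exp (\<gamma> / 2)"
    by (intro mult_left_mono order_trans[OF exp_half_ge E(2)]) simp
  also have "\<dots> = exp (3 / 2 * \<gamma>)" by (simp flip: exp_add)
  also have "\<dots> \<le> 2 * cosh (3 / 2 * \<gamma>)" by (simp add: cosh_def)
  finally have 1: "13 / 16 * exp \<gamma> \<le> cosh (3 / 2 * \<gamma>)" by simp
  have "exp (\<gamma> - 1) = exp \<gamma> / exp 1" by (simp add: exp_diff)
  also have "\<dots> \<le> exp \<gamma> / (13 / 5)" using exp_1_ge by (intro divide_left_mono) auto
  finally have 2: "exp (\<gamma> - 1) \<le> 5 / 13 * exp \<gamma>" by simp
  have "13 / 5 \<le> exp \<gamma>" using E(1) exp_1_ge by linarith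
  with 1 2 have "exp (\<gamma> - 1) \<le> cosh (3 / 2 * \<gamma>) - 1" by linarith
  then show ?thesis by (simp add: cosh_cut_def max_def mult_ac)
qed

text \<open>A cut-off function composed with \<open>cosh_cut k\<close> vanishes near the inner boundary, so its extension by
  zero is continuously differentiable on all of \<open>\<Omega>\<close>.\<close>

lemma bounded_weak_gradient_cut:
  fixes \<eta> :: "real^'d \<Rightarrow> real"
  assumes Om: "open \<Omega>" "bounded \<Omega>" and D: "open D" "D \<subseteq> \<Omega>"
    and \<eta>: "continuous_on (closure D) \<eta>" "continuous_on (closure D) g"
      "\<And>x. x \<in> D \<Longrightarrow> (\<eta> has_derivative (\<lambda>h. g x \<bullet> h)) (at x)"
      "\<And>x. x \<in> frontier D - frontier \<Omega> \<Longrightarrow> \<eta> x = 0"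
  shows "bounded_weak_gradient \<Omega> (\<lambda>x. if x \<in> D then cosh_cut k (\<eta> x) else 0)
    (\<lambda>x. if x \<in> D then cosh_cut' k (\<eta> x) *\<^sub>R g x else 0)" (is "bounded_weak_gradient \<Omega> ?v ?g")
proof -
  have cosh_cut_cont: "continuous_on UNIV (cosh_cut k)" "continuous_on UNIV (cosh_cut' k)"
    unfolding cosh_cut_def[abs_def] cosh_cut'_def[abs_def] by (intro continuous_intros)+
  \<comment> \<open>A point of \<Omega> outside D is either off the closure of D or on the inner
    part of its frontier, where \<eta> is 0.\<close>
  have near: "\<exists>r>0. \<forall>y\<in>ball x r. ?v y = 0 \<and> ?g y = 0" if x: "x \<in> \<Omega>" "x \<notin> D" for x
  proof (cases "x \<in> closure D")
    case True
    have "x \<notin> frontier \<Omega>" using x Om(1) by (simp add: frontier_def interior_open)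
    moreover have "x \<in> frontier D" using True x(2) D(1) by (simp add: frontier_def interior_open)
    ultimately have "\<eta> x = 0" using \<eta>(4) by blast
    \<comment> \<open>Continuity of \<eta> up to the frontier keeps it below 1/4 near x, inside the
      layer where \<open>cosh_cut\<close> vanishes.\<close>
    obtain r where r: "r > 0" "\<And>y. y \<in> closure D \<Longrightarrow> dist y x < r \<Longrightarrow> dist (\<eta> y) (\<eta> x) < 1 / 4"
      using \<eta>(1) True unfolding continuous_on_iff by (metis zero_less_divide_1_iff zero_less_numeral)
    have "?v y = 0 \<and> ?g y = 0" if "y \<in> ball x r" for y
    proof (cases "y \<in> D")
      case True
      then have "\<bar>\<eta> y\<bar> < 1 / 4"
        using r(2)[of y] that closure_subset \<open>\<eta> x = 0\<close> by (auto simp: dist_commute)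
      then have "max 0 (\<eta> y - 1 / 4) = 0" by simp
      then show ?thesis unfolding cosh_cut_def cosh_cut'_def by simp
    qed simp
    with r(1) show ?thesis by blast
  next
    case False
    then obtain r where "r > 0" "ball x r \<subseteq> - closure D"
      using open_contains_ball[of "- closure D"] by auto
    then show ?thesis using closure_subset[of D] by (intro exI[of _ r]) auto
  qed
  have der: "(?v has_derivative (\<lambda>h. ?g x \<bullet> h)) (at x)" if x: "x \<in> \<Omega>" for x
  proof (cases "x \<in> D")
    case True
    have "((\<lambda>x. cosh_cut k (\<eta> x)) has_derivative (\<lambda>h. cosh_cut' k (\<eta> x) * (g x \<bullet> h))) (at x)"
      by (rule has_derivative_compose[OF \<eta>(3)[OF True] DERIV_cut[unfolded has_field_derivative_def]])
    then have "(?v has_derivative (\<lambda>h. cosh_cut' k (\<eta> x) * (g x \<bullet> h))) (at x)"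
      by (rule has_derivative_transform_within_open[OF _ D(1) True]) simp
    then show ?thesis using True by simp
  next
    case False
    obtain r where r: "r > 0" "\<And>y. y \<in> ball x r \<Longrightarrow> ?v y = 0" using near[OF x False] by blast
    have "(?v has_derivative (\<lambda>h. 0)) (at x)"
      by (rule has_derivative_transform_within_open[OF has_derivative_const, where s="ball x r"]) (use r in auto)
    then show ?thesis using False by simp
  qed
  have contg: "continuous_on D (\<lambda>x. cosh_cut' k (\<eta> x) *\<^sub>R g x)" "continuous_on (closure D) (\<lambda>x. cosh_cut' k (\<eta> x) *\<^sub>R g x)"
    using \<eta>(1,2) closure_subset[of D]
    by (auto intro!: continuous_intros continuous_on_compose2[OF cosh_cut_cont(2)] intro: continuous_on_subset)
  have cont: "continuous_on \<Omega> ?g"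
  proof (rule continuous_at_imp_continuous_on, rule ballI)
    fix x assume x: "x \<in> \<Omega>"
    show "isCont ?g x"
    proof (cases "x \<in> D")
      case True
      have "isCont (\<lambda>x. cosh_cut' k (\<eta> x) *\<^sub>R g x) x"
        using contg(1) D(1) True by (simp add: continuous_on_eq_continuous_at)
      moreover have "\<forall>\<^sub>F y in nhds x. ?g y = cosh_cut' k (\<eta> y) *\<^sub>R g y"
        using eventually_nhds_in_open[OF D(1) True] by eventually_elim simp
      ultimately show ?thesis by (simp cong: isCont_cong)
    next
      case False
      obtain r where r: "r > 0" "\<And>y. y \<in> ball x r \<Longrightarrow> ?g y = 0" using near[OF x False] by blast
      have "\<forall>\<^sub>F y in nhds x. ?g y = 0"
      proof (rule eventually_mono)
        show "\<forall>\<^sub>F y in nhds x. y \<in> ball x r" using r(1) by (intro eventually_nhds_in_open) auto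
      qed (rule r(2))
      then show ?thesis by (subst isCont_cong) auto
    qed
  qed
  have comp: "compact (closure D)"
    using bounded_subset[OF Om(2) D(2)] by (simp add: compact_closure)
  have "bounded ((\<lambda>x. cosh_cut k (\<eta> x)) ` closure D)" "bounded ((\<lambda>x. cosh_cut' k (\<eta> x) *\<^sub>R g x) ` closure D)"
    by (intro compact_imp_bounded compact_continuous_image comp contg continuous_on_compose2[OF cosh_cut_cont(1) \<eta>(1)] subset_UNIV)+
  then obtain B1 B2 where B: "\<forall>y\<in>(\<lambda>x. cosh_cut k (\<eta> x)) ` closure D. norm y \<le> B1"
    "\<forall>y\<in>(\<lambda>x. cosh_cut' k (\<eta> x) *\<^sub>R g x) ` closure D. norm y \<le> B2"
    unfolding bounded_iff by blast
  show ?thesis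
  proof (rule bounded_weak_gradientI[where B="\<bar>B1\<bar>" and B'="\<bar>B2\<bar>"])
    show "is_weak_gradient \<Omega> ?v ?g" by (rule weak_gradient_C1[OF Om(1) der cont])
    have "continuous_on \<Omega> ?v"
      by (rule has_derivative_continuous_on[OF has_derivative_at_withinI[OF der]])
    then show "?v \<in> borel_measurable (lebesgue_on \<Omega>)"
      by (rule measurable_lebesgue_on_continuous) (use Om(1) in auto)
    show "?g \<in> borel_measurable (lebesgue_on \<Omega>)"
      by (rule measurable_lebesgue_on_continuous[OF cont]) (use Om(1) in auto)
    fix x
    have "x \<in> D \<Longrightarrow> x \<in> closure D" using closure_subset by blast
    then show "\<bar>?v x\<bar> \<le> \<bar>B1\<bar>" "norm (?g x) \<le> \<bar>B2\<bar>"
      using B by force+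
  qed
qed

section \<open>Exponential decay away from the inner boundary\<close>

context local_problem
begin

text \<open>One application of the Caccioppoli inequality with the exponentially growing cut-off
  \<open>cosh_cut k \<circ> \<eta>\<close> replaces the usual iteration over nested subdomains.\<close>

lemma decay:
  assumes D0: "open D0" "D0 \<subseteq> D'"
    and \<eta>: "continuous_on (closure D') \<eta>" "continuous_on (closure D') g"
      "\<And>x. x \<in> D' \<Longrightarrow> (\<eta> has_derivative (\<lambda>h. g x \<bullet> h)) (at x)"
      "\<And>x. x \<in> frontier D' - frontier \<Omega> \<Longrightarrow> \<eta> x = 0" "\<And>x. x \<in> D0 \<Longrightarrow> \<eta> x = 1"
      "\<And>x. x \<in> D' \<Longrightarrow> norm (g x) \<le> G" and G: "G \<ge> 0"
  shows "(\<epsilon> * sqrt amax * G * k)\<^sup>2 \<le> 3 / 5 \<Longrightarrow>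
      (cosh_cut k 1)\<^sup>2 * (LINT x|lebesgue_on D0. (w x)\<^sup>2) \<le> (LINT x|lebesgue_on D'. (w x)\<^sup>2)"
    and "G = 0 \<Longrightarrow> (cosh_cut k 1)\<^sup>2 * (LINT x|lebesgue_on D0. (w x)\<^sup>2) \<le> 0"
proof -
  let ?chi = "\<lambda>x. if x \<in> D' then cosh_cut k (\<eta> x) else 0"
  let ?c = "\<lambda>x. if x \<in> D' then cosh_cut' k (\<eta> x) *\<^sub>R g x else 0"
  have bwg: "bounded_weak_gradient \<Omega> ?chi ?c"
    by (rule bounded_weak_gradient_cut[OF Om D' \<eta>(1-4)])
  define q where "q x = ?chi x *\<^sub>R wg x + w x *\<^sub>R ?c x" for x
  have sets: "D0 \<in> sets lebesgue" "D' \<in> sets lebesgue" using D0(1) D'(1) by auto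
  obtain C where C: "C > 0" "\<And>x. x \<in> \<Omega> \<Longrightarrow> \<bar>?chi x\<bar> \<le> C" "\<And>x. x \<in> \<Omega> \<Longrightarrow> norm (?c x) \<le> C"
    "?chi \<in> borel_measurable (lebesgue_on \<Omega>)" "?c \<in> borel_measurable (lebesgue_on \<Omega>)"
    using bwg by (rule bounded_weak_gradientE) blast
  have [measurable]: "?chi \<in> borel_measurable (lebesgue_on D')" "?c \<in> borel_measurable (lebesgue_on D')"
    using C(4,5) D'(2) by (auto intro: measurable_lebesgue_on_subset)
  have [measurable]: "w \<in> borel_measurable (lebesgue_on D')" by (rule L2_D(1)[OF w_L2(1)])
  have w2: "integrable (lebesgue_on D') (\<lambda>x. (w x)\<^sup>2)"
    using L2_D(2)[OF w_L2(1)] by simp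
  have "0 \<le> (LINT x|lebesgue_on D'. (A x *v q x) \<bullet> q x)"
    using A_nonneg D'(2) by (intro Bochner_Integration.integral_nonneg) auto
  then have "0 \<le> \<epsilon>\<^sup>2 * (LINT x|lebesgue_on D'. (A x *v q x) \<bullet> q x)" by simp
  moreover have "\<epsilon>\<^sup>2 * (LINT x|lebesgue_on D'. (A x *v q x) \<bullet> q x) + (LINT x|lebesgue_on D'. (?chi x * w x)\<^sup>2)
      \<le> \<epsilon>\<^sup>2 * amax * (LINT x|lebesgue_on D'. (w x)\<^sup>2 * (norm (?c x))\<^sup>2)"
    unfolding q_def by (rule Caccioppoli[OF bwg]) simp
  ultimately have cacc: "(LINT x|lebesgue_on D'. (?chi x * w x)\<^sup>2) \<le> \<epsilon>\<^sup>2 * amax * (LINT x|lebesgue_on D'. (w x)\<^sup>2 * (norm (?c x))\<^sup>2)"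
    by linarith
  \<comment> \<open>On D0 the function \<eta> is constantly 1, so there the right side of the
    Caccioppoli inequality has no contribution and the left side keeps its full weight.\<close>
  have g0: "g x = 0" if "x \<in> D0" for x
  proof -
    have "(\<eta> has_derivative (\<lambda>h. 0)) (at x)"
      by (rule has_derivative_transform_within_open[OF has_derivative_const[of 1] D0(1) that]) (simp add: \<eta>(5))
    moreover have "(\<eta> has_derivative (\<lambda>h. g x \<bullet> h)) (at x)"
      using \<eta>(3) that D0(2) by auto
    ultimately have "(\<lambda>h. 0) = (\<lambda>h. g x \<bullet> h)" by (rule has_derivative_unique)
    from fun_cong[OF this, of "g x"] have "g x \<bullet> g x = 0" by simp
    then show ?thesis by simp
  qed
  have I1: "integrable (lebesgue_on D') (\<lambda>x. (?chi x * w x)\<^sup>2)"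
  proof -
    have "(\<lambda>x. ?chi x * w x) \<in> L2 D'"
    proof (rule L2_bounded_by[OF w_L2(1), where B=C])
      show "AE x in lebesgue_on D'. norm (?chi x * w x) \<le> C * norm (w x)"
      proof (rule AE_I2)
        fix x assume "x \<in> space (lebesgue_on D')"
        then have "\<bar>?chi x\<bar> \<le> C" using C(2)[of x] D'(2) by auto
        then have "\<bar>?chi x\<bar> * \<bar>w x\<bar> \<le> C * \<bar>w x\<bar>" by (rule mult_right_mono) simp
        then show "norm (?chi x * w x) \<le> C * norm (w x)" by (simp only: real_norm_def abs_mult)
      qed
    qed measurable
    then show ?thesis by (simp add: L2_def)
  qed
  have I2: "integrable (lebesgue_on D') (\<lambda>x. (w x)\<^sup>2 * (norm (?c x))\<^sup>2)"
  proof -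
    have "(\<lambda>x. w x *\<^sub>R ?c x) \<in> L2 D'"
    proof (rule L2_bounded_by[OF w_L2(1), where B=C])
      show "AE x in lebesgue_on D'. norm (w x *\<^sub>R ?c x) \<le> C * norm (w x)"
      proof (rule AE_I2)
        fix x assume "x \<in> space (lebesgue_on D')"
        then have "norm (?c x) \<le> C" using C(3)[of x] D'(2) by auto
        then have "\<bar>w x\<bar> * norm (?c x) \<le> \<bar>w x\<bar> * C" by (rule mult_left_mono) simp
        then show "norm (w x *\<^sub>R ?c x) \<le> C * norm (w x)" by (simp only: norm_scaleR real_norm_def mult.commute)
      qed
    qed measurable
    then show ?thesis by (simp add: L2_def power_mult_distrib)
  qed
  have ind: "integrable (lebesgue_on D') (\<lambda>x. if x \<in> D0 then (w x)\<^sup>2 else 0)"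
    "(LINT x|lebesgue_on D'. (if x \<in> D0 then (w x)\<^sup>2 else 0)) = (LINT x|lebesgue_on D0. (w x)\<^sup>2)"
  proof -
    show "(LINT x|lebesgue_on D'. (if x \<in> D0 then (w x)\<^sup>2 else 0)) = (LINT x|lebesgue_on D0. (w x)\<^sup>2)"
      by (rule Lebesgue_Measure.integral_restrict[OF D0(2) sets])
    show "integrable (lebesgue_on D') (\<lambda>x. if x \<in> D0 then (w x)\<^sup>2 else 0)"
    proof (rule Bochner_Integration.integrable_bound[OF w2])
      have "(\<lambda>x. (w x)\<^sup>2) \<in> borel_measurable (lebesgue_on D0)"
        by (rule measurable_lebesgue_on_subset[OF _ D0(2)]) measurable
      then show "(\<lambda>x. if x \<in> D0 then (w x)\<^sup>2 else 0) \<in> borel_measurable (lebesgue_on D')"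
        by (rule measurable_extend_by_zero[OF D0(1)])
    qed auto
  qed
  show "(cosh_cut k 1)\<^sup>2 * (LINT x|lebesgue_on D0. (w x)\<^sup>2) \<le> (LINT x|lebesgue_on D'. (w x)\<^sup>2)"
    if s: "(\<epsilon> * sqrt amax * G * k)\<^sup>2 \<le> 3 / 5"
  proof -
    have "\<epsilon>\<^sup>2 * amax * (LINT x|lebesgue_on D'. (w x)\<^sup>2 * (norm (?c x))\<^sup>2) - (LINT x|lebesgue_on D'. (?chi x * w x)\<^sup>2)
        = (LINT x|lebesgue_on D'. \<epsilon>\<^sup>2 * amax * ((w x)\<^sup>2 * (norm (?c x))\<^sup>2) - (?chi x * w x)\<^sup>2)"
      using I1 I2 by simp
    \<comment> \<open>The comparison is pointwise: on D0 the integrand is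
      \<open>- (cosh_cut k 1)\<^sup>2 * (w x)\<^sup>2\<close>, elsewhere it is at most
      \<open>(w x)\<^sup>2\<close> by the estimate for \<open>cosh_cut\<close>.\<close>
    also have "\<dots> \<le> (LINT x|lebesgue_on D'. (w x)\<^sup>2 - (cosh_cut k 1)\<^sup>2 * (if x \<in> D0 then (w x)\<^sup>2 else 0))"
    proof (rule integral_mono)
      show "integrable (lebesgue_on D') (\<lambda>x. \<epsilon>\<^sup>2 * amax * ((w x)\<^sup>2 * (norm (?c x))\<^sup>2) - (?chi x * w x)\<^sup>2)"
        by (intro Bochner_Integration.integrable_diff integrable_mult_right I1 I2)
      show "integrable (lebesgue_on D') (\<lambda>x. (w x)\<^sup>2 - (cosh_cut k 1)\<^sup>2 * (if x \<in> D0 then (w x)\<^sup>2 else 0))"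
        by (intro Bochner_Integration.integrable_diff integrable_mult_right w2 ind)
      fix x assume "x \<in> space (lebesgue_on D')"
      then have x: "x \<in> D'" by simp
      show "\<epsilon>\<^sup>2 * amax * ((w x)\<^sup>2 * (norm (?c x))\<^sup>2) - (?chi x * w x)\<^sup>2 \<le> (w x)\<^sup>2 - (cosh_cut k 1)\<^sup>2 * (if x \<in> D0 then (w x)\<^sup>2 else 0)"
      proof (cases "x \<in> D0")
        case True
        then show ?thesis using x g0[OF True] \<eta>(5)[OF True] by (simp add: power_mult_distrib)
      next
        case False
        have "(norm (g x))\<^sup>2 \<le> G\<^sup>2" using \<eta>(6)[OF x] by (intro power_mono) auto
        then have "\<epsilon>\<^sup>2 * amax * (cosh_cut' k (\<eta> x))\<^sup>2 * (norm (g x))\<^sup>2 \<le> \<epsilon>\<^sup>2 * amax * (cosh_cut' k (\<eta> x))\<^sup>2 * G\<^sup>2"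
          using amax_pos by (intro mult_left_mono) auto
        also have "\<dots> = (\<epsilon> * sqrt amax * G * cosh_cut' k (\<eta> x))\<^sup>2"
          using amax_pos by (simp add: power_mult_distrib mult_ac)
        finally have "\<epsilon>\<^sup>2 * amax * (cosh_cut' k (\<eta> x))\<^sup>2 * (norm (g x))\<^sup>2 - (cosh_cut k (\<eta> x))\<^sup>2 \<le> 1"
          using cosh_cut_estimate[OF s, of "\<eta> x"] by linarith
        then have "(w x)\<^sup>2 * (\<epsilon>\<^sup>2 * amax * (cosh_cut' k (\<eta> x))\<^sup>2 * (norm (g x))\<^sup>2 - (cosh_cut k (\<eta> x))\<^sup>2) \<le> (w x)\<^sup>2 * 1"
          by (rule mult_left_mono) simp
        then show ?thesis using x False by (simp add: power_mult_distrib right_diff_distrib mult_ac)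
      qed
    qed
    also have "\<dots> = (LINT x|lebesgue_on D'. (w x)\<^sup>2) - (cosh_cut k 1)\<^sup>2 * (LINT x|lebesgue_on D0. (w x)\<^sup>2)"
      using w2 ind by (simp add: Bochner_Integration.integral_diff)
    finally show ?thesis using cacc by linarith
  qed
  \<comment> \<open>A vanishing gradient bound is the case of infinite distance: the right side of
    the Caccioppoli inequality is 0 and w vanishes almost everywhere on D0.\<close>
  show "(cosh_cut k 1)\<^sup>2 * (LINT x|lebesgue_on D0. (w x)\<^sup>2) \<le> 0" if "G = 0"
  proof -
    have "(cosh_cut k 1)\<^sup>2 * (LINT x|lebesgue_on D0. (w x)\<^sup>2) = (LINT x|lebesgue_on D'. (cosh_cut k 1)\<^sup>2 * (if x \<in> D0 then (w x)\<^sup>2 else 0))"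
      using ind by simp
    also have "\<dots> \<le> (LINT x|lebesgue_on D'. (?chi x * w x)\<^sup>2)"
    proof (rule integral_mono[OF _ I1])
      show "integrable (lebesgue_on D') (\<lambda>x. (cosh_cut k 1)\<^sup>2 * (if x \<in> D0 then (w x)\<^sup>2 else 0))"
        by (intro integrable_mult_right ind)
      fix x assume "x \<in> space (lebesgue_on D')"
      then show "(cosh_cut k 1)\<^sup>2 * (if x \<in> D0 then (w x)\<^sup>2 else 0) \<le> (?chi x * w x)\<^sup>2"
        using \<eta>(5)[of x] by (simp add: power_mult_distrib)
    qed
    also have "\<dots> \<le> \<epsilon>\<^sup>2 * amax * (LINT x|lebesgue_on D'. (w x)\<^sup>2 * (norm (?c x))\<^sup>2)" by (rule cacc)
    also have "(LINT x|lebesgue_on D'. (w x)\<^sup>2 * (norm (?c x))\<^sup>2) = 0"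
      using \<eta>(6) that by (intro integral_eq_zero_AE AE_I2) simp
    finally show ?thesis by simp
  qed
qed

text \<open>The cut-off at distance d has gradient at most \<open>Cd / d\<close>, and the definition
  of \<gamma> is the scaling under which this slope times \<open>2 * \<gamma>\<close> gives a pure
  number. Dividing by the value of the cut-off on D0 yields the factor
  \<open>exp (1 - \<gamma>)\<close>.\<close>

lemma exponential_decay:
  assumes D0: "open D0" "connected D0" "D0 \<noteq> {}" "D0 \<subseteq> D'" and D'_conn: "connected D'"
    and Cd: "0 < Cd" "cutoff_constant \<Omega> Cd"
    and \<gamma>: "\<gamma> = set_distance D0 (frontier D' - frontier \<Omega>) / ereal (exp 1 * \<epsilon> * sqrt amax * Cd)" "1 < \<gamma>"
  shows "(LINT x|lebesgue_on D0. (w x)\<^sup>2) \<le> (exp 1 * exp_neg \<gamma>)\<^sup>2 * (LINT x|lebesgue_on D'. (w x)\<^sup>2)"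
proof -
  define \<delta> where "\<delta> = set_distance D0 (frontier D' - frontier \<Omega>)"
  define K where "K = exp 1 * \<epsilon> * sqrt amax * Cd"
  have K: "K > 0" unfolding K_def using eps amax_pos Cd by simp
  \<comment> \<open>\<open>cutoff_constant\<close> provides a cut-off only for positive distance,
    which \<open>\<gamma> > 1\<close> guarantees.\<close>
  have "\<delta> > 0"
  proof (rule ccontr)
    assume "\<not> \<delta> > 0"
    then have "\<delta> / ereal K \<le> 0" using K by (cases \<delta>) (auto simp: divide_nonpos_pos)
    then have "\<gamma> \<le> 0" by (simp only: \<gamma>(1) \<delta>_def K_def)
    moreover have "(0::ereal) < 1" by simp
    ultimately show False using \<gamma>(2) by (meson less_le_trans not_less_iff_gr_or_eq order.strict_trans)
  qed
  then have pre: "open D0 \<and> connected D0 \<and> open D' \<and> connected D' \<and> D0 \<subseteq> D' \<and> D' \<subseteq> \<Omega> \<and>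
      0 < set_distance D0 (frontier D' - frontier \<Omega>)"
    using D0 D' D'_conn by (simp add: \<delta>_def)
  obtain \<eta> g where \<eta>0: "continuous_on (closure D') \<eta>" "continuous_on (closure D') g"
      "\<forall>x\<in>D'. (\<eta> has_derivative (\<lambda>h. g x \<bullet> h)) (at x)"
      "\<forall>x\<in>frontier D' - frontier \<Omega>. \<eta> x = 0" "\<forall>x\<in>D0. \<eta> x = 1"
      "\<forall>x\<in>D'. ereal (norm (g x)) \<le> ereal Cd / set_distance D0 (frontier D' - frontier \<Omega>)"
    using Cd(2)[unfolded cutoff_constant_def, THEN spec, THEN spec, THEN mp, OF pre]
    by (elim exE conjE) (rule that)
  note \<eta> = \<eta>0(1,2) bspec[OF \<eta>0(3)] bspec[OF \<eta>0(4)] bspec[OF \<eta>0(5)] bspec[OF \<eta>0(6), folded \<delta>_def]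
  have w2: "0 \<le> (LINT x|lebesgue_on S. (w x)\<^sup>2)" for S
    by (simp add: Bochner_Integration.integral_nonneg)
  show ?thesis
  proof (cases \<delta>)
    case PInf
    \<comment> \<open>Infinite distance arises when D' has no inner boundary, for instance if it is
      all of \<Omega>. Division by \<open>\<infinity>\<close> then makes the gradient bound 0, in
      accordance with the value 0 of \<open>exp_neg\<close> at \<open>\<infinity>\<close>. The
      parameter 2 only has to make \<open>cosh_cut\<close> nonzero at 1.\<close>
    have g: "norm (g x) \<le> 0" if "x \<in> D'" for x
      using \<eta>(6)[OF that] by (simp add: PInf)
    have "cosh_cut 2 1 \<noteq> 0" using cosh_cut_1_ge[of 1] by simp
    moreover have "(cosh_cut 2 1)\<^sup>2 * (LINT x|lebesgue_on D0. (w x)\<^sup>2) \<le> 0"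
      by (rule decay(2)[OF D0(1,4) \<eta>(1-5) g]) auto
    ultimately have "(LINT x|lebesgue_on D0. (w x)\<^sup>2) \<le> 0"
      by (simp add: mult_le_0_iff)
    moreover have "exp_neg \<gamma> = 0"
      using PInf K by (simp add: exp_neg_def \<gamma> flip: \<delta>_def K_def)
    ultimately show ?thesis by simp
  next
    case MInf
    then show ?thesis using \<open>\<delta> > 0\<close> by simp
  next
    case (real d)
    then have d: "d > 0" using \<open>\<delta> > 0\<close> by simp
    define c where "c = d / K"
    have \<gamma>c: "\<gamma> = ereal c" using K by (simp add: \<gamma> c_def real flip: \<delta>_def K_def)
    have c: "c > 1" using \<gamma>(2) by (simp add: \<gamma>c)
    have g: "norm (g x) \<le> Cd / d" if "x \<in> D'" for x
      using \<eta>(6)[OF that] d by (simp add: real)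
    \<comment> \<open>With \<open>k = 2 * c\<close> everything cancels except the factor e built
      into \<gamma>.\<close>
    have s: "\<epsilon> * sqrt amax * (Cd / d) * (2 * c) = 2 / exp 1"
      unfolding c_def K_def using d eps amax_pos Cd by (simp add: field_simps)
    have "(2 / exp 1)\<^sup>2 \<le> (2 / (13 / 5) :: real)\<^sup>2"
      using exp_1_ge by (intro power_mono divide_left_mono) auto
    also have "\<dots> \<le> 3 / 5" by (simp add: power2_eq_square)
    finally have "(\<epsilon> * sqrt amax * (Cd / d) * (2 * c))\<^sup>2 \<le> 3 / 5" by (simp only: s)
    moreover have "Cd / d \<ge> 0" using d Cd by simp
    ultimately have "(cosh_cut (2 * c) 1)\<^sup>2 * (LINT x|lebesgue_on D0. (w x)\<^sup>2) \<le> (LINT x|lebesgue_on D'. (w x)\<^sup>2)"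
      by (intro decay(1)[OF D0(1,4) \<eta>(1-5) g])
    moreover have "(exp (c - 1))\<^sup>2 * (LINT x|lebesgue_on D0. (w x)\<^sup>2) \<le> (cosh_cut (2 * c) 1)\<^sup>2 * (LINT x|lebesgue_on D0. (w x)\<^sup>2)"
      using cosh_cut_1_ge[of c] c w2 by (intro mult_right_mono power_mono) auto
    ultimately have "(exp (1 - c))\<^sup>2 * ((exp (c - 1))\<^sup>2 * (LINT x|lebesgue_on D0. (w x)\<^sup>2)) \<le> (exp (1 - c))\<^sup>2 * (LINT x|lebesgue_on D'. (w x)\<^sup>2)"
      by (intro mult_left_mono) auto
    moreover have "(exp (1 - c))\<^sup>2 * (exp (c - 1))\<^sup>2 = (1::real)"
      by (simp flip: power_mult_distrib exp_add)
    moreover have "exp (1 - c) = exp 1 * exp_neg \<gamma>"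
      by (simp add: exp_neg_def \<gamma>c flip: exp_add)
    ultimately show ?thesis by (simp flip: mult.assoc)
  qed
qed

end

subsection \<open>The global error\<close>

text \<open>Nonnegativity of the form at \<open>q i - q j\<close> bounds each mixed term by the mean
  of two diagonal terms; every diagonal term is then counted once per index.\<close>

lemma (in elliptic) A_sum_le:
  assumes x: "x \<in> \<Omega>" and I: "finite I"
  shows "(A x *v (\<Sum>i\<in>I. q i)) \<bullet> (\<Sum>i\<in>I. q i) \<le> real (card I) * (\<Sum>i\<in>I. (A x *v q i) \<bullet> q i)"
proof -
  let ?Q = "\<lambda>i. (A x *v q i) \<bullet> q i"
  have pair: "(A x *v q i) \<bullet> q j \<le> (?Q i + ?Q j) / 2" for i j
  proof -
    have "0 \<le> (A x *v (q i - q j)) \<bullet> (q i - q j)" by (rule A_nonneg[OF x])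
    also have "\<dots> = ?Q i + ?Q j - 2 * ((A x *v q i) \<bullet> q j)"
      using A_sym[OF x, of "q j" "q i"]
      by (simp add: matrix_vector_mult_diff_distrib inner_diff_left inner_diff_right)
    finally show ?thesis by simp
  qed
  have "A x *v (\<Sum>i\<in>I. q i) = (\<Sum>i\<in>I. A x *v q i)"
    by (rule linear_sum[OF matrix_vector_mul_linear])
  then have "(A x *v (\<Sum>i\<in>I. q i)) \<bullet> (\<Sum>i\<in>I. q i) = (\<Sum>i\<in>I. \<Sum>j\<in>I. (A x *v q i) \<bullet> q j)"
    by (simp only: inner_sum_left) (simp only: inner_sum_right)
  also have "\<dots> \<le> (\<Sum>i\<in>I. \<Sum>j\<in>I. (?Q i + ?Q j) / 2)"
    by (intro sum_mono pair)
  also have "\<dots> = real (card I) * (\<Sum>i\<in>I. ?Q i)"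
    by (simp add: sum.distrib sum_divide_distrib[symmetric] add_divide_distrib sum_distrib_left[symmetric])
  finally show ?thesis .
qed

text \<open>After exchanging sum and integral, the sum at a point is h times the number of sets
  containing that point.\<close>

lemma sum_integral_overlap_le:
  fixes h :: "real^'d \<Rightarrow> real"
  assumes "open \<Omega>" "\<And>i. i \<in> {1..M} \<Longrightarrow> open (D i) \<and> D i \<subseteq> \<Omega>" "overlap_at_most \<Omega> M D k"
    and h: "integrable (lebesgue_on \<Omega>) h" "\<And>x. 0 \<le> h x"
  shows "(\<Sum>i=1..M. LINT x|lebesgue_on (D i). h x) \<le> real k * (LINT x|lebesgue_on \<Omega>. h x)"
proof -
  have int: "integrable (lebesgue_on \<Omega>) (\<lambda>x. if x \<in> D i then h x else 0)"
    and eq: "(LINT x|lebesgue_on \<Omega>. (if x \<in> D i then h x else 0)) = (LINT x|lebesgue_on (D i). h x)"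
    if i: "i \<in> {1..M}" for i
  proof -
    have sets: "D i \<in> sets lebesgue" "\<Omega> \<in> sets lebesgue" and sub: "D i \<subseteq> \<Omega>"
      using assms(1,2) i by auto
    show "(LINT x|lebesgue_on \<Omega>. (if x \<in> D i then h x else 0)) = (LINT x|lebesgue_on (D i). h x)"
      by (rule Lebesgue_Measure.integral_restrict[OF sub sets])
    have "h \<in> borel_measurable (lebesgue_on (D i))"
      by (rule measurable_lebesgue_on_subset[OF _ sub]) (use h(1) in auto)
    then have "(\<lambda>x. if x \<in> D i then h x else 0) \<in> borel_measurable (lebesgue_on \<Omega>)"
      using assms(2) i by (intro measurable_extend_by_zero) auto
    then show "integrable (lebesgue_on \<Omega>) (\<lambda>x. if x \<in> D i then h x else 0)"
      by (rule Bochner_Integration.integrable_bound[OF h(1)]) auto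
  qed
  have "(\<Sum>i=1..M. LINT x|lebesgue_on (D i). h x) = (\<Sum>i=1..M. LINT x|lebesgue_on \<Omega>. (if x \<in> D i then h x else 0))"
    by (intro sum.cong refl) (simp add: eq)
  also have "\<dots> = (LINT x|lebesgue_on \<Omega>. (\<Sum>i=1..M. if x \<in> D i then h x else 0))"
    by (rule Bochner_Integration.integral_sum[symmetric]) (rule int)
  also have "\<dots> \<le> (LINT x|lebesgue_on \<Omega>. real k * h x)"
  proof (rule integral_mono)
    show "integrable (lebesgue_on \<Omega>) (\<lambda>x. \<Sum>i=1..M. if x \<in> D i then h x else 0)"
      by (intro Bochner_Integration.integrable_sum int)
    fix x assume "x \<in> space (lebesgue_on \<Omega>)"
    then have "card {i \<in> {1..M}. x \<in> D i} \<le> k"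
      using assms(3) by (simp add: overlap_at_most_def)
    then have "real (card {i \<in> {1..M}. x \<in> D i}) * h x \<le> real k * h x"
      using h(2) by (intro mult_right_mono) auto
    moreover have "(\<Sum>i=1..M. if x \<in> D i then h x else 0) = real (card {i \<in> {1..M}. x \<in> D i}) * h x"
      by (subst sum.inter_filter[symmetric]) auto
    ultimately show "(\<Sum>i=1..M. if x \<in> D i then h x else 0) \<le> real k * h x" by simp
  qed (use h(1) in simp)
  finally show ?thesis by simp
qed

text \<open>\<open>real_of_ereal\<close> sends an infinite essential supremum to 0, which would make
  the bound false; finiteness on D is inherited from \<Omega>.\<close>

lemma Linf_norm_bound:
  assumes "h \<in> Linf \<Omega>" "D \<subseteq> \<Omega>" "D \<in> sets lebesgue" "\<Omega> \<in> sets lebesgue"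
  shows "AE x in lebesgue_on D. norm (h x) \<le> Linf_norm D h"
proof -
  let ?E = "\<lambda>S. esssup (lebesgue_on S) (\<lambda>x. ereal (norm (h x)))"
  have "AE x in lebesgue_on \<Omega>. ereal (norm (h x)) \<le> ?E \<Omega>" by (rule esssup_AE)
  then have "AE x in lebesgue_on D. ereal (norm (h x)) \<le> ?E \<Omega>"
    by (rule AE_lebesgue_on_subset[OF _ assms(2-4)])
  moreover have "(\<lambda>x. ereal (norm (h x))) \<in> borel_measurable (lebesgue_on D)"
  proof -
    have "h \<in> borel_measurable (lebesgue_on \<Omega>)" using assms(1) by (simp add: Linf_def)
    then have "h \<in> borel_measurable (lebesgue_on D)" using assms(2) by (rule measurable_lebesgue_on_subset)
    then show ?thesis by measurable
  qed
  ultimately have "?E D \<le> ?E \<Omega>" by (intro esssup_I)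
  then have fin: "?E D \<noteq> \<infinity>" using assms(1) by (auto simp: Linf_def)
  have "AE x in lebesgue_on D. ereal (norm (h x)) \<le> ?E D" by (rule esssup_AE)
  then show ?thesis
  proof eventually_elim
    case (elim x)
    then show ?case using fin unfolding Linf_norm_def by (cases "?E D") auto
  qed
qed

text \<open>A negative real essential supremum would make a norm negative almost everywhere, so
  every bound would hold almost everywhere and the supremum would be \<open>- \<infinity>\<close>
  instead. Infinite values are read as 0.\<close>

lemma Linf_norm_nonneg: "0 \<le> Linf_norm D h"
proof (rule ccontr)
  let ?E = "esssup (lebesgue_on D) (\<lambda>x. ereal (norm (h x)))"
  assume "\<not> 0 \<le> Linf_norm D h"
  then obtain r where r: "?E = ereal r" "r < 0" unfolding Linf_norm_def by (cases ?E) auto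
  \<comment> \<open>The essential supremum of a non-measurable function is
    \<open>\<infinity>\<close> by definition, so a real value implies measurability.\<close>
  then have m: "(\<lambda>x. ereal (norm (h x))) \<in> borel_measurable (lebesgue_on D)"
    using esssup_non_measurable by (metis PInfty_neq_ereal(1) top_ereal_def)
  have "AE x in lebesgue_on D. ereal (norm (h x)) \<le> ?E" by (rule esssup_AE)
  then have "AE x in lebesgue_on D. ereal (norm (h x)) \<le> - \<infinity>"
  proof eventually_elim
    case (elim x)
    then have "norm (h x) \<le> r" by (simp add: r)
    then have "norm (h x) < 0" using r(2) by linarith
    then show ?case by simp
  qed
  then have "?E \<le> - \<infinity>" by (rule esssup_I[OF m])
  then show False by (simp add: r)
qed

section \<open>Gluing the local errors by the partition of unity\<close>

locale gfem = elliptic \<Omega> A amin amax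
  for \<Omega> :: "(real^'d) set" and A amin amax +
  fixes \<epsilon> C :: real and f u :: "real^'d \<Rightarrow> real" and M \<kappa> \<kappa>' :: nat
    and \<omega> \<omega>' :: "nat \<Rightarrow> (real^'d) set" and chi \<psi> :: "nat \<Rightarrow> real^'d \<Rightarrow> real"
  assumes nonempty: "\<Omega> \<noteq> {}" and eps: "0 < \<epsilon>" and f: "f \<in> L2 \<Omega>"
    and u: "variational_solution A \<epsilon> \<Omega> (H10 \<Omega>) f u"
    and cover: "finite_cover \<Omega> M \<omega>" and overlap: "overlap_at_most \<Omega> M \<omega> \<kappa>"
    and pu: "pu_on_cover \<Omega> M \<omega> chi C"
    and oversampling: "\<And>i. i \<in> {1..M} \<Longrightarrow> open (\<omega>' i) \<and> \<omega> i \<subseteq> \<omega>' i \<and> \<omega>' i \<subseteq> \<Omega>"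
    and overlap': "overlap_at_most \<Omega> M \<omega>' \<kappa>'"
    and psi: "\<And>i. i \<in> {1..M} \<Longrightarrow> variational_solution A \<epsilon> (\<omega>' i) (H1_Gamma \<Omega> (\<omega>' i)) f (\<psi> i)"
begin

lemma local_problem: "i \<in> {1..M} \<Longrightarrow> local_problem \<Omega> A amin amax \<epsilon> f u (\<psi> i) (\<omega>' i)"
  using oversampling[of i] by unfold_locales (auto intro: eps f u psi)

lemma M_pos: "{1..M} \<noteq> {}"
  using cover nonempty by (auto simp: finite_cover_def)

lemma omega: "i \<in> {1..M} \<Longrightarrow> open (\<omega> i)" "i \<in> {1..M} \<Longrightarrow> \<omega> i \<subseteq> \<Omega>"
  using cover by (auto simp: finite_cover_def domain_in_space_def)

abbreviation Cchi :: real where "Cchi \<equiv> C_chi \<Omega> M \<omega> chi"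

abbreviation err :: "nat \<Rightarrow> real^'d \<Rightarrow> real" where "err i x \<equiv> u x - \<psi> i x"

text \<open>\<open>Cchi\<close> bounds the gradients only on the cover sets. Off
  \<open>\<omega> i\<close> the function \<open>chi i\<close> is zero, hence so is its gradient
  almost everywhere, even where \<open>\<omega> i\<close> has a boundary of positive
  measure.\<close>

lemma partition_gradients:
  obtains c where "\<And>i. i \<in> {1..M} \<Longrightarrow> bounded_weak_gradient \<Omega> (chi i) (c i)"
    "\<And>i. i \<in> {1..M} \<Longrightarrow> AE x in lebesgue_on \<Omega>. norm (c i x) \<le> (if x \<in> \<omega> i then Cchi else 0)"
proof -
  have "\<exists>c. bounded_weak_gradient \<Omega> (chi i) c \<and> (AE x in lebesgue_on \<Omega>. norm (c x) \<le> (if x \<in> \<omega> i then Cchi else 0))"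
    if i: "i \<in> {1..M}" for i
  proof -
    have chi: "chi i \<in> W1inf \<Omega>" "\<And>x. x \<in> \<Omega> \<Longrightarrow> \<bar>chi i x\<bar> \<le> 1" "\<And>x. x \<in> \<Omega> - \<omega> i \<Longrightarrow> chi i x = 0"
      using pu i by (auto simp: pu_on_cover_def)
    obtain c where c: "bounded_weak_gradient \<Omega> (chi i) c" "AE x in lebesgue_on \<Omega>. weak_grad \<Omega> (chi i) x = c x"
      "weak_grad \<Omega> (chi i) \<in> Linf \<Omega>"
      by (rule W1inf_bounded_weak_gradient[OF Om(1) chi(1,2)])
    have sets: "\<omega> i \<in> sets lebesgue" "\<Omega> \<in> sets lebesgue" using omega[OF i] Om(1) by auto
    have "AE x in lebesgue_on (\<omega> i). norm (weak_grad \<Omega> (chi i) x) \<le> Linf_norm (\<omega> i) (weak_grad \<Omega> (chi i))"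
      by (rule Linf_norm_bound[OF c(3) omega(2)[OF i] sets])
    then have bd: "AE x in lebesgue_on \<Omega>. x \<in> \<omega> i \<longrightarrow> norm (weak_grad \<Omega> (chi i) x) \<le> Linf_norm (\<omega> i) (weak_grad \<Omega> (chi i))"
      using sets by (auto simp: AE_restrict_space_iff elim: eventually_mono)
    have le: "Linf_norm (\<omega> i) (weak_grad \<Omega> (chi i)) \<le> Cchi"
      unfolding C_chi_def using i by (intro Max_ge) auto
    have "AE x in lebesgue_on \<Omega>. norm (c x) \<le> (if x \<in> \<omega> i then Cchi else 0)"
      using bd c(2) weak_gradient_zero_on_zero_set[OF Om c(1)] AE_space
    proof eventually_elim
      case (elim x)
      then show ?case using chi(3)[of x] le by (cases "x \<in> \<omega> i") auto
    qed
    then show ?thesis using c(1) by blast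
  qed
  then have "\<forall>i\<in>{1..M}. \<exists>c. bounded_weak_gradient \<Omega> (chi i) c \<and> (AE x in lebesgue_on \<Omega>. norm (c x) \<le> (if x \<in> \<omega> i then Cchi else 0))"
    by (intro ballI)
  from bchoice[OF this] obtain c where
    "\<forall>i\<in>{1..M}. bounded_weak_gradient \<Omega> (chi i) (c i) \<and> (AE x in lebesgue_on \<Omega>. norm (c i x) \<le> (if x \<in> \<omega> i then Cchi else 0))" ..
  then show thesis by (intro that[of c]) (drule (1) bspec, simp)+
qed

text \<open>Each index has its own instance of the local problem; here their results are collected
  with the index free, so that they can be summed.\<close>

lemma error_gradient:
  fixes c
  assumes c: "\<forall>i\<in>{1..M}. bounded_weak_gradient \<Omega> (chi i) (c i)"
  defines "q \<equiv> \<lambda>i x. if x \<in> \<omega>' i then chi i x *\<^sub>R local_problem.wg \<Omega> u (\<psi> i) (\<omega>' i) x + err i x *\<^sub>R c i x else 0"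
  shows "i \<in> {1..M} \<Longrightarrow> is_weak_gradient \<Omega> (\<lambda>x. chi i x * err i x) (q i)"
    and "i \<in> {1..M} \<Longrightarrow> (\<lambda>x. chi i x * err i x) \<in> L2 \<Omega>"
    and "i \<in> {1..M} \<Longrightarrow> q i \<in> L2 \<Omega>"
    and "i \<in> {1..M} \<Longrightarrow> \<epsilon>\<^sup>2 * (LINT x|lebesgue_on (\<omega>' i). (A x *v q i x) \<bullet> q i x) + (LINT x|lebesgue_on (\<omega>' i). (chi i x * err i x)\<^sup>2)
      \<le> \<epsilon>\<^sup>2 * amax * (LINT x|lebesgue_on (\<omega>' i). (err i x)\<^sup>2 * (norm (c i x))\<^sup>2)"
proof -
  have main: "is_weak_gradient \<Omega> (\<lambda>x. chi i x * err i x) (q i) \<and> (\<lambda>x. chi i x * err i x) \<in> L2 \<Omega> \<and> q i \<in> L2 \<Omega> \<and>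
    \<epsilon>\<^sup>2 * (LINT x|lebesgue_on (\<omega>' i). (A x *v q i x) \<bullet> q i x) + (LINT x|lebesgue_on (\<omega>' i). (chi i x * err i x)\<^sup>2)
      \<le> \<epsilon>\<^sup>2 * amax * (LINT x|lebesgue_on (\<omega>' i). (err i x)\<^sup>2 * (norm (c i x))\<^sup>2)" if i: "i \<in> {1..M}" for i
  proof -
    interpret L: local_problem \<Omega> A amin amax \<epsilon> f u "\<psi> i" "\<omega>' i" by (rule local_problem[OF i])
    have chi0: "chi i x = 0" if "x \<in> \<Omega> - \<omega>' i" for x
    proof -
      have "x \<in> \<Omega> - \<omega> i" using that oversampling[OF i] by blast
      then show ?thesis using pu i unfolding pu_on_cover_def by blast
    qed
    have w: "L.w = err i" by (auto simp: L.w_def)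
    have qeq: "(LINT x|lebesgue_on (\<omega>' i). (A x *v q i x) \<bullet> q i x)
        = (LINT x|lebesgue_on (\<omega>' i). (A x *v (chi i x *\<^sub>R L.wg x + err i x *\<^sub>R c i x)) \<bullet> (chi i x *\<^sub>R L.wg x + err i x *\<^sub>R c i x))"
      by (intro Bochner_Integration.integral_cong) (auto simp: q_def)
    show ?thesis
      using L.product_weak_gradient[OF bspec[OF c i] chi0] L.product_L2[OF bspec[OF c i] chi0] L.Caccioppoli[OF bspec[OF c i] chi0]
      unfolding w qeq by (simp add: q_def)
  qed
  show "i \<in> {1..M} \<Longrightarrow> is_weak_gradient \<Omega> (\<lambda>x. chi i x * err i x) (q i)"
    "i \<in> {1..M} \<Longrightarrow> (\<lambda>x. chi i x * err i x) \<in> L2 \<Omega>"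
    "i \<in> {1..M} \<Longrightarrow> q i \<in> L2 \<Omega>"
    "i \<in> {1..M} \<Longrightarrow> \<epsilon>\<^sup>2 * (LINT x|lebesgue_on (\<omega>' i). (A x *v q i x) \<bullet> q i x) + (LINT x|lebesgue_on (\<omega>' i). (chi i x * err i x)\<^sup>2)
      \<le> \<epsilon>\<^sup>2 * amax * (LINT x|lebesgue_on (\<omega>' i). (err i x)\<^sup>2 * (norm (c i x))\<^sup>2)"
    using main by blast+
qed

lemma Cchi_nonneg: "0 \<le> Cchi"
proof -
  obtain i where i: "i \<in> {1..M}" using M_pos by blast
  have "0 \<le> Linf_norm (\<omega> i) (weak_grad \<Omega> (chi i))" by (rule Linf_norm_nonneg)
  also have "\<dots> \<le> Cchi" unfolding C_chi_def using i by (intro Max_ge) auto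
  finally show ?thesis .
qed

text \<open>The partition of unity also decomposes u, so the global error is glued from the local
  ones.\<close>

lemma particular_expansion:
  assumes "x \<in> \<Omega>"
  shows "u x - global_particular M chi \<psi> x = (\<Sum>i=1..M. chi i x * err i x)"
proof -
  have "(\<Sum>i=1..M. chi i x) = 1" using pu assms by (simp add: pu_on_cover_def)
  then have "u x = (\<Sum>i=1..M. chi i x * u x)" by (simp flip: sum_distrib_right)
  then show ?thesis by (simp add: global_particular_def right_diff_distrib sum_subtractf)
qed

lemma u_L2: "u \<in> L2 \<Omega>" and u_H1: "u \<in> H1 \<Omega>"
proof -
  show "u \<in> H1 \<Omega>" using u by (auto simp: variational_solution_def H10_def)
  then show "u \<in> L2 \<Omega>" by (rule H1_D(1)[OF Om(1)])
qed

lemma f2: "integrable (lebesgue_on \<Omega>) (\<lambda>x. (f x)\<^sup>2)" and u2: "integrable (lebesgue_on \<Omega>) (\<lambda>x. (u x)\<^sup>2)"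
  using L2_D(2)[OF f] L2_D(2)[OF u_L2] by simp_all

text \<open>The square of a difference is at most twice the sum of squares, and the energy estimate
  bounds u on \<Omega> and each \<open>\<psi> i\<close> on its own domain by f. Two contributions of
  \<open>2 * \<kappa>'\<close> give the 4.\<close>

lemma sum_local_errors_le:
  "(\<Sum>i=1..M. LINT x|lebesgue_on (\<omega>' i). (err i x)\<^sup>2) \<le> 4 * real \<kappa>' * (L2_norm \<Omega> f)\<^sup>2"
proof -
  have "(LINT x|lebesgue_on (\<omega>' i). (err i x)\<^sup>2) \<le> 2 * (LINT x|lebesgue_on (\<omega>' i). (u x)\<^sup>2) + 2 * (LINT x|lebesgue_on (\<omega>' i). (f x)\<^sup>2)"
    if i: "i \<in> {1..M}" for i
  proof -
    interpret L: local_problem \<Omega> A amin amax \<epsilon> f u "\<psi> i" "\<omega>' i" by (rule local_problem[OF i])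
    have \<psi>: "\<psi> i \<in> L2 (\<omega>' i)" by (rule H1_D(1)[OF L.D'(1) L.\<psi>_H1])
    have "L2_norm (\<omega>' i) (\<psi> i) \<le> L2_norm (\<omega>' i) f"
      by (rule variational_solution_L2_norm_le[OF L.D' f L.spaces(2) L.\<psi>])
    then have "(L2_norm (\<omega>' i) (\<psi> i))\<^sup>2 \<le> (L2_norm (\<omega>' i) f)\<^sup>2"
      by (rule power_mono) (rule L2_norm_nonneg)
    then have \<psi>f: "(LINT x|lebesgue_on (\<omega>' i). (\<psi> i x)\<^sup>2) \<le> (LINT x|lebesgue_on (\<omega>' i). (f x)\<^sup>2)"
      by (simp add: L2_norm_squared)
    have int: "integrable (lebesgue_on (\<omega>' i)) (\<lambda>x. (u x)\<^sup>2)" "integrable (lebesgue_on (\<omega>' i)) (\<lambda>x. (\<psi> i x)\<^sup>2)"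
      using L2_D(2)[OF L.restrict_L2(1)[OF u_L2]] L2_D(2)[OF \<psi>] by simp_all
    have "(LINT x|lebesgue_on (\<omega>' i). (err i x)\<^sup>2) \<le> (LINT x|lebesgue_on (\<omega>' i). 2 * (u x)\<^sup>2 + 2 * (\<psi> i x)\<^sup>2)"
    proof (rule integral_mono)
      show "integrable (lebesgue_on (\<omega>' i)) (\<lambda>x. (err i x)\<^sup>2)"
        using L2_D(2)[OF L.w_L2(1)] by (simp add: L.w_def)
      show "(err i x)\<^sup>2 \<le> 2 * (u x)\<^sup>2 + 2 * (\<psi> i x)\<^sup>2" for x
        using zero_le_power2[of "u x + \<psi> i x"] by (simp add: power2_eq_square algebra_simps)
    qed (use int in simp)
    also have "\<dots> = 2 * (LINT x|lebesgue_on (\<omega>' i). (u x)\<^sup>2) + 2 * (LINT x|lebesgue_on (\<omega>' i). (\<psi> i x)\<^sup>2)"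
      using int by simp
    finally show ?thesis using \<psi>f by linarith
  qed
  then have "(\<Sum>i=1..M. LINT x|lebesgue_on (\<omega>' i). (err i x)\<^sup>2)
      \<le> (\<Sum>i=1..M. 2 * (LINT x|lebesgue_on (\<omega>' i). (u x)\<^sup>2) + 2 * (LINT x|lebesgue_on (\<omega>' i). (f x)\<^sup>2))"
    by (rule sum_mono)
  also have "\<dots> = 2 * (\<Sum>i=1..M. LINT x|lebesgue_on (\<omega>' i). (u x)\<^sup>2) + 2 * (\<Sum>i=1..M. LINT x|lebesgue_on (\<omega>' i). (f x)\<^sup>2)"
    by (simp add: sum.distrib sum_distrib_left)
  also have "\<dots> \<le> 2 * (real \<kappa>' * (LINT x|lebesgue_on \<Omega>. (u x)\<^sup>2)) + 2 * (real \<kappa>' * (LINT x|lebesgue_on \<Omega>. (f x)\<^sup>2))"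
    using oversampling by (intro add_mono mult_left_mono sum_integral_overlap_le Om overlap' u2 f2) auto
  also have "(LINT x|lebesgue_on \<Omega>. (u x)\<^sup>2) \<le> (LINT x|lebesgue_on \<Omega>. (f x)\<^sup>2)"
  proof -
    have "H10 \<Omega> \<subseteq> H1 \<Omega>" by (auto simp: H10_def)
    then have "L2_norm \<Omega> u \<le> L2_norm \<Omega> f"
      by (rule variational_solution_L2_norm_le[OF Om(1) order_refl f _ u])
    then have "(L2_norm \<Omega> u)\<^sup>2 \<le> (L2_norm \<Omega> f)\<^sup>2"
      by (rule power_mono) (rule L2_norm_nonneg)
    then show ?thesis by (simp add: L2_norm_squared)
  qed
  finally show ?thesis by (simp add: L2_norm_squared mult_left_mono)
qed

text \<open>B measures how much smaller the local error is on \<open>\<omega> i\<close> than on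
  \<open>\<omega>' i\<close>, and is all in which the two estimates differ: monotonicity gives
  \<open>B = 1\<close>, decay gives a small B.\<close>

theorem error_bound:
  assumes B: "0 \<le> B"
    and loc: "\<And>i. i \<in> {1..M} \<Longrightarrow> (LINT x|lebesgue_on (\<omega> i). (err i x)\<^sup>2) \<le> B\<^sup>2 * (LINT x|lebesgue_on (\<omega>' i). (err i x)\<^sup>2)"
  shows "global_particular M chi \<psi> \<in> H1 \<Omega>"
    and "a_norm A \<epsilon> \<Omega> (\<lambda>x. u x - global_particular M chi \<psi> x)
      \<le> 2 * \<epsilon> * sqrt (real \<kappa> * real \<kappa>') * sqrt amax * Cchi * B * L2_norm \<Omega> f"
proof -
  obtain c where c: "\<And>i. i \<in> {1..M} \<Longrightarrow> bounded_weak_gradient \<Omega> (chi i) (c i)"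
    "\<And>i. i \<in> {1..M} \<Longrightarrow> AE x in lebesgue_on \<Omega>. norm (c i x) \<le> (if x \<in> \<omega> i then Cchi else 0)"
    using partition_gradients by blast
  define q where "q i x = (if x \<in> \<omega>' i then chi i x *\<^sub>R local_problem.wg \<Omega> u (\<psi> i) (\<omega>' i) x + err i x *\<^sub>R c i x else 0)" for i x
  have "\<forall>i\<in>{1..M}. bounded_weak_gradient \<Omega> (chi i) (c i)" using c(1) by blast
  note q = error_gradient[OF this, folded q_def]
  let ?e = "\<lambda>x. u x - global_particular M chi \<psi> x"
  let ?s = "\<lambda>x. \<Sum>i=1..M. chi i x * err i x"
  let ?E = "\<lambda>x. \<Sum>i=1..M. q i x"
  have wgs: "is_weak_gradient \<Omega> ?s ?E"
    by (rule weak_gradient_sum[OF Om(1)]) (auto intro: q)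
  have sL: "?s \<in> L2 \<Omega>" and EL: "?E \<in> L2 \<Omega>"
    by (rule L2_sum; auto intro: q)+
  have se: "AE x in lebesgue_on \<Omega>. ?s x = ?e x"
    using particular_expansion by (intro AE_I2) simp
  have em: "?e \<in> borel_measurable (lebesgue_on \<Omega>)"
    by (rule measurable_lebesgue_on_cong_AE[OF Om(1) L2_D(1)[OF sL] se])
  have eL: "?e \<in> L2 \<Omega>" by (rule L2_cong_AE[OF se sL em])
  have wge: "is_weak_gradient \<Omega> ?e ?E"
    by (rule weak_gradient_cong_AE[OF Om(1) wgs se _ em L2_D(1)[OF EL]]) simp
  \<comment> \<open>The particular function is u minus the error, so its regularity follows from
    that of these two.\<close>
  have "is_weak_gradient \<Omega> (\<lambda>x. u x - ?e x) (\<lambda>x. weak_grad \<Omega> u x - ?E x)"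
    by (intro weak_gradient_diff Om(1) H1_D(2) u_H1 wge)
  moreover have "(\<lambda>x. u x - ?e x) \<in> L2 \<Omega>" "(\<lambda>x. weak_grad \<Omega> u x - ?E x) \<in> L2 \<Omega>"
    by (intro L2_diff u_L2 eL H1_D(3)[OF Om(1) u_H1] EL)+
  ultimately show "global_particular M chi \<psi> \<in> H1 \<Omega>"
    by (auto simp: H1_def)
  let ?Q = "\<lambda>i x. (A x *v q i x) \<bullet> q i x"
  have inner_int: "integrable (lebesgue_on \<Omega>) (\<lambda>x. (A x *v F x) \<bullet> F x)" if "F \<in> L2 \<Omega>" for F
    by (rule integrable_mult_L2[OF A_L2[OF order_refl that] that, where B=1])
       (use L2_D(1)[OF A_L2[OF order_refl that]] L2_D(1)[OF that] in \<open>auto intro: Cauchy_Schwarz_ineq2 borel_measurable_inner\<close>)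
  have grad: "AE x in lebesgue_on \<Omega>. weak_grad \<Omega> ?e x = ?E x"
    by (rule weak_grad_AE[OF Om(1) wge])
  \<comment> \<open>\<open>q i\<close> lives almost everywhere on the small set
    \<open>\<omega> i\<close>, although it is defined through \<open>\<omega>' i\<close>; hence the
    overlap counted at a point is \<kappa>.\<close>
  have zero: "AE x in lebesgue_on \<Omega>. \<forall>i\<in>{1..M}. x \<notin> \<omega> i \<longrightarrow> q i x = 0"
  proof (rule AE_finite_allI)
    fix i assume i: "i \<in> {1..M}"
    show "AE x in lebesgue_on \<Omega>. x \<notin> \<omega> i \<longrightarrow> q i x = 0"
      using c(2)[OF i] AE_space
    proof eventually_elim
      case (elim x)
      show ?case
      proof
        assume "x \<notin> \<omega> i"
        then have "c i x = 0" "chi i x = 0"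
          using elim pu i by (auto simp: pu_on_cover_def)
        then show "q i x = 0" by (simp add: q_def)
      qed
    qed
  qed simp
  have card: "real (card {i \<in> {1..M}. x \<in> \<omega> i}) \<le> real \<kappa>" if "x \<in> \<Omega>" for x
    using overlap that by (simp add: overlap_at_most_def)
  have "AE x in lebesgue_on \<Omega>. (A x *v weak_grad \<Omega> ?e x) \<bullet> weak_grad \<Omega> ?e x \<le> real \<kappa> * (\<Sum>i=1..M. ?Q i x)"
    using grad zero AE_space
  proof eventually_elim
    case (elim x)
    then have x: "x \<in> \<Omega>" by simp
    let ?S = "{i \<in> {1..M}. x \<in> \<omega> i}"
    have "?E x = (\<Sum>i\<in>?S. q i x)"
      using elim(2) by (intro sum.mono_neutral_right) auto
    then have "(A x *v ?E x) \<bullet> ?E x \<le> real (card ?S) * (\<Sum>i\<in>?S. ?Q i x)"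
      using A_sum_le[OF x, of ?S "\<lambda>i. q i x"] by simp
    also have "\<dots> \<le> real \<kappa> * (\<Sum>i=1..M. ?Q i x)"
      using card[OF x] A_nonneg[OF x] by (intro mult_mono sum_mono2 sum_nonneg) auto
    finally show ?case using elim(1) by simp
  qed
  then have "(LINT x|lebesgue_on \<Omega>. (A x *v weak_grad \<Omega> ?e x) \<bullet> weak_grad \<Omega> ?e x) \<le> (LINT x|lebesgue_on \<Omega>. real \<kappa> * (\<Sum>i=1..M. ?Q i x))"
    using inner_int[OF weak_grad_L2[OF Om(1) wge EL]] inner_int[OF q(3)]
    by (intro integral_mono_AE integrable_mult_right Bochner_Integration.integrable_sum) auto
  also have "\<dots> = real \<kappa> * (\<Sum>i=1..M. LINT x|lebesgue_on \<Omega>. ?Q i x)"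
    using inner_int[OF q(3)] by (simp add: Bochner_Integration.integral_sum)
  also have "\<dots> = real \<kappa> * (\<Sum>i=1..M. LINT x|lebesgue_on (\<omega>' i). ?Q i x)"
  proof (intro arg_cong[where f="(*) (real \<kappa>)"] sum.cong refl)
    fix i assume "i \<in> {1..M}"
    then show "(LINT x|lebesgue_on \<Omega>. ?Q i x) = (LINT x|lebesgue_on (\<omega>' i). ?Q i x)"
      using oversampling Om(1) by (intro integral_lebesgue_on_support) (auto simp: q_def)
  qed
  finally have part1: "(LINT x|lebesgue_on \<Omega>. (A x *v weak_grad \<Omega> ?e x) \<bullet> weak_grad \<Omega> ?e x)
      \<le> real \<kappa> * (\<Sum>i=1..M. LINT x|lebesgue_on (\<omega>' i). ?Q i x)" .
  have sq_int: "integrable (lebesgue_on \<Omega>) (\<lambda>x. (chi i x * err i x)\<^sup>2)" if "i \<in> {1..M}" for i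
    using L2_D(2)[OF q(2)[OF that]] by simp
  have "(LINT x|lebesgue_on \<Omega>. ?e x * ?e x) \<le> (LINT x|lebesgue_on \<Omega>. real \<kappa> * (\<Sum>i=1..M. (chi i x * err i x)\<^sup>2))"
  proof (rule integral_mono)
    show "integrable (lebesgue_on \<Omega>) (\<lambda>x. ?e x * ?e x)"
      using L2_D(2)[OF eL] by (simp add: power2_eq_square)
    show "integrable (lebesgue_on \<Omega>) (\<lambda>x. real \<kappa> * (\<Sum>i=1..M. (chi i x * err i x)\<^sup>2))"
      by (intro integrable_mult_right Bochner_Integration.integrable_sum sq_int)
    fix x assume "x \<in> space (lebesgue_on \<Omega>)"
    then have x: "x \<in> \<Omega>" by simp
    let ?S = "{i \<in> {1..M}. x \<in> \<omega> i}"
    have "?s x = (\<Sum>i\<in>?S. chi i x * err i x)"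
      using pu x by (intro sum.mono_neutral_right) (auto simp: pu_on_cover_def)
    then have "(?e x)\<^sup>2 \<le> (\<Sum>i\<in>?S. (chi i x * err i x)\<^sup>2) * real (card ?S)"
      using sum_squared_le_sum_of_squares[of "\<lambda>i. chi i x * err i x" ?S] particular_expansion[OF x] by simp
    also have "\<dots> \<le> (\<Sum>i=1..M. (chi i x * err i x)\<^sup>2) * real \<kappa>"
      using card[OF x] by (intro mult_mono sum_mono2 sum_nonneg) auto
    finally show "?e x * ?e x \<le> real \<kappa> * (\<Sum>i=1..M. (chi i x * err i x)\<^sup>2)"
      by (simp add: power2_eq_square[of "?e x"] mult.commute)
  qed
  also have "\<dots> = real \<kappa> * (\<Sum>i=1..M. LINT x|lebesgue_on \<Omega>. (chi i x * err i x)\<^sup>2)"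
    using sq_int by (simp add: Bochner_Integration.integral_sum)
  also have "\<dots> = real \<kappa> * (\<Sum>i=1..M. LINT x|lebesgue_on (\<omega>' i). (chi i x * err i x)\<^sup>2)"
  proof (intro arg_cong[where f="(*) (real \<kappa>)"] sum.cong refl)
    fix i assume i: "i \<in> {1..M}"
    have "chi i x = 0" if "x \<in> \<Omega> - \<omega>' i" for x
    proof -
      have "x \<in> \<Omega> - \<omega> i" using that oversampling[OF i] by blast
      then show ?thesis using pu i unfolding pu_on_cover_def by blast
    qed
    then show "(LINT x|lebesgue_on \<Omega>. (chi i x * err i x)\<^sup>2) = (LINT x|lebesgue_on (\<omega>' i). (chi i x * err i x)\<^sup>2)"
      using oversampling[OF i] Om(1) by (intro integral_lebesgue_on_support) auto
  qed
  finally have part2: "(LINT x|lebesgue_on \<Omega>. ?e x * ?e x) \<le> real \<kappa> * (\<Sum>i=1..M. LINT x|lebesgue_on (\<omega>' i). (chi i x * err i x)\<^sup>2)" .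
  \<comment> \<open>The Caccioppoli right side sees the local error only where \<open>c i\<close> is
    nonzero, that is on \<open>\<omega> i\<close>, which is where \<open>loc\<close> makes it
    small.\<close>
  have cl: "(LINT x|lebesgue_on (\<omega>' i). (err i x)\<^sup>2 * (norm (c i x))\<^sup>2) \<le> Cchi\<^sup>2 * (B\<^sup>2 * (LINT x|lebesgue_on (\<omega>' i). (err i x)\<^sup>2))"
    if i: "i \<in> {1..M}" for i
  proof -
    interpret L: local_problem \<Omega> A amin amax \<epsilon> f u "\<psi> i" "\<omega>' i" by (rule local_problem[OF i])
    have sets: "\<omega> i \<in> sets lebesgue" "\<omega>' i \<in> sets lebesgue" "\<Omega> \<in> sets lebesgue" and sub: "\<omega> i \<subseteq> \<omega>' i" "\<omega>' i \<subseteq> \<Omega>"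
      using omega[OF i] oversampling[OF i] Om(1) by auto
    have ae: "AE x in lebesgue_on (\<omega>' i). norm (c i x) \<le> (if x \<in> \<omega> i then Cchi else 0)"
      by (rule AE_lebesgue_on_subset[OF c(2)[OF i] sub(2) sets(2,3)])
    have wL: "err i \<in> L2 (\<omega>' i)" using L.w_L2(1) by (simp add: L.w_def[abs_def])
    have [measurable]: "err i \<in> borel_measurable (lebesgue_on (\<omega>' i))" by (rule L2_D(1)[OF wL])
    have w2: "integrable (lebesgue_on (\<omega>' i)) (\<lambda>x. (err i x)\<^sup>2)" using L2_D(2)[OF wL] by simp
    have int: "integrable (lebesgue_on (\<omega>' i)) (\<lambda>x. Cchi\<^sup>2 * (if x \<in> \<omega> i then (err i x)\<^sup>2 else 0))"
    proof (intro integrable_mult_right, rule Bochner_Integration.integrable_bound[OF w2])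
      have "(\<lambda>x. (err i x)\<^sup>2) \<in> borel_measurable (lebesgue_on (\<omega> i))"
        by (rule measurable_lebesgue_on_subset[OF _ sub(1)]) measurable
      then show "(\<lambda>x. if x \<in> \<omega> i then (err i x)\<^sup>2 else 0) \<in> borel_measurable (lebesgue_on (\<omega>' i))"
        by (rule measurable_extend_by_zero[OF omega(1)[OF i]])
    qed auto
    have "(LINT x|lebesgue_on (\<omega>' i). (err i x)\<^sup>2 * (norm (c i x))\<^sup>2) \<le> (LINT x|lebesgue_on (\<omega>' i). Cchi\<^sup>2 * (if x \<in> \<omega> i then (err i x)\<^sup>2 else 0))"
    proof (rule integral_mono_AE'[OF int])
      show "AE x in lebesgue_on (\<omega>' i). (err i x)\<^sup>2 * (norm (c i x))\<^sup>2 \<le> Cchi\<^sup>2 * (if x \<in> \<omega> i then (err i x)\<^sup>2 else 0)"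
        using ae
      proof eventually_elim
        case (elim x)
        show ?case
        proof (cases "x \<in> \<omega> i")
          case True
          then have "(norm (c i x))\<^sup>2 \<le> Cchi\<^sup>2" using elim by (intro power_mono) auto
          then have "(err i x)\<^sup>2 * (norm (c i x))\<^sup>2 \<le> (err i x)\<^sup>2 * Cchi\<^sup>2" by (rule mult_left_mono) simp
          then show ?thesis using True by (simp only: if_True mult.commute)
        next
          case False
          then show ?thesis using elim by simp
        qed
      qed
    qed auto
    also have "\<dots> = Cchi\<^sup>2 * (LINT x|lebesgue_on (\<omega> i). (err i x)\<^sup>2)"
      using Lebesgue_Measure.integral_restrict[OF sub(1) sets(1,2), of "\<lambda>x. (err i x)\<^sup>2"] by simp
    also have "\<dots> \<le> Cchi\<^sup>2 * (B\<^sup>2 * (LINT x|lebesgue_on (\<omega>' i). (err i x)\<^sup>2))"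
      by (intro mult_left_mono loc i) simp
    finally show ?thesis .
  qed
  have "a_form A \<epsilon> \<Omega> ?e ?e \<le> \<epsilon>\<^sup>2 * (real \<kappa> * (\<Sum>i=1..M. LINT x|lebesgue_on (\<omega>' i). ?Q i x))
      + real \<kappa> * (\<Sum>i=1..M. LINT x|lebesgue_on (\<omega>' i). (chi i x * err i x)\<^sup>2)"
    unfolding a_form_def by (intro add_mono mult_left_mono part1 part2) simp
  also have "\<dots> = real \<kappa> * (\<Sum>i=1..M. \<epsilon>\<^sup>2 * (LINT x|lebesgue_on (\<omega>' i). ?Q i x) + (LINT x|lebesgue_on (\<omega>' i). (chi i x * err i x)\<^sup>2))"
    by (simp add: sum.distrib sum_distrib_left algebra_simps)
  also have "\<dots> \<le> real \<kappa> * (\<Sum>i=1..M. \<epsilon>\<^sup>2 * amax * (Cchi\<^sup>2 * (B\<^sup>2 * (LINT x|lebesgue_on (\<omega>' i). (err i x)\<^sup>2))))"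
  proof (intro mult_left_mono sum_mono)
    fix i assume i: "i \<in> {1..M}"
    have "0 \<le> \<epsilon>\<^sup>2 * amax" using amax_pos by simp
    from mult_left_mono[OF cl[OF i] this] q(4)[OF i]
    show "\<epsilon>\<^sup>2 * (LINT x|lebesgue_on (\<omega>' i). ?Q i x) + (LINT x|lebesgue_on (\<omega>' i). (chi i x * err i x)\<^sup>2)
        \<le> \<epsilon>\<^sup>2 * amax * (Cchi\<^sup>2 * (B\<^sup>2 * (LINT x|lebesgue_on (\<omega>' i). (err i x)\<^sup>2)))"
      by linarith
  qed simp
  also have "\<dots> = real \<kappa> * (\<epsilon>\<^sup>2 * amax * Cchi\<^sup>2 * B\<^sup>2) * (\<Sum>i=1..M. LINT x|lebesgue_on (\<omega>' i). (err i x)\<^sup>2)"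
    by (simp add: sum_distrib_left mult_ac)
  \<comment> \<open>The factors \<kappa> from gluing and \<open>4 * \<kappa>'\<close> from the local
    errors combine to the square of \<open>2 * sqrt (\<kappa> * \<kappa>')\<close>.\<close>
  also have "\<dots> \<le> real \<kappa> * (\<epsilon>\<^sup>2 * amax * Cchi\<^sup>2 * B\<^sup>2) * (4 * real \<kappa>' * (L2_norm \<Omega> f)\<^sup>2)"
    using amax_pos by (intro mult_left_mono sum_local_errors_le) simp
  also have "\<dots> = (2 * \<epsilon> * sqrt (real \<kappa> * real \<kappa>') * sqrt amax * Cchi * B * L2_norm \<Omega> f)\<^sup>2"
    using amax_pos by (simp add: power_mult_distrib mult_ac)
  finally show "a_norm A \<epsilon> \<Omega> ?e \<le> 2 * \<epsilon> * sqrt (real \<kappa> * real \<kappa>') * sqrt amax * Cchi * B * L2_norm \<Omega> f"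
    unfolding a_norm_def using eps amax_pos Cchi_nonneg B L2_norm_nonneg[of \<Omega> f]
    by (intro real_le_lsqrt) auto
qed

end

section \<open>The two error estimates\<close>

theorem lemma3p15:
  fixes \<Omega> :: "(real^'d) set"
    and A :: "real^'d \<Rightarrow> real^'d^'d"
    and f u up uG :: "real^'d \<Rightarrow> real"
    and \<epsilon> amin amax C Cd :: real
    and M \<kappa> \<kappa>' :: nat
    and \<omega> \<omega>' :: "nat \<Rightarrow> (real^'d) set"
    and chi \<psi> :: "nat \<Rightarrow> real^'d \<Rightarrow> real"
    and \<delta> \<gamma> :: "nat \<Rightarrow> ereal"
  assumes dim: "CARD('d) = 2 \<or> CARD('d) = 3"
    and Omega: "bounded \<Omega>" "lipschitz_domain \<Omega>" "polyhedral \<Omega>"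
    and eps: "0 < \<epsilon>" "\<epsilon> \<le> 1"
    and f: "f \<in> L2 \<Omega>"
    and amin_amax: "0 < amin" "amin < amax"
    and A: "elliptic_coefficient \<Omega> amin amax A"
    and u: "variational_solution A \<epsilon> \<Omega> (H10 \<Omega>) f u"
    and cover: "finite_cover \<Omega> M \<omega>"
    and overlap: "overlap_at_most \<Omega> M \<omega> \<kappa>"
    and pu: "pu_on_cover \<Omega> M \<omega> chi C"
    and oversampling: "\<And>i. i \<in> {1..M} \<Longrightarrow> lipschitz_domain (\<omega>' i) \<and> \<omega> i \<subseteq> \<omega>' i \<and> \<omega>' i \<subseteq> \<Omega>"
    and overlap': "overlap_at_most \<Omega> M \<omega>' \<kappa>'"
    and psi: "\<And>i. i \<in> {1..M} \<Longrightarrow>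
                variational_solution A \<epsilon> (\<omega>' i) (H1_Gamma \<Omega> (\<omega>' i)) f (\<psi> i)"
    and up: "up = global_particular M chi \<psi>"
    and uG: "gfem_approximation A \<epsilon> \<Omega> f M chi (\<lambda>i. {\<lambda>x. 0}) up uG"
    and Cd: "0 < Cd" "cutoff_constant \<Omega> Cd"
    and delta: "\<And>i. i \<in> {1..M} \<Longrightarrow> \<delta> i = set_distance (\<omega> i) (frontier (\<omega>' i) - frontier \<Omega>)"
    and gamma: "\<And>i. i \<in> {1..M} \<Longrightarrow> \<gamma> i = \<delta> i / ereal (exp 1 * \<epsilon> * sqrt amax * Cd)"
  shows "up \<in> H1 \<Omega> \<and> uG = up \<and>
         a_norm A \<epsilon> \<Omega> (\<lambda>x. u x - uG x) = a_norm A \<epsilon> \<Omega> (\<lambda>x. u x - up x) \<and>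
         a_norm A \<epsilon> \<Omega> (\<lambda>x. u x - up x)
           \<le> 2 * \<epsilon> * sqrt (real \<kappa> * real \<kappa>') * sqrt amax * C_chi \<Omega> M \<omega> chi * L2_norm \<Omega> f \<and>
         ((\<forall>i\<in>{1..M}. 1 < \<gamma> i) \<longrightarrow>
            a_norm A \<epsilon> \<Omega> (\<lambda>x. u x - uG x)
              \<le> 2 * exp 1 * \<epsilon> * sqrt (real \<kappa> * real \<kappa>') * sqrt amax * C_chi \<Omega> M \<omega> chi
                  * (MAX i\<in>{1..M}. exp_neg (\<gamma> i)) * L2_norm \<Omega> f)"
proof -
  have Om: "open \<Omega>" "\<Omega> \<noteq> {}"
    using Omega(2) by (auto simp: lipschitz_domain_def domain_in_space_def)
  \<comment> \<open>The interpretation introduces a fact with the name \<open>oversampling\<close>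
    that keeps only openness of \<open>\<omega>' i\<close>; connectedness is needed again for the
    decay.\<close>
  note Lipschitz = oversampling
  interpret gfem \<Omega> A amin amax \<epsilon> C f u M \<kappa> \<kappa>' \<omega> \<omega>' chi \<psi>
    using oversampling Om(2)
    by unfold_locales
       (auto simp: lipschitz_domain_def domain_in_space_def intro: Om Omega eps f amin_amax A u cover overlap pu overlap' psi)
  \<comment> \<open>Local spaces consisting of 0 make the global space consist of 0 alone, so the
    affine trial space is the single function \<open>up\<close>.\<close>
  have uG_up: "uG = up"
    using uG by (auto simp: gfem_approximation_def gfem_space_def)
  have sub: "\<omega> i \<subseteq> \<omega>' i" "\<omega> i \<in> sets lebesgue" "\<omega>' i \<in> sets lebesgue" if "i \<in> {1..M}" for i
    using omega[OF that] oversampling[OF that] by auto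
  have err2: "integrable (lebesgue_on (\<omega>' i)) (\<lambda>x. (err i x)\<^sup>2)" if i: "i \<in> {1..M}" for i
  proof -
    interpret L: local_problem \<Omega> A amin amax \<epsilon> f u "\<psi> i" "\<omega>' i" by (rule local_problem[OF i])
    show ?thesis using L2_D(2)[OF L.w_L2(1)] by (simp add: L.w_def)
  qed
  \<comment> \<open>With \<open>B = 1\<close> the local hypothesis is monotonicity of the integral
    under \<open>\<omega> i \<subseteq> \<omega>' i\<close>.\<close>
  have loc1: "(LINT x|lebesgue_on (\<omega> i). (err i x)\<^sup>2) \<le> 1\<^sup>2 * (LINT x|lebesgue_on (\<omega>' i). (err i x)\<^sup>2)" if i: "i \<in> {1..M}" for i
    using integral_mono_lebesgue_on_AE[OF err2[OF i] _ _ sub[OF i]] by simp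
  have bound1: "up \<in> H1 \<Omega>" "a_norm A \<epsilon> \<Omega> (\<lambda>x. u x - up x)
      \<le> 2 * \<epsilon> * sqrt (real \<kappa> * real \<kappa>') * sqrt amax * C_chi \<Omega> M \<omega> chi * 1 * L2_norm \<Omega> f"
    by (rule error_bound[folded up, OF zero_le_one loc1]; assumption)+
  let ?m = "MAX i\<in>{1..M}. exp_neg (\<gamma> i)"
  have exp_neg_nonneg: "0 \<le> exp_neg t" for t by (simp add: exp_neg_def)
  \<comment> \<open>B has to be uniform in i, so the local factors
    \<open>exp 1 * exp_neg (\<gamma> i)\<close> are replaced by their maximum; the index set is
    nonempty because \<Omega> is.\<close>
  have bound2: "a_norm A \<epsilon> \<Omega> (\<lambda>x. u x - up x)
      \<le> 2 * \<epsilon> * sqrt (real \<kappa> * real \<kappa>') * sqrt amax * C_chi \<Omega> M \<omega> chi * (exp 1 * ?m) * L2_norm \<Omega> f"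
    if g1: "\<forall>i\<in>{1..M}. 1 < \<gamma> i"
  proof (rule error_bound(2)[folded up])
    have m: "exp_neg (\<gamma> i) \<le> ?m" if "i \<in> {1..M}" for i
      using that by (intro Max_ge) auto
    obtain j where "j \<in> {1..M}" using M_pos by blast
    then have "0 \<le> ?m" using m exp_neg_nonneg order_trans by blast
    then show "0 \<le> exp 1 * ?m" by simp
    fix i assume i: "i \<in> {1..M}"
    interpret L: local_problem \<Omega> A amin amax \<epsilon> f u "\<psi> i" "\<omega>' i" by (rule local_problem[OF i])
    have dom: "open (\<omega> i)" "connected (\<omega> i)" "\<omega> i \<noteq> {}" "connected (\<omega>' i)"
      using cover Lipschitz[OF i] i by (auto simp: finite_cover_def lipschitz_domain_def domain_in_space_def)
    have "\<gamma> i = set_distance (\<omega> i) (frontier (\<omega>' i) - frontier \<Omega>) / ereal (exp 1 * \<epsilon> * sqrt amax * Cd)"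
      using gamma[OF i] delta[OF i] by simp
    moreover have "1 < \<gamma> i" using g1 i by blast
    ultimately have "(LINT x|lebesgue_on (\<omega> i). (L.w x)\<^sup>2) \<le> (exp 1 * exp_neg (\<gamma> i))\<^sup>2 * (LINT x|lebesgue_on (\<omega>' i). (L.w x)\<^sup>2)"
      by (rule L.exponential_decay[OF dom(1-3) sub(1)[OF i] dom(4) Cd])
    also have "\<dots> \<le> (exp 1 * ?m)\<^sup>2 * (LINT x|lebesgue_on (\<omega>' i). (L.w x)\<^sup>2)"
      using m[OF i] exp_neg_nonneg by (intro mult_right_mono power_mono mult_left_mono Bochner_Integration.integral_nonneg) auto
    finally show "(LINT x|lebesgue_on (\<omega> i). (err i x)\<^sup>2) \<le> (exp 1 * ?m)\<^sup>2 * (LINT x|lebesgue_on (\<omega>' i). (err i x)\<^sup>2)"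
      by (simp add: L.w_def)
  qed
  show ?thesis
    using bound1 bound2 uG_up by (simp add: mult_ac)
qed

end
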